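(* Let $n \ge 3$ and let $G$ be a Lie group that is locally isomorphic to $\mathrm{SO}(2,n)$. Let $H$ be a closed subgroup of $G$ such that (i) the closure of $\mathrm{Ad}_G H$ is not compact, and (ii) there is a $G$-invariant Lorentz metric on $G/H$. Let $\mathfrak{g}$ and $\mathfrak{h} \subset \mathfrak{g}$ be the Lie algebras of $G$ and $H$. Then, after any identification of $\mathfrak{g}$ with $\mathfrak{so}(2,n)$ (that is, under any Lie algebra isomorphism $\mathfrak{g} \to \mathfrak{so}(2,n)$), the subalgebra $\mathfrak{h}$ is conjugate to a standard copy of $\mathfrak{so}(1,n)$ in $\mathfrak{so}(2,n)$.
   Context: $\mathrm{SO}(p,q)$ is the group of determinant-one linear transformations of $\mathbb{R}^{p+q}$ preserving the quadratic form $-x_1^2-\cdots-x_p^2+x_{p+1}^2+\cdots+x_{p+q}^2$, with Lie algebra $\mathfrak{so}(p,q)$. A standard copy of $\mathfrak{so}(1,n)$ in $\mathfrak{so}(2,n)$ is the subalgebra annihilating a coordinate vector on which the form is negative (e.g. the first one); "conjugate" means conjugate under the adjoint action of $\mathrm{SO}(2,n)$ on $\mathfrak{so}(2,n)$. A Minkowski form on a finite-dimensional real vector space $V$ is a nondegenerate quadratic form isometric to $-x_1^2 + x_2^2 + \cdots + x_{m+1}^2$ on $\mathbb{R}^{m+1}$, where $\dim V = m+1 \ge 2$ (in particular $\dim V\ge 2$ is required). A Lorentz metric on a smooth manifold $M$ is a choice of Minkowski form on each tangent space $T_pM$, varying smoothly with $p \in M$. A Lorentz metric on $G/H$ is $G$-invariant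 if the left-translation action of $G$ on $G/H$ preserves it. $\mathrm{Ad}_G$ is the adjoint representation of $G$ on $\mathfrak{g}$, and the closure of $\mathrm{Ad}_G H$ is taken in $\mathrm{GL}(\mathfrak{g})$. *)

theory Defs
  imports
    "HOL-Analysis.Analysis"
    "HOL-Algebra.Left_Coset"
    "HOL-Library.Function_Algebras"
    "HOL-Library.Numeral_Type"
begin

instantiation "fun" :: (type, real_vector) real_vector
begin

definition scaleR_fun_def: "c *\<^sub>R f = (\<lambda>x. c *\<^sub>R f x)"

instance
  by standard (simp_all add: scaleR_fun_def plus_fun_def fun_eq_iff scaleR_add_right scaleR_add_left)

end

definition linear_map_on ::
  "'v::real_vector set \<Rightarrow> 'w::real_vector set \<Rightarrow> ('v \<Rightarrow> 'w) \<Rightarrow> bool" where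
  "linear_map_on V W T \<longleftrightarrow>
     T \<in> V \<rightarrow> W \<and>
     (\<forall>x\<in>V. \<forall>y\<in>V. T (x + y) = T x + T y) \<and>
     (\<forall>c. \<forall>x\<in>V. T (c *\<^sub>R x) = c *\<^sub>R T x)"

text \<open>
  For a finite-dimensional subspace \<open>V\<close>. An automorphism is extended by zero outside \<open>V\<close>,
  so that it is determined by its restriction to \<open>V\<close>.
\<close>

definition GL :: "'v::real_vector set \<Rightarrow> ('v \<Rightarrow> 'v) set" where
  "GL V = {T. linear_map_on V V T \<and> bij_betw T V V \<and> (\<forall>v. v \<notin> V \<longrightarrow> T v = 0)}"

text \<open>
  The usual topology of \<open>GL V\<close>: the one pulled back along the matrix entries with respect to a
  basis of \<open>V\<close>. It does not depend on the basis.
\<close>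

definition GL_topology :: "'v::real_vector set \<Rightarrow> ('v \<Rightarrow> 'v) topology" where
  "GL_topology V =
     (let B = (SOME B. independent B \<and> span B = V)
      in pullback_topology (GL V)
           (\<lambda>T (b, c). if b \<in> B \<and> c \<in> B then representation B (T b) c else (0::real))
           euclidean)"

text \<open>Meaningful only for open \<open>U\<close>: the derivatives are taken at points of the full space.\<close>

primrec Ck_on ::
  "nat \<Rightarrow> 'a::euclidean_space set \<Rightarrow> ('a \<Rightarrow> 'b::euclidean_space) \<Rightarrow> bool" where
  "Ck_on 0 U f \<longleftrightarrow> continuous_on U f"
| "Ck_on (Suc k) U f \<longleftrightarrow>
     (\<forall>x\<in>U. f differentiable (at x)) \<and>
     (\<forall>v. Ck_on k U (\<lambda>x. frechet_derivative f (at x) v))"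

definition C_infinity_on ::
  "'a::euclidean_space set \<Rightarrow> ('a \<Rightarrow> 'b::euclidean_space) \<Rightarrow> bool" where
  "C_infinity_on U f \<longleftrightarrow> (\<forall>k. Ck_on k U f)"

text \<open>
  The dimension of a manifold is \<open>DIM('e)\<close>. The atlas need not be maximal. A chart is a pair
  \<open>(U, \<phi>)\<close> in which only the values of \<open>\<phi>\<close> on \<open>U\<close> matter.
\<close>

record ('a, 'e) manifold =
  mtop :: "'a topology"
  atlas :: "('a set \<times> ('a \<Rightarrow> 'e)) set"

definition smooth_manifold :: "('a, 'e::euclidean_space) manifold \<Rightarrow> bool" where
  "smooth_manifold M \<longleftrightarrow>
     Hausdorff_space (mtop M) \<and> second_countable (mtop M) \<and>
     topspace (mtop M) = (\<Union>(U, \<phi>)\<in>atlas M. U) \<and>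
     (\<forall>(U, \<phi>)\<in>atlas M. openin (mtop M) U \<and> open (\<phi> ` U) \<and>
        homeomorphic_map (subtopology (mtop M) U) (top_of_set (\<phi> ` U)) \<phi>) \<and>
     (\<forall>(U, \<phi>)\<in>atlas M. \<forall>(V, \<psi>)\<in>atlas M.
        C_infinity_on (\<phi> ` (U \<inter> V)) (\<psi> \<circ> inv_into U \<phi>))"

definition smooth_map ::
  "('a, 'e::euclidean_space) manifold \<Rightarrow> ('b, 'f::euclidean_space) manifold \<Rightarrow> ('a \<Rightarrow> 'b) \<Rightarrow> bool"
where
  "smooth_map M N F \<longleftrightarrow>
     continuous_map (mtop M) (mtop N) F \<and>
     (\<forall>(U, \<phi>)\<in>atlas M. \<forall>(V, \<psi>)\<in>atlas N.
        C_infinity_on (\<phi> ` (U \<inter> F -` V)) (\<psi> \<circ> F \<circ> inv_into U \<phi>))"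

definition euclidean_manifold :: "('e::euclidean_space, 'e) manifold" where
  "euclidean_manifold = \<lparr>mtop = euclidean, atlas = {(UNIV, \<lambda>x. x)}\<rparr>"

definition product_manifold ::
  "('a, 'e::euclidean_space) manifold \<Rightarrow> ('b, 'f::euclidean_space) manifold
     \<Rightarrow> ('a \<times> 'b, 'e \<times> 'f) manifold" where
  "product_manifold M N =
     \<lparr>mtop = prod_topology (mtop M) (mtop N),
      atlas = {(U \<times> V, map_prod \<phi> \<psi>) | U V \<phi> \<psi>. (U, \<phi>) \<in> atlas M \<and> (V, \<psi>) \<in> atlas N}\<rparr>"

definition open_submanifold ::
  "('a, 'e::euclidean_space) manifold \<Rightarrow> 'a set \<Rightarrow> ('a, 'e) manifold" where
  "open_submanifold M W =
     \<lparr>mtop = subtopology (mtop M) W, atlas = {(U \<inter> W, \<phi>) | U \<phi>. (U, \<phi>) \<in> atlas M}\<rparr>"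

text \<open>
  \<open>C\<^sup>\<infinity>(M)\<close>. Functions on the carrier are extended by zero, so that they form a subspace, closed
  under products, of the full function space.
\<close>

definition smooth_functions :: "('a, 'e::euclidean_space) manifold \<Rightarrow> ('a \<Rightarrow> real) set" where
  "smooth_functions M =
     {f. smooth_map M euclidean_manifold f \<and> (\<forall>x. x \<notin> topspace (mtop M) \<longrightarrow> f x = 0)}"

definition pullback ::
  "('a, 'e::euclidean_space) manifold \<Rightarrow> ('a \<Rightarrow> 'b) \<Rightarrow> ('b \<Rightarrow> real) \<Rightarrow> 'a \<Rightarrow> real" where
  "pullback M F f = (\<lambda>x. if x \<in> topspace (mtop M) then f (F x) else 0)"

text \<open>
  Tangent vectors at \<open>p\<close> are the point derivations of \<open>C\<^sup>\<infinity>(M)\<close> at \<open>p\<close>, and vector fields are the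
  derivations of the algebra \<open>C\<^sup>\<infinity>(M)\<close>. Both are extended by zero outside \<open>C\<^sup>\<infinity>(M)\<close>; products of
  functions are pointwise.
\<close>

definition tangent_space ::
  "('a, 'e::euclidean_space) manifold \<Rightarrow> 'a \<Rightarrow> (('a \<Rightarrow> real) \<Rightarrow> real) set" where
  "tangent_space M p =
     {v. linear_map_on (smooth_functions M) UNIV v \<and>
         (\<forall>f\<in>smooth_functions M. \<forall>g\<in>smooth_functions M. v (f * g) = f p * v g + g p * v f) \<and>
         (\<forall>f. f \<notin> smooth_functions M \<longrightarrow> v f = 0)}"

definition vector_fields ::
  "('a, 'e::euclidean_space) manifold \<Rightarrow> (('a \<Rightarrow> real) \<Rightarrow> ('a \<Rightarrow> real)) set" where
  "vector_fields M =
     {X. linear_map_on (smooth_functions M) (smooth_functions M) X \<and>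
         (\<forall>f\<in>smooth_functions M. \<forall>g\<in>smooth_functions M. X (f * g) = f * X g + g * X f) \<and>
         (\<forall>f. f \<notin> smooth_functions M \<longrightarrow> X f = 0)}"

definition differential ::
  "('a, 'e::euclidean_space) manifold \<Rightarrow> ('b, 'f::euclidean_space) manifold \<Rightarrow> ('a \<Rightarrow> 'b)
     \<Rightarrow> (('a \<Rightarrow> real) \<Rightarrow> real) \<Rightarrow> (('b \<Rightarrow> real) \<Rightarrow> real)" where
  "differential M N F v = (\<lambda>f. if f \<in> smooth_functions N then v (pullback M F f) else 0)"

definition smooth_submersion ::
  "('a, 'e::euclidean_space) manifold \<Rightarrow> ('b, 'f::euclidean_space) manifold \<Rightarrow> ('a \<Rightarrow> 'b) \<Rightarrow> bool"
where
  "smooth_submersion M N F \<longleftrightarrow>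
     smooth_map M N F \<and>
     (\<forall>p\<in>topspace (mtop M). differential M N F ` tangent_space M p = tangent_space N (F p))"

text \<open>\<open>S\<close> is the subset \<open>A\<close> with its structure of embedded submanifold of Euclidean space.\<close>

definition embedded_submanifold ::
  "('a::euclidean_space, 'e::euclidean_space) manifold \<Rightarrow> 'a set \<Rightarrow> bool" where
  "embedded_submanifold S A \<longleftrightarrow>
     smooth_manifold S \<and> mtop S = top_of_set A \<and>
     smooth_map S (euclidean_manifold :: ('a, 'a) manifold) (\<lambda>x. x) \<and>
     (\<forall>p\<in>A. inj_on (differential S (euclidean_manifold :: ('a, 'a) manifold) (\<lambda>x. x))
                   (tangent_space S p))"

text \<open>
  The map \<open>c \<mapsto> (\<Sum>i\<le>m. c i *\<^sub>R b i)\<close> is the isometry from \<open>\<real>\<^bsup>m+1\<^esup>\<close> with its standard form onto \<open>V\<close>.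
\<close>

definition minkowski_form :: "'v::real_vector set \<Rightarrow> ('v \<Rightarrow> real) \<Rightarrow> bool" where
  "minkowski_form V q \<longleftrightarrow>
     (\<exists>m\<ge>1. \<exists>b :: nat \<Rightarrow> 'v.
        inj_on b {..m} \<and> independent (b ` {..m}) \<and> span (b ` {..m}) = V \<and>
        (\<forall>c :: nat \<Rightarrow> real. q (\<Sum>i\<le>m. c i *\<^sub>R b i) = - (c 0)\<^sup>2 + (\<Sum>i=1..m. (c i)\<^sup>2)))"

text \<open>
  Smooth dependence on the point: \<open>q(X, X)\<close> is smooth for each smooth vector field \<open>X\<close>; by
  polarization, \<open>q(X, Y)\<close> is then smooth for all smooth vector fields \<open>X\<close> and \<open>Y\<close>.
\<close>

definition lorentz_metric ::
  "('a, 'e::euclidean_space) manifold \<Rightarrow> ('a \<Rightarrow> (('a \<Rightarrow> real) \<Rightarrow> real) \<Rightarrow> real) \<Rightarrow> bool" where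
  "lorentz_metric M q \<longleftrightarrow>
     (\<forall>p\<in>topspace (mtop M). minkowski_form (tangent_space M p) (q p)) \<and>
     (\<forall>X\<in>vector_fields M.
        (\<lambda>p. if p \<in> topspace (mtop M) then q p (\<lambda>f. X f p) else 0) \<in> smooth_functions M)"

definition lie_group :: "'g monoid \<Rightarrow> ('g, 'e::euclidean_space) manifold \<Rightarrow> bool" where
  "lie_group G M \<longleftrightarrow>
     group G \<and> smooth_manifold M \<and> topspace (mtop M) = carrier G \<and>
     smooth_map (product_manifold M M) M (\<lambda>(x, y). x \<otimes>\<^bsub>G\<^esub> y) \<and>
     smooth_map M M (\<lambda>x. inv\<^bsub>G\<^esub> x)"

definition local_hom :: "'g monoid \<Rightarrow> 'g set \<Rightarrow> 'h monoid \<Rightarrow> ('g \<Rightarrow> 'h) \<Rightarrow> bool" where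
  "local_hom G U G' f \<longleftrightarrow>
     (\<forall>x\<in>U. \<forall>y\<in>U. x \<otimes>\<^bsub>G\<^esub> y \<in> U \<longrightarrow> f (x \<otimes>\<^bsub>G\<^esub> y) = f x \<otimes>\<^bsub>G'\<^esub> f y)"

definition locally_isomorphic ::
  "'g monoid \<Rightarrow> ('g, 'e::euclidean_space) manifold
     \<Rightarrow> 'h monoid \<Rightarrow> ('h, 'f::euclidean_space) manifold \<Rightarrow> bool" where
  "locally_isomorphic G M G' M' \<longleftrightarrow>
     (\<exists>U V f f'.
        openin (mtop M) U \<and> \<one>\<^bsub>G\<^esub> \<in> U \<and> openin (mtop M') V \<and> \<one>\<^bsub>G'\<^esub> \<in> V \<and>
        smooth_map (open_submanifold M U) (open_submanifold M' V) f \<and>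
        smooth_map (open_submanifold M' V) (open_submanifold M U) f' \<and>
        (\<forall>x\<in>U. f' (f x) = x) \<and> (\<forall>y\<in>V. f (f' y) = y) \<and>
        local_hom G U G' f \<and> local_hom G' V G f')"

definition lie_algebra ::
  "'g monoid \<Rightarrow> ('g, 'e::euclidean_space) manifold \<Rightarrow> (('g \<Rightarrow> real) \<Rightarrow> ('g \<Rightarrow> real)) set" where
  "lie_algebra G M =
     {X \<in> vector_fields M. \<forall>a\<in>carrier G. \<forall>f\<in>smooth_functions M.
        X (pullback M (\<lambda>x. a \<otimes>\<^bsub>G\<^esub> x) f) = pullback M (\<lambda>x. a \<otimes>\<^bsub>G\<^esub> x) (X f)}"

definition lie_bracket ::
  "(('g \<Rightarrow> real) \<Rightarrow> ('g \<Rightarrow> real)) \<Rightarrow> (('g \<Rightarrow> real) \<Rightarrow> ('g \<Rightarrow> real))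
     \<Rightarrow> (('g \<Rightarrow> real) \<Rightarrow> ('g \<Rightarrow> real))" where
  "lie_bracket X Y = (\<lambda>f. X (Y f) - Y (X f))"

text \<open>\<open>Ad a X\<close> is the push-forward of \<open>X\<close> under the inner automorphism \<open>x \<mapsto> a x a\<^sup>-\<^sup>1\<close>.\<close>

definition Ad ::
  "'g monoid \<Rightarrow> ('g, 'e::euclidean_space) manifold \<Rightarrow> 'g
     \<Rightarrow> (('g \<Rightarrow> real) \<Rightarrow> ('g \<Rightarrow> real)) \<Rightarrow> (('g \<Rightarrow> real) \<Rightarrow> ('g \<Rightarrow> real))" where
  "Ad G M a X =
     (if X \<in> lie_algebra G M then
        (\<lambda>f. if f \<in> smooth_functions M then
               pullback M (\<lambda>x. inv\<^bsub>G\<^esub> a \<otimes>\<^bsub>G\<^esub> x \<otimes>\<^bsub>G\<^esub> a)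
                 (X (pullback M (\<lambda>x. a \<otimes>\<^bsub>G\<^esub> x \<otimes>\<^bsub>G\<^esub> inv\<^bsub>G\<^esub> a) f))
             else 0)
      else 0)"

text \<open>\<open>\<gamma>(t) = exp (t X)\<close>.\<close>

definition one_parameter_subgroup ::
  "'g monoid \<Rightarrow> ('g, 'e::euclidean_space) manifold
     \<Rightarrow> (('g \<Rightarrow> real) \<Rightarrow> ('g \<Rightarrow> real)) \<Rightarrow> (real \<Rightarrow> 'g) \<Rightarrow> bool" where
  "one_parameter_subgroup G M X \<gamma> \<longleftrightarrow>
     smooth_map (euclidean_manifold :: (real, real) manifold) M \<gamma> \<and>
     (\<forall>s t. \<gamma> (s + t) = \<gamma> s \<otimes>\<^bsub>G\<^esub> \<gamma> t) \<and>
     (\<forall>f\<in>smooth_functions M. \<forall>x\<in>carrier G.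
        ((\<lambda>t. f (x \<otimes>\<^bsub>G\<^esub> \<gamma> t)) has_real_derivative X f x) (at 0))"

text \<open>
  The Lie algebra of a closed subgroup \<open>H\<close>, as the subalgebra of the \<open>X\<close> with \<open>exp (t X) \<in> H\<close> for
  all \<open>t\<close>.
\<close>

definition subgroup_lie_algebra ::
  "'g monoid \<Rightarrow> ('g, 'e::euclidean_space) manifold \<Rightarrow> 'g set
     \<Rightarrow> (('g \<Rightarrow> real) \<Rightarrow> ('g \<Rightarrow> real)) set" where
  "subgroup_lie_algebra G M H =
     {X \<in> lie_algebra G M. \<exists>\<gamma>. one_parameter_subgroup G M X \<gamma> \<and> range \<gamma> \<subseteq> H}"

text \<open>
  \<open>N\<close> is the set \<open>G/H\<close> of left cosets with the quotient topology and its canonical smooth structure,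
  which is the unique one making the projection a submersion.
\<close>

definition coset_manifold ::
  "'g monoid \<Rightarrow> ('g, 'e::euclidean_space) manifold \<Rightarrow> 'g set
     \<Rightarrow> ('g set, 'f::euclidean_space) manifold \<Rightarrow> bool" where
  "coset_manifold G M H N \<longleftrightarrow>
     smooth_manifold N \<and> topspace (mtop N) = lcosets\<^bsub>G\<^esub> H \<and>
     quotient_map (mtop M) (mtop N) (\<lambda>a. a <#\<^bsub>G\<^esub> H) \<and>
     smooth_submersion M N (\<lambda>a. a <#\<^bsub>G\<^esub> H)"

definition left_translation_invariant ::
  "'g monoid \<Rightarrow> ('g set, 'f::euclidean_space) manifold
     \<Rightarrow> ('g set \<Rightarrow> (('g set \<Rightarrow> real) \<Rightarrow> real) \<Rightarrow> real) \<Rightarrow> bool" where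
  "left_translation_invariant G N q \<longleftrightarrow>
     (\<forall>a\<in>carrier G. \<forall>p\<in>topspace (mtop N). \<forall>v\<in>tangent_space N p.
        q (a <#\<^bsub>G\<^esub> p) (differential N N (\<lambda>x. a <#\<^bsub>G\<^esub> x) v) = q p v)"

text \<open>
  \<open>\<real>\<^bsup>p+q\<^esup>\<close> is indexed by a disjoint sum of types: the form is negative on the coordinates
  \<open>Inl i\<close> and positive on the coordinates \<open>Inr j\<close>.
\<close>

definition quad_form :: "real ^ ('p::finite + 'q::finite) \<Rightarrow> real" where
  "quad_form x = - (\<Sum>i\<in>UNIV. (x $ Inl i)\<^sup>2) + (\<Sum>j\<in>UNIV. (x $ Inr j)\<^sup>2)"

definition bilin_form ::
  "real ^ ('p::finite + 'q::finite) \<Rightarrow> real ^ ('p + 'q) \<Rightarrow> real" where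
  "bilin_form x y = - (\<Sum>i\<in>UNIV. x $ Inl i * y $ Inl i) + (\<Sum>j\<in>UNIV. x $ Inr j * y $ Inr j)"

definition SO :: "(real ^ ('p::finite + 'q::finite) ^ ('p + 'q)) set" where
  "SO = {A. det A = 1 \<and> (\<forall>x. quad_form (A *v x) = quad_form x)}"

definition SO_group :: "(real ^ ('p::finite + 'q::finite) ^ ('p + 'q)) monoid" where
  "SO_group = \<lparr>carrier = SO, mult = (**), one = mat 1\<rparr>"

definition so :: "(real ^ ('p::finite + 'q::finite) ^ ('p + 'q)) set" where
  "so = {A. \<forall>x y. bilin_form (A *v x) y + bilin_form x (A *v y) = 0}"

definition standard_so1n :: "2 \<Rightarrow> (real ^ (2 + 'n::finite) ^ (2 + 'n)) set" where
  "standard_so1n i = {A \<in> so. A *v axis (Inl i) 1 = 0}"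

definition lie_algebra_iso_so ::
  "(('g \<Rightarrow> real) \<Rightarrow> ('g \<Rightarrow> real)) set
     \<Rightarrow> ((('g \<Rightarrow> real) \<Rightarrow> ('g \<Rightarrow> real)) \<Rightarrow> real ^ ('p::finite + 'q::finite) ^ ('p + 'q)) \<Rightarrow> bool" where
  "lie_algebra_iso_so L \<sigma> \<longleftrightarrow>
     linear_map_on L so \<sigma> \<and> bij_betw \<sigma> L so \<and>
     (\<forall>X\<in>L. \<forall>Y\<in>L. \<sigma> (lie_bracket X Y) = \<sigma> X ** \<sigma> Y - \<sigma> Y ** \<sigma> X)"

end

theory Submission
  imports Defs
begin

text \<open>
  Pulled back to \<open>so(2,n)\<close>, the invariant metric becomes a symmetric form with radical \<open>h\<close>, invariant under \<open>Ad H\<close> and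
  hence under \<open>ad h\<close>. Along a divergent sequence in \<open>Ad H\<close>, the limits of images of vectors tending to zero are null and
  mutually orthogonal. As a Lorentz form has no totally isotropic plane, some combination \<open>w\<close> of two independent limits lies
  in \<open>h\<close>, and the rate of contraction can be arranged so that \<open>(ad w)\<^sup>5 = 0\<close>.

  Such a \<open>w\<close> is a nilpotent matrix, and a case analysis on its degree shows that \<open>h\<close> contains some \<open>u \<and> p\<close> with \<open>u\<close> null and
  orthogonal to \<open>p\<close>. If \<open>p\<close> is null as well, weights force \<open>h = so(2,n)\<close>, which is absurd. Otherwise the \<open>q\<close> orthogonal to
  \<open>u\<close> with \<open>u \<and> q\<close> in \<open>h\<close> are those orthogonal to a vector \<open>p0\<close>; the Lorentz signature makes \<open>p0\<close> negative, and \<open>h\<close> is its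
  annihilator.

  On the geometric side, \<open>h\<close> is the kernel of the differential of \<open>G \<rightarrow> G/H\<close> at the identity, because smooth functions on
  \<open>G/H\<close> separate points; and the isotropy representation preserves the pulled back form.
\<close>

section \<open>Skew matrices of an indefinite form\<close>

text \<open>The obstacle is that one limit of contracted vectors is only a null vector of
  \<open>so / h\<close>, not an element of \<open>h\<close>: two independent limits are needed, and
  the second may be contracted much more slowly than the first. If \<open>lam\<close> bounds the
  norms of an automorphism and of its inverse, the first vector has size \<open>1 / lam\<close>,
  while for the second only size \<open>1 / sqrt lam\<close> can be guaranteed. Conjugating
  \<open>ad v\<close> costs a factor \<open>lam\<close> on each side, so the k-th power of the limit
  is controlled by \<open>lam^2 |v|^k\<close>, and k = 5 is the least exponent for which this tends
  to zero. The same 5 is still small enough that its binomial expansion on bivectors excludes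
  nilpotent matrices \<open>w\<close> with \<open>w^3\<close> nonzero.

  The signature of the metric enters the algebra only through \<open>lor\<close>: the quotient has
  no totally isotropic plane. The bound on \<open>CARD('n)\<close> enters through dimension counts:
  the matrices act on a space of dimension at least 5, so four linear conditions leave a nonzero
  vector and two leave a positive one.\<close>

abbreviation bf :: "real ^ ('p::finite + 'q::finite) \<Rightarrow> real ^ ('p + 'q) \<Rightarrow> real" where
  "bf \<equiv> bilin_form"

definition sg :: "'p + 'q \<Rightarrow> real" where "sg i = (case i of Inl _ \<Rightarrow> - 1 | Inr _ \<Rightarrow> 1)"

lemma sum_plus_type:
  fixes f :: "'p::finite + 'q::finite \<Rightarrow> 'a::comm_monoid_add"
  shows "sum f UNIV = (\<Sum>i\<in>UNIV. f (Inl i)) + (\<Sum>j\<in>UNIV. f (Inr j))"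
proof -
  have "sum f UNIV = sum f (UNIV <+> UNIV)" by simp
  also have "\<dots> = (\<Sum>i\<in>UNIV. f (Inl i)) + (\<Sum>j\<in>UNIV. f (Inr j))"
    by (subst sum.Plus) (simp_all add: o_def)
  finally show ?thesis .
qed

lemma bf_sum: "bf x y = (\<Sum>i\<in>UNIV. sg i * x $ i * y $ i)"
  unfolding bilin_form_def sum_plus_type by (simp add: sg_def sum_negf)

lemma quad_form_bf: "quad_form x = bf x x"
  unfolding quad_form_def bilin_form_def by (simp add: power2_eq_square)

lemma bf_sym: "bf x y = bf y x"
  unfolding bf_sum by (simp add: mult.commute mult.left_commute)

lemma bf_add_left [simp]: "bf (x + y) z = bf x z + bf y z"
  and bf_diff_left [simp]: "bf (x - y) z = bf x z - bf y z"
  and bf_scaleR_left [simp]: "bf (c *\<^sub>R x) z = c * bf x z"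
  and bf_minus_left [simp]: "bf (- x) z = - bf x z"
  and bf_zero_left [simp]: "bf 0 z = 0"
  unfolding bf_sum by (simp_all add: algebra_simps sum.distrib sum_subtractf sum_distrib_left sum_negf)

lemma bf_add_right [simp]: "bf z (x + y) = bf z x + bf z y"
  and bf_diff_right [simp]: "bf z (x - y) = bf z x - bf z y"
  and bf_scaleR_right [simp]: "bf z (c *\<^sub>R x) = c * bf z x"
  and bf_minus_right [simp]: "bf z (- x) = - bf z x"
  and bf_zero_right [simp]: "bf z 0 = 0"
  by (simp_all add: bf_sym[of z])

lemma bf_axis: "bf x (axis i 1) = sg i * x $ i"
  unfolding bf_sum axis_def by (simp add: if_distrib if_distribR cong: if_cong)

lemma sg_square [simp]: "sg i * sg i = 1"
  by (simp add: sg_def split: sum.split)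

lemma sg_nonzero [simp]: "sg i \<noteq> 0"
  by (simp add: sg_def split: sum.split)

lemma bf_nondegenerate: "(\<And>y. bf x y = 0) \<Longrightarrow> x = 0"
  by (simp add: vec_eq_iff) (metis bf_axis mult_eq_0_iff sg_nonzero)

lemma bf_eqI: "(\<And>y. bf x y = bf z y) \<Longrightarrow> x = z"
  using bf_nondegenerate[of "x - z"] by simp

lemma bf_riesz:
  assumes "linear f" obtains p where "\<And>x. f x = bf p x"
proof
  fix x :: "real ^ ('a + 'b)"
  have "f x = f (\<Sum>i\<in>UNIV. x $ i *\<^sub>R axis i 1)"
    by (rule arg_cong[of _ _ f]) (simp add: vec_eq_iff axis_def if_distrib cong: if_cong)
  also have "\<dots> = (\<Sum>i\<in>UNIV. x $ i * f (axis i 1))" by (simp add: linear_sum[OF assms] linear_cmul[OF assms])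
  also have "\<dots> = bf (\<chi> i. sg i * f (axis i 1)) x"
    unfolding bf_sum by (simp add: mult.commute mult.left_commute mult.assoc[symmetric])
  finally show "f x = bf (\<chi> i. sg i * f (axis i 1)) x" .
qed

lemma bf_inner: "bf a x = (\<chi> i. sg i * a $ i) \<bullet> x"
  by (simp add: bf_sum inner_vec_def)

lemma subspace_bf_zero: "subspace {x. bf a x = 0}"
  by (auto simp: subspace_def)

lemma dim_Int_bf_zero:
  assumes "subspace S" shows "dim S \<le> dim (S \<inter> {x. bf a x = 0}) + 1"
proof (cases "a = 0")
  case False
  define b where "b = (\<chi> i. sg i * a $ i)"
  have "b \<noteq> 0"
  proof
    assume "b = 0"
    then have "a = 0" by (simp add: b_def vec_eq_iff)
    then show False using False by simp
  qed
  have eq: "{x. bf a x = 0} = {x. b \<bullet> x = 0}" by (simp add: bf_inner b_def)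
  have "dim {x. b \<bullet> x = 0} + 1 = DIM(real ^ ('a + 'b))" using dim_hyperplane[OF \<open>b \<noteq> 0\<close>] by simp
  moreover have "dim {x + y |x y. x \<in> S \<and> y \<in> {x. b \<bullet> x = 0}} + dim (S \<inter> {x. b \<bullet> x = 0}) = dim S + dim
      {x. b \<bullet> x = 0}"
    by (rule dim_sums_Int[OF assms subspace_hyperplane])
  moreover have "dim {x + y |x y. x \<in> S \<and> y \<in> {x. b \<bullet> x = 0}} \<le> DIM(real ^ ('a + 'b))" by (rule dim_subset_UNIV)
  ultimately show ?thesis unfolding eq by linarith
qed (simp)

lemma dim_pos_nonzero:
  fixes S :: "'a::euclidean_space set"
  assumes "dim S \<ge> 1" shows "\<exists>x\<in>S. x \<noteq> 0"
proof (rule ccontr)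
  assume "\<not> (\<exists>x\<in>S. x \<noteq> 0)"
  then have "S \<subseteq> {0}" by auto
  then have "dim S = 0" by (simp only: dim_eq_0)
  then show False using assms by linarith
qed

text \<open>The negative index is 2: two linear conditions remove the negative coordinates, and in
  dimension 3 a nonzero vector survives them.\<close>

lemma positive_vector_exists:
  fixes S :: "(real ^ (2 + 'n::finite)) set"
  assumes "subspace S" "dim S \<ge> 3"
  shows "\<exists>x\<in>S. bf x x > 0"
proof -
  let ?S1 = "S \<inter> {x. bf (axis (Inl 1) 1) x = 0}"
  let ?S2 = "?S1 \<inter> {x. bf (axis (Inl 2) 1) x = 0}"
  have s1: "subspace ?S1" by (intro subspace_inter assms subspace_bf_zero)
  have s2: "subspace ?S2" by (intro subspace_inter s1 subspace_bf_zero)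
  have "dim ?S2 \<ge> 1"
    using dim_Int_bf_zero[OF assms(1), of "axis (Inl 1) 1"] dim_Int_bf_zero[OF s1, of "axis (Inl 2) 1"] assms(2) by linarith
  then obtain x where x: "x \<in> ?S2" "x \<noteq> 0" using dim_pos_nonzero[of ?S2] by blast
  have 0: "x $ Inl i = 0" for i :: 2
    using x(1) bf_axis[of x "Inl 1"] bf_axis[of x "Inl 2"] exhaust_2[of i] by (auto simp: bf_sym)
  then have "\<exists>j. x $ Inr j \<noteq> 0" using x(2) by (auto simp: vec_eq_iff) (metis sum.exhaust)
  then have "(\<Sum>j\<in>UNIV. (x $ Inr j)\<^sup>2) > 0" by (auto intro!: sum_pos2 simp: zero_less_power2)
  then have "bf x x > 0" by (simp add: bilin_form_def 0 power2_eq_square)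
  then show ?thesis using x(1) by blast
qed

lemma negative_vector_orthogonal:
  fixes u :: "real ^ (2 + 'n::finite)"
  shows "\<exists>a. bf u a = 0 \<and> bf a a < 0"
proof -
  let ?e = "\<lambda>i. axis (Inl i) 1 :: real ^ (2 + 'n)"
  have ee: "bf (?e i) (?e j) = (if i = j then - 1 else 0)" for i j
    unfolding bf_axis by (simp add: axis_def sg_def)
  have ue: "bf u (?e i) = - u $ Inl i" for i by (simp add: bf_axis sg_def)
  show ?thesis
  proof (cases "u $ Inl 1 = 0")
    case True
    then show ?thesis by (intro exI[of _ "?e 1"]) (simp add: ue ee)
  next
    case False
    \<comment> \<open>The negative part of \<open>u\<close> turned by a right angle inside the
      negative plane.\<close>
    let ?a = "u $ Inl 2 *\<^sub>R ?e 1 - u $ Inl 1 *\<^sub>R ?e 2"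
    have "bf ?a ?a = - ((u $ Inl 2)\<^sup>2 + (u $ Inl 1)\<^sup>2)" by (simp add: ee power2_eq_square)
    moreover have "(u $ Inl 2)\<^sup>2 + (u $ Inl 1)\<^sup>2 > 0" using False by (simp add: sum_power2_gt_zero_iff)
    ultimately show ?thesis by (intro exI[of _ ?a]) (simp add: ue)
  qed
qed

text \<open>\<open>wdg a b\<close> is the bivector \<open>a \<and> b\<close> under the isomorphism of the second exterior power with \<open>so\<close>.\<close>

definition wdg :: "real ^ ('p::finite + 'q::finite) \<Rightarrow> real ^ ('p + 'q) \<Rightarrow> real ^ ('p + 'q) ^ ('p + 'q)" where
  "wdg a b = matrix (\<lambda>x. bf a x *\<^sub>R b - bf b x *\<^sub>R a)"

lemma wdg_apply: "wdg a b *v x = bf a x *\<^sub>R b - bf b x *\<^sub>R a"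
  unfolding wdg_def by (rule fun_cong[OF matrix_vector_mul(2)]) (auto intro!: linearI simp: algebra_simps)

lemma mat_eqI: "(\<And>x. A *v x = B *v x) \<Longrightarrow> A = B" for A B :: "real ^ 'm ^ 'n"
  by (simp add: matrix_eq)

lemma mv_scaleR: "(c *\<^sub>R A) *v x = c *\<^sub>R (A *v x)" for A :: "real ^ 'm ^ 'n"
  by (simp add: matrix_vector_mult_def vec_eq_iff sum_distrib_left mult.assoc)

lemma mv_minus: "(- A) *v x = - (A *v x)" for A :: "real ^ 'm ^ 'n"
  by (simp add: matrix_vector_mult_def vec_eq_iff sum_negf)

lemma mv_zero: "0 *v x = 0" for x :: "real ^ 'm"
  by (simp add: matrix_vector_mult_def vec_eq_iff)

lemma mv_minus_right: "A *v (- x) = - (A *v x)" for A :: "real ^ 'm ^ 'n"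
  by (simp add: matrix_vector_mult_def vec_eq_iff sum_negf)

lemmas mv_simps = mv_minus_right matrix_vector_mult_add_rdistrib matrix_vector_mult_diff_rdistrib mv_scaleR mv_minus mv_zero
  matrix_vector_right_distrib matrix_vector_mult_diff_distrib matrix_vector_mult_scaleR matrix_vector_mul_assoc[symmetric]

lemma wdg_add_left: "wdg (a + a') b = wdg a b + wdg a' b"
  and wdg_add_right: "wdg a (b + b') = wdg a b + wdg a b'"
  and wdg_diff_left: "wdg (a - a') b = wdg a b - wdg a' b"
  and wdg_diff_right: "wdg a (b - b') = wdg a b - wdg a b'"
  and wdg_scaleR_left: "wdg (c *\<^sub>R a) b = c *\<^sub>R wdg a b"
  and wdg_scaleR_right: "wdg a (c *\<^sub>R b) = c *\<^sub>R wdg a b"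
  and wdg_minus_left: "wdg (- a) b = - wdg a b"
  and wdg_minus_right: "wdg a (- b) = - wdg a b"
  and wdg_zero_left: "wdg 0 b = 0"
  and wdg_zero_right: "wdg a 0 = 0"
  and wdg_self: "wdg a a = 0"
  by (rule mat_eqI; simp add: wdg_apply mv_simps algebra_simps)+

lemmas wdg_simps = wdg_add_left wdg_add_right wdg_diff_left wdg_diff_right wdg_scaleR_left wdg_scaleR_right
  wdg_minus_left wdg_minus_right wdg_zero_left wdg_zero_right wdg_self

lemma wdg_swap: "wdg b a = - wdg a b"
  by (rule mat_eqI) (simp add: wdg_apply mv_simps)

lemma soD: "A \<in> so \<Longrightarrow> bf (A *v x) y = - bf x (A *v y)"
  unfolding so_def mem_Collect_eq by (metis add_eq_0_iff minus_minus)

lemma soD0: "A \<in> so \<Longrightarrow> bf x (A *v x) = 0"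
  using soD[of A x x] bf_sym[of "A *v x" x] by simp

lemma wdg_so: "wdg a b \<in> so"
  unfolding so_def by (auto simp: wdg_apply bf_sym[of _ a] bf_sym[of _ b])

lemma subspace_so: "subspace so"
  unfolding subspace_def so_def by (auto simp: mv_simps algebra_simps) (metis distrib_left mult_zero_right)

definition br :: "real ^ 'm ^ 'm \<Rightarrow> real ^ 'm ^ 'm \<Rightarrow> real ^ 'm ^ 'm" where
  "br A B = A ** B - B ** A"

lemma br_apply: "br A B *v x = A *v (B *v x) - B *v (A *v x)"
  by (simp add: br_def mv_simps)

lemma br_add_right: "br A (B + C) = br A B + br A C"
  and br_scaleR_right: "br A (c *\<^sub>R B) = c *\<^sub>R br A B"
  and br_diff_right: "br A (B - C) = br A B - br A C"
  and br_minus_right: "br A (- B) = - br A B"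
  and br_zero_right: "br A 0 = 0"
  and br_add_left: "br (B + C) A = br B A + br C A"
  and br_scaleR_left: "br (c *\<^sub>R B) A = c *\<^sub>R br B A"
  by (rule mat_eqI; simp add: br_apply mv_simps algebra_simps)+

lemma br_swap: "br A B = - br B A"
  by (simp add: br_def)

lemma so_br:
  assumes A: "A \<in> so" and B: "B \<in> so" shows "br A B \<in> so"
proof -
  have "bf (br A B *v x) y + bf x (br A B *v y) = 0" for x y
    by (simp add: br_apply soD[OF A] soD[OF B])
  then show ?thesis unfolding so_def by blast
qed

text \<open>Skewness of \<open>A\<close> moves it across the pairing, so that \<open>ad A\<close> is
  a derivation of bivectors. Nearly every bracket below is evaluated by this rule.\<close>

lemma br_wdg: "A \<in> so \<Longrightarrow> br A (wdg a b) = wdg (A *v a) b + wdg a (A *v b)"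
  by (rule mat_eqI) (simp add: br_apply wdg_apply mv_simps soD)

text \<open>The sum over the basis and its dual (\<open>sg i\<close> times the basis vector) meets
  every bivector of basis vectors twice, hence the factor 1/2.\<close>

lemma so_expansion:
  assumes A: "A \<in> so"
  shows "A = (1 / 2) *\<^sub>R (\<Sum>i\<in>UNIV. sg i *\<^sub>R wdg (axis i 1) (A *v axis i 1))"
proof (rule mat_eqI, rule bf_eqI)
  fix x y
  have mvs: "(\<Sum>i\<in>I. f i) *v x = (\<Sum>i\<in>I. f i *v x)" for I :: "'i set" and f :: "'i \<Rightarrow> real ^ ('a + 'b) ^ ('a + 'b)"
    by (induction I rule: infinite_finite_induct) (simp_all add: mv_simps)
  have bfs: "bf (\<Sum>i\<in>I. f i) y = (\<Sum>i\<in>I. bf (f i) y)" for I :: "'i set" and f :: "'i \<Rightarrow> real ^ ('a + 'b)"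
    by (induction I rule: infinite_finite_induct) simp_all
  have e: "(\<Sum>i\<in>UNIV. sg i * (bf (axis i 1) p * bf (axis i 1) q)) = bf p q" for p q :: "real ^ ('a + 'b)"
    unfolding bf_sym[of "axis _ _"] bf_axis unfolding bf_sum
    by (rule sum.cong) (simp_all add: mult.assoc[symmetric] mult.commute[of "_ $ _"])
  have "bf ((\<Sum>i\<in>UNIV. sg i *\<^sub>R wdg (axis i 1) (A *v axis i 1)) *v x) y
      = (\<Sum>i\<in>UNIV. sg i * (bf (axis i 1) x * bf (A *v axis i 1) y - bf (A *v axis i 1) x * bf (axis i 1) y))"
    by (simp add: mvs bfs mv_simps wdg_apply)
  also have "\<dots> = (\<Sum>i\<in>UNIV. sg i * (bf (axis i 1) (A *v x) * bf (axis i 1) y)) - (\<Sum>i\<in>UNIV. sg i * (bf (axis i 1) x *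
      bf (axis i 1) (A *v y)))"
    by (simp add: soD[OF A] sum_subtractf[symmetric] algebra_simps)
  also have "\<dots> = 2 * bf (A *v x) y" unfolding e using soD[OF A, of x y] by simp
  finally show "bf (A *v x) y = bf (((1 / 2) *\<^sub>R (\<Sum>i\<in>UNIV. sg i *\<^sub>R wdg (axis i 1) (A *v axis i 1))) *v x) y"
    by (simp add: mv_simps)
qed

text \<open>It suffices to test bivectors of a spanning set: the condition extends linearly in one
  slot at a time, and \<open>so_expansion\<close> writes every element of \<open>so\<close> by
  bivectors.\<close>

lemma so_subset_subspace:
  assumes T: "subspace T" and S: "\<And>x. x \<in> span S" and w: "\<And>a b. a \<in> S \<Longrightarrow> b \<in> S \<Longrightarrow> wdg a b \<in> T"
    and A: "A \<in> so"
  shows "A \<in> T"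
proof -
  have 1: "wdg a b \<in> T" if "b \<in> S" for a b
    by (rule span_induct[OF S[of a], of "\<lambda>a. wdg a b \<in> T"])
      (use T w that in \<open>auto simp: subspace_def wdg_simps\<close>)
  have 2: "wdg a b \<in> T" for a b
    by (rule span_induct[OF S[of b], of "\<lambda>b. wdg a b \<in> T"])
      (use T 1 in \<open>auto simp: subspace_def wdg_simps\<close>)
  have "(1 / 2) *\<^sub>R (\<Sum>i\<in>UNIV. sg i *\<^sub>R wdg (axis i 1) (A *v axis i 1)) \<in> T"
    by (intro subspace_mul[OF T] subspace_sum[OF T] 2)
  then show ?thesis using so_expansion[OF A] by simp
qed

lemma bf_separate:
  assumes v: "\<And>c. u \<noteq> c *\<^sub>R v" obtains x where "bf u x = 1" "bf v x = 0"
proof -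
  have "\<exists>x. bf v x = 0 \<and> bf u x \<noteq> 0"
  proof (rule ccontr)
    assume *: "\<nexists>x. bf v x = 0 \<and> bf u x \<noteq> 0"
    show False
    proof (cases "v = 0")
      case True
      then have "u = 0" using * by (intro bf_nondegenerate) auto
      then show False using v[of 0] by simp
    next
      case False
      then obtain z where z: "bf v z \<noteq> 0" using bf_nondegenerate by blast
      have "bf u x = bf ((bf u z / bf v z) *\<^sub>R v) x" for x
      proof -
        \<comment> \<open>Up to the factor \<open>bf v z\<close>, this is the projection of
          \<open>x\<close> along \<open>z\<close> into the orthogonal complement of
          \<open>v\<close>.\<close>
        have "bf v (bf v z *\<^sub>R x - bf v x *\<^sub>R z) = 0" by (simp add: mult.commute)
        then have "bf u (bf v z *\<^sub>R x - bf v x *\<^sub>R z) = 0" using * by blast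
        then show ?thesis using z by (simp add: field_simps)
      qed
      then have "u = (bf u z / bf v z) *\<^sub>R v" by (rule bf_eqI)
      then show False using v by blast
    qed
  qed
  then obtain x where "bf v x = 0" "bf u x \<noteq> 0" by blast
  then show ?thesis by (intro that[of "(1 / bf u x) *\<^sub>R x"]) simp_all
qed

text \<open>Products of vectors are componentwise, so \<open>w * 2\<close> is twice
  \<open>w\<close>; the simplifier may collect \<open>w + w\<close> in this form.\<close>

lemma bf_double: "bf (w * 2) y = 2 * bf w y"
  by (simp only: mult_2_right bf_add_left mult_2)

text \<open>The span would be three-dimensional and free of positive vectors, against
  \<open>positive_vector_exists\<close>.\<close>

lemma null_triple_dependent:
  fixes u v p :: "real ^ (2 + 'n::finite)"
  assumes ind: "\<And>a b c. a *\<^sub>R u + b *\<^sub>R v + c *\<^sub>R p = 0 \<Longrightarrow> a = 0 \<and> b = 0 \<and> c = 0"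
    and 0: "bf u u = 0" "bf v v = 0" "bf p p = 0" "bf u v = 0" "bf u p = 0" "bf v p = 0"
  shows False
proof -
  define f where "f = (\<lambda>(a, b, c). a *\<^sub>R u + b *\<^sub>R v + c *\<^sub>R p)"
  have lin: "linear f" unfolding f_def by (rule linearI) (auto simp: algebra_simps)
  have "inj f"
    unfolding linear_injective_0[OF lin] using ind by (auto simp: f_def zero_prod_def)
  then have "dim (f ` UNIV) = dim (UNIV :: (real \<times> real \<times> real) set)"
    by (intro dim_image_eq[OF lin]) (simp add: inj_on_def)
  then have "dim (range f) = 3" by simp
  moreover have "subspace (range f)" by (rule linear_subspace_image[OF lin subspace_UNIV])
  ultimately obtain x where "x \<in> range f" "bf x x > 0" using positive_vector_exists[of "range f"] by auto
  then show False using 0 bf_sym[of v u] bf_sym[of p u] bf_sym[of p v] by (auto simp: f_def)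
qed

lemma dim_orthogonal_list:
  fixes as :: "(real ^ (2 + 'n::finite)) list"
  shows "subspace {x. \<forall>a\<in>set as. bf a x = 0} \<and> 2 + CARD('n) \<le> dim {x. \<forall>a\<in>set as. bf a x = 0} + length as"
proof (induction as)
  case (Cons a as)
  have eq: "{x. \<forall>a'\<in>set (a # as). bf a' x = 0} = {x. \<forall>a\<in>set as. bf a x = 0} \<inter> {x. bf a x = 0}" by auto
  show ?case unfolding eq
    using Cons dim_Int_bf_zero[of "{x. \<forall>a\<in>set as. bf a x = 0}" a] subspace_inter[OF _ subspace_bf_zero, of _ a] by auto
qed simp

text \<open>As a quadratic in \<open>t\<close> the form has leading and constant coefficients of
  opposite sign, so its discriminant \<open>4 * D\<close> is positive.\<close>

lemma bilinear_null_root: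
  fixes a b :: "real ^ (2 + 'n::finite)"
  assumes "bf a a < 0" "bf b b > 0"
  obtains t where "bf (a + t *\<^sub>R b) (a + t *\<^sub>R b) = 0"
proof -
  define D where "D = (bf a b)\<^sup>2 - bf b b * bf a a"
  have D: "D \<ge> 0" unfolding D_def using assms by (smt (verit) mult_pos_neg zero_le_power2)
  define t where "t = (- bf a b + sqrt D) / bf b b"
  have 1: "bf b b * t = - bf a b + sqrt D" using assms by (simp add: t_def)
  have "bf b b * bf (a + t *\<^sub>R b) (a + t *\<^sub>R b) = bf b b * bf a a + 2 * bf a b * (bf b b * t) + (bf b b * t)\<^sup>2"
    by (simp add: bf_sym[of b a] algebra_simps power2_eq_square)
  also have "\<dots> = bf b b * bf a a - (bf a b)\<^sup>2 + (sqrt D)\<^sup>2"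
    unfolding 1 by (simp add: algebra_simps power2_eq_square)
  also have "\<dots> = 0" using D by (simp add: D_def)
  finally show ?thesis using assms that by auto
qed

section \<open>Subalgebras of so(2,n) with an invariant Lorentz form on the quotient\<close>

text \<open>\<open>\<beta>\<close> is the pullback to \<open>so\<close> of the Lorentz form on \<open>so / h\<close>.\<close>

locale so_isotropy =
  fixes h :: "(real ^ (2 + 'n::finite) ^ (2 + 'n)) set"
    and \<beta> :: "real ^ (2 + 'n) ^ (2 + 'n) \<Rightarrow> real ^ (2 + 'n) ^ (2 + 'n) \<Rightarrow> real"
  assumes n3: "CARD('n) \<ge> 3"
    and h_so: "h \<subseteq> so"
    and lin: "\<And>A. linear (\<beta> A)"
    and sym: "\<And>A B. \<beta> A B = \<beta> B A"
    and rad: "\<And>X. X \<in> so \<Longrightarrow> X \<in> h \<longleftrightarrow> (\<forall>Y\<in>so. \<beta> X Y = 0)"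
    and inv: "\<And>X A B. X \<in> h \<Longrightarrow> A \<in> so \<Longrightarrow> B \<in> so \<Longrightarrow> \<beta> (br X A) B = -
        \<beta> A (br X B)"
    and lor: "\<And>X Y. X \<in> so \<Longrightarrow> Y \<in> so \<Longrightarrow> \<beta> X X = 0 \<Longrightarrow> \<beta> X Y = 0
        \<Longrightarrow> \<beta> Y Y = 0 \<Longrightarrow>
      \<exists>s t. (s \<noteq> 0 \<or> t \<noteq> 0) \<and> s *\<^sub>R X + t *\<^sub>R Y \<in> h"
    and proper: "h \<noteq> so"
begin

lemma beta_right: "\<beta> A (B + C) = \<beta> A B + \<beta> A C" "\<beta> A (B - C) = \<beta> A B - \<beta> A C"
  "\<beta> A (c *\<^sub>R B) = c * \<beta> A B" "\<beta> A (- B) = - \<beta> A B" "\<beta> A 0 = 0"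
  using linear_add[OF lin] linear_diff[OF lin] linear_cmul[OF lin] linear_neg[OF lin] linear_0[OF lin] by auto

lemma beta_left: "\<beta> (B + C) A = \<beta> B A + \<beta> C A" "\<beta> (B - C) A = \<beta> B A - \<beta> C A"
  "\<beta> (c *\<^sub>R B) A = c * \<beta> B A" "\<beta> (- B) A = - \<beta> B A" "\<beta> 0 A = 0"
  by (simp_all add: sym[of _ A] beta_right)

lemma so_ops: "A \<in> so \<Longrightarrow> B \<in> so \<Longrightarrow> A + B \<in> so" "A \<in> so \<Longrightarrow> B \<in> so
    \<Longrightarrow> A - B \<in> so" "A \<in> so \<Longrightarrow> c *\<^sub>R A \<in> so"
  using subspace_so subspace_add subspace_diff subspace_mul by blast+

lemma h_in_so: "X \<in> h \<Longrightarrow> X \<in> so" using h_so by blast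

lemma beta_h: "X \<in> h \<Longrightarrow> Y \<in> so \<Longrightarrow> \<beta> X Y = 0" "X \<in> h \<Longrightarrow> Y \<in> so
    \<Longrightarrow> \<beta> Y X = 0"
  using rad h_so sym by (metis subsetD)+

lemma subspace_h: "subspace h"
  unfolding subspace_def
proof (intro conjI ballI allI)
  show "0 \<in> h" using rad[of 0] subspace_0[OF subspace_so] by (simp add: beta_left)
  fix X assume X: "X \<in> h"
  show "c *\<^sub>R X \<in> h" for c
    unfolding rad[OF so_ops(3)[OF h_in_so[OF X]]] using beta_h(1)[OF X] by (simp add: beta_left)
  fix Y assume Y: "Y \<in> h"
  show "X + Y \<in> h"
    unfolding rad[OF so_ops(1)[OF h_in_so[OF X] h_in_so[OF Y]]]
    using beta_h(1)[OF X] beta_h(1)[OF Y] by (simp add: beta_left)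
qed

lemmas h_add = subspace_add[OF subspace_h] and h_diff = subspace_diff[OF subspace_h]
  and h_scale = subspace_mul[OF subspace_h] and h_minus = subspace_neg[OF subspace_h] and h_zero = subspace_0[OF subspace_h]

lemma h_cancel_scale: "c *\<^sub>R X \<in> h \<Longrightarrow> c \<noteq> 0 \<Longrightarrow> X \<in> h"
  using h_scale[of "c *\<^sub>R X" "1 / c"] by simp

lemma h_add_cancel: "X + Y \<in> h \<Longrightarrow> Y \<in> h \<Longrightarrow> X \<in> h"
  using h_diff[of "X + Y" Y] by simp

lemma h_br:
  assumes X: "X \<in> h" and Y: "Y \<in> h" shows "br X Y \<in> h"
  unfolding rad[OF so_br[OF h_in_so[OF X] h_in_so[OF Y]]]
  using inv[OF X h_in_so[OF Y]] beta_h(1)[OF Y so_br[OF h_in_so[OF X]]] by simp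

abbreviation adp :: "real ^ (2 + 'n) ^ (2 + 'n) \<Rightarrow> nat \<Rightarrow> real ^ (2 + 'n) ^ (2 + 'n) \<Rightarrow> real ^ (2 + 'n) ^
    (2 + 'n)" where
  "adp X k \<equiv> br X ^^ k"

lemma adp_so: "X \<in> so \<Longrightarrow> A \<in> so \<Longrightarrow> adp X k A \<in> so"
  by (induction k) (auto intro: so_br)

lemma adp_h: "X \<in> h \<Longrightarrow> A \<in> h \<Longrightarrow> adp X k A \<in> h"
  by (induction k) (auto intro: h_br)

lemma adp_add: "adp X i (adp X j A) = adp X (i + j) A"
  by (simp add: funpow_add)

lemma beta_adp:
  assumes X: "X \<in> h" and A: "A \<in> so" and B: "B \<in> so"
  shows "\<beta> (adp X i A) B = (- 1) ^ i * \<beta> A (adp X i B)"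
  using B
proof (induction i arbitrary: B)
  case (Suc i)
  have "\<beta> (adp X (Suc i) A) B = - \<beta> (adp X i A) (br X B)"
    using inv[OF X adp_so[OF h_in_so[OF X] A] Suc.prems] by simp
  also have "\<dots> = (- 1) ^ Suc i * \<beta> A (adp X i (br X B))"
    using Suc.IH[OF so_br[OF h_in_so[OF X] Suc.prems]] by simp
  finally show ?case by (simp add: funpow_swap1)
qed simp

text \<open>By skewness all \<open>i + j\<close> brackets can be moved to one argument, which then
  lies in the radical \<open>h\<close>.\<close>

lemma adp_vanish:
  assumes X: "X \<in> h" and k: "\<And>A. A \<in> so \<Longrightarrow> adp X k A \<in> h" and A: "A \<in> so" and B: "B \<in> so"
      and ij: "i + j \<ge> k"
  shows "\<beta> (adp X i A) (adp X j B) = 0"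
proof -
  have "adp X (i + j) B = adp X (i + j - k) (adp X k B)" using ij by (simp add: adp_add)
  then have "adp X (i + j) B \<in> h" using adp_h[OF X k[OF B]] by simp
  then show ?thesis
    using beta_adp[OF X A adp_so[OF h_in_so[OF X] B], of i j] beta_h(2)[OF _ A] by (simp add: adp_add)
qed

text \<open>\<open>X \<in> h\<close> acts on \<open>so / h\<close> as a skew endomorphism of a Lorentz space; if nilpotent, such an endomorphism has
  vanishing cube.\<close>

lemma adp_nilpotent_step:
  assumes X: "X \<in> h" and k: "\<And>A. A \<in> so \<Longrightarrow> adp X (Suc k) A \<in> h" "k \<ge> 3" and A: "A \<in> so"
  shows "adp X k A \<in> h"
proof -
  let ?a = "adp X k A" and ?b = "adp X (k - 1) A"
  have so: "?a \<in> so" "?b \<in> so" using adp_so[OF h_in_so[OF X] A] by auto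
  \<comment> \<open>The least total exponent that occurs is \<open>2 * (k - 1)\<close>, and it
    reaches \<open>Suc k\<close> because \<open>k >= 3\<close>.\<close>
  obtain s t where st: "s \<noteq> 0 \<or> t \<noteq> 0" "s *\<^sub>R ?a + t *\<^sub>R ?b \<in> h"
    using lor[OF so adp_vanish[OF X k(1) A A] adp_vanish[OF X k(1) A A] adp_vanish[OF X k(1) A A]] k(2) by force
  show ?thesis
  proof (cases "t = 0")
    case True
    then show ?thesis using st h_cancel_scale[of s ?a] by simp
  next
    case False
    \<comment> \<open>Bracketing with \<open>X\<close> raises both exponents: the first term falls
      into \<open>h\<close> and the second becomes a multiple of \<open>?a\<close>.\<close>
    have "br X (s *\<^sub>R ?a + t *\<^sub>R ?b) \<in> h" by (rule h_br[OF X st(2)])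
    moreover have "br X ?b = ?a" using k(2) by (cases k) auto
    ultimately have "t *\<^sub>R ?a + s *\<^sub>R adp X (Suc k) A \<in> h" by (simp add: br_add_right br_scaleR_right add.commute)
    then have "t *\<^sub>R ?a \<in> h" by (rule h_add_cancel) (rule h_scale[OF k(1)[OF A]])
    then show ?thesis using False h_cancel_scale by blast
  qed
qed

text \<open>On \<open>so / h\<close> a skew map with square zero has totally isotropic image, hence
  rank at most one in a Lorentz space; and a skew map of rank one vanishes, as pairing with
  \<open>A\<close> shows.\<close>

lemma adp_square_zero:
  assumes X: "X \<in> h" and sq: "\<And>A. A \<in> so \<Longrightarrow> br X (br X A) \<in> h" and A: "A \<in> so"
  shows "br X A \<in> h"
proof (rule ccontr)
  assume n: "br X A \<notin> h"
  have Xs: "X \<in> so" by (rule h_in_so[OF X])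
  obtain B where B: "B \<in> so" "\<beta> (br X A) B \<noteq> 0" using n rad[OF so_br[OF Xs A]] by blast
  have z: "\<beta> (br X C) (br X D) = 0" if "C \<in> so" "D \<in> so" for C D
    using inv[OF X that(1) so_br[OF Xs that(2)]] beta_h(2)[OF sq[OF that(2)] that(1)] by simp
  obtain s t where st: "s \<noteq> 0 \<or> t \<noteq> 0" "s *\<^sub>R br X A + t *\<^sub>R br X B \<in> h"
    using lor[OF so_br[OF Xs A] so_br[OF Xs B(1)] z z z] A B(1) by blast
  have AA: "\<beta> A (br X A) = 0" using inv[OF X A A] sym[of A "br X A"] by simp
  have AB: "\<beta> A (br X B) \<noteq> 0" using inv[OF X A B(1)] B(2) by simp
  have "\<beta> A (s *\<^sub>R br X A + t *\<^sub>R br X B) = 0" by (rule beta_h(2)[OF st(2) A])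
  then have "t = 0" using AA AB by (simp add: beta_right)
  then show False using st n h_cancel_scale[of s "br X A"] by simp
qed

lemma weights_orthogonal:
  assumes "Z \<in> h" "x \<in> so" "y \<in> so" "br Z x = c *\<^sub>R x" "br Z y = d *\<^sub>R y" "c + d \<noteq> 0"
  shows "\<beta> x y = 0"
proof -
  have "c * \<beta> x y = - (d * \<beta> x y)" using inv[OF assms(1-3)] by (simp add: assms(4,5) beta_left beta_right)
  then have "(c + d) * \<beta> x y = 0" by (simp add: algebra_simps)
  then show ?thesis using assms(6) by simp
qed

text \<open>An element of weight \<open>c\<close> pairs to zero with every weight other than
  \<open>- c\<close>; \<open>opp\<close> settles the bivectors of that weight, and then
  \<open>x\<close> lies in the radical.\<close>

lemma weights_in_h:
  assumes Z: "Z \<in> h" and S: "\<And>x. x \<in> span S" and wt: "\<And>a. a \<in> S \<Longrightarrow> Z *v a = wt a *\<^sub>R a"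
    and x: "x \<in> so" "br Z x = c *\<^sub>R x"
    and opp: "\<And>a b. a \<in> S \<Longrightarrow> b \<in> S \<Longrightarrow> wt a + wt b + c = 0 \<Longrightarrow> \<beta> x (wdg a b) = 0"
  shows "x \<in> h"
proof -
  have "subspace {y. \<beta> x y = 0}" by (auto simp: subspace_def beta_right)
  moreover have "wdg a b \<in> {y. \<beta> x y = 0}" if "a \<in> S" "b \<in> S" for a b
  proof (cases "wt a + wt b + c = 0")
    case True
    then show ?thesis using opp that by simp
  next
    case False
    have "br Z (wdg a b) = (wt a + wt b) *\<^sub>R wdg a b"
      using br_wdg[OF h_in_so[OF Z]] wt that by (simp add: wdg_simps scaleR_add_left)
    from weights_orthogonal[OF Z x(1) wdg_so x(2) this] False show ?thesis by (simp add: add.commute)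
  qed
  ultimately have "y \<in> {y. \<beta> x y = 0}" if "y \<in> so" for y
    using so_subset_subspace[OF _ S _ that] by blast
  then show ?thesis using rad[OF x(1)] by blast
qed

lemma orthogonal_nonzero:
  fixes as :: "(real ^ (2 + 'n)) list"
  assumes "length as \<le> 4" obtains x where "x \<noteq> 0" "\<And>a. a \<in> set as \<Longrightarrow> bf a x = 0"
proof -
  have "dim {x. \<forall>a\<in>set as. bf a x = 0} \<ge> 1" using dim_orthogonal_list[of as] n3 assms by linarith
  from dim_pos_nonzero[OF this] show ?thesis using that by blast
qed

lemma orthogonal_positive:
  fixes as :: "(real ^ (2 + 'n)) list"
  assumes "length as \<le> 2" obtains x where "bf x x > 0" "\<And>a. a \<in> set as \<Longrightarrow> bf a x = 0"
proof -
  have "dim {x. \<forall>a\<in>set as. bf a x = 0} \<ge> 3" using dim_orthogonal_list[of as] n3 assms by linarith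
  then show ?thesis using positive_vector_exists[of "{x. \<forall>a\<in>set as. bf a x = 0}"] dim_orthogonal_list[of as] that by blast
qed

text \<open>For a totally isotropic plane the square of \<open>ad (u \<and> v)\<close> has its
  values in the line of \<open>u \<and> v\<close>, so \<open>adp_square_zero\<close> puts the whole
  image of \<open>ad (u \<and> v)\<close> in \<open>h\<close>. It contains all bivectors of negative
  weight and the grading element \<open>Z\<close>; those of positive weight then lie in the radical,
  and brackets of weights -1 and 1 supply weight zero.\<close>

lemma no_null_plane:
  assumes w: "wdg u v \<in> h" and null: "bf u u = 0" "bf v v = 0" "bf u v = 0" and ind: "\<And>c. u \<noteq> c *\<^sub>R v" "v \<noteq> 0"
  shows False
proof -
  have vu: "bf v u = 0" using null(3) bf_sym by metis
  let ?w = "wdg u v"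
  have br_w: "br ?w A \<in> h" if A: "A \<in> so" for A
  proof (rule adp_square_zero[OF w _ A])
    fix A :: "real ^ (2 + 'n) ^ (2 + 'n)" assume A: "A \<in> so"
    have "br ?w (br ?w A) = (- 2 * bf u (A *v v)) *\<^sub>R ?w"
      using null vu soD0[OF A] soD[OF A, of v u] bf_sym[of "A *v v" u]
      by (intro mat_eqI bf_eqI) (simp add: br_apply wdg_apply mv_simps, simp add: algebra_simps bf_double)
    then show "br ?w (br ?w A) \<in> h" by (simp only: h_scale[OF w])
  qed
  have br_w': "wdg (A *v u) v + wdg u (A *v v) \<in> h" if A: "A \<in> so" for A
    using h_minus[OF br_w[OF A]] br_wdg[OF A, of u v] br_swap[of A ?w] by simp
  have nu: "\<And>c. v \<noteq> c *\<^sub>R u"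
  proof
    fix c assume c: "v = c *\<^sub>R u"
    then have "c \<noteq> 0" using ind(2) by auto
    then have "u = (1 / c) *\<^sub>R v" using c by simp
    then show False using ind(1) by blast
  qed
  obtain x1 where x1: "bf u x1 = 1" "bf v x1 = 0" using bf_separate[OF ind(1)] by blast
  obtain x2 where x2: "bf v x2 = 1" "bf u x2 = 0" using bf_separate[OF nu] by blast
  \<comment> \<open>The corrections make \<open>u'\<close> and \<open>v'\<close> null and orthogonal
    to each other: \<open>u, u'\<close> and \<open>v, v'\<close> are two orthogonal hyperbolic
    pairs.\<close>
  define u' where "u' = x1 - (bf x1 x1 / 2) *\<^sub>R u"
  define v' where "v' = x2 - (bf x2 x2 / 2) *\<^sub>R v - bf x2 u' *\<^sub>R u"
  have uu': "bf u u' = 1" and vu': "bf v u' = 0" and u'u': "bf u' u' = 0"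
    using x1 null vu bf_sym[of x1 u] by (simp_all add: u'_def algebra_simps)
  have uv': "bf u v' = 0" and vv': "bf v v' = 1" and u'v': "bf u' v' = 0" and v'v': "bf v' v' = 0"
    using x2 null vu vu' uu' bf_sym[of u' u] bf_sym[of u' v] bf_sym[of u' x2] bf_sym[of x2 u] bf_sym[of x2 v]
    by (simp_all add: v'_def algebra_simps)
  have u'u: "bf u' u = 1" and u'v: "bf u' v = 0" and v'u: "bf v' u = 0" and v'v: "bf v' v = 1" and v'u': "bf v' u' = 0"
    using uu' vu' uv' vv' u'v' bf_sym by metis+
  note tab = null vu uu' vu' u'u' uv' vv' u'v' v'v' u'u u'v v'u v'v v'u'
  have vp: "wdg p v \<in> h" if p: "bf u p = 0" "bf v p = 0" for p
  proof -
    \<comment> \<open>\<open>u' \<and> p\<close> sends \<open>u\<close> to \<open>p\<close> and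
      kills \<open>v\<close>, so its bracket with \<open>u \<and> v\<close> isolates
      \<open>p \<and> v\<close>.\<close>
    have "wdg u' p *v u = p" "wdg u' p *v v = 0" using tab p bf_sym[of p u] bf_sym[of p v] by (simp_all add: wdg_apply)
    then show ?thesis using br_w'[OF wdg_so, of u' p] by (simp add: wdg_simps)
  qed
  have up: "wdg u p \<in> h" if p: "bf u p = 0" "bf v p = 0" for p
  proof -
    have "wdg v' p *v u = 0" "wdg v' p *v v = p" using tab p bf_sym[of p u] bf_sym[of p v] by (simp_all add: wdg_apply)
    then show ?thesis using br_w'[OF wdg_so, of v' p] by (simp add: wdg_simps)
  qed
  \<comment> \<open>\<open>Z\<close> grades the space: weight -1 on \<open>u, v\<close>, weight 1 on
    \<open>u', v'\<close>, weight 0 on their common complement \<open>W\<close>.\<close>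
  define Z where "Z = wdg u u' + wdg v v'"
  have Z: "Z \<in> h"
  proof -
    have "wdg u' v' *v u = v'" "wdg u' v' *v v = - u'" using tab by (simp_all add: wdg_apply)
    then show ?thesis
      using h_minus[OF br_w'[OF wdg_so, of u' v']] wdg_swap[of v v'] by (simp add: wdg_simps Z_def add.commute)
  qed
  define W where "W = {p. bf u p = 0 \<and> bf v p = 0 \<and> bf u' p = 0 \<and> bf v' p = 0}"
  define S where "S = {u, v, u', v'} \<union> W"
  define wt where "wt = (\<lambda>a. if a = u \<or> a = v then - 1 else if a = u' \<or> a = v' then 1 else (0::real))"
  have dist: "u' \<noteq> u" "u' \<noteq> v" "v' \<noteq> u" "v' \<noteq> v" using tab by auto
  have Wdist: "u \<notin> W" "v \<notin> W" "u' \<notin> W" "v' \<notin> W" using tab by (auto simp: W_def)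
  have wtv: "wt u = - 1" "wt v = - 1" "wt u' = 1" "wt v' = 1" "\<And>p. p \<in> W \<Longrightarrow> wt p = 0"
    using dist Wdist by (auto simp: wt_def)
  have Zv: "Z *v u = - u" "Z *v v = - v" "Z *v u' = u'" "Z *v v' = v'" "\<And>p. p \<in> W \<Longrightarrow> Z *v p = 0"
    using tab by (simp_all add: Z_def wdg_apply mv_simps W_def)
  have Zwt: "Z *v a = wt a *\<^sub>R a" if "a \<in> S" for a
    using that by (auto simp: S_def wtv Zv)
  have span: "x \<in> span S" for x
  proof -
    let ?w = "x - bf u' x *\<^sub>R u - bf u x *\<^sub>R u' - bf v' x *\<^sub>R v - bf v x *\<^sub>R v'"
    have "?w \<in> W" using tab by (simp add: W_def)
    then have "?w \<in> span S" by (intro span_base) (simp add: S_def)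
    moreover have "u \<in> span S" "v \<in> span S" "u' \<in> span S" "v' \<in> span S" by (auto intro!: span_base simp: S_def)
    ultimately have "?w + bf v x *\<^sub>R v' + bf v' x *\<^sub>R v + bf u x *\<^sub>R u' + bf u' x *\<^sub>R u \<in> span S"
      by (intro span_add span_scale)
    then show ?thesis by simp
  qed
  have Wuv: "wdg u p \<in> h" "wdg v p \<in> h" "wdg p u \<in> h" "wdg p v \<in> h" if "p \<in> W" for p
    using up[of p] vp[of p] that h_minus[OF up[of p]] h_minus[OF vp[of p]] wdg_swap[of p u] wdg_swap[of p v]
    by (auto simp: W_def)
  have wvu: "wdg v u \<in> h" using h_minus[OF w] wdg_swap[of v u] by simp
  have low: "\<beta> x (wdg a b) = 0" if "a \<in> S" "b \<in> S" "wt a + wt b \<le> - 1" "x \<in> so" for a b x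
  proof -
    have "wdg a b \<in> h"
      using that(1-3) w wvu Wuv h_zero unfolding S_def by (auto simp: wtv wdg_simps)
    then show ?thesis using beta_h(2) that(4) by blast
  qed
  have u'p: "wdg u' p \<in> h" if p: "p \<in> W" for p
  proof (rule weights_in_h[OF Z span Zwt wdg_so, where c = 1])
    show "br Z (wdg u' p) = 1 *\<^sub>R wdg u' p" using p by (simp add: br_wdg[OF h_in_so[OF Z]] Zv wdg_simps)
  qed (use low[OF _ _ _ wdg_so] in auto)
  have v'p: "wdg v' p \<in> h" if p: "p \<in> W" for p
  proof (rule weights_in_h[OF Z span Zwt wdg_so, where c = 1])
    show "br Z (wdg v' p) = 1 *\<^sub>R wdg v' p" using p by (simp add: br_wdg[OF h_in_so[OF Z]] Zv wdg_simps)
  qed (use low[OF _ _ _ wdg_so] in auto)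
  have u'v'h: "wdg u' v' \<in> h"
  proof (rule weights_in_h[OF Z span Zwt wdg_so, where c = 2])
    show "br Z (wdg u' v') = 2 *\<^sub>R wdg u' v'" by (simp add: br_wdg[OF h_in_so[OF Z]] Zv wdg_simps scaleR_2)
  qed (use low[OF _ _ _ wdg_so] in auto)
  \<comment> \<open>A nonzero vector of \<open>W\<close> exists because the dimension is at least 5;
    it is not null, since \<open>u\<close>, \<open>v\<close> and it would form a null triple. It
    separates the bivectors of weight zero: with \<open>p = q = p0\<close> the bivector
    \<open>p \<and> q\<close> drops out of \<open>rel\<close>.\<close>
  obtain p0 where p0: "p0 \<noteq> 0" "p0 \<in> W"
    by (rule orthogonal_nonzero[of "[u, v, u', v']"]) (auto simp: W_def)
  have k0: "bf p0 p0 \<noteq> 0"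
  proof
    assume "bf p0 p0 = 0"
    show False
    proof (rule null_triple_dependent[of u v p0])
      fix a b c assume abc: "a *\<^sub>R u + b *\<^sub>R v + c *\<^sub>R p0 = 0"
      have "bf u' (a *\<^sub>R u + b *\<^sub>R v + c *\<^sub>R p0) = 0" "bf v' (a *\<^sub>R u + b *\<^sub>R v + c *\<^sub>R p0) = 0"
          unfolding abc by simp_all
      then have "a = 0" "b = 0" using tab p0(2) by (simp_all add: W_def)
      then show "a = 0 \<and> b = 0 \<and> c = 0" using abc p0(1) by simp
    qed (use null p0(2) \<open>bf p0 p0 = 0\<close> in \<open>auto simp: W_def\<close>)
  qed
  have rel: "wdg p q + bf p q *\<^sub>R wdg u u' \<in> h" if p: "p \<in> W" and q: "q \<in> W" for p q
  proof -
    have "br (wdg u p) (wdg u' q) = wdg p q + bf p q *\<^sub>R wdg u u'"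
      using p q tab wdg_swap[of u' u] bf_sym[of p u'] by (simp add: br_wdg[OF wdg_so] wdg_apply W_def wdg_simps)
    then show ?thesis using h_br[OF Wuv(1)[OF p] u'p[OF q]] by simp
  qed
  have uu'h: "wdg u u' \<in> h" using rel[OF p0(2) p0(2)] k0 h_cancel_scale by (simp add: wdg_simps)
  have vv'h: "wdg v v' \<in> h" using h_diff[OF Z uu'h] by (simp add: Z_def)
  have pq: "wdg p q \<in> h" if "p \<in> W" "q \<in> W" for p q
    using h_add_cancel[OF rel[OF that] h_scale[OF uu'h]] .
  have uv'h: "wdg u v' \<in> h"
  proof -
    have "br (wdg u p0) (wdg v' p0) = bf p0 p0 *\<^sub>R wdg u v'"
      using p0(2) tab wdg_swap[of v' u] bf_sym[of p0 v'] by (simp add: br_wdg[OF wdg_so] wdg_apply W_def wdg_simps)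
    then show ?thesis using h_br[OF Wuv(1)[OF p0(2)] v'p[OF p0(2)]] k0 h_cancel_scale by simp
  qed
  have vu'h: "wdg v u' \<in> h"
  proof -
    have "br (wdg v p0) (wdg u' p0) = bf p0 p0 *\<^sub>R wdg v u'"
      using p0(2) tab wdg_swap[of u' v] bf_sym[of p0 u'] by (simp add: br_wdg[OF wdg_so] wdg_apply W_def wdg_simps)
    then show ?thesis using h_br[OF Wuv(2)[OF p0(2)] u'p[OF p0(2)]] k0 h_cancel_scale by simp
  qed
  have swap: "wdg b a \<in> h" if "wdg a b \<in> h" for a b using h_minus[OF that] wdg_swap[of b a] by simp
  have all: "wdg a b \<in> h" if "a \<in> S" "b \<in> S" for a b
    using that w Wuv u'p v'p u'v'h uu'h vv'h pq uv'h vu'h h_zero unfolding S_def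
    by (auto simp: wdg_simps intro: swap)
  have "so \<subseteq> h" using so_subset_subspace[OF subspace_h span all] by blast
  then show False using h_so proper by blast
qed

end

section \<open>Null rotations in \<open>h\<close> and the stabilizer of a negative vector\<close>

text \<open>Removing the \<open>p\<close>-component first keeps \<open>bf u y = 1\<close>, since
  \<open>u\<close> is orthogonal to \<open>p\<close>; a multiple of \<open>u\<close> then makes the
  vector null.\<close>

lemma dual_null_vector:
  assumes "u \<noteq> 0" "bf u u = 0" "bf u p = 0" "bf p p \<noteq> 0"
  obtains u' where "bf u u' = 1" "bf u' u' = 0" "bf p u' = 0"
proof -
  obtain x where x: "bf u x \<noteq> 0" using assms(1) bf_nondegenerate by blast
  define y where "y = (1 / bf u x) *\<^sub>R (x - (bf p x / bf p p) *\<^sub>R p)"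
  have y: "bf u y = 1" "bf p y = 0" using x assms by (simp_all add: y_def)
  show ?thesis
    by (rule that[of "y - (bf y y / 2) *\<^sub>R u"])
      (use assms y bf_sym[of p u] bf_sym[of y u] in \<open>simp_all add: algebra_simps\<close>)
qed

context so_isotropy
begin

text \<open>\<open>A u\<close> is orthogonal to \<open>u\<close> by skewness, so the square takes
  its values in the bivectors \<open>u \<and> c\<close> with \<open>c\<close> orthogonal to
  \<open>u\<close>. These commute with one another, whence \<open>wdg_cube\<close>.\<close>

lemma wdg_square:
  assumes u: "bf u u = 0" "bf u q = 0" and A: "A \<in> so"
  shows "br (wdg u q) (br (wdg u q) A) = (- bf q q) *\<^sub>R wdg u (A *v u) + (2 * bf (A *v u) q) *\<^sub>R wdg u q"
proof -
  have "bf q u = 0" using u bf_sym by metis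
  moreover have "bf u (A *v q) = - bf q (A *v u)" using soD[OF A, of u q] bf_sym[of "A *v u" q] by simp
  ultimately show ?thesis
    using u soD0[OF A] soD[OF A, of u] soD[OF A, of q]
    by (intro mat_eqI bf_eqI) (simp add: br_apply wdg_apply mv_simps, simp add: algebra_simps bf_double)
qed

lemma br_wdg_null:
  assumes u: "bf u u = 0" "bf u q = 0" "bf u c = 0"
  shows "br (wdg u q) (wdg u c) = 0"
  using u bf_sym[of q u] by (simp add: br_wdg[OF wdg_so] wdg_apply wdg_simps)

lemma wdg_cube:
  assumes u: "bf u u = 0" "bf u q = 0" and A: "A \<in> so"
  shows "br (wdg u q) (br (wdg u q) (br (wdg u q) A)) = 0"
  using br_wdg_null[OF u soD0[OF A]] br_wdg_null[OF u u(2)]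
  by (simp add: wdg_square[OF u A] br_add_right br_diff_right br_scaleR_right br_minus_right)

text \<open>For \<open>X = u \<and> q\<close> the image of \<open>(ad X)^2\<close> is totally
  isotropic modulo \<open>h\<close>, since the fourth power vanishes, so it is at most a line there.
  On \<open>u' \<and> d\<close> the square returns \<open>u \<and> d\<close> up to the factor
  \<open>- bf q q\<close> and a multiple of \<open>X\<close>.\<close>

lemma wdg_square_codim:
  assumes q: "wdg u q \<in> h" and u: "u \<noteq> 0" "bf u u = 0" "bf u q = 0" "bf q q \<noteq> 0" and c: "bf u c1 = 0" "bf u c2 = 0"
  shows "\<exists>s t. (s \<noteq> 0 \<or> t \<noteq> 0) \<and> s *\<^sub>R wdg u c1 + t *\<^sub>R wdg u c2 \<in> h"
proof -
  let ?X = "wdg u q"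
  obtain u' where u': "bf u u' = 1" using dual_null_vector[OF u] by blast
  have Au: "wdg u' d *v u = d" if "bf u d = 0" for d
    using that u' bf_sym[of u' u] bf_sym[of d u] by (simp add: wdg_apply)
  have sq: "br ?X (br ?X (wdg u' d)) = (- bf q q) *\<^sub>R wdg u d + (2 * bf d q) *\<^sub>R ?X" if "bf u d = 0" for d
    using wdg_square[OF u(2,3) wdg_so, of u' d] unfolding Au[OF that] .
  have k3: "adp ?X 3 A \<in> h" if "A \<in> so" for A
    using wdg_cube[OF u(2,3) that] h_zero by (simp add: numeral_3_eq_3)
  have van: "\<beta> (br ?X (br ?X A)) (br ?X (br ?X B)) = 0" if "A \<in> so" "B \<in> so" for A B
    using adp_vanish[OF q k3 that, of 2 2] by (simp add: numeral_2_eq_2)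
  have in_so: "br ?X (br ?X (wdg u' d)) \<in> so" for d by (intro so_br wdg_so)
  obtain s t where st: "s \<noteq> 0 \<or> t \<noteq> 0"
      "s *\<^sub>R br ?X (br ?X (wdg u' c1)) + t *\<^sub>R br ?X (br ?X (wdg u' c2)) \<in> h"
    using lor[OF in_so in_so van[OF wdg_so wdg_so] van[OF wdg_so wdg_so] van[OF wdg_so wdg_so], of c1 c2] by blast
  have "s *\<^sub>R br ?X (br ?X (wdg u' c1)) + t *\<^sub>R br ?X (br ?X (wdg u' c2))
      = (- bf q q) *\<^sub>R (s *\<^sub>R wdg u c1 + t *\<^sub>R wdg u c2) + (2 * (s * bf c1 q + t * bf c2 q)) *\<^sub>R ?X"
    unfolding sq[OF c(1)] sq[OF c(2)] by (simp add: algebra_simps)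
  then have "(- bf q q) *\<^sub>R (s *\<^sub>R wdg u c1 + t *\<^sub>R wdg u c2) \<in> h"
    using st(2) h_add_cancel[OF _ h_scale[OF q]] by metis
  then have "s *\<^sub>R wdg u c1 + t *\<^sub>R wdg u c2 \<in> h" by (rule h_cancel_scale) (use u(4) in simp)
  then show ?thesis using st(1) by blast
qed

lemma null_direction:
  assumes u: "u \<noteq> 0" "bf u u = 0" and q: "wdg u q \<in> h" "bf u q = 0" "bf q q = 0"
  shows "\<exists>c. q = c *\<^sub>R u"
proof (rule ccontr)
  assume n: "\<nexists>c. q = c *\<^sub>R u"
  have "wdg q u \<in> h" using h_minus[OF q(1)] wdg_swap[of q u] by simp
  then show False using no_null_plane[of q u] n u q bf_sym[of q u] by auto
qed

text \<open>Some \<open>a + t b\<close> is null, and by \<open>null_direction\<close> it is a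
  multiple of \<open>u\<close>, thus orthogonal to \<open>a\<close> and \<open>b\<close>. This makes
  \<open>bf a a\<close> a nonnegative multiple of \<open>bf b b\<close>.\<close>

lemma indefinite_contradiction:
  assumes u: "u \<noteq> 0" "bf u u = 0" and a: "bf u a = 0" "bf a a < 0" and b: "bf u b = 0" "bf b b > 0"
    and h: "\<And>t. wdg u (a + t *\<^sub>R b) \<in> h"
  shows False
proof -
  obtain t where t: "bf (a + t *\<^sub>R b) (a + t *\<^sub>R b) = 0" using bilinear_null_root[OF a(2) b(2)] by blast
  have "bf u (a + t *\<^sub>R b) = 0" using a b by simp
  then obtain c where c: "a + t *\<^sub>R b = c *\<^sub>R u" using null_direction[OF u h[of t] _ t] by blast
  have 1: "bf (a + t *\<^sub>R b) a = 0" "bf (a + t *\<^sub>R b) b = 0" unfolding c using a b by auto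
  then have "bf a b = - t * bf b b" by simp
  then have "bf a a = t\<^sup>2 * bf b b" using 1 bf_sym[of b a] by (simp add: power2_eq_square)
  then show False using a(2) b(2) by (smt (verit) mult_nonneg_nonneg zero_le_power2)
qed

text \<open>In the complement of \<open>u\<close>, the condition \<open>u \<and> q \<in> h\<close>
  defines a subspace of codimension at most one by \<open>wdg_square_codim\<close>, and a proper one
  by \<open>indefinite_contradiction\<close>. Hence it is the kernel of a functional, which
  \<open>bf\<close> turns into \<open>p0\<close>.\<close>

lemma isotropy_hyperplane:
  assumes p: "wdg u p \<in> h" and u: "u \<noteq> 0" "bf u u = 0" "bf u p = 0" "bf p p \<noteq> 0"
  obtains p0 where "bf u p0 = 0" "bf p0 p0 < 0" "\<And>q. bf u q = 0 \<Longrightarrow> wdg u q \<in> h \<longleftrightarrow> bf p0 q = 0"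
proof -
  have "\<exists>q1. bf u q1 = 0 \<and> wdg u q1 \<notin> h"
  proof (rule ccontr)
    assume n: "\<nexists>q1. bf u q1 = 0 \<and> wdg u q1 \<notin> h"
    obtain a where a: "bf u a = 0" "bf a a < 0" using negative_vector_orthogonal by blast
    obtain b where b: "bf b b > 0" "bf u b = 0" by (rule orthogonal_positive[of "[u]"]) auto
    have "wdg u (a + t *\<^sub>R b) \<in> h" for t using n a b by simp
    then show False using indefinite_contradiction[OF u(1,2) a b(2,1)] by blast
  qed
  then obtain q1 where q1: "bf u q1 = 0" "wdg u q1 \<notin> h" by blast
  have ex: "\<exists>!c. wdg u (x - c *\<^sub>R q1) \<in> h" if x: "bf u x = 0" for x
  proof -
    obtain s t where st: "s \<noteq> 0 \<or> t \<noteq> 0" "s *\<^sub>R wdg u q1 + t *\<^sub>R wdg u x \<in> h"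
      using wdg_square_codim[OF p u q1(1) x] by blast
    have "t \<noteq> 0" using st q1(2) h_cancel_scale[of s "wdg u q1"] by auto
    have "wdg u (x - (- (s / t)) *\<^sub>R q1) = (1 / t) *\<^sub>R (s *\<^sub>R wdg u q1 + t *\<^sub>R wdg u x)"
      using \<open>t \<noteq> 0\<close> by (simp add: wdg_simps scaleR_add_right add.commute)
    then have "wdg u (x - (- (s / t)) *\<^sub>R q1) \<in> h" using h_scale[OF st(2)] by simp
    moreover have "c = c'" if "wdg u (x - c *\<^sub>R q1) \<in> h" "wdg u (x - c' *\<^sub>R q1) \<in> h" for c c'
    proof (rule ccontr)
      assume "c \<noteq> c'"
      have "wdg u (x - c *\<^sub>R q1) - wdg u (x - c' *\<^sub>R q1) = (c' - c) *\<^sub>R wdg u q1"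
        by (simp add: wdg_simps scaleR_diff_left)
      then have "(c' - c) *\<^sub>R wdg u q1 \<in> h" using h_diff[OF that] by simp
      then show False using h_cancel_scale q1(2) \<open>c \<noteq> c'\<close> by (metis right_minus_eq)
    qed
    ultimately show ?thesis by blast
  qed
  obtain u' where u': "bf u u' = 1" using dual_null_vector[OF u] by blast
  \<comment> \<open>\<open>pr\<close> extends the functional from the complement of \<open>u\<close>
    to the whole space, where \<open>bf_riesz\<close> applies.\<close>
  define pr where "pr = (\<lambda>x. x - bf u x *\<^sub>R u')"
  have pr: "bf u (pr x) = 0" for x using u' by (simp add: pr_def)
  define f where "f = (\<lambda>x. THE c. wdg u (pr x - c *\<^sub>R q1) \<in> h)"
  have f: "wdg u (pr x - f x *\<^sub>R q1) \<in> h" for x unfolding f_def by (rule theI'[OF ex[OF pr]])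
  have f_eq: "f x = c" if "wdg u (pr x - c *\<^sub>R q1) \<in> h" for x c using ex[OF pr] f that by blast
  have "linear f"
  proof (rule linearI)
    fix x y
    have "wdg u (pr (x + y) - (f x + f y) *\<^sub>R q1) = wdg u (pr x - f x *\<^sub>R q1) + wdg u (pr y - f y *\<^sub>R q1)"
      by (simp add: wdg_simps pr_def scaleR_add_left)
    then show "f (x + y) = f x + f y" using f_eq h_add[OF f f] by metis
  next
    fix c x
    have "wdg u (pr (c *\<^sub>R x) - (c * f x) *\<^sub>R q1) = c *\<^sub>R wdg u (pr x - f x *\<^sub>R q1)"
      by (simp add: wdg_simps pr_def scaleR_diff_right)
    then show "f (c *\<^sub>R x) = c *\<^sub>R f x" using f_eq h_scale[OF f] by (metis real_scaleR_def)
  qed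
  then obtain p0 where p0: "\<And>x. f x = bf p0 x" using bf_riesz by blast
  have Q: "wdg u q \<in> h \<longleftrightarrow> bf p0 q = 0" if q: "bf u q = 0" for q
  proof -
    have prq: "pr q = q" using q by (simp add: pr_def)
    show ?thesis
    proof
      assume "wdg u q \<in> h"
      then have "f q = 0" using f_eq[of q 0] by (simp add: prq)
      then show "bf p0 q = 0" by (simp add: p0)
    next
      assume "bf p0 q = 0"
      then show "wdg u q \<in> h" using f[of q] by (simp add: p0 prq)
    qed
  qed
  have p0u: "bf p0 u = 0" using Q[OF u(2)] h_zero by (simp add: wdg_self)
  then have up0: "bf u p0 = 0" using bf_sym by metis
  \<comment> \<open>A null \<open>p0\<close> would satisfy its own condition and so be a multiple of
    \<open>u\<close>; then every \<open>q\<close> orthogonal to \<open>u\<close> would satisfy it,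
    including \<open>q1\<close>.\<close>
  have "bf p0 p0 \<noteq> 0"
  proof
    assume z: "bf p0 p0 = 0"
    then have "wdg u p0 \<in> h" using Q[OF up0] by simp
    then obtain c where "p0 = c *\<^sub>R u" using null_direction[OF u(1,2) _ up0 z] by blast
    then have "bf p0 q1 = 0" using q1(1) by simp
    then show False using Q[OF q1(1)] q1(2) by simp
  qed
  \<comment> \<open>A positive \<open>p0\<close> would leave vectors of both signs, \<open>a\<close>
    and \<open>b\<close>, in the common complement of \<open>u\<close> and
    \<open>p0\<close>.\<close>
  moreover have "\<not> bf p0 p0 > 0"
  proof
    assume pos: "bf p0 p0 > 0"
    obtain a0 where a0: "bf u a0 = 0" "bf a0 a0 < 0" using negative_vector_orthogonal by blast
    define a where "a = a0 - (bf p0 a0 / bf p0 p0) *\<^sub>R p0"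
    have a: "bf u a = 0" "bf p0 a = 0" using a0 up0 pos by (simp_all add: a_def)
    have "bf a a = bf a0 a0 - (bf p0 a0)\<^sup>2 / bf p0 p0"
      using pos bf_sym[of a0 p0] by (simp add: a_def power2_eq_square)
    also have "\<dots> < 0" using a0(2) pos by (smt (verit) divide_nonneg_pos zero_le_power2)
    finally have aa: "bf a a < 0" .
    obtain b where b: "bf b b > 0" "bf u b = 0" "bf p0 b = 0" by (rule orthogonal_positive[of "[u, p0]"]) auto
    have "wdg u (a + t *\<^sub>R b) \<in> h" for t using Q[of "a + t *\<^sub>R b"] a b by simp
    then show False using indefinite_contradiction[OF u(1,2) a(1) aa b(2,1)] by blast
  qed
  ultimately show ?thesis using that[of p0] up0 Q by force
qed

text \<open>Modulo \<open>h\<close> the square of \<open>ad (u \<and> q)\<close> sends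
  \<open>A\<close> to a multiple of \<open>bf (A u) p0\<close> times \<open>e = u \<and> p0\<close>.
  So \<open>e\<close> spans a null line of \<open>so / h\<close> whose orthogonal complement is
  given by \<open>bf (A u) p0 = 0\<close>; on that complement \<open>ad (u \<and> q)\<close> has
  null values orthogonal to \<open>e\<close>, and in a Lorentz space these are multiples of
  \<open>e\<close>.\<close>

lemma isotropy_eps:
  assumes u: "u \<noteq> 0" "bf u u = 0" and p0: "bf u p0 = 0" "bf p0 p0 < 0"
    and Q0: "\<forall>q. bf u q = 0 \<longrightarrow> (wdg u q \<in> h \<longleftrightarrow> bf p0 q = 0)"
    and q: "bf u q = 0" "bf p0 q = 0" "bf q q \<noteq> 0"
  shows "wdg u p0 \<notin> h"
    and "\<And>A. A \<in> h \<Longrightarrow> bf (A *v u) p0 = 0"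
    and "\<And>A. A \<in> so \<Longrightarrow> bf (A *v u) p0 = 0 \<Longrightarrow> \<beta> (wdg u p0) A = 0"
    and "\<And>A. A \<in> so \<Longrightarrow> bf (A *v u) p0 = 0 \<Longrightarrow> \<exists>c. br (wdg u q) A + c *\<^sub>R wdg u p0 \<in> h"
proof -
  let ?X = "wdg u q" and ?e = "wdg u p0"
  have Q: "wdg u q \<in> h \<longleftrightarrow> bf p0 q = 0" if "bf u q = 0" for q using Q0 that by blast
  show e: "?e \<notin> h" using Q[OF p0(1)] p0(2) by simp
  have X: "?X \<in> h" using Q[OF q(1)] q(2) by simp
  have Xs: "?X \<in> so" by (rule wdg_so)
  have sq: "br ?X (br ?X A) + (bf q q * (bf (A *v u) p0 / bf p0 p0)) *\<^sub>R ?e \<in> h" if A: "A \<in> so" for A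
  proof -
    \<comment> \<open>The component of \<open>A u\<close> orthogonal to \<open>p0\<close>: by
      \<open>Q0\<close> its bivector with \<open>u\<close> lies in \<open>h\<close>, so only the
      \<open>p0\<close>-component of the square survives.\<close>
    let ?d = "A *v u - (bf (A *v u) p0 / bf p0 p0) *\<^sub>R p0"
    have "wdg u ?d \<in> h" using Q[of ?d] soD0[OF A, of u] p0 bf_sym[of "A *v u" p0] by simp
    then have "(- bf q q) *\<^sub>R wdg u ?d + (2 * bf (A *v u) q) *\<^sub>R ?X \<in> h" by (intro h_add h_scale X)
    moreover have "br ?X (br ?X A) + (bf q q * (bf (A *v u) p0 / bf p0 p0)) *\<^sub>R ?e
        = (- bf q q) *\<^sub>R wdg u ?d + (2 * bf (A *v u) q) *\<^sub>R ?X"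
      unfolding wdg_square[OF u(2) q(1) A] by (simp add: wdg_simps scaleR_diff_right)
    ultimately show ?thesis by simp
  qed
  show 2: "bf (A *v u) p0 = 0" if A: "A \<in> h" for A
  proof -
    have "br ?X (br ?X A) \<in> h" by (intro h_br X A)
    then have "(bf q q * (bf (A *v u) p0 / bf p0 p0)) *\<^sub>R ?e \<in> h"
      using sq[OF h_in_so[OF A]] h_add_cancel by (metis add.commute)
    then have "bf q q * (bf (A *v u) p0 / bf p0 p0) = 0" using h_cancel_scale e by blast
    then show ?thesis using q(3) p0(2) by simp
  qed
  have sq0: "br ?X (br ?X A) \<in> h" if "A \<in> so" "bf (A *v u) p0 = 0" for A
    using sq[OF that(1)] that(2) by simp
  obtain u' where u': "bf u u' = 1" using dual_null_vector[OF u p0(1)] p0(2) by (metis less_irrefl)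
  \<comment> \<open>\<open>A1\<close> is chosen with \<open>A1 u = p0\<close>, so that its square
    represents \<open>e\<close> up to the factor \<open>- bf q q\<close>; pairings with
    \<open>e\<close> can then be moved across the square by skewness.\<close>
  define A1 where "A1 = wdg u' p0"
  have A1: "A1 \<in> so" "A1 *v u = p0"
    using u' p0(1) bf_sym[of u' u] bf_sym[of p0 u] wdg_so by (simp_all add: A1_def wdg_apply)
  have e1: "br ?X (br ?X A1) + bf q q *\<^sub>R ?e \<in> h" using sq[OF A1(1)] A1(2) p0(2) by simp
  have eB: "bf q q * \<beta> ?e B = - \<beta> (br ?X (br ?X A1)) B" if "B \<in> so" for B
    using beta_h(1)[OF e1 that] by (simp add: beta_left)
  have mv: "\<beta> (br ?X (br ?X A)) B = \<beta> A (br ?X (br ?X B))" if "A \<in> so" "B \<in> so" for A B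
    using inv[OF X so_br[OF Xs that(1)] that(2)] inv[OF X that(1) so_br[OF Xs that(2)]] by simp
  show 3: "\<beta> ?e A = 0" if A: "A \<in> so" "bf (A *v u) p0 = 0" for A
    using eB[OF A(1)] mv[OF A1(1) A(1)] beta_h(2)[OF sq0[OF A] A1(1)] q(3) by simp
  show "\<exists>c. br ?X A + c *\<^sub>R ?e \<in> h" if A: "A \<in> so" "bf (A *v u) p0 = 0" for A
  proof -
    have NA: "br ?X A \<in> so" by (rule so_br[OF Xs A(1)])
    have 1: "\<beta> (br ?X A) (br ?X A) = 0"
      using inv[OF X A(1) NA] beta_h(2)[OF sq0[OF A] A(1)] by simp
    have 4: "\<beta> (br ?X A) ?e = 0"
      using eB[OF NA] mv[OF A1(1) NA] wdg_cube[OF u(2) q(1) A(1)] q(3) by (simp add: sym[of "br ?X A"] beta_right)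
    have 5: "\<beta> ?e ?e = 0"
      by (rule 3[OF wdg_so]) (use u(2) p0(1) bf_sym[of p0 u] in \<open>simp add: wdg_apply\<close>)
    obtain s t where st: "s \<noteq> 0 \<or> t \<noteq> 0" "s *\<^sub>R br ?X A + t *\<^sub>R ?e \<in> h"
      using lor[OF NA wdg_so 1 4 5] by blast
    have "s \<noteq> 0" using st e h_cancel_scale[of t ?e] by auto
    then have "(1 / s) *\<^sub>R (s *\<^sub>R br ?X A + t *\<^sub>R ?e) = br ?X A + (t / s) *\<^sub>R ?e" by (simp add: scaleR_add_right)
    then show ?thesis using h_scale[OF st(2), of "1 / s"] by metis
  qed
qed

text \<open>Weights of the boost \<open>u \<and> u'\<close> decide the whole of \<open>h\<close>:
  all bivectors of vectors orthogonal to \<open>p0\<close> turn out to lie in \<open>h\<close>,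
  while no nonzero \<open>p0 \<and> r\<close> with \<open>r\<close> orthogonal to \<open>p0\<close>
  does.\<close>

lemma isotropy_stabilizer_aux:
  assumes u: "u \<noteq> 0" "bf u u = 0" and p0: "bf u p0 = 0" "bf p0 p0 < 0"
    and Q0: "\<forall>q. bf u q = 0 \<longrightarrow> (wdg u q \<in> h \<longleftrightarrow> bf p0 q = 0)"
    and u': "bf u u' = 1" "bf u' u' = 0" "bf p0 u' = 0" and Z: "wdg u u' \<in> h"
  shows "h = {A \<in> so. A *v p0 = 0}"
proof -
  have Q: "wdg u q \<in> h \<longleftrightarrow> bf p0 q = 0" if "bf u q = 0" for q using Q0 that by blast
  have u'u: "bf u' u = 1" and p0u: "bf p0 u = 0" and u'p0: "bf u' p0 = 0" using u' p0 bf_sym by metis+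
  note tab = u(2) p0(1) u' u'u p0u u'p0
  define W where "W = {q. bf u q = 0 \<and> bf u' q = 0 \<and> bf p0 q = 0}"
  \<comment> \<open>By \<open>null_direction\<close> such a vector is a multiple of
    \<open>u\<close>, and being orthogonal to \<open>u'\<close> it vanishes.\<close>
  have Wnull: "q = 0" if q: "q \<in> W" "bf q q = 0" for q
  proof -
    have "wdg u q \<in> h" using Q q by (simp add: W_def)
    then obtain c where c: "q = c *\<^sub>R u" using null_direction[OF u _ _ q(2)] q(1) by (auto simp: W_def)
    have "bf u' q = 0" using q(1) by (simp add: W_def)
    then show ?thesis using c u'u by simp
  qed
  obtain q0 where q0: "q0 \<noteq> 0" "q0 \<in> W" by (rule orthogonal_nonzero[of "[u, u', p0]"]) (auto simp: W_def)
  have q00: "bf q0 q0 \<noteq> 0" using Wnull q0 by blast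
  have q0': "bf u q0 = 0" "bf p0 q0 = 0" using q0(2) by (auto simp: W_def)
  note eps = isotropy_eps[OF u p0 Q0 q0' q00]
  have uq: "wdg u q \<in> h" if "q \<in> W" for q using Q[of q] that by (simp add: W_def)
  have br_uq: "br (wdg u q) (wdg u' q') = wdg q q' + bf q q' *\<^sub>R wdg u u'" if "q \<in> W" "q' \<in> W" for q q'
    using that tab wdg_swap[of u' u] bf_sym[of q u'] by (simp add: br_wdg[OF wdg_so] wdg_apply W_def wdg_simps)
  have Zv: "wdg u u' *v u = - u" "wdg u u' *v u' = u'" "wdg u u' *v p0 = 0" "\<And>q. q \<in> W \<Longrightarrow> wdg u u' *v q = 0"
    using tab by (simp_all add: wdg_apply W_def)
  have qq: "wdg q q' \<in> h" if q: "q \<in> W" and q': "q' \<in> W" for q q'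
  proof (cases "q = 0")
    case False
    have nq: "bf q q \<noteq> 0" using Wnull q False by blast
    have "bf u q = 0" "bf p0 q = 0" using q by (auto simp: W_def)
    note epsq = isotropy_eps(4)[OF u p0 Q0 this nq wdg_so]
    have "wdg u' q' *v u = q'" using q' u'u bf_sym[of q' u] by (simp add: wdg_apply W_def)
    then have "bf (wdg u' q' *v u) p0 = 0" using q' bf_sym[of q' p0] by (simp add: W_def)
    from epsq[OF this] obtain c where c: "wdg q q' + bf q q' *\<^sub>R wdg u u' + c *\<^sub>R wdg u p0 \<in> h"
      unfolding br_uq[OF q q'] by blast
    then have 1: "wdg q q' + c *\<^sub>R wdg u p0 \<in> h"
      using h_diff[OF c h_scale[OF Z, of "bf q q'"]] by (simp add: algebra_simps)
    \<comment> \<open>The unwanted term has weight -1 while \<open>q \<and> q'\<close> has weight 0,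
      so bracketing with the boost isolates it; as \<open>u \<and> p0\<close> is not in
      \<open>h\<close>, its coefficient is zero.\<close>
    have "br (wdg u u') (wdg q q' + c *\<^sub>R wdg u p0) = (- c) *\<^sub>R wdg u p0"
      using q q' by (simp add: br_add_right br_scaleR_right br_wdg[OF wdg_so] Zv wdg_simps)
    then have "(- c) *\<^sub>R wdg u p0 \<in> h" using h_br[OF Z 1] by simp
    then have "c = 0" using h_cancel_scale eps(1) by (metis neg_equal_0_iff_equal)
    then show ?thesis using 1 by simp
  qed (simp add: wdg_simps h_zero)
  define S where "S = {u, u', p0} \<union> W"
  define wt where "wt = (\<lambda>a. if a = u then - 1 else if a = u' then 1 else (0::real))"
  have "u' \<noteq> u" "p0 \<noteq> u" "p0 \<noteq> u'" "u \<notin> W" "u' \<notin> W" using tab p0 by (auto simp: W_def)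
  then have wtv: "wt u = - 1" "wt u' = 1" "wt p0 = 0" "\<And>q. q \<in> W \<Longrightarrow> wt q = 0" by (auto simp: wt_def)
  have Zwt: "wdg u u' *v a = wt a *\<^sub>R a" if "a \<in> S" for a using that by (auto simp: S_def wtv Zv)
  have span: "x \<in> span S" for x
  proof -
    let ?w = "x - bf u' x *\<^sub>R u - bf u x *\<^sub>R u' - (bf p0 x / bf p0 p0) *\<^sub>R p0"
    have "?w \<in> W" using tab p0(2) by (simp add: W_def)
    then have "?w \<in> span S" by (intro span_base) (simp add: S_def)
    moreover have "u \<in> span S" "u' \<in> span S" "p0 \<in> span S" by (auto intro!: span_base simp: S_def)
    ultimately have "?w + (bf p0 x / bf p0 p0) *\<^sub>R p0 + bf u x *\<^sub>R u' + bf u' x *\<^sub>R u \<in> span S"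
      by (intro span_add span_scale)
    then show ?thesis by simp
  qed
  have swap: "wdg b a \<in> h" if "wdg a b \<in> h" for a b using h_minus[OF that] wdg_swap[of b a] by simp
  have u'q: "wdg u' q \<in> h" if q: "q \<in> W" for q
  proof (rule weights_in_h[OF Z span Zwt wdg_so, where c = 1])
    show "br (wdg u u') (wdg u' q) = 1 *\<^sub>R wdg u' q" using q by (simp add: br_wdg[OF wdg_so] Zv wdg_simps)
    fix a b assume ab: "a \<in> S" "b \<in> S" "wt a + wt b + 1 = 0"
    \<comment> \<open>In weight -1 the bivectors are \<open>u \<and> q\<close> with \<open>q\<close>
      in \<open>W\<close>, which lie in \<open>h\<close>, and \<open>u \<and> p0\<close>, which
      needs this separate argument.\<close>
    have "\<beta> (wdg u p0) (wdg u' q) = 0"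
      by (rule eps(3)[OF wdg_so]) (use q u'u bf_sym[of q u] bf_sym[of q p0] in \<open>simp add: wdg_apply W_def\<close>)
    then have "\<beta> (wdg u' q) (wdg u p0) = 0" "\<beta> (wdg u' q) (wdg p0 u) = 0"
      using sym[of "wdg u p0"] wdg_swap[of p0 u] by (simp_all add: beta_right)
    then show "\<beta> (wdg u' q) (wdg a b) = 0"
      using ab beta_h(2)[OF uq wdg_so] beta_h(2)[OF swap[OF uq] wdg_so] unfolding S_def by (auto simp: wtv)
  qed
  let ?s = "{A \<in> so. A *v p0 = 0}"
  have kill: "wdg a b *v p0 = 0" if "bf p0 a = 0" "bf p0 b = 0" for a b
    using that bf_sym[of a p0] bf_sym[of b p0] by (simp add: wdg_apply)
  \<comment> \<open>\<open>T\<close> collects the matrices that split into an element of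
    \<open>h\<close> killing \<open>p0\<close> and some \<open>p0 \<and> r\<close>. Being a subspace
    that contains all bivectors of \<open>S\<close>, it contains \<open>so\<close>;
    \<open>r0\<close> below then identifies \<open>h\<close>.\<close>
  define T where "T = {A. \<exists>r. bf p0 r = 0 \<and> A - wdg p0 r \<in> h \<and> (A - wdg p0 r) *v p0 = 0}"
  have subT: "subspace T"
    unfolding subspace_def
  proof (intro conjI ballI allI)
    show "0 \<in> T" unfolding T_def by (auto intro!: exI[of _ 0] simp: wdg_simps h_zero mv_simps)
    fix A assume "A \<in> T"
    then obtain r where r: "bf p0 r = 0" "A - wdg p0 r \<in> h" "(A - wdg p0 r) *v p0 = 0" unfolding T_def by blast
    show "c *\<^sub>R A \<in> T" for c
    proof -
      have "c *\<^sub>R A - wdg p0 (c *\<^sub>R r) = c *\<^sub>R (A - wdg p0 r)" by (simp add: wdg_simps scaleR_diff_right)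
      then show ?thesis unfolding T_def using r h_scale[OF r(2), of c] by (auto intro!: exI[of _ "c *\<^sub>R r"] simp: mv_scaleR)
    qed
    fix B assume "B \<in> T"
    then obtain r' where r': "bf p0 r' = 0" "B - wdg p0 r' \<in> h" "(B - wdg p0 r') *v p0 = 0" unfolding T_def by blast
    have eq: "A + B - wdg p0 (r + r') = (A - wdg p0 r) + (B - wdg p0 r')" by (simp add: wdg_simps)
    show "A + B \<in> T"
      unfolding T_def mem_Collect_eq
    proof (intro exI[of _ "r + r'"] conjI)
      show "A + B - wdg p0 (r + r') \<in> h" unfolding eq by (rule h_add[OF r(2) r'(2)])
      show "(A + B - wdg p0 (r + r')) *v p0 = 0"
        unfolding eq matrix_vector_mult_add_rdistrib r(3) r'(3) by simp
    qed (simp add: r(1) r'(1))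
  qed
  have T1: "A \<in> T" if "A \<in> h" "A *v p0 = 0" for A
    unfolding T_def using that by (auto intro!: exI[of _ 0] simp: wdg_simps)
  have T2: "wdg p0 r \<in> T" if "bf p0 r = 0" for r
    unfolding T_def using that by (auto intro!: exI[of _ r] simp: h_zero mv_simps)
  have T3: "wdg r p0 \<in> T" if "bf p0 r = 0" for r
    using subspace_neg[OF subT T2[OF that]] wdg_swap[of r p0] by simp
  have W0: "bf p0 q = 0" if "q \<in> W" for q using that by (simp add: W_def)
  have zT: "0 \<in> T" using subspace_0[OF subT] .
  have "wdg a b \<in> T" if "a \<in> S" "b \<in> S" for a b
  proof -
    have T4: "wdg a b \<in> T \<and> wdg b a \<in> T" if "wdg a b \<in> h" "bf p0 a = 0" "bf p0 b = 0" for a b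
      using T1[OF that(1) kill] T1[OF swap[OF that(1)] kill] that by blast
    have "wdg u q \<in> T \<and> wdg q u \<in> T" "wdg u' q \<in> T \<and> wdg q u' \<in> T" if "q \<in> W" for q
      using T4[OF uq[OF that]] T4[OF u'q[OF that]] W0[OF that] tab by auto
    moreover have "wdg q q' \<in> T" if "q \<in> W" "q' \<in> W" for q q'
      using T4[OF qq[OF that]] W0 that by auto
    moreover have "wdg u u' \<in> T \<and> wdg u' u \<in> T" using T4[OF Z] tab by auto
    moreover have "wdg p0 r \<in> T \<and> wdg r p0 \<in> T" if "r = u \<or> r = u' \<or> r \<in> W" for r
      using T2[of r] T3[of r] that tab W0 by auto
    ultimately show ?thesis using that zT unfolding S_def by (auto simp: wdg_self)
  qed
  then have soT: "A \<in> T" if "A \<in> so" for A using so_subset_subspace[OF subT span _ that] by blast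
  \<comment> \<open>Three tests bring \<open>r\<close> down: \<open>isotropy_eps\<close> gives
    \<open>bf u r = 0\<close>, the bracket with the boost gives \<open>bf u' r = 0\<close>, and the
    bracket with \<open>u' \<and> r\<close> turns \<open>p0 \<and> r\<close> into a multiple of
    \<open>p0 \<and> u'\<close>, forcing \<open>bf r r = 0\<close>.\<close>
  have r0: "r = 0" if r: "bf p0 r = 0" "wdg p0 r \<in> h" for r
  proof -
    have "bf u r = 0 " if r: "bf p0 r = 0" "wdg p0 r \<in> h" for r
      using eps(2)[OF r(2)] r(1) p0(2) p0u bf_sym[of r u] by (simp add: wdg_apply)
    note ur = this
    have "br (wdg u u') (wdg p0 r) = (- bf u' r) *\<^sub>R wdg p0 u"
      using ur[OF r] by (simp add: br_wdg[OF wdg_so] Zv wdg_apply[of u u' r] wdg_simps)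
    then have "(- bf u' r) *\<^sub>R wdg p0 u \<in> h" using h_br[OF Z r(2)] by simp
    then have "bf u' r = 0" using h_cancel_scale swap eps(1) by (metis neg_equal_0_iff_equal)
    then have "r \<in> W" using ur[OF r] r(1) by (simp add: W_def)
    have "br (wdg u' r) (wdg p0 r) = wdg p0 ((- bf r r) *\<^sub>R u')"
      using \<open>bf u' r = 0\<close> r(1) tab bf_sym[of r p0] by (simp add: br_wdg[OF wdg_so] wdg_apply wdg_simps)
    then have "wdg p0 ((- bf r r) *\<^sub>R u') \<in> h" using h_br[OF u'q[OF \<open>r \<in> W\<close>] r(2)] by simp
    from ur[OF _ this] have "bf r r = 0" using u' by simp
    then show ?thesis using Wnull[OF \<open>r \<in> W\<close>] by blast
  qed
  show ?thesis
  proof (intro equalityI subsetI)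
    fix A assume A: "A \<in> h"
    then obtain r where r: "bf p0 r = 0" "A - wdg p0 r \<in> h" "(A - wdg p0 r) *v p0 = 0"
      using soT[OF h_in_so[OF A]] unfolding T_def by blast
    have "wdg p0 r \<in> h" using h_diff[OF A r(2)] by simp
    then have "r = 0" using r0 r(1) by blast
    then show "A \<in> ?s" using r(3) h_in_so[OF A] by (simp add: wdg_simps)
  next
    fix A assume A: "A \<in> ?s"
    then obtain r where r: "bf p0 r = 0" "A - wdg p0 r \<in> h" "(A - wdg p0 r) *v p0 = 0"
      using soT unfolding T_def by blast
    have "wdg p0 r *v p0 = 0" using r(3) A by (simp add: mv_simps)
    then have "bf p0 p0 *\<^sub>R r = 0" using r(1) bf_sym[of r p0] by (simp add: wdg_apply)
    then have "r = 0" using p0(2) by simp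
    then show "A \<in> h" using r(2) by (simp add: wdg_simps)
  qed
qed

text \<open>\<open>isotropy_eps\<close> gives the boost \<open>u \<and> u'\<close> only up to a
  multiple of \<open>u \<and> p0\<close>. A null rotation fixing \<open>u\<close> absorbs the error:
  it replaces \<open>u'\<close> and \<open>p0\<close> by \<open>u''\<close> and \<open>p1\<close>
  without changing the condition on \<open>q\<close>.\<close>

lemma isotropy_stabilizer:
  assumes p: "wdg u p \<in> h" and u: "u \<noteq> 0" "bf u u = 0" "bf u p = 0" "bf p p \<noteq> 0"
  shows "\<exists>p0. bf p0 p0 < 0 \<and> h = {A \<in> so. A *v p0 = 0}"
proof -
  obtain p0 where p0: "bf u p0 = 0" "bf p0 p0 < 0" and Q: "\<And>q. bf u q = 0 \<Longrightarrow> wdg u q \<in> h \<longleftrightarrow> bf p0 q = 0"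
    by (rule isotropy_hyperplane[OF p u]) blast
  have Q0: "\<forall>q. bf u q = 0 \<longrightarrow> (wdg u q \<in> h \<longleftrightarrow> bf p0 q = 0)" using Q by blast
  have nz: "bf p0 p0 \<noteq> 0" using p0(2) by simp
  obtain u' where u': "bf u u' = 1" "bf u' u' = 0" "bf p0 u' = 0" using dual_null_vector[OF u(1,2) p0(1) nz] by blast
  have sy: "bf u' u = 1" "bf p0 u = 0" "bf u' p0 = 0" using u' p0 bf_sym by metis+
  obtain q where q: "q \<noteq> 0" "bf u q = 0" "bf u' q = 0" "bf p0 q = 0" by (rule orthogonal_nonzero[of "[u, u', p0]"]) auto
  have uq: "wdg u q \<in> h" using Q[OF q(2)] q(4) by simp
  have qq: "bf q q \<noteq> 0"
  proof
    assume "bf q q = 0"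
    then obtain c where "q = c *\<^sub>R u" using null_direction[OF u(1,2) uq q(2)] by blast
    then show False using q sy by simp
  qed
  have "bf (wdg u' q *v u) p0 = 0" using q sy bf_sym[of q u] bf_sym[of q p0] by (simp add: wdg_apply)
  from isotropy_eps(4)[OF u(1,2) p0 Q0 q(2,4) qq wdg_so this]
  obtain c where c: "br (wdg u q) (wdg u' q) + c *\<^sub>R wdg u p0 \<in> h" by blast
  have "br (wdg u q) (wdg u' q) = bf q q *\<^sub>R wdg u u'"
    using q u' sy wdg_swap[of u' u] bf_sym[of q u'] by (simp add: br_wdg[OF wdg_so] wdg_apply wdg_simps)
  then have c: "bf q q *\<^sub>R wdg u u' + c *\<^sub>R wdg u p0 \<in> h" using c by simp
  define d where "d = c / bf q q"
  have d: "wdg u u' + d *\<^sub>R wdg u p0 \<in> h"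
    using h_scale[OF c, of "1 / bf q q"] qq by (simp add: d_def scaleR_add_right)
  \<comment> \<open>\<open>e\<close> is determined by \<open>bf u'' u'' = 0\<close>.\<close>
  define e where "e = - (d\<^sup>2 * bf p0 p0) / 2"
  define u'' where "u'' = u' + d *\<^sub>R p0 + e *\<^sub>R u"
  define p1 where "p1 = p0 - (d * bf p0 p0) *\<^sub>R u"
  have "h = {A \<in> so. A *v p1 = 0}"
  proof (rule isotropy_stabilizer_aux[OF u(1,2)])
    show "bf u p1 = 0" "bf p1 p1 < 0" using u p0 sy by (simp_all add: p1_def)
    show "\<forall>q. bf u q = 0 \<longrightarrow> (wdg u q \<in> h \<longleftrightarrow> bf p1 q = 0)" using Q by (simp add: p1_def)
    show "bf u u'' = 1" "bf p1 u'' = 0" using u u' p0 sy by (simp_all add: u''_def p1_def)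
    show "bf u'' u'' = 0" using u u' p0 sy by (simp add: u''_def e_def power2_eq_square)
    have "wdg u u'' = wdg u u' + d *\<^sub>R wdg u p0" by (simp add: u''_def wdg_simps)
    then show "wdg u u'' \<in> h" using d by simp
  qed
  moreover have "bf p1 p1 < 0" using u p0 sy by (simp add: p1_def)
  ultimately show ?thesis by blast
qed

end

section \<open>Elements of \<open>h\<close> that are ad-nilpotent\<close>

lemma funpow_additive:
  fixes P :: "'a::ab_group_add \<Rightarrow> 'a"
  assumes "\<And>f g. P (f + g) = P f + P g" shows "(P ^^ n) (f + g) = (P ^^ n) f + (P ^^ n) g"
  by (induction n) (simp_all add: assms)

lemma additive_zero:
  fixes P :: "'a::ab_group_add \<Rightarrow> 'a"
  assumes "\<And>f g. P (f + g) = P f + P g" shows "(P ^^ n) 0 = 0"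
  using funpow_additive[OF assms, of n 0 0] by simp

text \<open>The binomial argument for commuting nilpotents at a single vector: nilpotency is only
  known on \<open>F\<close>. The induction on \<open>m + n\<close> splits off one application of
  \<open>P + Q\<close>.\<close>

lemma commuting_nilpotent_add:
  fixes P Q :: "'a::ab_group_add \<Rightarrow> 'a"
  assumes add: "\<And>f g. P (f + g) = P f + P g" "\<And>f g. Q (f + g) = Q f + Q g"
    and comm: "\<And>f. P (Q f) = Q (P f)"
    and nil: "(P ^^ m) F = 0" "(Q ^^ n) F = 0"
  shows "((\<lambda>f. P f + Q f) ^^ (m + n)) F = 0"
proof -
  have cPQ: "(Q ^^ n) (P f) = P ((Q ^^ n) f)" and cQP: "(P ^^ n) (Q f) = Q ((P ^^ n) f)" for n f
    by (induction n) (simp_all add: comm)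
  let ?R = "\<lambda>f. P f + Q f"
  have Radd: "?R (f + g) = ?R f + ?R g" for f g by (simp add: add)
  have "(?R ^^ k) F = 0" if "(P ^^ m) F = 0" "(Q ^^ n) F = 0" "k = m + n" for k m n F
    using that
  proof (induction k arbitrary: m n F)
    case (Suc k)
    have R: "(?R ^^ Suc k) F = (?R ^^ k) (P F) + (?R ^^ k) (Q F)"
      using funpow_additive[of ?R k "P F" "Q F", OF Radd] by (simp only: funpow_Suc_right comp_apply)
    show ?case
    proof (cases "m = 0 \<or> n = 0")
      case True
      then have "F = 0" using Suc.prems by auto
      then show ?thesis using additive_zero[of ?R "Suc k", OF Radd] by (simp only:)
    next
      case False
      then obtain m' n' where mn: "m = Suc m'" "n = Suc n'" by (cases m; cases n) auto
      have "(?R ^^ k) (P F) = 0"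
      proof (rule Suc.IH[of m' "P F" n])
        show "(P ^^ m') (P F) = 0" using Suc.prems(1) mn by (simp add: funpow_swap1)
        show "(Q ^^ n) (P F) = 0" using Suc.prems(2) additive_zero[of P 1, OF add(1)] by (simp add: cPQ)
        show "k = m' + n" using Suc.prems mn by simp
      qed
      moreover have "(?R ^^ k) (Q F) = 0"
      proof (rule Suc.IH[of m "Q F" n'])
        show "(Q ^^ n') (Q F) = 0" using Suc.prems(2) mn by (simp add: funpow_swap1)
        show "(P ^^ m) (Q F) = 0" using Suc.prems(1) additive_zero[of Q 1, OF add(2)] by (simp add: cQP)
        show "k = m + n'" using Suc.prems mn by simp
      qed
      ultimately show ?thesis using R by simp
    qed
  qed simp
  from this[OF nil] show ?thesis by simp
qed

lemma wdg_zero_dependent: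
  assumes "wdg p q = 0" "q \<noteq> 0" shows "\<exists>c. p = c *\<^sub>R q"
proof -
  obtain x where x: "bf q x \<noteq> 0" using assms(2) bf_nondegenerate by blast
  have "bf p x *\<^sub>R q - bf q x *\<^sub>R p = 0" using wdg_apply[of p q x] assms(1) by (simp add: mv_simps)
  then have "bf q x *\<^sub>R p = bf p x *\<^sub>R q" by simp
  then have "(1 / bf q x) *\<^sub>R (bf q x *\<^sub>R p) = (1 / bf q x) *\<^sub>R (bf p x *\<^sub>R q)" by simp
  then have "p = (bf p x / bf q x) *\<^sub>R q" using x by simp
  then show ?thesis by blast
qed

context so_isotropy
begin

text \<open>With \<open>y\<close> and \<open>z\<close> inserted, the form
  \<open>a \<and> b \<and> c\<close> reduces to \<open>bf a\<close> in its remaining argument, which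
  lets a trilinear statement be read as one about vectors.\<close>

lemma separated_frame:
  fixes a :: "real ^ (2 + 'n)"
  obtains y z b c where "bf a y = 0" "bf a z = 0" "bf b y = 1" "bf b z = 0" "bf c y = 0" "bf c z = 1"
proof -
  obtain y where y: "y \<noteq> 0" "bf a y = 0" by (rule orthogonal_nonzero[of "[a]"]) auto
  obtain y' where y': "bf y y' \<noteq> 0" using y(1) bf_nondegenerate by blast
  obtain z where z: "z \<noteq> 0" "bf a z = 0" "bf y' z = 0" by (rule orthogonal_nonzero[of "[a, y']"]) auto
  have 1: "z \<noteq> c *\<^sub>R y" for c
  proof
    assume "z = c *\<^sub>R y"
    then show False using z(1,3) y' bf_sym[of y' y] by auto
  qed
  have 2: "y \<noteq> c *\<^sub>R z" for c
  proof
    assume "y = c *\<^sub>R z"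
    then have "bf y y' = c * bf z y'" by simp
    then show False using y' z(3) bf_sym[of z y'] by simp
  qed
  obtain b where b: "bf y b = 1" "bf z b = 0" using bf_separate[OF 2] by blast
  obtain c where c: "bf z c = 1" "bf y c = 0" using bf_separate[OF 1] by blast
  show ?thesis by (rule that[of y z b c]) (use y z b c bf_sym[of b] bf_sym[of c] in auto)
qed

text \<open>On alternating trilinear forms, \<open>w\<close> acting in any two of the three slots is nilpotent because it is so
  on \<open>\<Lambda>\<^sup>2\<close>; hence so is \<open>w\<close> acting in a single slot.\<close>

lemma ad_nilpotent_imp_nilpotent:
  assumes w: "w \<in> so" and ad: "\<And>A. A \<in> so \<Longrightarrow> adp w 5 A = 0"
  shows "((\<lambda>x. w *v x) ^^ 15) x = 0"
proof -
  let ?w = "\<lambda>x. w *v x"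
  define X1 :: "(real ^ (2 + 'n) \<Rightarrow> real ^ (2 + 'n) \<Rightarrow> real ^ (2 + 'n) \<Rightarrow> real) \<Rightarrow> (real ^ (2 +
      'n) \<Rightarrow> real ^ (2 + 'n) \<Rightarrow> real ^ (2 + 'n) \<Rightarrow> real)" where "X1 = (\<lambda>F x y z. F (?w x) y z)"
  define X2 :: "(real ^ (2 + 'n) \<Rightarrow> real ^ (2 + 'n) \<Rightarrow> real ^ (2 + 'n) \<Rightarrow> real) \<Rightarrow> (real ^ (2 +
      'n) \<Rightarrow> real ^ (2 + 'n) \<Rightarrow> real ^ (2 + 'n) \<Rightarrow> real)" where "X2 = (\<lambda>F x y z. F x (?w y) z)"
  define X3 :: "(real ^ (2 + 'n) \<Rightarrow> real ^ (2 + 'n) \<Rightarrow> real ^ (2 + 'n) \<Rightarrow> real) \<Rightarrow> (real ^ (2 +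
      'n) \<Rightarrow> real ^ (2 + 'n) \<Rightarrow> real ^ (2 + 'n) \<Rightarrow> real)" where "X3 = (\<lambda>F x y z. F x y (?w z))"
  define f12 :: "real ^ (2 + 'n) ^ (2 + 'n) \<Rightarrow> real ^ (2 + 'n) \<Rightarrow> real ^ (2 + 'n) \<Rightarrow> real ^ (2 + 'n)
      \<Rightarrow> real ^ (2 + 'n) \<Rightarrow> real" where "f12 = (\<lambda>B c x y z. bf (B *v x) y * bf c z)"
  define f23 :: "real ^ (2 + 'n) ^ (2 + 'n) \<Rightarrow> real ^ (2 + 'n) \<Rightarrow> real ^ (2 + 'n) \<Rightarrow> real ^ (2 + 'n)
      \<Rightarrow> real ^ (2 + 'n) \<Rightarrow> real" where "f23 = (\<lambda>B c x y z. bf (B *v y) z * bf c x)"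
  define f31 :: "real ^ (2 + 'n) ^ (2 + 'n) \<Rightarrow> real ^ (2 + 'n) \<Rightarrow> real ^ (2 + 'n) \<Rightarrow> real ^ (2 + 'n)
      \<Rightarrow> real ^ (2 + 'n) \<Rightarrow> real" where "f31 = (\<lambda>B c x y z. bf (B *v z) x * bf c y)"
  \<comment> \<open>The sign in \<open>B\<close> makes \<open>A + C + B\<close> equal to twice
    \<open>X1\<close>, so \<open>w\<close> in a single slot is up to a factor a sum of three
    commuting operators. Each has fifth power zero on \<open>F0\<close>, hence the exponent
    15.\<close>
  define A where "A = (\<lambda>F. X1 F + X2 F)"
  define B where "B = (\<lambda>F. - (X2 F + X3 F))"
  define C where "C = (\<lambda>F. X3 F + X1 F)"
  have skew: "bf (E *v (w *v x)) y + bf (E *v x) (w *v y) = bf (br w (- E) *v x) y" for E x y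
    using soD[OF w, of "E *v x" y] by (simp add: br_apply mv_simps)
  have A1: "A (f12 E c) = f12 (br w (- E)) c" for E c
    unfolding A_def f12_def X1_def X2_def by (simp add: fun_eq_iff distrib_right[symmetric] skew)
  have B1: "B (f23 E c) = f23 (br w E) c" for E c
    unfolding B_def f23_def X2_def X3_def
    by (simp add: fun_eq_iff distrib_right[symmetric] skew br_minus_right mv_simps del: minus_add_distrib)
  have C1: "C (f31 E c) = f31 (br w (- E)) c" for E c
    unfolding C_def f31_def X3_def X1_def by (simp add: fun_eq_iff distrib_right[symmetric] skew)
  have sgn_in: "- E \<in> so" if "E \<in> so" for E :: "real ^ (2 + 'n) ^ (2 + 'n)" using so_ops(3)[OF that, of "-1"] by simp
  have sgn: "((\<lambda>E. br w (- E)) ^^ k) E = (- 1) ^ k *\<^sub>R adp w k E" for k E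
    by (induction k) (simp_all add: br_minus_right br_scaleR_right)
  have Ak: "(A ^^ k) (f12 E c) = f12 (((\<lambda>E. br w (- E)) ^^ k) E) c" for k E c by (induction k) (simp_all add: A1)
  have Bk: "(B ^^ k) (f23 E c) = f23 (adp w k E) c" for k E c by (induction k) (simp_all add: B1)
  have Ck: "(C ^^ k) (f31 E c) = f31 (((\<lambda>E. br w (- E)) ^^ k) E) c" for k E c by (induction k) (simp_all add: C1)
  have z: "f12 0 c = 0" "f23 0 c = 0" "f31 0 c = 0" for c
    unfolding f12_def f23_def f31_def by (simp_all add: fun_eq_iff mv_simps)
  have Aadd: "A (F + G) = A F + A G" and Badd: "B (F + G) = B F + B G" and Cadd: "C (F + G) = C F + C G" for F G
    unfolding A_def B_def C_def X1_def X2_def X3_def by (simp_all add: fun_eq_iff)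
  have A5: "(A ^^ 5) (f12 E c) = 0" and B5: "(B ^^ 5) (f23 E c) = 0" and C5: "(C ^^ 5) (f31 E c) = 0"
    if "E \<in> so" for E c
    unfolding Ak Bk Ck sgn ad[OF that] by (simp_all add: z)
  \<comment> \<open>\<open>F0 a b c\<close> is the alternating form
    \<open>a \<and> b \<and> c\<close>; its three cyclic expansions present it through elements of
    \<open>so\<close> in any chosen pair of slots.\<close>
  define F0 where "F0 a b c = f12 (wdg a b) c + f12 (wdg b c) a + f12 (wdg c a) b" for a b c
  note F0 = F0_def
  have F23: "F0 a b c = f23 (wdg a b) c + f23 (wdg b c) a + f23 (wdg c a) b" for a b c
    unfolding F0 f12_def f23_def by (simp add: fun_eq_iff wdg_apply algebra_simps)
  have F31: "F0 a b c = f31 (wdg a b) c + f31 (wdg b c) a + f31 (wdg c a) b" for a b c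
    unfolding F0 f12_def f31_def by (simp add: fun_eq_iff wdg_apply algebra_simps)
  have FA: "(A ^^ 5) (F0 a b c) = 0" for a b c
    unfolding F0 funpow_additive[of A, OF Aadd] A5[OF wdg_so] by simp
  have FB: "(B ^^ 5) (F0 a b c) = 0" for a b c
    unfolding F23 funpow_additive[of B, OF Badd] B5[OF wdg_so] by simp
  have FC: "(C ^^ 5) (F0 a b c) = 0" for a b c
    unfolding F31 funpow_additive[of C, OF Cadd] C5[OF wdg_so] by simp
  have AC: "A (C F) = C (A F)" for F unfolding A_def C_def X1_def X2_def X3_def by (simp add: fun_eq_iff)
  have ACB: "(A (B F) + C (B F)) = B (A F + C F)" for F unfolding A_def B_def C_def X1_def X2_def X3_def by (simp add: fun_eq_iff)
  have FAC: "((\<lambda>F. A F + C F) ^^ (5 + 5)) (F0 a b c) = 0" for a b c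
    by (rule commuting_nilpotent_add[OF Aadd Cadd AC FA FC])
  have nil: "((\<lambda>F. (A F + C F) + B F) ^^ ((5 + 5) + 5)) (F0 a b c) = 0" for a b c
    by (rule commuting_nilpotent_add[OF _ Badd _ FAC FB]) (simp_all add: Aadd Cadd ACB)
  have op: "(\<lambda>F. (A F + C F) + B F) = (\<lambda>F x y z. 2 * F (?w x) y z)"
    unfolding A_def B_def C_def X1_def X2_def X3_def by (simp add: fun_eq_iff)
  have pow: "((\<lambda>F x y z. 2 * F (?w x) y z) ^^ k) F x y z = 2 ^ k * F ((?w ^^ k) x) y z" for k
      and F :: "real ^ (2 + 'n) \<Rightarrow> real ^ (2 + 'n) \<Rightarrow> real ^ (2 + 'n) \<Rightarrow> real" and x y z
    by (induction k arbitrary: x) (simp_all add: funpow_swap1)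
  have F15: "F0 a b c ((?w ^^ 15) x) y z = 0" for a b c x y z
  proof -
    have "((\<lambda>F x y z. 2 * F (?w x) y z) ^^ ((5 + 5) + 5)) (F0 a b c) x y z = 0"
      using fun_cong[OF fun_cong[OF fun_cong[OF nil[of a b c, unfolded op], of x], of y], of z] by simp
    then have "2 ^ ((5 + 5) + 5) * F0 a b c ((?w ^^ ((5 + 5) + 5)) x) y z = 0" unfolding pow .
    then show ?thesis by simp
  qed
  have "bf a ((?w ^^ 15) x) = 0" for a
  proof -
    obtain y z b c where 1: "bf a y = 0" "bf a z = 0" "bf b y = 1" "bf b z = 0" "bf c y = 0" "bf c z = 1"
      by (rule separated_frame)
    show ?thesis using F15[of a b c x y z] by (simp add: F0 f12_def wdg_apply 1)
  qed
  then have "bf ((?w ^^ 15) x) a = 0" for a using bf_sym by metis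
  then show ?thesis by (rule bf_nondegenerate)
qed

end

text \<open>If every \<open>f c\<close> were a multiple of \<open>f a\<close>, then
  \<open>bf (f a) c = - bf a (f c)\<close> would be a multiple of
  \<open>bf a (f a) = 0\<close>.\<close>

lemma skew_rank:
  assumes sk: "\<And>x y. bf (f x) y = - bf x (f y)" and a: "f a \<noteq> 0"
  obtains c where "\<And>k. f c \<noteq> k *\<^sub>R f a"
proof -
  have "\<exists>c. \<forall>k. f c \<noteq> k *\<^sub>R f a"
  proof (rule ccontr)
    assume "\<nexists>c. \<forall>k. f c \<noteq> k *\<^sub>R f a"
    then have *: "\<exists>k. f c = k *\<^sub>R f a" for c by blast
    have aa: "bf a (f a) = 0" using sk[of a a] bf_sym[of a "f a"] by simp
    have "bf (f a) c = 0" for c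
    proof -
      obtain k where "f c = k *\<^sub>R f a" using * by blast
      then show ?thesis using sk[of a c] aa by simp
    qed
    then show False using a bf_nondegenerate by blast
  qed
  then show ?thesis using that by blast
qed

lemma square_zero_rank_two:
  fixes w :: "real ^ (2 + 'n::finite) ^ (2 + 'n)"
  assumes w: "w \<in> so" and sq: "\<And>x. w *v (w *v x) = 0" and a: "w *v a \<noteq> 0"
  obtains c where "\<And>k. w *v c \<noteq> k *\<^sub>R (w *v a)" "bf (w *v a) (w *v a) = 0" "bf (w *v c) (w *v c) = 0"
    "bf (w *v a) (w *v c) = 0"
proof -
  obtain c where c: "\<And>k. w *v c \<noteq> k *\<^sub>R (w *v a)" by (rule skew_rank[of "\<lambda>x. w *v x", OF soD[OF w] a]) blast
  show ?thesis by (rule that[OF c]) (simp_all add: soD[OF w] sq)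
qed

lemma independent_triple:
  fixes u v x :: "'a::real_vector"
  assumes v: "\<And>k. v \<noteq> k *\<^sub>R u" and u: "u \<noteq> 0" and x: "\<And>a b. x \<noteq> a *\<^sub>R u + b *\<^sub>R v"
    and 0: "a *\<^sub>R u + b *\<^sub>R v + c *\<^sub>R x = 0"
  shows "a = 0 \<and> b = 0 \<and> c = 0"
proof -
  have c: "c = 0"
  proof (rule ccontr)
    assume c: "c \<noteq> 0"
    have "c *\<^sub>R x = - (a *\<^sub>R u + b *\<^sub>R v)" unfolding eq_neg_iff_add_eq_0 using 0 by (simp only: ac_simps)
    then have "c *\<^sub>R x = (- a) *\<^sub>R u + (- b) *\<^sub>R v" by simp
    then have "(1 / c) *\<^sub>R (c *\<^sub>R x) = (- a / c) *\<^sub>R u + (- b / c) *\<^sub>R v" by (simp add: scaleR_add_right scaleR_diff_right)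
    then have "x = (- a / c) *\<^sub>R u + (- b / c) *\<^sub>R v" using c by (simp only: scaleR_scaleR) simp
    then show False using x[of "- a / c" "- b / c"] by blast
  qed
  have b: "b = 0"
  proof (rule ccontr)
    assume b: "b \<noteq> 0"
    have "b *\<^sub>R v = (- a) *\<^sub>R u" using 0 c by (simp add: eq_neg_iff_add_eq_0 add.commute)
    then have "(1 / b) *\<^sub>R (b *\<^sub>R v) = (- a / b) *\<^sub>R u" by simp
    then have "v = (- a / b) *\<^sub>R u" using b by (simp only: scaleR_scaleR) simp
    then show False using v by blast
  qed
  show ?thesis using 0 b c u by simp
qed

context so_isotropy
begin

text \<open>The image of a nonzero \<open>w\<close> is totally isotropic, of dimension at least 2 by
  skewness and at most 2 by the index, so \<open>w\<close> is tied to \<open>u \<and> v\<close> for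
  a null plane, which \<open>no_null_plane\<close> excludes.\<close>

lemma square_zero_not_in_h:
  assumes w: "w \<in> h" and sq: "\<And>x. w *v (w *v x) = 0" shows "w = 0"
proof (rule ccontr)
  assume "w \<noteq> 0"
  then obtain a where a: "w *v a \<noteq> 0" using mat_eqI[of w 0] by (auto simp: mv_simps)
  note so = h_in_so[OF w]
  obtain c where c: "\<And>k. w *v c \<noteq> k *\<^sub>R (w *v a)" and n: "bf (w *v a) (w *v a) = 0" "bf (w *v c) (w *v c) = 0"
    "bf (w *v a) (w *v c) = 0" by (rule square_zero_rank_two[OF so sq a]) blast
  define u v where "u = w *v a" and "v = w *v c"
  have u: "u \<noteq> 0" and uv: "\<And>k. v \<noteq> k *\<^sub>R u" and nn: "bf u u = 0" "bf v v = 0" "bf u v = 0"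
    using a c n unfolding u_def v_def by blast+
  have co: "\<exists>\<alpha> \<beta>. w *v x = \<alpha> *\<^sub>R u + \<beta> *\<^sub>R v" for x
  proof (rule ccontr)
    assume "\<nexists>\<alpha> \<beta>. w *v x = \<alpha> *\<^sub>R u + \<beta> *\<^sub>R v"
    then have x: "\<And>\<alpha> \<beta>. w *v x \<noteq> \<alpha> *\<^sub>R u + \<beta> *\<^sub>R v" by blast
    have "bf (w *v y) (w *v z) = 0" for y z by (simp add: soD[OF so] sq)
    then show False
      by (intro null_triple_dependent[of u v "w *v x", OF independent_triple[OF uv u x]]) (simp_all add: u_def v_def)
  qed
  define s where "s = bf u c"
  have av: "bf a v = - s" using soD[OF so, of a c] by (simp add: s_def u_def v_def)
  have au: "bf a u = 0" and cv: "bf c v = 0" using soD0[OF so] by (simp_all add: u_def v_def)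
  have cu: "bf c u = s" using bf_sym[of c u] by (simp add: s_def)
  \<comment> \<open>Read as a formula for \<open>u \<and> v\<close>, this puts it in
    \<open>h\<close> whatever the value of \<open>s\<close>.\<close>
  have 1: "s *\<^sub>R w = wdg u v"
  proof (rule mat_eqI)
    fix x
    obtain \<alpha> \<beta> where x: "w *v x = \<alpha> *\<^sub>R u + \<beta> *\<^sub>R v" using co by blast
    have "bf u x = \<beta> * s" using soD[OF so, of a x] by (simp add: u_def[symmetric] x au av)
    moreover have "bf v x = - (\<alpha> * s)" using soD[OF so, of c x] by (simp add: v_def[symmetric] x cu cv)
    ultimately show "(s *\<^sub>R w) *v x = wdg u v *v x" by (simp add: mv_simps x wdg_apply scaleR_add_right mult.commute)
  qed
  have "wdg v u \<in> h" using h_scale[OF w, of "- s"] 1 wdg_swap[of v u] by simp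
  then show False by (rule no_null_plane) (use nn uv u bf_sym[of v u] in auto)
qed

text \<open>Subtracting \<open>u \<and> p\<close> from \<open>s w\<close> leaves \<open>w1\<close>,
  which kills \<open>a\<close>, \<open>p\<close>, \<open>u\<close> and has square zero. A nonzero
  \<open>w1\<close> would have a totally isotropic plane in its image, orthogonal to the null vector
  \<open>u\<close> and not containing it, which is one dimension too many. So \<open>w\<close> is a
  multiple of \<open>u \<and> p\<close>, and \<open>bf p p = - s\<close> is nonzero.\<close>

lemma rank_one_square:
  assumes w: "w \<in> h" and cube: "\<And>x. w *v (w *v (w *v x)) = 0" and sq: "w *v (w *v a) \<noteq> 0"
    and rk: "\<And>x. \<exists>k. w *v (w *v x) = k *\<^sub>R (w *v (w *v a))"
  shows "\<exists>p0. bf p0 p0 < 0 \<and> h = {A \<in> so. A *v p0 = 0}"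
proof -
  note so = h_in_so[OF w]
  define u p s where "u = w *v (w *v a)" and "p = w *v a" and "s = bf a u"
  have u: "u \<noteq> 0" and wp: "w *v p = u" and wu: "w *v u = 0" and wa: "w *v a = p"
    using sq cube by (simp_all add: u_def p_def)
  have sk: "bf (w *v (w *v x)) y = bf x (w *v (w *v y))" for x y by (simp add: soD[OF so])
  have rk': "\<exists>k. w *v (w *v x) = k *\<^sub>R u \<and> bf u x = k * s" for x
  proof -
    obtain k where k: "w *v (w *v x) = k *\<^sub>R u" using rk u_def by blast
    have "bf u x = bf a (w *v (w *v x))" unfolding u_def by (rule sk)
    then show ?thesis using k by (auto simp: s_def)
  qed
  have s: "s \<noteq> 0"
  proof
    assume "s = 0"
    then have "bf u x = 0" for x using rk'[of x] by auto
    then show False using u bf_nondegenerate by blast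
  qed
  have ua: "bf u a = s" using bf_sym[of u a] by (simp add: s_def)
  have uu: "bf u u = 0" using rk'[of u] wu s by (auto simp: mv_simps u)
  have pp: "bf p p = - s" using soD[OF so, of a p] by (simp add: wa wp s_def)
  have pu: "bf p u = 0" using soD[OF so, of a u] by (simp add: wa wu)
  have up: "bf u p = 0" using pu bf_sym[of u p] by simp
  have pa: "bf p a = 0" using soD0[OF so, of a] bf_sym[of p a] by (simp add: wa)
  define w1 where "w1 = s *\<^sub>R w - wdg u p"
  have w1: "w1 \<in> so" unfolding w1_def by (intro so_ops so wdg_so)
  have z: "w1 *v a = 0" "w1 *v p = 0" "w1 *v u = 0"
    unfolding w1_def by (simp_all add: mv_simps wdg_apply wa wp wu ua uu pp pu up pa)
  have o: "bf u (w1 *v x) = 0" "bf p (w1 *v x) = 0" "bf (w1 *v x) a = 0" "bf (w1 *v x) u = 0" for x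
    using soD[OF w1, of u x] soD[OF w1, of p x] soD[OF w1, of x a] soD[OF w1, of x u] by (simp_all add: z)
  have sq1: "w1 *v (w1 *v x) = 0" for x
  proof -
    obtain k where k: "w *v (w *v x) = k *\<^sub>R u" "bf u x = k * s" using rk' by blast
    have "w1 *v y = s *\<^sub>R (w *v y)" if "bf u y = 0" "bf p y = 0" for y
      using that by (simp add: w1_def mv_simps wdg_apply)
    then have "w1 *v (w1 *v x) = s *\<^sub>R (w *v (w1 *v x))" using o[of x] by blast
    also have "\<dots> = 0" unfolding w1_def by (simp add: mv_simps wdg_apply k wp wu)
    finally show ?thesis .
  qed
  have "w1 = 0"
  proof (rule ccontr)
    assume "w1 \<noteq> 0"
    then obtain b where b: "w1 *v b \<noteq> 0" using mat_eqI[of w1 0] by (auto simp: mv_simps)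
    obtain c where c: "\<And>k. w1 *v c \<noteq> k *\<^sub>R (w1 *v b)" and n: "bf (w1 *v b) (w1 *v b) = 0"
      "bf (w1 *v c) (w1 *v c) = 0" "bf (w1 *v b) (w1 *v c) = 0"
      by (rule square_zero_rank_two[OF w1 sq1 b]) blast
    have "u \<noteq> k *\<^sub>R (w1 *v b) + l *\<^sub>R (w1 *v c)" for k l
    proof
      assume "u = k *\<^sub>R (w1 *v b) + l *\<^sub>R (w1 *v c)"
      then have "bf u a = 0" using o(3) by simp
      then show False using ua s by simp
    qed
    from null_triple_dependent[of "w1 *v b" "w1 *v c" u, OF independent_triple[OF c b this]]
    show False using n o uu by simp
  qed
  then have "wdg u p \<in> h" using h_scale[OF w, of s] by (simp add: w1_def)
  then show ?thesis by (rule isotropy_stabilizer) (use u uu up pp s in auto)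
qed

text \<open>\<open>m\<close> is the last nonzero power of \<open>w\<close>. Degree 1 is excluded
  outright; in degree 2 the square has rank one; degrees 3 and above contradict
  \<open>(ad w)^5 = 0\<close> on a suitable bivector.\<close>

lemma nilpotent_stabilizer:
  assumes w: "w \<in> h" "w \<noteq> 0" and ad: "\<And>A. A \<in> so \<Longrightarrow> adp w 5 A = 0"
  shows "\<exists>p0. bf p0 p0 < 0 \<and> h = {A \<in> so. A *v p0 = 0}"
proof -
  note so = h_in_so[OF w(1)]
  let ?P = "\<lambda>k x. ((\<lambda>x. w *v x) ^^ k) x"
  have nil: "?P 15 x = 0" for x by (rule ad_nilpotent_imp_nilpotent[OF so ad])
  have P0: "?P k 0 = 0" for k by (induction k) simp_all
  have Padd: "?P k (?P l x) = ?P (k + l) x" for k l x by (simp add: funpow_add)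
  have Pge: "?P l x = 0" if "?P k x = 0" "k \<le> l" for k l x
    using Padd[of "l - k" k x] that P0 by simp
  have Pw: "?P k (w *v x) = ?P (Suc k) x" for k x by (simp add: funpow_swap1)
  have ad5: "wdg (?P 5 a) b + 5 *\<^sub>R wdg (?P 4 a) (?P 1 b) + 10 *\<^sub>R wdg (?P 3 a) (?P 2 b)
      + 10 *\<^sub>R wdg (?P 2 a) (?P 3 b) + 5 *\<^sub>R wdg (?P 1 a) (?P 4 b) + wdg a (?P 5 b) = 0" for a b
  proof -
    define Q where "Q i j = wdg (?P i a) (?P j b)" for i j
    have Q: "br w (Q i j) = Q (Suc i) j + Q i (Suc j)" for i j by (simp add: Q_def br_wdg[OF so])
    have a5: "adp w 5 A = br w (br w (br w (br w (br w A))))" for A by (simp add: numeral_eq_Suc)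
    have "adp w 5 (Q 0 0) = Q 5 0 + 5 *\<^sub>R Q 4 1 + 10 *\<^sub>R Q 3 2 + 10 *\<^sub>R Q 2 3 + 5 *\<^sub>R Q 1 4 + Q 0 5"
      by (rule mat_eqI, rule bf_eqI)
        (simp only: a5 Q br_add_right mv_simps bf_add_left bf_scaleR_left, simp add: eval_nat_numeral)
    then show ?thesis using ad[OF wdg_so] by (simp add: Q_def)
  qed
  have "\<exists>m. (\<forall>x. ?P (Suc m) x = 0) \<and> (\<exists>x. ?P m x \<noteq> 0)"
  proof -
    define m where "m = (LEAST k. \<forall>x. ?P k x = 0)"
    have m: "\<forall>x. ?P m x = 0" unfolding m_def by (rule LeastI[of _ 15]) (use nil in blast)
    have "m \<noteq> 0"
    proof
      assume "m = 0"
      then have "x = 0" for x :: "real ^ (2 + 'n)" using m by simp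
      then have "w *v x = 0" for x .
      then show False using w(2) mat_eqI[of w 0] by (auto simp: mv_simps)
    qed
    then obtain k where k: "m = Suc k" by (cases m) auto
    have "\<not> (\<forall>x. ?P k x = 0)" using not_less_Least[of k "\<lambda>k. \<forall>x. ?P k x = 0"] k unfolding m_def by simp
    then show ?thesis using m k by blast
  qed
  then obtain m a where m: "\<And>x. ?P (Suc m) x = 0" and a: "?P m a \<noteq> 0" by blast
  have vanish: "?P k x = 0" if "m < k" for k x by (rule Pge[OF m]) (use that in simp)
  consider "m \<le> 1" | "m = 2" | "m = 3" | "m \<ge> 4" by linarith
  then show ?thesis
  proof cases
    case 1
    have "w *v (w *v x) = 0" for x using vanish[of 2 x] 1 by (simp add: numeral_2_eq_2)
    then show ?thesis using square_zero_not_in_h[OF w(1)] w(2) by blast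
  next
    case 2
    have cube: "w *v (w *v (w *v x)) = 0" for x using vanish[of 3 x] 2 by (simp add: numeral_3_eq_3)
    have a2: "w *v (w *v a) \<noteq> 0" using a 2 by (simp add: numeral_2_eq_2)
    have iso: "bf (w *v (w *v x)) (w *v (w *v y)) = 0" for x y by (simp add: soD[OF so] cube)
    have "\<exists>k. w *v (w *v x) = k *\<^sub>R (w *v (w *v a))" for x
    proof (rule ccontr)
      assume "\<nexists>k. w *v (w *v x) = k *\<^sub>R (w *v (w *v a))"
      then have ind: "\<And>k. w *v (w *v x) \<noteq> k *\<^sub>R (w *v (w *v a))" by blast
      \<comment> \<open>As \<open>w^3 = 0\<close>, only the middle term of the binomial expansion
        survives, with coefficient 6. The fourth power has its values in \<open>h\<close> by
        \<open>adp_nilpotent_step\<close>.\<close>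
      have "adp w 4 (wdg x a) = 6 *\<^sub>R wdg (w *v (w *v x)) (w *v (w *v a))"
      proof -
        have a4: "adp w 4 A = br w (br w (br w (br w A)))" for A by (simp add: numeral_eq_Suc)
        show ?thesis
          by (rule mat_eqI, rule bf_eqI)
            (simp only: a4 br_wdg[OF so] br_add_right mv_simps bf_add_left bf_scaleR_left cube wdg_simps br_zero_right, simp)
      qed
      moreover have "adp w 4 (wdg x a) \<in> h"
        by (rule adp_nilpotent_step[OF w(1)]) (use ad h_zero wdg_so in simp_all)
      ultimately have "wdg (w *v (w *v x)) (w *v (w *v a)) \<in> h" using h_cancel_scale[of 6] by simp
      then show False by (rule no_null_plane[OF _ iso iso iso ind a2])
    qed
    then show ?thesis by (rule rank_one_square[OF w(1) cube a2])
  next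
    case 3
    \<comment> \<open>Odd powers of \<open>w\<close> are skew, so \<open>w^3\<close> cannot have
      rank one; on \<open>c \<and> w a\<close> the fifth power of \<open>ad w\<close> is 10 times
      \<open>w^3 c \<and> w^3 a\<close>.\<close>
    have sk: "bf (?P 3 x) y = - bf x (?P 3 y)" for x y by (simp add: soD[OF so] numeral_3_eq_3)
    obtain c where c: "\<And>k. ?P 3 c \<noteq> k *\<^sub>R ?P 3 a"
      by (rule skew_rank[of "?P 3", OF sk]) (use a 3 in auto)
    have z: "w *v (w *v (w *v (w *v x))) = 0" for x using vanish[of 4 x] 3 by (simp add: numeral_eq_Suc)
    have "wdg (?P 3 c) (?P 3 a) = 0"
      using ad5[of c "w *v a"] by (simp add: z wdg_simps numeral_eq_Suc)
    then show ?thesis using wdg_zero_dependent[of "?P 3 c" "?P 3 a"] a 3 c by auto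
  next
    case 4
    \<comment> \<open>\<open>w^4 b\<close> is nonzero and \<open>w^5 b = 0\<close>. On
      \<open>b \<and> w b\<close> the expansion leaves
      \<open>5 (w^4 b \<and> w^2 b) + 10 (w^2 b \<and> w^4 b)\<close>, that is
      \<open>5 (w^2 b \<and> w^4 b)\<close>; so \<open>w^2 b\<close> is a multiple of
      \<open>w^4 b\<close>, and applying \<open>w^2\<close> makes \<open>w^4 b\<close> a multiple of
      \<open>w^6 b = 0\<close>.\<close>
    define b where "b = ?P (m - 4) a"
    have b4: "?P 4 b \<noteq> 0" using a 4 Padd[of 4 "m - 4" a] by (simp add: b_def)
    have bz: "?P k b = 0" if "k \<ge> 5" for k using Padd[of k "m - 4" a] vanish[of "k + (m - 4)" a] that 4 by (simp add: b_def)
    have z: "w *v (w *v (w *v (w *v (w *v b)))) = 0" using bz[of 5] by (simp add: numeral_eq_Suc)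
    have "5 *\<^sub>R wdg (?P 4 b) (?P 2 b) + 10 *\<^sub>R wdg (?P 2 b) (?P 4 b) = 0"
      using ad5[of b "w *v b"] z by (simp add: wdg_simps numeral_eq_Suc)
    then have "5 *\<^sub>R wdg (?P 2 b) (?P 4 b) = 0" using wdg_swap[of "?P 4 b" "?P 2 b"] by (simp add: scaleR_left_distrib[symmetric])
    then obtain k where k: "?P 2 b = k *\<^sub>R ?P 4 b" using wdg_zero_dependent[of "?P 2 b" "?P 4 b"] b4 by auto
    have "?P 4 b = ?P 2 (?P 2 b)" by (simp add: numeral_eq_Suc)
    also have "\<dots> = k *\<^sub>R ?P 6 b" unfolding k by (simp add: numeral_eq_Suc mv_simps)
    finally show ?thesis using b4 bz[of 6] by simp
  qed
qed

end

section \<open>Unbounded isotropy and contracted directions\<close>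

text \<open>The skew part with respect to the form. Precomposing with it extends maps on
  \<open>so\<close> to all matrices, where operator norms and compactness are at hand.\<close>

definition so_proj :: "real ^ ('p::finite + 'q::finite) ^ ('p + 'q) \<Rightarrow> real ^ ('p + 'q) ^ ('p + 'q)" where
  "so_proj A = (\<chi> i j. (A $ i $ j - sg i * sg j * A $ j $ i) / 2)"

lemma linear_so_proj: "linear so_proj"
  by (rule linearI) (simp_all add: so_proj_def vec_eq_iff field_simps)

lemma bf_matrix_axis: "bf (A *v axis j 1) (axis i 1) = sg i * A $ i $ j"
  unfolding bf_axis by (simp add: matrix_vector_mul_component column_def matrix_vector_mult_basis)

lemma so_iff: "A \<in> so \<longleftrightarrow> (\<forall>i j. sg i * A $ i $ j + sg j * A $ j $ i = 0)"
proof
  assume "A \<in> so"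
  then have "bf (A *v axis j 1) (axis i 1) = - bf (A *v axis i 1) (axis j 1)" for i j
    using soD[of A "axis j 1" "axis i 1"] bf_sym[of "axis j 1" "A *v axis i 1"] by simp
  then have e: "sg i * A $ i $ j = - (sg j * A $ j $ i)" for i j unfolding bf_matrix_axis .
  show "\<forall>i j. sg i * A $ i $ j + sg j * A $ j $ i = 0" by (intro allI) (subst e, rule left_minus)
next
  assume *: "\<forall>i j. sg i * A $ i $ j + sg j * A $ j $ i = 0"
  have "bf (A *v x) y + bf x (A *v y) = 0" for x y
  proof -
    have 1: "bf (A *v x) y = (\<Sum>i\<in>UNIV. \<Sum>j\<in>UNIV. (sg i * A $ i $ j) * (x $ j * y $ i))"
      unfolding bf_sum matrix_vector_mult_def by (simp add: sum_distrib_left sum_distrib_right mult_ac)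
    have "bf x (A *v y) = (\<Sum>j\<in>UNIV. \<Sum>i\<in>UNIV. (sg j * A $ j $ i) * (x $ j * y $ i))"
      unfolding bf_sum matrix_vector_mult_def by (simp add: sum_distrib_left sum_distrib_right mult_ac)
    also have "\<dots> = (\<Sum>i\<in>UNIV. \<Sum>j\<in>UNIV. (sg j * A $ j $ i) * (x $ j * y $ i))" by (rule sum.swap)
    finally have 2: "bf x (A *v y) = (\<Sum>i\<in>UNIV. \<Sum>j\<in>UNIV. (sg j * A $ j $ i) * (x $ j * y $ i))" .
    show ?thesis unfolding 1 2 using * by (simp add: sum.distrib[symmetric] distrib_right[symmetric])
  qed
  then show "A \<in> so" unfolding so_def by blast
qed

lemma so_proj_in: "so_proj A \<in> so"
proof -
  have e: "sg i * ((x - sg i * sg j * y) / 2) = (sg i * x - sg j * y) / 2" for i j :: "'a + 'b" and x y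
    by (simp add: right_diff_distrib mult.assoc[symmetric])
  show ?thesis unfolding so_iff so_proj_def vec_lambda_beta e by (simp add: diff_divide_distrib)
qed

lemma so_proj_eq: "A \<in> so \<Longrightarrow> so_proj A = A"
proof -
  assume "A \<in> so"
  then have "sg i * A $ i $ j = - (sg j * A $ j $ i)" for i j unfolding so_iff by (simp add: eq_neg_iff_add_eq_0)
  note skew = this
  have e: "sg i * sg j * A $ j $ i = - A $ i $ j" for i j
  proof -
    have "sg i * sg j * A $ j $ i = sg i * (- (sg i * A $ i $ j))"
      unfolding skew[of j i, symmetric] by (rule mult.assoc)
    also have "\<dots> = - (sg i * sg i * A $ i $ j)" by (simp only: mult_minus_right mult.assoc)
    finally show ?thesis by simp
  qed
  show "so_proj A = A" by (simp add: so_proj_def vec_eq_iff e)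
qed

lemma bounded_bilinear_br: "bounded_bilinear br"
  unfolding bilinear_conv_bounded_bilinear[symmetric] bilinear_def
  by (auto intro!: linearI simp: br_add_left br_add_right br_scaleR_left br_scaleR_right)

context so_isotropy
begin

text \<open>With \<open>bf c c > 0\<close> and \<open>a \<and> c\<close>, \<open>c \<and> b\<close>
  in the kernel, their bracket is \<open>- bf c c\<close> times \<open>a \<and> b\<close> modulo the
  kernel. Such a \<open>c\<close> exists because these are only two linear conditions on it.\<close>

lemma hyperplane_not_subalgebra:
  fixes A :: "real ^ (2 + 'n) ^ (2 + 'n)"
  assumes \<xi>: "linear \<xi>" and A: "A \<in> so" "\<xi> A \<noteq> (0::real)"
  obtains x y where "x \<in> so" "y \<in> so" "\<xi> x = 0" "\<xi> y = 0" "\<xi> (br x y) \<noteq> 0"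
proof -
  note l = linear_add[OF \<xi>] linear_diff[OF \<xi>] linear_scale[OF \<xi>] linear_neg[OF \<xi>] linear_0[OF \<xi>]
  obtain a b where ab: "\<xi> (wdg a b) \<noteq> 0"
  proof (rule ccontr)
    assume "\<not> thesis"
    then have *: "\<xi> (wdg a b) = 0" for a b using that by blast
    have "A \<in> {A. \<xi> A = 0}"
      by (rule so_subset_subspace[of _ UNIV]) (use A(1) * in \<open>auto simp: subspace_def l\<close>)
    then show False using A(2) by simp
  qed
  have "linear (\<lambda>x. \<xi> (wdg a x))" "linear (\<lambda>x. \<xi> (wdg x b))" by (auto intro!: linearI simp: wdg_simps l)
  from bf_riesz[OF this(1)] bf_riesz[OF this(2)] obtain p q where pq: "\<And>x. \<xi> (wdg a x) = bf p x" "\<And>x. \<xi> (wdg x b) = bf q x"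
    by metis
  obtain c where c: "bf c c > 0" "bf p c = 0" "bf q c = 0" by (rule orthogonal_positive[of "[p, q]"]) auto
  have z: "\<xi> (wdg a c) = 0" "\<xi> (wdg c b) = 0" using pq c by auto
  then have "\<xi> (wdg c a) = 0" using wdg_swap[of a c] l(4) by simp
  then have "\<xi> (br (wdg a c) (wdg c b)) = - bf c c * \<xi> (wdg a b)"
    by (simp add: br_wdg[OF wdg_so] wdg_apply wdg_simps l z)
  then show ?thesis using that[OF wdg_so wdg_so z] ab c(1) by simp
qed

text \<open>An isometric automorphism of \<open>so\<close> with its inverse, each factored through
  \<open>so_proj\<close>: they are linear maps on all matrices, yet determined by their restrictions
  to \<open>so\<close>. Keeping the inverse in the pair lets the two exchange roles.\<close>

definition autpair :: "(real ^ (2 + 'n) ^ (2 + 'n) \<Rightarrow> real ^ (2 + 'n) ^ (2 + 'n)) \<Rightarrow> (real ^ (2 + 'n) ^ (2 + 'n)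
    \<Rightarrow> real ^ (2 + 'n) ^ (2 + 'n)) \<Rightarrow> bool" where
  "autpair T S \<longleftrightarrow> linear T \<and> linear S \<and> (\<forall>A. T (so_proj A) = T A) \<and> (\<forall>A. S (so_proj A) = S A) \<and>
    (\<forall>A\<in>so. T A \<in> so \<and> S A \<in> so \<and> S (T A) = A \<and> T (S A) = A \<and> \<beta> (T A) (T A) = \<beta> A A) \<and>
    (\<forall>A\<in>so. \<forall>B\<in>so. T (br A B) = br (T A) (T B))"

lemma autpairD:
  assumes "autpair T S"
  shows "linear T" "linear S" "T (so_proj A) = T A" "A \<in> so \<Longrightarrow> T A \<in> so" "A \<in> so \<Longrightarrow> S A \<in> so"
      "A \<in> so \<Longrightarrow> S (T A) = A"
    "A \<in> so \<Longrightarrow> T (S A) = A" "A \<in> so \<Longrightarrow> \<beta> (T A) (T A) = \<beta> A A" "A \<in> so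
        \<Longrightarrow> B \<in> so \<Longrightarrow> T (br A B) = br (T A) (T B)"
  using assms unfolding autpair_def by blast+

lemma autpair_beta:
  assumes "autpair T S" "A \<in> so" "B \<in> so" shows "\<beta> (T A) (T B) = \<beta> A B"
proof -
  note a = autpairD[OF assms(1)]
  have "\<beta> (T (A + B)) (T (A + B)) = \<beta> (A + B) (A + B)" by (rule a(8)) (intro so_ops assms)
  then show ?thesis unfolding linear_add[OF a(1)] beta_left beta_right
    using a(8)[OF assms(2)] a(8)[OF assms(3)] sym[of "T B" "T A"] sym[of B A] by simp
qed

lemma autpair_sym:
  assumes "autpair T S" shows "autpair S T"
proof -
  note a = autpairD[OF assms]
  have "\<beta> (S A) (S A) = \<beta> A A" if "A \<in> so" for A using a(8)[OF a(5)[OF that]] a(7)[OF that] by simp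
  moreover have "S (br A B) = br (S A) (S B)" if "A \<in> so" "B \<in> so" for A B
  proof -
    have "S (br A B) = S (T (br (S A) (S B)))" using a(9)[OF a(5)[OF that(1)] a(5)[OF that(2)]] a(7) that by simp
    then show ?thesis using a(6)[OF so_br[OF a(5)[OF that(1)] a(5)[OF that(2)]]] by simp
  qed
  ultimately show ?thesis using assms unfolding autpair_def by blast
qed

lemma autpair_adp:
  assumes "autpair T S" "v \<in> so" "A \<in> so" shows "adp (T v) n (T A) = T (adp v n A)"
  by (induction n) (simp_all add: autpairD(9)[OF assms(1,2) adp_so[OF assms(2,3)]])

lemma closed_so: "closed (so :: (real ^ (2 + 'n) ^ (2 + 'n)) set)"
  by (rule closed_subspace[OF subspace_so])

lemma bounded_bilinear_beta: "bounded_bilinear \<beta>"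
  unfolding bilinear_conv_bounded_bilinear[symmetric] bilinear_def
proof (intro conjI allI)
  show "linear (\<beta> A)" for A by (rule lin)
  then show "linear (\<lambda>A. \<beta> A B)" for B by (subst sym) simp
qed

lemma tendsto_adp:
  assumes "(\<lambda>k. u k) \<longlonglongrightarrow> w" shows "(\<lambda>k. adp (u k) n A) \<longlonglongrightarrow> adp w n A"
  by (induction n) (auto intro!: bounded_bilinear.tendsto[OF bounded_bilinear_br] assms)

text \<open>The operator \<open>adp (T v) 5\<close> is conjugate to \<open>adp v 5\<close> by \<open>T\<close>, hence of norm \<open>O(\<lambda>\<^sup>2 \<bar>v\<bar>\<^sup>5)\<close>, and this tends to zero when
  \<open>\<lambda> \<bar>v\<bar>\<^sup>2\<close> stays bounded.\<close>

lemma contracted_limit: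
  assumes aut: "\<And>k. autpair (T k) (S k)" and lam: "filterlim lam at_top sequentially"
    and bnd: "\<And>k A. norm (T k A) \<le> lam k * norm A" "\<And>k A. norm (S k A) \<le> lam k * norm A"
    and lam0: "\<And>k. lam k > 0"
    and v: "\<And>k. v k \<in> so" "\<And>k. lam k * (norm (v k))\<^sup>2 \<le> C" and lim: "(\<lambda>k. T k (v k)) \<longlonglongrightarrow> w"
  shows "w \<in> so" "v \<longlonglongrightarrow> 0" "A \<in> so \<Longrightarrow> adp w 5 A = 0"
proof -
  show "w \<in> so"
    by (rule closed_sequentially[OF closed_so _ lim]) (use autpairD(4)[OF aut v(1)] in auto)
  have Cl: "(\<lambda>k. C / lam k) \<longlonglongrightarrow> 0" by (rule real_tendsto_divide_at_top[OF tendsto_const lam])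
  have le: "norm ((norm (v k))\<^sup>2) \<le> C / lam k" for k using v(2)[of k] lam0[of k] by (simp add: field_simps)
  have "(\<lambda>k. (norm (v k))\<^sup>2) \<longlonglongrightarrow> 0"
    by (rule Lim_null_comparison[OF always_eventually Cl]) (rule allI, rule le)
  from tendsto_real_sqrt[OF this] have vn: "(\<lambda>k. norm (v k)) \<longlonglongrightarrow> 0" by simp
  then show "v \<longlonglongrightarrow> 0" by (rule tendsto_norm_zero_cancel)
  assume A: "A \<in> so"
  obtain K where K: "K > 0" "\<And>A B. norm (br A B :: real ^ (2 + 'n) ^ (2 + 'n)) \<le> norm A * norm B * K"
    using bounded_bilinear.pos_bounded[OF bounded_bilinear_br] by blast
  have adn: "norm (adp x n B) \<le> (K * norm x) ^ n * norm B" for x n B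
  proof (induction n)
    case (Suc n)
    have "norm (adp x (Suc n) B) \<le> norm x * norm (adp x n B) * K" using K(2)[of x "adp x n B"] by simp
    also have "\<dots> \<le> norm x * ((K * norm x) ^ n * norm B) * K" using Suc K(1) by (intro mult_right_mono mult_left_mono) auto
    finally show ?case by (simp add: mult_ac)
  qed simp
  have le5: "norm (adp (T k (v k)) 5 A) \<le> K ^ 5 * C\<^sup>2 * norm A * norm (v k)" for k
  proof -
    note a = autpairD[OF aut[of k]]
    let ?n = "norm (v k)"
    have "adp (T k (v k)) 5 A = T k (adp (v k) 5 (S k A))"
      using autpair_adp[OF aut[of k] v(1)[of k] a(5)[OF A]] a(7)[OF A] by simp
    then have "norm (adp (T k (v k)) 5 A) \<le> lam k * norm (adp (v k) 5 (S k A))" using bnd(1) by simp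
    also have "\<dots> \<le> lam k * ((K * ?n) ^ 5 * (lam k * norm A))"
      by (rule mult_left_mono[OF order_trans[OF adn mult_left_mono[OF bnd(2)]]]) (use lam0[of k] K(1) in auto)
    \<comment> \<open>Two factors \<open>lam\<close> use up four factors of the norm; the fifth one
      is what tends to zero.\<close>
    also have "\<dots> = (lam k * ?n\<^sup>2)\<^sup>2 * (K ^ 5 * norm A * ?n)" by (simp add: power_mult_distrib eval_nat_numeral mult_ac)
    also have "\<dots> \<le> C\<^sup>2 * (K ^ 5 * norm A * ?n)"
      by (intro mult_right_mono power_mono v(2)) (use lam0[of k] K(1) in auto)
    finally show ?thesis by (simp add: mult_ac)
  qed
  have "(\<lambda>k. K ^ 5 * C\<^sup>2 * norm A * norm (v k)) \<longlonglongrightarrow> 0" by (rule tendsto_mult_right_zero[OF vn])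
  then have "(\<lambda>k. adp (T k (v k)) 5 A) \<longlonglongrightarrow> 0"
    by (rule Lim_null_comparison[OF always_eventually, rotated]) (rule allI, rule le5)
  then show "adp w 5 A = 0" by (rule LIMSEQ_unique[OF tendsto_adp[OF lim]])
qed

lemma contracted_pair:
  assumes aut: "\<And>k. autpair (T k) (S k)" and lam: "filterlim lam at_top sequentially"
    and bnd: "\<And>k A. norm (T k A) \<le> lam k * norm A" "\<And>k A. norm (S k A) \<le> lam k * norm A"
    and lam0: "\<And>k. lam k > 0"
    and x: "\<And>k. x k \<in> so" "\<And>k. lam k * (norm (x k))\<^sup>2 \<le> C" "(\<lambda>k. T k (x k)) \<longlonglongrightarrow> Z"
    and y: "\<And>k. y k \<in> so" "\<And>k. lam k * (norm (y k))\<^sup>2 \<le> D" "(\<lambda>k. T k (y k)) \<longlonglongrightarrow> W"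
    and ind: "Z \<noteq> 0" "\<And>c. W \<noteq> c *\<^sub>R Z"
  shows "\<exists>w\<in>h. w \<noteq> 0 \<and> (\<forall>A\<in>so. adp w 5 A = 0)"
proof -
  note cx = contracted_limit[OF aut lam bnd lam0 x] and cy = contracted_limit[OF aut lam bnd lam0 y]
  have b0: "\<beta> X Y = 0" if "\<And>k. a k \<in> so" "\<And>k. b k \<in> so" "a \<longlonglongrightarrow> 0" "b \<longlonglongrightarrow> 0"
    "(\<lambda>k. T k (a k)) \<longlonglongrightarrow> X" "(\<lambda>k. T k (b k)) \<longlonglongrightarrow> Y" for a b X Y
  proof (rule LIMSEQ_unique)
    show "(\<lambda>k. \<beta> (T k (a k)) (T k (b k))) \<longlonglongrightarrow> \<beta> X Y"
        by (rule bounded_bilinear.tendsto[OF bounded_bilinear_beta that(5,6)])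
    have "(\<lambda>k. \<beta> (a k) (b k)) \<longlonglongrightarrow> \<beta> 0 0"
        by (rule bounded_bilinear.tendsto[OF bounded_bilinear_beta that(3,4)])
    then show "(\<lambda>k. \<beta> (T k (a k)) (T k (b k))) \<longlonglongrightarrow> 0"
      using linear_0[OF lin] by (simp add: autpair_beta[OF aut that(1,2)])
  qed
  have "\<beta> Z Z = 0" "\<beta> Z W = 0" "\<beta> W W = 0"
    by (rule b0[OF x(1) x(1) cx(2) cx(2) x(3) x(3)] b0[OF x(1) y(1) cx(2) cy(2) x(3) y(3)] b0[OF y(1) y(1) cy(2) cy(2) y(3) y(3)])+
  then obtain s t where st: "s \<noteq> 0 \<or> t \<noteq> 0" "s *\<^sub>R Z + t *\<^sub>R W \<in> h" using lor[OF cx(1) cy(1)] by blast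
  let ?w = "s *\<^sub>R Z + t *\<^sub>R W"
  have "?w \<noteq> 0"
  proof
    assume w: "?w = 0"
    show False
    proof (cases "t = 0")
      case True
      then show False using w st ind(1) by simp
    next
      case False
      have "t *\<^sub>R W = (- s) *\<^sub>R Z" using w by (simp add: eq_neg_iff_add_eq_0 add.commute)
      then have "(1 / t) *\<^sub>R (t *\<^sub>R W) = (1 / t) *\<^sub>R ((- s) *\<^sub>R Z)" by simp
      then have "W = (- s / t) *\<^sub>R Z" using False by (simp only: scaleR_scaleR) simp
      then show False using ind(2) by blast
    qed
  qed
  moreover have "adp ?w 5 A = 0" if "A \<in> so" for A
  proof (rule contracted_limit(3)[OF aut lam bnd lam0])
    show "s *\<^sub>R x k + t *\<^sub>R y k \<in> so" for k by (intro so_ops x y)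
    \<comment> \<open>The coefficients \<open>s\<close> and \<open>t\<close> come from
      \<open>lor\<close> and cannot be prescribed, so the rate bound must survive arbitrary
      combinations.\<close>
    show "lam k * (norm (s *\<^sub>R x k + t *\<^sub>R y k))\<^sup>2 \<le> 2 * s\<^sup>2 * C + 2 * t\<^sup>2 * D" for k
    proof -
      have "norm (s *\<^sub>R x k + t *\<^sub>R y k) \<le> \<bar>s\<bar> * norm (x k) + \<bar>t\<bar> * norm (y k)"
          by (metis norm_scaleR norm_triangle_ineq)
      then have "(norm (s *\<^sub>R x k + t *\<^sub>R y k))\<^sup>2 \<le> (\<bar>s\<bar> * norm (x k) + \<bar>t\<bar> * norm (y
          k))\<^sup>2" by (intro power_mono) auto
      also have "\<dots> \<le> 2 * (\<bar>s\<bar> * norm (x k))\<^sup>2 + 2 * (\<bar>t\<bar> * norm (y k))\<^sup>2"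
        using zero_le_power2[of "\<bar>s\<bar> * norm (x k) - \<bar>t\<bar> * norm (y k)"] by (simp add: power2_eq_square algebra_simps)
      finally have "lam k * (norm (s *\<^sub>R x k + t *\<^sub>R y k))\<^sup>2 \<le> lam k * (2 * (\<bar>s\<bar> * norm (x k))\<^sup>2 + 2
          * (\<bar>t\<bar> * norm (y k))\<^sup>2)"
        using lam0[of k] by (intro mult_left_mono) auto
      also have "\<dots> = 2 * s\<^sup>2 * (lam k * (norm (x k))\<^sup>2) + 2 * t\<^sup>2 * (lam k * (norm (y k))\<^sup>2)"
        by (simp add: power_mult_distrib algebra_simps)
      also have "\<dots> \<le> 2 * s\<^sup>2 * C + 2 * t\<^sup>2 * D" by (intro add_mono mult_left_mono x y) auto
      finally show ?thesis .
    qed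
    show "(\<lambda>k. T k (s *\<^sub>R x k + t *\<^sub>R y k)) \<longlonglongrightarrow> ?w"
      using tendsto_add[OF tendsto_scaleR[OF tendsto_const x(3)] tendsto_scaleR[OF tendsto_const y(3)]]
      by (simp add: linear_add[OF autpairD(1)[OF aut]] linear_scale[OF autpairD(1)[OF aut]])
    show "A \<in> so" by (rule that)
  qed
  ultimately show ?thesis using st(2) by blast
qed

end

context so_isotropy
begin

text \<open>Of an automorphism and its inverse the one of larger norm is taken as
  \<open>T k\<close>, so that \<open>lam\<close> bounds both. The rescaled maps have norm one in a
  finite-dimensional space, hence accumulate at some nonzero \<open>P\<close>.\<close>

lemma expanding_sequence:
  assumes \<Gamma>: "\<And>T. T \<in> \<Gamma> \<Longrightarrow> \<exists>S. autpair T S"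
      and unb: "\<And>C. \<exists>T\<in>\<Gamma>. \<exists>A. norm (T A) > C * norm A"
  obtains T S lam F P x0 where "\<forall>k. autpair (T k) (S k)" "filterlim lam at_top sequentially"
    "\<forall>k A. norm (T k A) \<le> lam k * norm A" "\<forall>k A. norm (S k A) \<le> lam k * norm A" "\<forall>k. lam k > (0::real)"
    "\<forall>k A. T k A = lam k *\<^sub>R blinfun_apply (F k) A" "F \<longlonglongrightarrow> P"
    "x0 \<in> so" "blinfun_apply P x0 \<noteq> 0" "\<forall>A. blinfun_apply P (so_proj A) = blinfun_apply P A"
proof -
  have ex: "\<exists>TS. autpair (fst TS) (snd TS) \<and> onorm (snd TS) \<le> onorm (fst TS) \<and> real k + 1 \<le> onorm (fst TS)" for k
  proof -
    obtain T A where T: "T \<in> \<Gamma>" "norm (T A) > (real k + 1) * norm A" using unb by blast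
    obtain S where TS: "autpair T S" using \<Gamma>[OF T(1)] by blast
    have bl: "bounded_linear T" using autpairD(1)[OF TS] linear_conv_bounded_linear by blast
    have A: "norm A > 0" using T(2) linear_0[OF autpairD(1)[OF TS]] by (cases "A = 0") auto
    have "(real k + 1) * norm A \<le> onorm T * norm A" using onorm[OF bl, of A] T(2) by linarith
    then have k: "real k + 1 \<le> onorm T" using A by simp
    show ?thesis
    proof (cases "onorm S \<le> onorm T")
      case True
      then show ?thesis using TS k by (intro exI[of _ "(T, S)"]) simp
    next
      case False
      then show ?thesis using autpair_sym[OF TS] k by (intro exI[of _ "(S, T)"]) simp
    qed
  qed
  define TS where "TS k = (SOME TS. autpair (fst TS) (snd TS) \<and> onorm (snd TS) \<le> onorm (fst TS) \<and> real k + 1 \<le> onorm (fst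
      TS))" for k
  define T S lam where "T k = fst (TS k)" and "S k = snd (TS k)" and "lam k = onorm (T k)" for k
  have "autpair (T k) (S k) \<and> onorm (S k) \<le> lam k \<and> real k + 1 \<le> lam k" for k
    unfolding T_def S_def lam_def TS_def by (rule someI_ex[OF ex])
  then have aut: "autpair (T k) (S k)" and Sl: "onorm (S k) \<le> lam k" and lk: "real k + 1 \<le> lam k" for k by blast+
  have lam0: "lam k > 0" for k using lk[of k] by simp
  have blT: "bounded_linear (T k)" and blS: "bounded_linear (S k)" for k
    using autpairD(1,2)[OF aut] linear_conv_bounded_linear by blast+
  define F where "F k = (1 / lam k) *\<^sub>R Blinfun (T k)" for k
  have TF: "T k A = lam k *\<^sub>R blinfun_apply (F k) A" for k A
    using lam0[of k] by (simp add: F_def scaleR_blinfun.rep_eq bounded_linear_Blinfun_apply[OF blT])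
  have "norm (Blinfun (T k)) = lam k" for k
    by (simp add: norm_blinfun.rep_eq bounded_linear_Blinfun_apply[OF blT] lam_def)
  then have nF: "norm (F k) = 1" for k using lam0[of k] by (simp add: F_def)
  have "bounded (range F)" unfolding bounded_iff using nF by auto
  then obtain P r where r: "strict_mono (r :: nat \<Rightarrow> nat)" "(F \<circ> r) \<longlonglongrightarrow> P"
      using bounded_imp_convergent_subsequence by blast
  have limA: "(\<lambda>k. blinfun_apply (F (r k)) A) \<longlonglongrightarrow> blinfun_apply P A" for A
    using blinfun.tendsto[OF r(2) tendsto_const, of A] by (simp add: o_def)
  have Pp: "blinfun_apply P (so_proj A) = blinfun_apply P A" for A
  proof (rule LIMSEQ_unique[OF limA])
    have "blinfun_apply (F (r k)) (so_proj A) = blinfun_apply (F (r k)) A" for k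
      using autpairD(3)[OF aut, of "r k" A] lam0[of "r k"] by (simp add: TF)
    then show "(\<lambda>k. blinfun_apply (F (r k)) (so_proj A)) \<longlonglongrightarrow> blinfun_apply P A" using limA[of A] by simp
  qed
  have "norm P = 1"
    by (rule LIMSEQ_unique[OF tendsto_norm[OF r(2)]]) (simp add: nF o_def)
  then obtain A where A: "blinfun_apply P A \<noteq> 0" by (metis blinfun_eqI norm_zero zero_blinfun.rep_eq zero_neq_one)
  have lam: "filterlim (\<lambda>k. lam (r k)) at_top sequentially"
  proof (rule filterlim_at_top_mono[OF filterlim_real_sequentially])
    show "eventually (\<lambda>k. real k \<le> lam (r k)) sequentially"
    proof (rule always_eventually, rule allI)
      fix k show "real k \<le> lam (r k)" using lk[of "r k"] seq_suble[OF r(1), of k] by linarith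
    qed
  qed
  show ?thesis
  proof (rule that[of "\<lambda>k. T (r k)" "\<lambda>k. S (r k)" "\<lambda>k. lam (r k)" "F \<circ> r" P "so_proj A"])
    show "\<forall>k A. norm (T (r k) A) \<le> lam (r k) * norm A" using onorm[OF blT] by (simp add: lam_def)
    show "\<forall>k A. norm (S (r k) A) \<le> lam (r k) * norm A"
      using order_trans[OF onorm[OF blS] mult_right_mono[OF Sl norm_ge_zero]] by blast
  qed (simp_all add: aut lam lam0 TF r(2) so_proj_in A Pp)
qed

text \<open>When the limit \<open>P\<close> of \<open>T k / lam k\<close> has rank one, \<open>ker P\<close> is a hyperplane, hence not a subalgebra. For \<open>x\<close>, \<open>y\<close> in \<open>ker P\<close>
  with \<open>br x y\<close> outside, \<open>lam k\<close> is at most a constant times \<open>\<bar>T k x\<bar> \<bar>T k y\<bar>\<close>, so that \<open>T k\<close> still stretches \<open>x\<close> or \<open>y\<close>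
  by the square root of \<open>lam k\<close>.\<close>

lemma unbounded_imp_nilpotent:
  assumes \<Gamma>: "\<And>T. T \<in> \<Gamma> \<Longrightarrow> \<exists>S. autpair T S"
      and unb: "\<And>C. \<exists>T\<in>\<Gamma>. \<exists>A. norm (T A) > C * norm A"
  shows "\<exists>w\<in>h. w \<noteq> 0 \<and> (\<forall>A\<in>so. adp w 5 A = 0)"
proof -
  obtain T S lam F P x0 where s: "\<forall>k. autpair (T k) (S k)" "filterlim lam at_top sequentially"
    "\<forall>k A. norm (T k A) \<le> lam k * norm A" "\<forall>k A. norm (S k A) \<le> lam k * norm A" "\<forall>k. lam k > (0::real)"
    "\<forall>k A. T k A = lam k *\<^sub>R blinfun_apply (F k) A" "F \<longlonglongrightarrow> P"
    "x0 \<in> so" "blinfun_apply P x0 \<noteq> 0" "\<forall>A. blinfun_apply P (so_proj A) = blinfun_apply P A"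
    by (rule expanding_sequence[OF \<Gamma> unb])
  note aut = s(1)[rule_format] and lam = s(2) and bT = s(3)[rule_format] and bS = s(4)[rule_format]
    and lam0 = s(5)[rule_format] and TF = s(6)[rule_format]
  let ?P = "blinfun_apply P"
  define Z where "Z = ?P x0"
  have scaled: "lam k * (norm ((1 / lam k) *\<^sub>R x))\<^sup>2 \<le> C" if "(norm x)\<^sup>2 \<le> C * lam k" for k x C
    using that lam0[of k] by (simp add: power_divide field_simps power2_eq_square)
  \<comment> \<open>A positive lower bound for \<open>lam\<close> gives every fixed \<open>x\<close>
    an estimate \<open>|x|^2 <= C * lam k\<close>, the form that \<open>scaled\<close> asks
    for.\<close>
  have lam1: "\<exists>C. \<forall>k. lam k \<ge> C \<and> C > 0"
  proof -
    obtain N where N: "\<And>k. k \<ge> N \<Longrightarrow> lam k \<ge> 1" using lam unfolding filterlim_at_top eventually_sequentially by blast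
    define C where "C = Min (insert 1 (lam ` {..N}))"
    have "C > 0" unfolding C_def using lam0 by (subst Min_gr_iff) auto
    moreover have "lam k \<ge> C" for k
    proof (cases "k \<le> N")
      case True then show ?thesis unfolding C_def by (intro Min_le) auto
    next
      case False
      have "C \<le> 1" unfolding C_def by (intro Min_le) auto
      then show ?thesis using N[of k] False by simp
    qed
    ultimately show ?thesis by blast
  qed
  have fix_le: "\<exists>C. \<forall>k. lam k * (norm ((1 / lam k) *\<^sub>R x))\<^sup>2 \<le> C" for x :: "real ^ (2 + 'n) ^ (2 + 'n)"
  proof -
    obtain c where c: "\<And>k. lam k \<ge> c" "c > 0" using lam1 by blast
    have "(norm x)\<^sup>2 \<le> (norm x)\<^sup>2 / c * lam k" for k
      using mult_left_mono[OF c(1)[of k], of "(norm x)\<^sup>2 / c"] c(2) by simp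
    then show ?thesis using scaled by blast
  qed
  have fix_lim: "(\<lambda>k. T k ((1 / lam k) *\<^sub>R x)) \<longlonglongrightarrow> ?P x" for x
  proof -
    have "T k ((1 / lam k) *\<^sub>R x) = blinfun_apply (F k) x" for k
      using lam0[of k] by (simp add: TF blinfun.scaleR_right)
    then show ?thesis using blinfun.tendsto[OF s(7) tendsto_const, of x] by simp
  qed
  have Z: "Z \<noteq> 0" using s(9) by (simp add: Z_def)
  obtain C0 where C0: "\<And>k. lam k * (norm ((1 / lam k) *\<^sub>R x0))\<^sup>2 \<le> C0" using fix_le[of x0] by blast
  have x0k: "(1 / lam k) *\<^sub>R x0 \<in> so" for k by (intro so_ops s)
  show ?thesis
  proof (cases "\<exists>x1\<in>so. \<forall>c. ?P x1 \<noteq> c *\<^sub>R Z")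
    case True
    then obtain x1 where x1: "x1 \<in> so" "\<And>c. ?P x1 \<noteq> c *\<^sub>R Z" by blast
    obtain C1 where C1: "\<And>k. lam k * (norm ((1 / lam k) *\<^sub>R x1))\<^sup>2 \<le> C1" using fix_le[of x1] by blast
    have x1k: "(1 / lam k) *\<^sub>R x1 \<in> so" for k by (intro so_ops x1)
    show ?thesis
      by (rule contracted_pair[OF aut lam bT bS lam0 x0k C0 fix_lim[of x0, folded Z_def] x1k C1 fix_lim Z x1(2)])
  next
    case False
    \<comment> \<open>The coordinate along \<open>Z\<close>. In this case \<open>P\<close> maps
      \<open>so\<close> to the line of \<open>Z\<close>, and \<open>\<zeta> (P x)\<close> is the
      functional whose kernel is not a subalgebra.\<close>
    define \<zeta> where "\<zeta> A = (A \<bullet> Z) / (Z \<bullet> Z)" for A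
    have l\<zeta>: "bounded_linear \<zeta>" unfolding \<zeta>_def
      by (rule bounded_linear_compose[OF bounded_linear_divide bounded_linear_inner_left])
    note ladd = linear_add[OF bounded_linear.linear[OF l\<zeta>]] linear_diff[OF bounded_linear.linear[OF l\<zeta>]] linear_scale[OF
        bounded_linear.linear[OF l\<zeta>]]
    have \<zeta>Z: "\<zeta> Z = 1" using Z by (simp add: \<zeta>_def)
    have Pso: "?P x = \<zeta> (?P x) *\<^sub>R Z" if "x \<in> so" for x
    proof -
      from False have "\<forall>x1\<in>so. \<exists>c. ?P x1 = c *\<^sub>R Z" by simp
      from bspec[OF this that] obtain c where "?P x = c *\<^sub>R Z" by (rule exE)
      then show ?thesis using \<zeta>Z by (simp add: ladd)
    qed
    have \<xi>: "linear (\<lambda>x. \<zeta> (?P x))" by (rule linear_compose[OF _ bounded_linear.linear[OF l\<zeta>], unfolded o_def])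
        (rule bounded_linear.linear[OF blinfun.bounded_linear_right])
    obtain x y where xy: "x \<in> so" "y \<in> so" "\<zeta> (?P x) = 0" "\<zeta> (?P y) = 0" "\<zeta> (?P (br x y)) \<noteq> 0"
      by (rule hyperplane_not_subalgebra[OF \<xi> s(8)]) (simp_all add: Z_def[symmetric] \<zeta>Z)
    have lF: "(\<lambda>k. \<zeta> (blinfun_apply (F k) a)) \<longlonglongrightarrow> \<zeta> (?P a)" for a
      by (rule bounded_linear.tendsto[OF l\<zeta> blinfun.tendsto[OF s(7) tendsto_const]])
    define co where "co a k = \<zeta> (blinfun_apply (F k) a) / \<zeta> (blinfun_apply (F k) x0)" for a k
    \<comment> \<open>For \<open>a\<close> in the kernel, a small multiple of \<open>x0\<close> is
      subtracted so that \<open>T k (ad a k)\<close> eventually has no \<open>Z\<close>-component at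
      all. Otherwise the normalised limit could again be a multiple of \<open>Z\<close>.\<close>
    define ad where "ad a k = a - co a k *\<^sub>R x0" for a k
    have adso: "ad a k \<in> so" if "a \<in> so" for a k unfolding ad_def by (intro so_ops that s)
    have adlim: "ad a \<longlonglongrightarrow> a" if "\<zeta> (?P a) = 0" for a
    proof -
      have "(\<lambda>k. co a k) \<longlonglongrightarrow> \<zeta> (?P a) / \<zeta> (?P x0)"
        unfolding co_def by (intro tendsto_divide lF) (simp add: Z_def[symmetric] \<zeta>Z)
      then have "(\<lambda>k. a - co a k *\<^sub>R x0) \<longlonglongrightarrow> a - 0 *\<^sub>R x0" using that by (intro tendsto_intros) simp
      then show ?thesis unfolding ad_def[abs_def] by simp
    qed
    have "eventually (\<lambda>k. \<zeta> (blinfun_apply (F k) x0) \<noteq> 0) sequentially"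
      by (rule tendsto_imp_eventually_ne[OF lF]) (simp add: Z_def[symmetric] \<zeta>Z)
    then have ev1: "eventually (\<lambda>k. \<forall>a. \<zeta> (T k (ad a k)) = 0) sequentially"
    proof (rule eventually_mono)
      fix k assume nz: "\<zeta> (blinfun_apply (F k) x0) \<noteq> 0"
      show "\<forall>a. \<zeta> (T k (ad a k)) = 0"
        using nz by (simp add: TF ad_def ladd co_def blinfun.diff_right blinfun.scaleR_right)
    qed
    obtain K where K: "K > 0" "\<And>A B. norm (br A B :: real ^ (2 + 'n) ^ (2 + 'n)) \<le> norm A * norm B * K"
      using bounded_bilinear.pos_bounded[OF bounded_bilinear_br] by blast
    define c where "c = norm (?P (br x y)) / 2"
    have "?P (br x y) \<noteq> 0" using xy(5) linear_0[OF bounded_linear.linear[OF l\<zeta>]] by auto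
    then have c: "c > 0" by (simp add: c_def)
    have "(\<lambda>k. norm (blinfun_apply (F k) (br (ad x k) (ad y k)))) \<longlonglongrightarrow> norm (?P (br x y))"
      by (intro tendsto_norm blinfun.tendsto s(7) bounded_bilinear.tendsto[OF bounded_bilinear_br] adlim xy)
    then have ev2: "eventually (\<lambda>k. c < norm (blinfun_apply (F k) (br (ad x k) (ad y k)))) sequentially"
      by (rule order_tendstoD(1)) (use c in \<open>simp add: c_def\<close>)
    have "Bseq (ad x)" "Bseq (ad y)" using adlim xy(3,4) convergentI convergent_imp_Bseq by metis+
    then obtain Bx By where B: "\<And>k. norm (ad x k) \<le> Bx" "\<And>k. norm (ad y k) \<le> By" unfolding Bseq_def by blast
    define B where "B = max Bx By"
    have BB: "norm (ad x k) \<le> B" "norm (ad y k) \<le> B" for k using B[of k] by (simp_all add: B_def)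
    obtain N where N: "\<And>k a. k \<ge> N \<Longrightarrow> \<zeta> (T k (ad a k)) = 0"
      "\<And>k. k \<ge> N \<Longrightarrow> c < norm (blinfun_apply (F k) (br (ad x k) (ad y k)))"
      using eventually_conj[OF ev1 ev2] unfolding eventually_sequentially by blast
    \<comment> \<open>One of the two vectors is stretched by at least a constant times the square
      root of \<open>lam k\<close>; which one may vary with \<open>k\<close>.\<close>
    have ex: "\<exists>z. z \<in> so \<and> norm z \<le> B \<and> \<zeta> (T k z) = 0 \<and> (norm (T k z))\<^sup>2 \<ge> c / K * lam k"
        if k: "k \<ge> N" for k
    proof -
      let ?x = "norm (T k (ad x k))" and ?y = "norm (T k (ad y k))"
      have "c * lam k \<le> norm (T k (br (ad x k) (ad y k)))"
        using N(2)[OF k] lam0[of k] by (simp add: TF mult.commute)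
      also have "\<dots> \<le> ?x * ?y * K" unfolding autpairD(9)[OF aut adso[OF xy(1)] adso[OF xy(2)]] by (rule K(2))
      finally have le: "c / K * lam k \<le> ?x * ?y" using K(1) by (simp add: field_simps)
      show ?thesis
      proof (cases "?x \<le> ?y")
        case True
        then have "?x * ?y \<le> ?y\<^sup>2" by (simp add: power2_eq_square mult_right_mono)
        then show ?thesis using le adso[OF xy(2)] BB(2) N(1)[OF k] by (intro exI[of _ "ad y k"]) auto
      next
        case False
        then have "?x * ?y \<le> ?x\<^sup>2" by (simp add: power2_eq_square mult_left_mono)
        then show ?thesis using le adso[OF xy(1)] BB(1) N(1)[OF k] by (intro exI[of _ "ad x k"]) auto
      qed
    qed
    define z where "z k = (SOME z. z \<in> so \<and> norm z \<le> B \<and> \<zeta> (T (k + N) z) = 0 \<and> (norm (T (k + N) z))\<^sup>2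
        \<ge> c / K * lam (k + N))" for k
    have "z k \<in> so \<and> norm (z k) \<le> B \<and> \<zeta> (T (k + N) (z k)) = 0 \<and> (norm (T (k + N) (z k)))\<^sup>2 \<ge> c / K *
        lam (k + N)" for k
      unfolding z_def by (rule someI_ex[OF ex]) simp
    then have z: "z k \<in> so" "norm (z k) \<le> B" "\<zeta> (T (k + N) (z k)) = 0" "(norm (T (k + N) (z k)))\<^sup>2 \<ge> c / K * lam (k
        + N)" for k
      by blast+
    have pos: "c / K * lam k > 0" for k using c K(1) lam0[of k] by simp
    define n where "n k = norm (T (k + N) (z k))" for k
    have n: "n k > 0" for k
    proof -
      have "(n k)\<^sup>2 > 0" using z(4)[of k] pos[of "k + N"] unfolding n_def by linarith
      then show ?thesis by (simp add: n_def)
    qed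
    \<comment> \<open>The image of \<open>u k\<close> is a unit vector, while \<open>u k\<close>
      itself has norm at most \<open>B / n k\<close>. As \<open>(n k)^2\<close> is at least a
      multiple of \<open>lam (k + N)\<close>, this is the rate required by
      \<open>contracted_pair\<close>.\<close>
    define u where "u k = (1 / n k) *\<^sub>R z k" for k
    have Tu: "T (k + N) (u k) = (1 / n k) *\<^sub>R T (k + N) (z k)" for k
      by (simp add: u_def linear_scale[OF autpairD(1)[OF aut]])
    have nTu: "norm (T (k + N) (u k)) = 1" for k using n[of k] by (simp add: Tu n_def)
    have "bounded (range (\<lambda>k. T (k + N) (u k)))" unfolding bounded_iff using nTu by auto
    then obtain W r where r: "strict_mono (r :: nat \<Rightarrow> nat)" "((\<lambda>k. T (k + N) (u k)) \<circ> r) \<longlonglongrightarrow> W"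
      using bounded_imp_convergent_subsequence by blast
    have W1: "norm W = 1" by (rule LIMSEQ_unique[OF tendsto_norm[OF r(2)]]) (simp add: nTu o_def)
    have W0: "\<zeta> W = 0"
      by (rule LIMSEQ_unique[OF bounded_linear.tendsto[OF l\<zeta> r(2)]]) (simp add: o_def Tu ladd z(3))
    have Wind: "W \<noteq> a *\<^sub>R Z" for a
    proof
      assume "W = a *\<^sub>R Z"
      then show False using W0 W1 by (simp add: ladd \<zeta>Z)
    qed
    let ?r = "\<lambda>k. r k + N"
    have lamr: "filterlim (\<lambda>k. lam (?r k)) at_top sequentially"
      by (rule filterlim_compose[OF lam filterlim_compose[OF filterlim_add_const_nat_at_top filterlim_subseq[OF r(1)]]])
    have uso: "u k \<in> so" for k unfolding u_def by (intro so_ops z)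
    have ule: "lam (?r k) * (norm (u (r k)))\<^sup>2 \<le> B\<^sup>2 * K / c" for k
    proof -
      let ?k = "r k"
      have "lam (?r k) * (norm (u ?k))\<^sup>2 = lam (?r k) * (norm (z ?k))\<^sup>2 / (n ?k)\<^sup>2"
        using n[of ?k] by (simp add: u_def power_divide)
      also have "\<dots> \<le> lam (?r k) * B\<^sup>2 / (c / K * lam (?r k))"
        using z(2,4)[of ?k] lam0[of "?r k"] pos[of "?r k"] unfolding n_def
        by (intro frac_le mult_left_mono power_mono) auto
      also have "\<dots> = B\<^sup>2 * K / c" using lam0[of "?r k"] c K(1) by (simp add: field_simps)
      finally show ?thesis .
    qed
    have Zr: "(\<lambda>k. T (?r k) ((1 / lam (?r k)) *\<^sub>R x0)) \<longlonglongrightarrow> Z"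
      using filterlim_compose[OF fix_lim[of x0] filterlim_compose[OF filterlim_add_const_nat_at_top filterlim_subseq[OF r(1)]]]
      by (simp add: Z_def)
    have Wr: "(\<lambda>k. T (?r k) (u (r k))) \<longlonglongrightarrow> W" using r(2) by (simp add: o_def)
    show ?thesis
      by (rule contracted_pair[OF aut lamr bT bS lam0 x0k C0 Zr uso ule Wr Z Wind])
  qed
qed

end

section \<open>Reflections and transitivity on negative lines\<close>

definition reflection :: "real ^ ('p::finite + 'q::finite) \<Rightarrow> real ^ ('p + 'q) ^ ('p + 'q)" where
  "reflection v = matrix (\<lambda>x. x - (2 * bf v x / bf v v) *\<^sub>R v)"

lemma reflection_apply: "reflection v *v x = x - (2 * bf v x / bf v v) *\<^sub>R v"
  unfolding reflection_def
  by (rule fun_cong[OF matrix_vector_mul(2)]) (auto intro!: linearI simp: algebra_simps add_divide_distrib)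

lemma bf_reflection: "bf v v \<noteq> 0 \<Longrightarrow> bf (reflection v *v x) (reflection v *v y) = bf x y"
  using bf_sym[of x v] by (simp add: reflection_apply field_simps)

lemma reflection_reflection: "bf v v \<noteq> 0 \<Longrightarrow> reflection v ** reflection v = mat 1"
  by (rule mat_eqI, rule bf_eqI) (simp add: reflection_apply mv_simps)

lemma det_reflection:
  assumes "bf v v \<noteq> 0" shows "det (reflection v) = 1 \<or> det (reflection v) = - 1"
proof -
  have "det (reflection v) * det (reflection v) = 1"
    using reflection_reflection[OF assms] det_mul[of "reflection v" "reflection v"] by simp
  then show ?thesis by (metis power2_eq_1_iff power2_eq_square)
qed

lemma det_reflection_axis:
  fixes i :: "'p::finite + 'q::finite"
  shows "det (reflection (axis i 1)) = - 1"
proof -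
  have e: "reflection (axis i 1) $ k $ j = (if k = j then if k = i then - 1 else 1 else 0)" for k j
  proof -
    have b: "bf (axis i 1) (axis j 1) = sg j * axis i 1 $ j" for j by (rule bf_axis)
    have "reflection (axis i 1) $ k $ j = (reflection (axis i 1) *v axis j 1) $ k"
      by (simp add: matrix_vector_mult_basis column_def)
    also have "\<dots> = (if k = j then if k = i then - 1 else 1 else 0)"
      unfolding reflection_apply b by (auto simp: axis_def)
    finally show ?thesis .
  qed
  have "det (reflection (axis i 1)) = (\<Prod>k\<in>UNIV. reflection (axis i 1) $ k $ k)"
    by (rule det_diagonal) (simp add: e)
  also have "\<dots> = (\<Prod>k\<in>UNIV. if k = i then - 1 else 1)" unfolding e by simp
  finally show ?thesis by simp
qed

text \<open>The reflection in \<open>e - u\<close> takes \<open>e\<close> to \<open>u\<close>, that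
  in \<open>e + u\<close> takes it to \<open>- u\<close>; one of the two vectors is not null,
  because their values under the form add up to -4. A determinant of -1 is repaired by first
  reflecting in a positive axis, which fixes \<open>e\<close>.\<close>

lemma unit_negative_transitive:
  fixes p :: "real ^ ('p::finite + 'q::finite)"
  assumes p: "bf p p < 0"
  obtains g c where "g \<in> SO" "g *v axis (Inl i) 1 = c *\<^sub>R p" "c \<noteq> 0"
proof -
  define e :: "real ^ ('p + 'q)" where "e = axis (Inl i) 1"
  define d :: "real ^ ('p + 'q) ^ ('p + 'q)" where "d = reflection (axis (Inr undefined) 1)"
  define u where "u = (1 / sqrt (- bf p p)) *\<^sub>R p"
  have e: "bf e e = - 1" unfolding e_def bf_axis by (simp add: axis_def sg_def)
  have u: "bf u u = - 1" using p by (simp add: u_def field_simps)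
  have ue: "bf u e = bf e u" by (rule bf_sym)
  have nz: "bf (e - u) (e - u) \<noteq> 0 \<or> bf (e + u) (e + u) \<noteq> 0"
      unfolding bf_add_left bf_add_right bf_diff_left bf_diff_right e u ue by linarith
  have "\<exists>v. bf v v \<noteq> 0 \<and> (reflection v *v e = u \<or> reflection v *v e = - u)"
  proof (cases "bf (e - u) (e - u) \<noteq> 0")
    case True
    have "2 * bf (e - u) e / bf (e - u) (e - u) = 1" using True by (simp add: e u ue field_simps)
    then have "reflection (e - u) *v e = u" unfolding reflection_apply by (simp only: scaleR_one) simp
    then show ?thesis using True by blast
  next
    case False
    then have nz': "bf (e + u) (e + u) \<noteq> 0" using nz by blast
    have "2 * bf (e + u) e / bf (e + u) (e + u) = 1" using nz' by (simp add: e u ue field_simps)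
    then have "reflection (e + u) *v e = - u" unfolding reflection_apply by (simp only: scaleR_one) simp
    then show ?thesis using nz' by blast
  qed
  then obtain v where v: "bf v v \<noteq> 0" "reflection v *v e = u \<or> reflection v *v e = - u" by blast
  have nd: "bf (axis (Inr undefined) 1) (axis (Inr undefined) 1 :: real ^ ('p + 'q)) \<noteq> 0"
    unfolding bf_axis by (simp add: axis_def)
  have de: "d *v e = e" unfolding d_def reflection_apply e_def bf_axis by (simp add: axis_def)
  have "\<exists>g. det g = 1 \<and> (\<forall>x y. bf (g *v x) (g *v y) = bf x y) \<and> (g *v e = u \<or> g *v e = - u)"
  proof (cases "det (reflection v) = 1")
    case True
    then show ?thesis using bf_reflection[OF v(1)] v(2) by (intro exI[of _ "reflection v"]) simp
  next
    case False
    then have "det (reflection v ** d) = 1" using det_reflection[OF v(1)] by (simp add: det_mul d_def det_reflection_axis)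
    then show ?thesis using bf_reflection[OF v(1)] bf_reflection[OF nd] v(2) de
      by (intro exI[of _ "reflection v ** d"]) (simp add: d_def mv_simps)
  qed
  then obtain g where g: "det g = 1" "\<forall>x y. bf (g *v x) (g *v y) = bf x y" "g *v e = u \<or> g *v e = - u" by blast
  have "g \<in> SO" unfolding SO_def quad_form_bf using g by simp
  moreover have "\<exists>c. g *v e = c *\<^sub>R p \<and> c \<noteq> 0"
    using g(3)
  proof
    assume "g *v e = u"
    then show ?thesis using p by (intro exI[of _ "1 / sqrt (- bf p p)"]) (simp add: u_def)
  next
    assume "g *v e = - u"
    then show ?thesis using p by (intro exI[of _ "- 1 / sqrt (- bf p p)"]) (simp add: u_def)
  qed
  ultimately show ?thesis using that unfolding e_def by blast
qed

lemma SO_bf: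
  assumes "g \<in> SO" shows "bf (g *v x) (g *v y) = bf x y"
proof -
  have q: "bf (g *v x) (g *v x) = bf x x" for x using assms unfolding SO_def quad_form_bf by blast
  show ?thesis using q[of "x + y"] q[of x] q[of y] bf_sym[of y x] bf_sym[of "g *v y" "g *v x"] by (simp add: mv_simps)
qed

lemma stabilizer_conjugate:
  assumes g: "g \<in> SO" and e: "g *v e = c *\<^sub>R p" "c \<noteq> 0"
  shows "(\<lambda>A. g ** A ** matrix_inv g) ` {A \<in> so. A *v e = 0} = {A \<in> so. A *v p = 0}"
proof -
  define k where "k = matrix_inv g"
  have "invertible g" using g unfolding SO_def invertible_det_nz by simp
  then have "g ** k = mat 1 \<and> k ** g = mat 1" unfolding k_def matrix_inv_def invertible_def by (rule someI_ex)
  then have gk: "g ** k = mat 1" "k ** g = mat 1" by blast+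
  then have gk': "g *v (k *v x) = x" "k *v (g *v x) = x" for x by (simp_all add: matrix_vector_mul_assoc)
  have bk: "bf (k *v x) (k *v y) = bf x y" for x y using SO_bf[OF g, of "k *v x" "k *v y"] gk' by simp
  have kp: "k *v p = (1 / c) *\<^sub>R e"
  proof -
    have "c *\<^sub>R (k *v p) = e" using gk'(2)[of e] by (simp add: e mv_simps)
    then have "(1 / c) *\<^sub>R (c *\<^sub>R (k *v p)) = (1 / c) *\<^sub>R e" by simp
    then show ?thesis using e(2) by (simp only: scaleR_scaleR) simp
  qed
  have conj: "g ** A ** k \<in> so" if "A \<in> so" for A
  proof -
    have "bf ((g ** A ** k) *v x) y + bf x ((g ** A ** k) *v y) = 0" for x y
      using SO_bf[OF g, of "A *v (k *v x)" "k *v y"] SO_bf[OF g, of "k *v x" "A *v (k *v y)"] soD[OF that, of "k *v x" "k *v y"]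
      by (simp add: mv_simps gk')
    then show ?thesis unfolding so_def by blast
  qed
  have conj': "k ** A ** g \<in> so" if "A \<in> so" for A
  proof -
    have "bf ((k ** A ** g) *v x) y + bf x ((k ** A ** g) *v y) = 0" for x y
      using bk[of "A *v (g *v x)" "g *v y"] bk[of "g *v x" "A *v (g *v y)"] soD[OF that, of "g *v x" "g *v y"]
      by (simp add: mv_simps gk')
    then show ?thesis unfolding so_def by blast
  qed
  show ?thesis
  proof (rule subset_antisym; rule subsetI)
    fix B assume "B \<in> (\<lambda>A. g ** A ** matrix_inv g) ` {A \<in> so. A *v e = 0}"
    then obtain A where "B = g ** A ** k" "A \<in> so" "A *v e = 0" unfolding k_def by blast
    then show "B \<in> {A \<in> so. A *v p = 0}" using conj by (simp add: mv_simps kp)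
  next
    fix B assume "B \<in> {A \<in> so. A *v p = 0}"
    then have B: "B \<in> so" "B *v p = 0" by blast+
    have "B = g ** (k ** B ** g) ** k" by (rule mat_eqI) (simp add: mv_simps gk')
    moreover have "(k ** B ** g) *v e = 0" by (simp add: mv_simps e B)
    ultimately show "B \<in> (\<lambda>A. g ** A ** matrix_inv g) ` {A \<in> so. A *v e = 0}" using conj'[OF B(1)] unfolding k_def by blast
  qed
qed

section \<open>Smooth functions on Euclidean spaces\<close>

lemma Ck_on_cong:
  assumes "open U" "\<And>x. x \<in> U \<Longrightarrow> f x = g x"
  shows "Ck_on k U f \<longleftrightarrow> Ck_on k U g"
  using assms(2)
proof (induction k arbitrary: f g)
  case 0
  then show ?case by (simp cong: continuous_on_cong)
next
  case (Suc k)
  have d: "(f has_derivative D) (at x) \<longleftrightarrow> (g has_derivative D) (at x)" if "x \<in> U" for x D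
    using that assms(1) Suc.prems
    by (metis has_derivative_transform_within_open)
  have "frechet_derivative f (at x) = frechet_derivative g (at x)" if "x \<in> U" for x
    unfolding frechet_derivative_def using d[OF that] by simp
  moreover have "f differentiable at x \<longleftrightarrow> g differentiable at x" if "x \<in> U" for x
    using d[OF that] by (simp add: differentiable_def)
  ultimately show ?case
    using Suc.IH[of "\<lambda>x. frechet_derivative f (at x) v" "\<lambda>x. frechet_derivative g (at x) v" for v]
    by auto
qed

lemma Ck_on_subset: "Ck_on k U f \<Longrightarrow> V \<subseteq> U \<Longrightarrow> Ck_on k V f"
  by (induction k arbitrary: f) (auto intro: continuous_on_subset)

lemma Ck_on_locally:
  assumes "open U" "\<And>x. x \<in> U \<Longrightarrow> \<exists>V. open V \<and> x \<in> V \<and> Ck_on k V f"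
  shows "Ck_on k U f"
  using assms(2)
proof (induction k arbitrary: f)
  case 0
  have "isCont f x" if "x \<in> U" for x
    using 0[OF that] continuous_on_eq_continuous_at by auto
  then show ?case by (simp add: continuous_at_imp_continuous_on)
next
  case (Suc k)
  have "f differentiable at x" if "x \<in> U" for x
    using Suc.prems[OF that] by auto
  moreover have "Ck_on k U (\<lambda>x. frechet_derivative f (at x) v)" for v
    by (rule Suc.IH) (use Suc.prems in fastforce)
  ultimately show ?case by simp
qed

lemma Ck_on_SucI:
  assumes "open U" "\<And>x. x \<in> U \<Longrightarrow> (f has_derivative f' x) (at x)" "\<And>v. Ck_on k U (\<lambda>x. f' x v)"
  shows "Ck_on (Suc k) U f"
proof -
  have "frechet_derivative f (at x) = f' x" if "x \<in> U" for x
    using assms(2)[OF that] frechet_derivative_at by metis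
  then have "Ck_on k U (\<lambda>x. frechet_derivative f (at x) v)" for v
    using Ck_on_cong[OF assms(1), of "\<lambda>x. frechet_derivative f (at x) v" "\<lambda>x. f' x v"] assms(3) by auto
  then show ?thesis using assms(2) by (auto simp: differentiable_def)
qed

lemma Ck_on_SucD: "Ck_on (Suc k) U f \<Longrightarrow> Ck_on k U f"
proof (induction k arbitrary: f)
  case 0
  then show ?case by (simp add: continuous_at_imp_continuous_on differentiable_imp_continuous_within)
next
  case (Suc k)
  have "f differentiable at x" if "x \<in> U" for x
    using Suc.prems that by simp
  moreover have "Ck_on k U (\<lambda>x. frechet_derivative f (at x) v)" for v
    by (rule Suc.IH) (use Suc.prems in simp)
  ultimately show ?case by simp
qed

lemma Ck_on_Suc_frechet: "Ck_on (Suc k) U f \<Longrightarrow> Ck_on k U (\<lambda>x. frechet_derivative f (at x) v)"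
  by simp

lemma Ck_on_Suc_has_derivative:
  "Ck_on (Suc k) U f \<Longrightarrow> x \<in> U \<Longrightarrow> (f has_derivative frechet_derivative f (at x)) (at x)"
  using frechet_derivative_works by (metis Ck_on.simps(2))

lemma Ck_on_const [simp]: "Ck_on k U (\<lambda>x. c)"
  by (induction k arbitrary: c) auto

lemma Ck_on_bounded_linear:
  assumes "bounded_linear f" "open U" shows "Ck_on k U f"
proof (cases k)
  case 0
  then show ?thesis using assms by (simp add: linear_continuous_on)
next
  case (Suc m)
  then show ?thesis
    using Ck_on_SucI[OF assms(2), of f "\<lambda>_. f" m] bounded_linear_imp_has_derivative[OF assms(1)] by auto
qed

lemma Ck_on_add:
  assumes "open U" "Ck_on k U f" "Ck_on k U g" shows "Ck_on k U (\<lambda>x. f x + g x)"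
  using assms(2,3)
proof (induction k arbitrary: f g)
  case 0
  then show ?case by (simp add: continuous_on_add)
next
  case (Suc k)
  show ?case
  proof (rule Ck_on_SucI[OF assms(1), of _ "\<lambda>x v. frechet_derivative f (at x) v + frechet_derivative g (at x) v"])
    show "((\<lambda>x. f x + g x) has_derivative (\<lambda>v. frechet_derivative f (at x) v + frechet_derivative g (at x) v)) (at x)"
      if "x \<in> U" for x
      by (rule has_derivative_add[OF Ck_on_Suc_has_derivative[OF Suc.prems(1) that]
            Ck_on_Suc_has_derivative[OF Suc.prems(2) that]])
  qed (use Suc in auto)
qed

lemma Ck_on_bilinear:
  fixes prod :: "'b::euclidean_space \<Rightarrow> 'c::euclidean_space \<Rightarrow> 'd::euclidean_space"
  assumes "bounded_bilinear prod" "open U" "Ck_on k U f" "Ck_on k U g"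
  shows "Ck_on k U (\<lambda>x. prod (f x) (g x))"
  using assms(3,4)
proof (induction k arbitrary: f g)
  case 0
  then show ?case by (simp add: bounded_bilinear.continuous_on[OF assms(1)])
next
  case (Suc k)
  show ?case
  proof (rule Ck_on_SucI[OF assms(2), of _ "\<lambda>x v. prod (f x) (frechet_derivative g (at x) v)
        + prod (frechet_derivative f (at x) v) (g x)"])
    show "((\<lambda>x. prod (f x) (g x)) has_derivative (\<lambda>v. prod (f x) (frechet_derivative g (at x) v)
        + prod (frechet_derivative f (at x) v) (g x))) (at x)" if "x \<in> U" for x
      using bounded_bilinear.FDERIV[OF assms(1) Ck_on_Suc_has_derivative[OF Suc.prems(1) that]
          Ck_on_Suc_has_derivative[OF Suc.prems(2) that]] .
    show "Ck_on k U (\<lambda>x. prod (f x) (frechet_derivative g (at x) v) + prod (frechet_derivative f (at x) v) (g x))" for v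
      using Suc by (intro Ck_on_add[OF assms(2)] Suc.IH Ck_on_SucD[OF Suc.prems(1)] Ck_on_SucD[OF Suc.prems(2)]) auto
  qed
qed

lemma Ck_on_sum:
  assumes "open U" "\<And>i. i \<in> I \<Longrightarrow> Ck_on k U (f i)" shows "Ck_on k U (\<lambda>x. \<Sum>i\<in>I. f i x)"
  using assms(2) by (induction I rule: infinite_finite_induct) (auto intro: Ck_on_add[OF assms(1)])

lemma linear_euclidean_sum:
  fixes D :: "'a::euclidean_space \<Rightarrow> 'b::real_vector"
  assumes "linear D" shows "D w = (\<Sum>b\<in>Basis. (w \<bullet> b) *\<^sub>R D b)"
  by (metis (no_types, lifting) assms euclidean_representation linear_cmul linear_sum sum.cong)

text \<open>The chain rule is expanded in a basis so that the derivative of \<open>g\<close> occurs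
  only in fixed directions \<open>b\<close>; each summand is then within reach of the induction
  hypothesis.\<close>

lemma Ck_on_compose:
  fixes f :: "'a::euclidean_space \<Rightarrow> 'b::euclidean_space" and g :: "'b \<Rightarrow> 'c::euclidean_space"
  assumes "open U" "open V" "f ` U \<subseteq> V" "Ck_on k U f" "Ck_on k V g"
  shows "Ck_on k U (\<lambda>x. g (f x))"
  using assms(4,5)
proof (induction k arbitrary: g)
  case 0
  then show ?case using continuous_on_compose2 assms(3) by auto
next
  case (Suc k)
  let ?D = "\<lambda>x v. \<Sum>b\<in>Basis. (frechet_derivative f (at x) v \<bullet> b) *\<^sub>R frechet_derivative g (at (f x)) b"
  show ?case
  proof (rule Ck_on_SucI[OF assms(1), of _ ?D])
    fix x assume x: "x \<in> U"
    have 1: "(f has_derivative frechet_derivative f (at x)) (at x)"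
      using Ck_on_Suc_has_derivative[OF Suc.prems(1) x] .
    have 2: "(g has_derivative frechet_derivative g (at (f x))) (at (f x))"
      using Ck_on_Suc_has_derivative[OF Suc.prems(2)] x assms(3) by auto
    show "((\<lambda>x. g (f x)) has_derivative ?D x) (at x)"
      by (rule has_derivative_eq_rhs[OF diff_chain_at[OF 1 2, unfolded o_def]])
        (rule ext, rule linear_euclidean_sum[OF has_derivative_linear[OF 2]])
  next
    fix v
    have "Ck_on k U (\<lambda>x. frechet_derivative g (at (f x)) b)" for b
      using Suc.IH[OF Ck_on_SucD[OF Suc.prems(1)], of "\<lambda>y. frechet_derivative g (at y) b"] Suc.prems(2) by simp
    moreover have "Ck_on k U (\<lambda>x. frechet_derivative f (at x) v \<bullet> b)" for b
      using Ck_on_bilinear[OF bounded_bilinear_inner assms(1), of k "\<lambda>x. frechet_derivative f (at x) v" "\<lambda>x. b"]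
        Suc.prems(1) by simp
    ultimately show "Ck_on k U (\<lambda>x. ?D x v)"
      by (intro Ck_on_sum[OF assms(1)] Ck_on_bilinear[OF bounded_bilinear_scaleR assms(1)])
  qed
qed

lemma C_infinity_on_cong:
  "open U \<Longrightarrow> (\<And>x. x \<in> U \<Longrightarrow> f x = g x) \<Longrightarrow> C_infinity_on U f \<longleftrightarrow>
      C_infinity_on U g"
  unfolding C_infinity_on_def using Ck_on_cong by blast

lemma C_infinity_on_subset: "C_infinity_on U f \<Longrightarrow> V \<subseteq> U \<Longrightarrow> C_infinity_on V f"
  unfolding C_infinity_on_def using Ck_on_subset by blast

lemma C_infinity_on_locally:
  assumes "open U" "\<And>x. x \<in> U \<Longrightarrow> \<exists>V. open V \<and> x \<in> V \<and> C_infinity_on V f"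
  shows "C_infinity_on U f"
  unfolding C_infinity_on_def
proof
  fix k show "Ck_on k U f"
    by (rule Ck_on_locally[OF assms(1)]) (meson C_infinity_on_def assms(2))
qed

lemma C_infinity_on_imp_continuous_on: "C_infinity_on U f \<Longrightarrow> continuous_on U f"
  unfolding C_infinity_on_def by (metis Ck_on.simps(1))

lemma C_infinity_on_has_derivative:
  "C_infinity_on U f \<Longrightarrow> x \<in> U \<Longrightarrow> (f has_derivative frechet_derivative f (at x)) (at x)"
  unfolding C_infinity_on_def by (rule Ck_on_Suc_has_derivative[of 0]) blast+

lemma C_infinity_on_frechet:
  "C_infinity_on U f \<Longrightarrow> C_infinity_on U (\<lambda>x. frechet_derivative f (at x) v)"
  by (simp add: C_infinity_on_def Ck_on_Suc_frechet del: Ck_on.simps)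

lemma C_infinity_on_const [simp]: "C_infinity_on U (\<lambda>x. c)"
  by (simp add: C_infinity_on_def)

lemma C_infinity_on_bounded_linear: "bounded_linear f \<Longrightarrow> open U \<Longrightarrow> C_infinity_on U f"
  by (simp add: C_infinity_on_def Ck_on_bounded_linear)

lemma C_infinity_on_id [simp]: "open U \<Longrightarrow> C_infinity_on U (\<lambda>x. x)"
  by (simp add: C_infinity_on_bounded_linear bounded_linear_ident)

lemma C_infinity_on_add:
  "open U \<Longrightarrow> C_infinity_on U f \<Longrightarrow> C_infinity_on U g \<Longrightarrow> C_infinity_on U (\<lambda>x. f x + g x)"
  by (simp add: C_infinity_on_def Ck_on_add)

lemma C_infinity_on_bilinear:
  fixes prod :: "'b::euclidean_space \<Rightarrow> 'c::euclidean_space \<Rightarrow> 'd::euclidean_space"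
  shows "bounded_bilinear prod \<Longrightarrow> open U \<Longrightarrow> C_infinity_on U f \<Longrightarrow> C_infinity_on U g
    \<Longrightarrow> C_infinity_on U (\<lambda>x. prod (f x) (g x))"
  by (simp add: C_infinity_on_def Ck_on_bilinear)

lemmas C_infinity_on_mult = C_infinity_on_bilinear[OF bounded_bilinear_mult]
lemmas C_infinity_on_scaleR = C_infinity_on_bilinear[OF bounded_bilinear_scaleR]
lemmas C_infinity_on_inner = C_infinity_on_bilinear[OF bounded_bilinear_inner]

lemma C_infinity_on_sum:
  "open U \<Longrightarrow> (\<And>i. i \<in> I \<Longrightarrow> C_infinity_on U (f i)) \<Longrightarrow> C_infinity_on U (\<lambda>x.
      \<Sum>i\<in>I. f i x)"
  by (simp add: C_infinity_on_def Ck_on_sum)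

lemma C_infinity_on_compose:
  fixes f :: "'a::euclidean_space \<Rightarrow> 'b::euclidean_space" and g :: "'b \<Rightarrow> 'c::euclidean_space"
  assumes "open U" "open V" "f ` U \<subseteq> V" "C_infinity_on U f" "C_infinity_on V g"
  shows "C_infinity_on U (\<lambda>x. g (f x))"
  using assms(4,5) by (simp add: C_infinity_on_def Ck_on_compose[OF assms(1-3)] del: Ck_on.simps)

lemma C_infinity_on_linear_compose:
  fixes f :: "'a::euclidean_space \<Rightarrow> 'b::euclidean_space" and l :: "'b \<Rightarrow> 'c::euclidean_space"
  assumes "bounded_linear l" "open U" "C_infinity_on U f"
  shows "C_infinity_on U (\<lambda>x. l (f x))"
  using C_infinity_on_compose[OF assms(2) open_UNIV _ assms(3) C_infinity_on_bounded_linear[OF assms(1)]] by auto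

lemma C_infinity_on_componentwise:
  fixes f :: "'a::euclidean_space \<Rightarrow> 'b::euclidean_space"
  assumes "open U" "\<And>b. b \<in> Basis \<Longrightarrow> C_infinity_on U (\<lambda>x. f x \<bullet> b)"
  shows "C_infinity_on U f"
proof -
  have "C_infinity_on U (\<lambda>x. \<Sum>b\<in>Basis. (f x \<bullet> b) *\<^sub>R b)"
    by (intro C_infinity_on_sum C_infinity_on_scaleR assms C_infinity_on_const)
  then show ?thesis by (simp add: euclidean_representation)
qed

lemma C_infinity_on_Pair:
  assumes "open U" "C_infinity_on U f" "C_infinity_on U g"
  shows "C_infinity_on U (\<lambda>x. (f x, g x))"
proof -
  have "C_infinity_on U (\<lambda>x. (f x, 0) + (0, g x))"
    by (intro C_infinity_on_add assms C_infinity_on_linear_compose[of "\<lambda>x. (x, 0)"]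
        C_infinity_on_linear_compose[of "\<lambda>x. (0, x)"] bounded_linear_Pair bounded_linear_ident bounded_linear_zero)
  then show ?thesis by simp
qed

lemma C_infinity_on_fst: "open U \<Longrightarrow> C_infinity_on U f \<Longrightarrow> C_infinity_on U (\<lambda>x. fst (f x))"
  by (intro C_infinity_on_linear_compose[of fst] bounded_linear_fst)

lemma C_infinity_on_snd: "open U \<Longrightarrow> C_infinity_on U f \<Longrightarrow> C_infinity_on U (\<lambda>x. snd (f x))"
  by (intro C_infinity_on_linear_compose[of snd] bounded_linear_snd)

lemma C_infinity_on_real_derivatives:
  fixes F :: "nat \<Rightarrow> real \<Rightarrow> real"
  assumes "open U" "\<And>k x. x \<in> U \<Longrightarrow> (F k has_real_derivative F (Suc k) x) (at x)"
  shows "C_infinity_on U (F j)"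
  unfolding C_infinity_on_def
proof
  fix k show "Ck_on k U (F j)"
  proof (induction k arbitrary: j)
    case 0
    show ?case using assms(2) by (auto intro: continuous_at_imp_continuous_on DERIV_isCont)
  next
    case (Suc k)
    show ?case
      by (rule Ck_on_SucI[OF assms(1), of _ "\<lambda>x v. F (Suc j) x * v"])
        (use assms Suc in \<open>auto simp: has_field_derivative_def intro!: Ck_on_bilinear[OF bounded_bilinear_mult]\<close>)
  qed
qed

section \<open>Flat functions and bump functions\<close>

lemma C_infinity_on_inverse: "C_infinity_on {x::real. x \<noteq> 0} inverse"
proof -
  have "open {x::real. x \<noteq> 0}" by (simp add: open_Collect_neq)
  moreover have "((\<lambda>x::real. (-1)^k * fact k * inverse x ^ Suc k) has_real_derivative
      (-1)^Suc k * fact (Suc k) * inverse x ^ Suc (Suc k)) (at x)" if "x \<in> {x. x \<noteq> 0}" for k x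
  proof -
    have x: "x \<noteq> 0" using that by simp
    have "((\<lambda>x. inverse x ^ Suc k) has_real_derivative real (Suc k) * (- (inverse x ^ Suc (Suc 0)) * inverse x ^ k)) (at x)"
      using DERIV_power[OF DERIV_inverse[OF x], of "Suc k"] by simp
    from DERIV_cmult[OF this, of "(-1)^k * fact k"] show ?thesis
      by (rule back_subst[of "\<lambda>D. (_ has_real_derivative D) _"]) (simp add: ac_simps)
  qed
  ultimately have "C_infinity_on {x::real. x \<noteq> 0} ((\<lambda>k x. (-1)^k * fact k * inverse x ^ Suc k) 0)"
    by (rule C_infinity_on_real_derivatives)
  then show ?thesis by simp
qed

text \<open>The functions \<open>p(1/x) exp(-1/x)\<close>, continued by zero, form a family closed
  under differentiation, which settles smoothness at 0 for all orders at once.\<close>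

definition flat_poly :: "real poly \<Rightarrow> real \<Rightarrow> real" where
  "flat_poly p x = (if x > 0 then poly p (inverse x) * exp (- inverse x) else 0)"

text \<open>In terms of \<open>y = 1/x\<close> the derivative is
  \<open>y^2 (p(y) - p'(y)) exp(-y)\<close>.\<close>

definition flat_deriv_poly :: "real poly \<Rightarrow> real poly" where
  "flat_deriv_poly p = [:0, 0, 1:] * (p - pderiv p)"

lemma poly_times_exp_minus_tendsto_0: "((\<lambda>x::real. poly p x * exp (- x)) \<longlongrightarrow> 0) at_top"
proof -
  have "((\<lambda>x. \<Sum>i\<le>degree p. coeff p i * (x ^ i / exp x)) \<longlongrightarrow> (\<Sum>i\<le>degree p. coeff p i * 0)) at_top"
    by (intro tendsto_sum tendsto_mult tendsto_const tendsto_power_div_exp_0)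
  then show ?thesis
    by (simp add: poly_altdef exp_minus sum_distrib_left divide_inverse ac_simps)
qed

lemma flat_poly_has_derivative:
  "(flat_poly p has_real_derivative flat_poly (flat_deriv_poly p) x) (at x)"
proof -
  consider "x < 0" | "x > 0" | "x = 0" by linarith
  then show ?thesis
  proof cases
    case 1
    have "((\<lambda>x. 0) has_real_derivative 0) (at x)" by simp
    then have "(flat_poly p has_real_derivative 0) (at x)"
      by (rule has_field_derivative_transform_within_open[of _ _ _ "{..<0}"]) (use 1 in \<open>auto simp: flat_poly_def\<close>)
    then show ?thesis using 1 by (simp add: flat_poly_def)
  next
    case 2
    have i: "(inverse has_real_derivative - (inverse x ^ 2)) (at x)"
      using DERIV_inverse[of x] 2 by (simp add: numeral_2_eq_2)
    have "((\<lambda>x. poly p (inverse x) * exp (- inverse x)) has_real_derivative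
        poly p (inverse x) * (exp (- inverse x) * - (- (inverse x ^ 2)))
        + poly (pderiv p) (inverse x) * (- (inverse x ^ 2)) * exp (- inverse x)) (at x)"
      by (intro DERIV_mult' DERIV_chain2[OF poly_DERIV i] DERIV_chain2[OF DERIV_exp] DERIV_minus i)
    moreover have "poly p (inverse x) * (exp (- inverse x) * - (- (inverse x ^ 2)))
        + poly (pderiv p) (inverse x) * (- (inverse x ^ 2)) * exp (- inverse x) = flat_poly (flat_deriv_poly p) x"
      using 2 by (simp add: flat_poly_def flat_deriv_poly_def algebra_simps power2_eq_square)
    ultimately have "((\<lambda>x. poly p (inverse x) * exp (- inverse x)) has_real_derivative
        flat_poly (flat_deriv_poly p) x) (at x)" by simp
    then show ?thesis
      by (rule has_field_derivative_transform_within_open[of _ _ _ "{0<..}"]) (use 2 in \<open>auto simp: flat_poly_def\<close>)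
  next
    case 3
    have "((\<lambda>y. flat_poly p y / y) \<longlongrightarrow> 0) (at_right 0)"
    proof -
      have "((\<lambda>y. poly (pCons 0 p) (inverse y) * exp (- inverse y)) \<longlongrightarrow> 0) (at_right (0::real))"
        by (rule filterlim_compose[OF poly_times_exp_minus_tendsto_0 filterlim_inverse_at_top_right])
      then show ?thesis
        by (rule Lim_transform_eventually)
          (auto simp: flat_poly_def eventually_at_filter divide_inverse)
    qed
    moreover have "((\<lambda>y. flat_poly p y / y) \<longlongrightarrow> 0) (at_left 0)"
      by (rule Lim_transform_eventually[OF tendsto_const]) (auto simp: flat_poly_def eventually_at_filter)
    ultimately have "((\<lambda>y. flat_poly p y / y) \<longlongrightarrow> 0) (at 0)"
      using filterlim_at_split by blast
    then show ?thesis using 3 by (simp add: has_field_derivative_iff flat_poly_def)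
  qed
qed

lemma C_infinity_on_flat_poly: "C_infinity_on UNIV (flat_poly p)"
proof -
  have "C_infinity_on UNIV ((\<lambda>k. flat_poly ((flat_deriv_poly ^^ k) p)) 0)"
    by (rule C_infinity_on_real_derivatives) (simp_all add: flat_poly_has_derivative)
  then show ?thesis by simp
qed

lemma C_infinity_on_reciprocal:
  fixes f :: "'a::euclidean_space \<Rightarrow> real"
  assumes "open U" "C_infinity_on U f" "\<And>x. x \<in> U \<Longrightarrow> f x \<noteq> 0"
  shows "C_infinity_on U (\<lambda>x. inverse (f x))"
  by (rule C_infinity_on_compose[OF assms(1) _ _ assms(2) C_infinity_on_inverse])
    (use assms(3) in \<open>auto simp: open_Collect_neq\<close>)

lemma smooth_step_exists:
  obtains s :: "real \<Rightarrow> real"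
      where "C_infinity_on UNIV s" "\<And>t. t \<le> 0 \<Longrightarrow> s t = 0" "\<And>t. t \<ge> 1 \<Longrightarrow> s t = 1"
proof
  let ?f = "flat_poly 1"
  let ?s = "\<lambda>t. ?f t * inverse (?f t + ?f (1 + - t))"
  have pos: "?f t + ?f (1 + - t) > 0" for t
    by (cases "t > 0") (auto simp: flat_poly_def add_pos_pos)
  have "C_infinity_on UNIV (\<lambda>t::real. ?f (1 + - t))"
    by (rule C_infinity_on_compose[OF open_UNIV open_UNIV subset_UNIV _ C_infinity_on_flat_poly])
      (intro C_infinity_on_add C_infinity_on_const C_infinity_on_bounded_linear bounded_linear_minus
        bounded_linear_ident open_UNIV)
  then show "C_infinity_on UNIV ?s"
    using pos by (intro C_infinity_on_mult C_infinity_on_reciprocal C_infinity_on_add C_infinity_on_flat_poly)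
      (auto simp: less_imp_neq[symmetric])
  show "?s t = 0" if "t \<le> 0" for t using that by (simp add: flat_poly_def)
  show "?s t = 1" if "t \<ge> 1" for t using that by (simp add: flat_poly_def)
qed

lemma euclidean_bump_exists:
  fixes c :: "'e::euclidean_space"
  assumes "r > 0"
  obtains bmp :: "'e \<Rightarrow> real" where "C_infinity_on UNIV bmp" "\<And>y. y \<in> ball c r \<Longrightarrow> bmp y = 1"
    "\<And>y. y \<notin> ball c (2 * r) \<Longrightarrow> bmp y = 0"
proof -
  obtain s :: "real \<Rightarrow> real"
      where s: "C_infinity_on UNIV s" "\<And>t. t \<le> 0 \<Longrightarrow> s t = 0" "\<And>t. t \<ge> 1 \<Longrightarrow> s t = 1"
    by (rule smooth_step_exists) blast
  \<comment> \<open>\<open>2 - |y - c|^2 / r^2\<close> is smooth, at least 1 on the inner ball and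
    negative outside the outer one.\<close>
  let ?g = "\<lambda>y. 2 + (- (1 / r^2)) * ((y + - c) \<bullet> (y + - c))"
  have "C_infinity_on UNIV (\<lambda>y. s (?g y))"
    by (rule C_infinity_on_compose[OF open_UNIV open_UNIV subset_UNIV _ s(1)])
      (intro C_infinity_on_add C_infinity_on_mult C_infinity_on_inner C_infinity_on_id C_infinity_on_const open_UNIV)
  moreover have "s (?g y) = 1" if "y \<in> ball c r" for y
  proof (rule s(3))
    have "norm (y - c) ^ 2 \<le> r ^ 2" using that by (auto simp: dist_norm norm_minus_commute intro!: power_mono)
    then show "1 \<le> ?g y" using assms by (simp add: power2_norm_eq_inner[symmetric] field_simps)
  qed
  moreover have "s (?g y) = 0" if "y \<notin> ball c (2 * r)" for y
  proof (rule s(2))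
    have "(2 * r) ^ 2 \<le> norm (y - c) ^ 2"
      using that assms by (intro power_mono) (auto simp: dist_norm norm_minus_commute)
    then have "2 * r ^ 2 \<le> norm (y - c) ^ 2" using assms by (simp add: power_mult_distrib) (smt (verit) zero_le_power2)
    then show "?g y \<le> 0" using assms by (simp add: power2_norm_eq_inner[symmetric] field_simps)
  qed
  ultimately show ?thesis using that by blast
qed

section \<open>Symmetry of second derivatives\<close>

lemma C_infinity_on_directional:
  assumes "C_infinity_on U f" "x + t *\<^sub>R u \<in> U"
  shows "((\<lambda>t. f (x + t *\<^sub>R u)) has_vector_derivative frechet_derivative f (at (x + t *\<^sub>R u)) u) (at t)"
proof -
  have "((\<lambda>t. x + t *\<^sub>R u) has_derivative (\<lambda>s. s *\<^sub>R u)) (at t)"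
    by (auto intro!: derivative_eq_intros)
  from diff_chain_at[OF this C_infinity_on_has_derivative[OF assms]]
  show ?thesis
    using linear_cmul[OF has_derivative_linear[OF C_infinity_on_has_derivative[OF assms]]]
    by (simp add: has_vector_derivative_def o_def)
qed

text \<open>Two applications of the mean value theorem turn the second difference into
  \<open>h^2\<close> times a mixed derivative at an intermediate point. The difference is symmetric
  in \<open>u\<close> and \<open>v\<close>, which gives
  \<open>frechet_derivative_symmetric\<close>.\<close>

lemma second_difference_limit:
  fixes f :: "'a::euclidean_space \<Rightarrow> real" and u v :: 'a
  assumes "open U" "C_infinity_on U f" "x \<in> U"
  defines "\<Delta> \<equiv> \<lambda>h. f (x + h *\<^sub>R u + h *\<^sub>R v) - f (x + h *\<^sub>R u) - f (x + h *\<^sub>R v) + f x"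
  shows "((\<lambda>h. \<Delta> h / h\<^sup>2) \<longlongrightarrow> frechet_derivative (\<lambda>y. frechet_derivative f (at y) u) (at x)
      v) (at_right 0)"
proof -
  define g where "g = (\<lambda>y. frechet_derivative f (at y) u)"
  define k where "k = (\<lambda>y. frechet_derivative g (at y) v)"
  have g: "C_infinity_on U g" unfolding g_def by (rule C_infinity_on_frechet[OF assms(2)])
  have k: "C_infinity_on U k" unfolding k_def by (rule C_infinity_on_frechet[OF g])
  obtain r where r: "r > 0" "ball x r \<subseteq> U" using assms(1,3) openE by blast
  have "isCont k x"
    using C_infinity_on_imp_continuous_on[OF k] assms(1,3) continuous_on_eq_continuous_at by blast
  have "frechet_derivative (\<lambda>y. frechet_derivative f (at y) u) (at x) v = k x"
    by (simp add: k_def g_def)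
  moreover have "((\<lambda>h. \<Delta> h / h\<^sup>2) \<longlongrightarrow> k x) (at_right 0)"
    unfolding tendsto_iff
  proof (intro allI impI)
    fix e :: real assume "e > 0"
    then obtain d where d: "d > 0" "\<And>y. dist y x < d \<Longrightarrow> dist (k y) (k x) < e"
      using \<open>isCont k x\<close> unfolding continuous_at_eps_delta by metis
    define \<rho> where "\<rho> = min r d / (1 + norm u + norm v)"
    have pos: "1 + norm u + norm v > 0" by (simp add: add_pos_nonneg)
    have "\<rho> > 0" using r(1) d(1) pos by (simp add: \<rho>_def)
    have small: "norm (a *\<^sub>R u + b *\<^sub>R v) < min r d" if "0 \<le> a" "a \<le> h" "0 \<le> b" "b \<le> h" "h < \<rho>" "0 < h" for a b h
    proof -
      have "norm (a *\<^sub>R u + b *\<^sub>R v) \<le> a * norm u + b * norm v"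
        using norm_triangle_ineq[of "a *\<^sub>R u" "b *\<^sub>R v"] that by simp
      also have "\<dots> \<le> h * norm u + h * norm v" using that by (intro add_mono mult_right_mono) auto
      also have "\<dots> < h * (1 + norm u + norm v)" using that by (simp add: algebra_simps)
      also have "\<dots> < \<rho> * (1 + norm u + norm v)" using that pos by (intro mult_strict_right_mono) auto
      finally show ?thesis using pos by (simp add: \<rho>_def)
    qed
    have inU: "x + a *\<^sub>R u + b *\<^sub>R v \<in> U" if "0 \<le> a" "a \<le> h" "0 \<le> b" "b \<le> h" "h < \<rho>" "0 < h" for a b h
    proof -
      have "dist (x + (a *\<^sub>R u + b *\<^sub>R v)) x < r" using small[OF that] by (simp add: dist_norm)
      then show ?thesis using r(2) by (auto simp: add.assoc subset_iff dist_commute)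
    qed
    have "dist (\<Delta> h / h\<^sup>2) (k x) < e" if h: "0 < h" "h < \<rho>" for h
    proof -
      let ?\<phi> = "\<lambda>s. f (x + s *\<^sub>R u + h *\<^sub>R v) - f (x + s *\<^sub>R u)"
      let ?\<phi>' = "\<lambda>s. g (x + s *\<^sub>R u + h *\<^sub>R v) - g (x + s *\<^sub>R u)"
      have der: "(?\<phi> has_real_derivative ?\<phi>' s) (at s)" if s: "0 \<le> s" "s \<le> h" for s
      proof -
        have "x + s *\<^sub>R u + 0 *\<^sub>R v \<in> U" using inU[of s h 0] s h by auto
        then have "((\<lambda>s. f (x + s *\<^sub>R u)) has_vector_derivative g (x + s *\<^sub>R u)) (at s)"
          using C_infinity_on_directional[OF assms(2), of x s u] by (simp add: g_def)
        moreover have "x + h *\<^sub>R v + s *\<^sub>R u \<in> U" using inU[of s h h] s h by (auto simp: algebra_simps)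
        from C_infinity_on_directional[OF assms(2) this]
        have "((\<lambda>s. f (x + s *\<^sub>R u + h *\<^sub>R v)) has_vector_derivative g (x + s *\<^sub>R u + h *\<^sub>R v)) (at s)"
          by (simp add: g_def algebra_simps)
        ultimately show ?thesis
          unfolding has_real_derivative_iff_has_vector_derivative by (intro has_vector_derivative_diff)
      qed
      obtain s where s: "0 < s" "s < h" "?\<phi> h - ?\<phi> 0 = (h - 0) * ?\<phi>' s"
        using MVT2[OF h(1) der] by blast
      have "((\<lambda>t. g (x + s *\<^sub>R u + t *\<^sub>R v)) has_real_derivative k (x + s *\<^sub>R u + t *\<^sub>R v)) (at t)"
        if "0 \<le> t" "t \<le> h" for t
        using C_infinity_on_directional[OF g, of "x + s *\<^sub>R u" t v] inU[of s h t] s h that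
        by (simp add: k_def has_real_derivative_iff_has_vector_derivative)
      from MVT2[OF h(1) this] obtain t where t: "0 < t" "t < h"
        "g (x + s *\<^sub>R u + h *\<^sub>R v) - g (x + s *\<^sub>R u + 0 *\<^sub>R v) = (h - 0) * k (x + s *\<^sub>R u + t *\<^sub>R v)"
        by blast
      have "\<Delta> h = ?\<phi> h - ?\<phi> 0" by (simp add: \<Delta>_def)
      also have "\<dots> = h\<^sup>2 * k (x + s *\<^sub>R u + t *\<^sub>R v)"
        unfolding s(3) using t(3) by (simp add: power2_eq_square)
      finally have "\<Delta> h / h\<^sup>2 = k (x + s *\<^sub>R u + t *\<^sub>R v)" using h by simp
      moreover have "dist (x + s *\<^sub>R u + t *\<^sub>R v) x < d"
        using small[of s h t] s t h by (simp add: dist_norm add.assoc)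
      ultimately show ?thesis using d(2) by simp
    qed
    then show "\<forall>\<^sub>F h in at_right 0. dist (\<Delta> h / h\<^sup>2) (k x) < e"
      unfolding eventually_at_right_field using \<open>\<rho> > 0\<close> by auto
  qed
  ultimately show ?thesis by simp
qed

lemma frechet_derivative_symmetric:
  fixes f :: "'a::euclidean_space \<Rightarrow> real"
  assumes "open U" "C_infinity_on U f" "x \<in> U"
  shows "frechet_derivative (\<lambda>y. frechet_derivative f (at y) u) (at x) v
       = frechet_derivative (\<lambda>y. frechet_derivative f (at y) v) (at x) u"
proof -
  have *: "(\<lambda>h. (f (x + h *\<^sub>R v + h *\<^sub>R u) - f (x + h *\<^sub>R v) - f (x + h *\<^sub>R u) + f x) / h\<^sup>2)
      = (\<lambda>h. (f (x + h *\<^sub>R u + h *\<^sub>R v) - f (x + h *\<^sub>R u) - f (x + h *\<^sub>R v) + f x) / h\<^sup>2)"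
    by (simp add: algebra_simps)
  show ?thesis
    using tendsto_unique[OF _ second_difference_limit[OF assms, of u v] second_difference_limit[OF assms, of v u, unfolded *]]
    by simp
qed

section \<open>The smooth inverse function theorem\<close>

text \<open>A product rule for a second factor that is merely continuous: where the first factor
  vanishes, the variation of the second is of higher order. This lets the inverse derivative be
  differentiated before it is known to be differentiable.\<close>

lemma has_derivative_scaleR_vanishing:
  fixes \<phi> :: "'a::real_normed_vector \<Rightarrow> real" and \<psi> :: "'a \<Rightarrow> 'b::real_normed_vector"
  assumes "(\<phi> has_derivative \<phi>') (at y)" "\<phi> y = 0" "isCont \<psi> y"
  shows "((\<lambda>z. \<phi> z *\<^sub>R \<psi> z) has_derivative (\<lambda>h. \<phi>' h *\<^sub>R \<psi> y)) (at y)"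
proof -
  have bl: "bounded_linear \<phi>'" using assms(1) has_derivative_bounded_linear by blast
  then obtain K where K: "K > 0" "\<And>h. \<bar>\<phi>' h\<bar> \<le> norm h * K"
    using bounded_linear.pos_bounded by (metis real_norm_def)
  show ?thesis unfolding has_derivative_at_alt
  proof (intro conjI allI impI)
    show "bounded_linear (\<lambda>h. \<phi>' h *\<^sub>R \<psi> y)" by (rule bounded_linear_scaleR_const[OF bl])
    fix e :: real assume e: "e > 0"
    define e1 where "e1 = e / (2 * (norm (\<psi> y) + 1))"
    define e2 where "e2 = min 1 (e / (2 * (K + 1)))"
    have n: "norm (\<psi> y) + 1 > 0" by (simp add: add_nonneg_pos)
    have e1: "e1 > 0" using e n by (simp add: e1_def)
    have e2: "e2 > 0" using e K by (simp add: e2_def)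
    obtain d1 where d1: "d1 > 0" "\<And>z. norm (z - y) < d1 \<Longrightarrow> \<bar>\<phi> z - \<phi>' (z - y)\<bar> \<le> e1 * norm (z - y)"
      using assms(1,2) e1 unfolding has_derivative_at_alt by (metis diff_zero real_norm_def)
    obtain d3 where d3: "d3 > 0" "\<And>z. norm (z - y) < d3 \<Longrightarrow> \<bar>\<phi> z - \<phi>' (z - y)\<bar> \<le> 1 * norm (z - y)"
      using assms(1,2) unfolding has_derivative_at_alt by (metis diff_zero real_norm_def zero_less_one)
    obtain d2 where d2: "d2 > 0" "\<And>z. norm (z - y) < d2 \<Longrightarrow> norm (\<psi> z - \<psi> y) < e2"
      using assms(3) e2 unfolding continuous_at_eps_delta by (metis dist_norm)
    show "\<exists>d>0. \<forall>z. norm (z - y) < d \<longrightarrow>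
      norm (\<phi> z *\<^sub>R \<psi> z - \<phi> y *\<^sub>R \<psi> y - \<phi>' (z - y) *\<^sub>R \<psi> y) \<le> e * norm (z - y)"
    proof (intro exI[of _ "min d1 (min d2 d3)"] conjI allI impI)
      show "0 < min d1 (min d2 d3)" using d1 d2 d3 by simp
      fix z assume z: "norm (z - y) < min d1 (min d2 d3)"
      have eq: "\<phi> z *\<^sub>R \<psi> z - \<phi> y *\<^sub>R \<psi> y - \<phi>' (z - y) *\<^sub>R \<psi> y
          = (\<phi> z - \<phi>' (z - y)) *\<^sub>R \<psi> y + \<phi> z *\<^sub>R (\<psi> z - \<psi> y)"
        using assms(2) by (simp add: algebra_simps)
      have "\<bar>\<phi> z\<bar> \<le> \<bar>\<phi>' (z - y)\<bar> + \<bar>\<phi> z - \<phi>' (z - y)\<bar>" by simp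
      also have "\<dots> \<le> (K + 1) * norm (z - y)" using K(2)[of "z - y"] d3(2)[of z] z by (simp add: algebra_simps)
      finally have b: "\<bar>\<phi> z\<bar> \<le> (K + 1) * norm (z - y)" .
      have "norm ((\<phi> z - \<phi>' (z - y)) *\<^sub>R \<psi> y) \<le> e1 * norm (z - y) * norm (\<psi> y)"
        using d1(2)[of z] z by (simp add: mult_right_mono)
      also have "\<dots> \<le> e1 * norm (z - y) * (norm (\<psi> y) + 1)" using e1 by (intro mult_left_mono) auto
      also have "\<dots> = e / 2 * norm (z - y)" using n by (simp add: e1_def field_simps)
      finally have 1: "norm ((\<phi> z - \<phi>' (z - y)) *\<^sub>R \<psi> y) \<le> e / 2 * norm (z - y)" .
      have "norm (\<phi> z *\<^sub>R (\<psi> z - \<psi> y)) \<le> ((K + 1) * norm (z - y)) * e2"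
        using b d2(2)[of z] z by (simp add: mult_mono less_imp_le)
      also have "\<dots> \<le> ((K + 1) * norm (z - y)) * (e / (2 * (K + 1)))" using K
        by (intro mult_left_mono) (auto simp: e2_def)
      also have "\<dots> = e / 2 * norm (z - y)" using K by (simp add: field_simps)
      finally have 2: "norm (\<phi> z *\<^sub>R (\<psi> z - \<psi> y)) \<le> e / 2 * norm (z - y)" .
      show "norm (\<phi> z *\<^sub>R \<psi> z - \<phi> y *\<^sub>R \<psi> y - \<phi>' (z - y) *\<^sub>R \<psi> y) \<le> e * norm (z - y)"
        unfolding eq using norm_triangle_mono[OF 1 2] by simp
    qed
  qed
qed

text \<open>\<open>B y\<close> inverts the derivative of \<open>f\<close> at \<open>g y\<close> and
  is the derivative of \<open>g\<close>. Level k + 1 for \<open>g\<close> needs level k for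
  \<open>B\<close>, and \<open>B\<close> is differentiated by means of \<open>A (B c) = c\<close>,
  which involves \<open>g\<close>, \<open>B\<close> and derivatives of \<open>f\<close>; so both are
  treated in one induction. The estimate by \<open>K\<close> yields continuity of \<open>B\<close>
  without operator inverses.\<close>

lemma Ck_on_inverse_function:
  fixes f :: "'a::euclidean_space \<Rightarrow> 'a"
  assumes U: "open U" "C_infinity_on U f" and V: "open V" and gU: "\<And>y. y \<in> V \<Longrightarrow> g y \<in> U"
    and g: "\<And>y. y \<in> V \<Longrightarrow> (g has_derivative B y) (at y)"
    and AB: "\<And>y v. y \<in> V \<Longrightarrow> frechet_derivative f (at (g y)) (B y v) = v"
    and K: "\<And>y v. y \<in> V \<Longrightarrow> norm v \<le> K * norm (frechet_derivative f (at (g y)) v)"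
  shows "Ck_on k V g \<and> (\<forall>c. Ck_on k V c \<longrightarrow> Ck_on k V (\<lambda>y. B y (c y)))"
proof (induction k)
  define A where "A = (\<lambda>y. frechet_derivative f (at (g y)))"
  have contg: "continuous_on V g"
    using g has_derivative_continuous continuous_at_imp_continuous_on by blast
  have linA: "linear (A y)" if "y \<in> V" for y
    unfolding A_def using C_infinity_on_has_derivative[OF U(2) gU[OF that]] has_derivative_linear by blast
  have linB: "linear (B y)" if "y \<in> V" for y using g[OF that] has_derivative_linear by blast
  have AB': "A z (B z v) = v" if "z \<in> V" for z v using AB[OF that] by (simp add: A_def)
  have diff: "B z c - w = B z (c - A z w)" if "z \<in> V" for z c w
  proof -
    have 1: "A z (B z (c - A z w) - (B z c - w)) = 0"
      by (simp add: linear_diff[OF linA[OF that]] AB'[OF that])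
    have "norm (B z (c - A z w) - (B z c - w)) \<le> K * norm (0::'a)"
      using K[OF that, of "B z (c - A z w) - (B z c - w)"] 1 by (simp add: A_def)
    then show ?thesis by simp
  qed
  have contA: "continuous_on V (\<lambda>z. A z w)" for w
    unfolding A_def
    by (rule continuous_on_compose2[OF C_infinity_on_imp_continuous_on[OF C_infinity_on_frechet[OF U(2)]] contg])
      (use gU in auto)
  have cont: "continuous_on V (\<lambda>y. B y (c y))" if c: "continuous_on V c" for c
    unfolding continuous_on_eq_continuous_at[OF V]
  proof
    fix y assume y: "y \<in> V"
    have "((\<lambda>z. K * norm (c z - A z (B y (c y)))) \<longlongrightarrow> K * norm (c y - A y (B y (c y)))) (at y)"
      using c contA[of "B y (c y)"] y V
      by (auto simp: continuous_on_eq_continuous_at isCont_def intro!: tendsto_intros)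
    moreover have "c y - A y (B y (c y)) = 0" using AB[OF y] by (simp add: A_def)
    ultimately have lim: "((\<lambda>z. K * norm (c z - A z (B y (c y)))) \<longlongrightarrow> 0) (at y)" by simp
    have "\<forall>\<^sub>F z in at y. norm (B z (c z) - B y (c y)) \<le> K * norm (c z - A z (B y (c y)))"
      using eventually_at_in_open'[OF V y]
    proof eventually_elim
      case (elim z)
      have "norm (B z (c z - A z (B y (c y)))) \<le> K * norm (A z (B z (c z - A z (B y (c y)))))"
        using K[OF elim] by (simp add: A_def)
      then show ?case using AB[OF elim] diff[OF elim] by (simp add: A_def)
    qed
    then have "((\<lambda>z. B z (c z) - B y (c y)) \<longlongrightarrow> 0) (at y)"
      by (rule Lim_null_comparison[OF _ lim])
    then show "isCont (\<lambda>y. B y (c y)) y" unfolding isCont_def by (rule LIM_zero_cancel)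
  qed
  {
    case 0
    show ?case using contg cont by simp
  next
    case (Suc k)
    define H where "H = (\<lambda>x b. frechet_derivative (\<lambda>x. frechet_derivative f (at x) b) (at x))"
    have gk: "Ck_on k V g" and Bk: "\<And>c. Ck_on k V c \<Longrightarrow> Ck_on k V (\<lambda>y. B y (c y))" using Suc by auto
    have "Ck_on (Suc k) V g" by (rule Ck_on_SucI[OF V g]) (use Bk[of "\<lambda>_. v" for v] in auto)
    moreover have "Ck_on (Suc k) V (\<lambda>y. B y (c y))" if c: "Ck_on (Suc k) V c" for c
    proof (rule Ck_on_SucI[OF V])
      let ?R = "\<lambda>y u. frechet_derivative c (at y) u - (\<Sum>b\<in>Basis. (B y (c y) \<bullet> b) *\<^sub>R H (g y) b (B y u))"
      show "((\<lambda>y. B y (c y)) has_derivative (\<lambda>u. B y (?R y u))) (at y)" if y: "y \<in> V" for y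
      proof -
        define w where "w = B y (c y)"
        \<comment> \<open>Around \<open>y\<close>, \<open>B z (c z) = B z (r z) + w\<close> with
          \<open>r y = 0\<close>, so continuity of \<open>B\<close> suffices to differentiate the
          right-hand side.\<close>
        define r where "r = (\<lambda>z. c z - A z w)"
        have "((\<lambda>z. A z b) has_derivative (\<lambda>u. H (g y) b (B y u))) (at y)" for b
          unfolding A_def H_def
          using diff_chain_at[OF g[OF y] C_infinity_on_has_derivative[OF C_infinity_on_frechet[OF U(2)] gU[OF y]]]
          by (simp add: o_def)
        then have "((\<lambda>z. \<Sum>b\<in>Basis. (w \<bullet> b) *\<^sub>R A z b) has_derivative
            (\<lambda>u. \<Sum>b\<in>Basis. (w \<bullet> b) *\<^sub>R H (g y) b (B y u))) (at y)"
          by (intro has_derivative_sum has_derivative_scaleR_right)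
        then have 1: "((\<lambda>z. \<Sum>b\<in>Basis. (w \<bullet> b) *\<^sub>R A z b) has_derivative
            (\<lambda>u. \<Sum>b\<in>Basis. (w \<bullet> b) *\<^sub>R H (g y) b (B y u))) (at y)" .
        have Aw: "(\<Sum>b\<in>Basis. (w \<bullet> b) *\<^sub>R A z b) = A z w" if "z \<in> V" for z
          using linear_euclidean_sum[OF linA[OF that], of w] by simp
        have "((\<lambda>z. A z w) has_derivative
            (\<lambda>u. \<Sum>b\<in>Basis. (w \<bullet> b) *\<^sub>R H (g y) b (B y u))) (at y)"
          by (rule has_derivative_transform_within_open[OF 1 V y Aw])
        then have r: "(r has_derivative ?R y) (at y)"
          unfolding r_def w_def[symmetric]
          by (intro has_derivative_diff Ck_on_Suc_has_derivative[OF c y])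
        have r0: "r y = 0" using AB[OF y] by (simp add: r_def w_def A_def)
        have "((\<lambda>z. \<Sum>b\<in>Basis. (r z \<bullet> b) *\<^sub>R B z b) has_derivative (\<lambda>u. \<Sum>b\<in>Basis. (?R y u
            \<bullet> b) *\<^sub>R B y b)) (at y)"
        proof (intro has_derivative_sum has_derivative_scaleR_vanishing)
          fix b :: 'a assume "b \<in> Basis"
          show "((\<lambda>z. r z \<bullet> b) has_derivative (\<lambda>u. ?R y u \<bullet> b)) (at y)"
            by (rule has_derivative_inner_left[OF r])
          show "r y \<bullet> b = 0" by (simp add: r0)
          show "isCont (\<lambda>z. B z b) y"
            using cont[of "\<lambda>_. b"] y V by (simp add: continuous_on_eq_continuous_at)
        qed
        then have 2: "((\<lambda>z. \<Sum>b\<in>Basis. (r z \<bullet> b) *\<^sub>R B z b) has_derivative (\<lambda>u. B y (?R y u))) (at y)"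
          by (rule has_derivative_eq_rhs) (rule ext, rule linear_euclidean_sum[OF linB[OF y], symmetric])
        have "((\<lambda>z. B z (r z)) has_derivative (\<lambda>u. B y (?R y u))) (at y)"
          by (rule has_derivative_transform_within_open[OF 2 V y]) (rule linear_euclidean_sum[OF linB, symmetric])
        then have 3: "((\<lambda>z. B z (r z) + w) has_derivative (\<lambda>u. B y (?R y u))) (at y)"
          by (rule has_derivative_add_const)
        have "B z (r z) + w = B z (c z)" if "z \<in> V" for z
          unfolding r_def diff[OF that, symmetric] by simp
        then show ?thesis by (rule has_derivative_transform_within_open[OF 3 V y])
      qed
      fix u
      have Hc: "Ck_on k V (\<lambda>y. H (g y) b d)" for b d
        by (rule Ck_on_compose[OF V U(1) _ gk])
          (use gU C_infinity_on_frechet[OF C_infinity_on_frechet[OF U(2)]] in \<open>auto simp: H_def C_infinity_on_def\<close>)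
      have Bu: "Ck_on k V (\<lambda>y. B y u)" using Bk[of "\<lambda>_. u"] by simp
      have Hu: "Ck_on k V (\<lambda>y. H (g y) b (B y u))" for b
      proof -
        have "Ck_on k V (\<lambda>y. \<Sum>d\<in>Basis. (B y u \<bullet> d) *\<^sub>R H (g y) b d)"
          by (intro Ck_on_sum[OF V] Ck_on_bilinear[OF bounded_bilinear_scaleR V]
              Ck_on_bilinear[OF bounded_bilinear_inner V] Bu Hc Ck_on_const)
        moreover have eq: "(\<Sum>d\<in>Basis. (B y u \<bullet> d) *\<^sub>R H (g y) b d) = H (g y) b (B y u)" if "y \<in> V" for y
          unfolding H_def
          by (rule linear_euclidean_sum[OF has_derivative_linear[OF C_infinity_on_has_derivative[OF
                C_infinity_on_frechet[OF U(2)] gU[OF that]]], symmetric])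
        ultimately show ?thesis by (simp only: Ck_on_cong[OF V eq])
      qed
      have "Ck_on k V (\<lambda>y. frechet_derivative c (at y) u + (- 1) *\<^sub>R (\<Sum>b\<in>Basis. (B y (c y) \<bullet> b) *\<^sub>R H
          (g y) b (B y u)))"
        by (intro Ck_on_add[OF V] Ck_on_sum[OF V] Ck_on_bilinear[OF bounded_bilinear_scaleR V]
              Ck_on_bilinear[OF bounded_bilinear_inner V] Hu Ck_on_const Bk Ck_on_SucD[OF c] Ck_on_Suc_frechet[OF c])
      then show "Ck_on k V (\<lambda>y. B y (?R y u))" using Bk[of "\<lambda>y. ?R y u"] by simp
    qed
    ultimately show ?case by blast
  }
qed

lemma smooth_inverse_function:
  fixes f :: "'a::euclidean_space \<Rightarrow> 'a"
  assumes U: "open U" "C_infinity_on U f" "x0 \<in> U"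
    and inj: "\<And>v. frechet_derivative f (at x0) v = 0 \<Longrightarrow> v = 0"
  obtains U' V g where "open U'" "U' \<subseteq> U" "x0 \<in> U'" "open V" "f x0 \<in> V" "homeomorphism U' V f g"
    "C_infinity_on V g"
proof -
  define f' where "f' = (\<lambda>x. Blinfun (frechet_derivative f (at x)))"
  have f': "blinfun_apply (f' x) = frechet_derivative f (at x)" if "x \<in> U" for x
    unfolding f'_def
    using bounded_linear_Blinfun_apply has_derivative_bounded_linear[OF C_infinity_on_has_derivative[OF U(2) that]] by blast
  have contf': "continuous_on U f'"
  proof (rule continuous_on_blinfun_componentwise)
    fix b :: 'a assume "b \<in> Basis"
    show "continuous_on U (\<lambda>x. blinfun_apply (f' x) b)"
      using C_infinity_on_imp_continuous_on[OF C_infinity_on_frechet[OF U(2), of b]]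
      by (rule continuous_on_eq) (simp add: f')
  qed
  have "linear (frechet_derivative f (at x0))"
    using C_infinity_on_has_derivative[OF U(2,3)] has_derivative_linear by blast
  moreover have "inj (frechet_derivative f (at x0))"
    using inj calculation linear_injective_0 by blast
  ultimately obtain m where m: "m > 0" "\<And>v. m * norm v \<le> norm (frechet_derivative f (at x0) v)"
    using linear_inj_bounded_below_pos by blast
  obtain h where h: "linear h" "h \<circ> frechet_derivative f (at x0) = id"
    using linear_injective_left_inverse[OF \<open>linear (frechet_derivative f (at x0))\<close> \<open>inj (frechet_derivative f (at
        x0))\<close>] by blast
  \<comment> \<open>Within \<open>m / 2\<close> of the derivative at \<open>x0\<close>, every
    derivative still stretches vectors by at least \<open>m / 2\<close>; this gives the uniform
    constant \<open>K = 2 / m\<close>.\<close>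
  define U1 where "U1 = {x \<in> U. norm (f' x - f' x0) < m / 2}"
  have "open U1"
  proof -
    have "open (f' -` ball (f' x0) (m / 2) \<inter> U)"
      using continuous_on_open_vimage[OF U(1)] contf' open_ball by blast
    moreover have "f' -` ball (f' x0) (m / 2) \<inter> U = U1"
      by (auto simp: U1_def dist_norm norm_minus_commute)
    ultimately show ?thesis by simp
  qed
  have "x0 \<in> U1" "U1 \<subseteq> U" using U(3) m by (auto simp: U1_def)
  have low: "norm v \<le> 2 / m * norm (frechet_derivative f (at x) v)" if x: "x \<in> U1" for x v
  proof -
    have "norm (blinfun_apply (f' x - f' x0) v) \<le> m / 2 * norm v"
      using norm_blinfun[of "f' x - f' x0" v] x mult_right_mono[of "norm (f' x - f' x0)" "m / 2" "norm v"]
      by (auto simp: U1_def)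
    then have "norm (blinfun_apply (f' x0) v) \<le> norm (blinfun_apply (f' x) v) + m / 2 * norm v"
      using norm_triangle_sub[of "blinfun_apply (f' x0) v" "blinfun_apply (f' x) v"]
      by (simp add: blinfun.diff_left norm_minus_commute)
    then have "m / 2 * norm v \<le> norm (frechet_derivative f (at x) v)"
      using m(2)[of v] f'[of x] f'[of x0] x U(3) by (auto simp: U1_def)
    then show ?thesis using m(1) by (simp add: field_simps)
  qed
  have "Blinfun h o\<^sub>L f' x0 = id_blinfun"
  proof (rule blinfun_eqI)
    fix v show "blinfun_apply (Blinfun h o\<^sub>L f' x0) v = blinfun_apply id_blinfun v"
      using h f'[OF U(3)] by (simp add: bounded_linear_Blinfun_apply linear_conv_bounded_linear[symmetric] o_def fun_eq_iff)
  qed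
  have der1: "(f has_derivative blinfun_apply (f' x)) (at x)" if "x \<in> U1" for x
    using f' \<open>U1 \<subseteq> U\<close> C_infinity_on_has_derivative[OF U(2)] that by (metis subsetD)
  obtain U' V g g' where r: "open U'" "U' \<subseteq> U1" "x0 \<in> U'" "open V" "f x0 \<in> V" "homeomorphism U' V f g"
    and g: "\<And>y. y \<in> V \<Longrightarrow> (g has_derivative (g' y)) (at y)"
    "\<And>y. y \<in> V \<Longrightarrow> g' y = inv_into UNIV (blinfun_apply (f' (g y)))"
    "\<And>y. y \<in> V \<Longrightarrow> bij (blinfun_apply (f' (g y)))"
    by (rule inverse_function_theorem[where U = U1 and f = f and f' = f', OF \<open>open U1\<close> der1
          continuous_on_subset[OF contf' \<open>U1 \<subseteq> U\<close>] \<open>x0 \<in> U1\<close> \<open>Blinfun h o\<^sub>L f' x0 =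
              id_blinfun\<close>]) blast+
  have gU: "g y \<in> U1" if "y \<in> V" for y
    using r(2,6) that unfolding homeomorphism_def by blast
  have "Ck_on k V g" for k
  proof -
    have 1: "frechet_derivative f (at (g y)) (g' y v) = v" if "y \<in> V" for y v
      using g(2,3)[OF that] f'[of "g y"] gU[OF that] \<open>U1 \<subseteq> U\<close> by (metis bij_inv_eq_iff subsetD)
    show ?thesis
      using Ck_on_inverse_function[OF \<open>open U1\<close> C_infinity_on_subset[OF U(2) \<open>U1 \<subseteq> U\<close>] r(4) gU g(1) 1
          low] gU by blast
  qed
  then show ?thesis using that r \<open>U1 \<subseteq> U\<close> unfolding C_infinity_on_def by blast
qed

section \<open>Hadamard's lemma\<close>

text \<open>Each differentiation under the integral brings out one factor \<open>t\<close>; the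
  weights \<open>t ^ j\<close> are included so that the induction closes.\<close>

lemma Ck_on_ray_integral:
  fixes k :: "'a::euclidean_space \<Rightarrow> real"
  assumes "C_infinity_on (ball c r) k"
  shows "Ck_on m (ball c r) (\<lambda>y. integral {0..1} (\<lambda>t. t ^ j * k (c + t *\<^sub>R (y - c))))"
proof -
  let ?B = "ball c r"
  let ?p = "\<lambda>y t. c + t *\<^sub>R (y - c)"
  have inB: "?p y t \<in> ?B" if "y \<in> ?B" "t \<in> {0..1}" for y t
  proof -
    have "norm (t *\<^sub>R (y - c)) \<le> 1 * norm (y - c)"
      using that by (simp only: norm_scaleR) (intro mult_right_mono, auto)
    then show ?thesis using that by (auto simp: dist_norm norm_minus_commute)
  qed
  have cont: "continuous_on (?B \<times> {0..1}) (\<lambda>(y, t). t ^ j * k (?p y t))"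
    if "C_infinity_on ?B k" for j and k :: "'a \<Rightarrow> real"
    unfolding case_prod_unfold
    by (intro continuous_intros continuous_on_compose2[OF C_infinity_on_imp_continuous_on[OF that]])
      (use inB in auto)
  have contt: "continuous_on {0..1} (\<lambda>t. t ^ j * k (?p y t))" if "C_infinity_on ?B k" "y \<in> ?B" for j y and k :: "'a \<Rightarrow> real"
  proof -
    have "continuous_on {0..1} (\<lambda>t. case (y, t) of (y, t) \<Rightarrow> t ^ j * k (?p y t))"
      by (rule continuous_on_compose2[OF cont[OF that(1)]]) (use that in \<open>auto intro!: continuous_intros\<close>)
    then show ?thesis by (simp only: prod.case)
  qed
  have der: "((\<lambda>y. integral {0..1} (\<lambda>t. t ^ j * k (?p y t))) has_derivative
      (\<lambda>v. integral {0..1} (\<lambda>t. t ^ Suc j * frechet_derivative k (at (?p y t)) v))) (at y)"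
    if k: "C_infinity_on ?B k" and y: "y \<in> ?B" for j y and k :: "'a \<Rightarrow> real"
  proof -
    define D where "D = (\<lambda>y t. \<Sum>b\<in>Basis. (t ^ Suc j * frechet_derivative k (at (?p y t)) b) *\<^sub>R blinfun_inner_left (b::'a))"
    have appD: "blinfun_apply (D y t) v = t ^ Suc j * frechet_derivative k (at (?p y t)) v"
      if "y \<in> ?B" "t \<in> {0..1}" for y t v
    proof -
      have "frechet_derivative k (at (?p y t)) v = (\<Sum>b\<in>Basis. (v \<bullet> b) *\<^sub>R frechet_derivative k (at (?p y t)) b)"
        by (rule linear_euclidean_sum[OF has_derivative_linear[OF C_infinity_on_has_derivative[OF k inB[OF that]]]])
      then show ?thesis
        by (simp add: D_def blinfun.sum_left blinfun.scaleR_left sum_distrib_left inner_commute ac_simps)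
    qed
    have contD: "continuous_on (?B \<times> {0..1}) (\<lambda>(y, t). D y t)"
    proof -
      have "continuous_on (?B \<times> {0..1}) (\<lambda>yt. \<Sum>b\<in>Basis. (case yt of (y, t) \<Rightarrow> t ^ Suc j *
          frechet_derivative k (at (?p y t)) b) *\<^sub>R blinfun_inner_left (b::'a))"
        by (intro continuous_on_sum continuous_on_scaleR continuous_on_const cont C_infinity_on_frechet k)
      then show ?thesis by (simp add: D_def case_prod_unfold)
    qed
    have L: "((\<lambda>y. integral (cbox 0 1) (\<lambda>t. t ^ j * k (?p y t))) has_derivative
        blinfun_apply (integral (cbox 0 1) (D y))) (at y within ?B)"
    proof (rule leibniz_rule)
      fix y' and t :: real assume y': "y' \<in> ?B" and "t \<in> cbox 0 1"
      then have t: "t \<in> {0..1}" by simp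
      have "((\<lambda>y. ?p y t) has_derivative (\<lambda>v. t *\<^sub>R v)) (at y')"
        by (auto intro!: derivative_eq_intros)
      from diff_chain_at[OF this C_infinity_on_has_derivative[OF k inB[OF y' t]]]
      have "((\<lambda>y. t ^ j * k (?p y t)) has_derivative (\<lambda>v. t ^ j * frechet_derivative k (at (?p y' t)) (t *\<^sub>R v))) (at y')"
        by (intro has_derivative_mult_right) (simp add: o_def)
      moreover have "t ^ j * frechet_derivative k (at (?p y' t)) (t *\<^sub>R v) = blinfun_apply (D y' t) v" for v
        using linear_cmul[OF has_derivative_linear[OF C_infinity_on_has_derivative[OF k inB[OF y' t]]]]
        by (simp add: appD[OF y' t])
      ultimately show "((\<lambda>y. t ^ j * k (?p y t)) has_derivative blinfun_apply (D y' t)) (at y' within ?B)"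
        by (simp add: has_derivative_at_withinI)
    next
      fix y' assume "y' \<in> ?B"
      then show "(\<lambda>t. t ^ j * k (?p y' t)) integrable_on cbox 0 1"
        using contt[OF k] by (simp add: integrable_continuous_real)
    qed (use contD y in auto)
    have I: "blinfun_apply (integral (cbox 0 1) (D y)) v
        = integral {0..1} (\<lambda>t. t ^ Suc j * frechet_derivative k (at (?p y t)) v)" for v
    proof -
      have "continuous_on {0..1} (\<lambda>t. case (y, t) of (y, t) \<Rightarrow> D y t)"
        by (rule continuous_on_compose2[OF contD]) (use y in \<open>auto intro!: continuous_intros\<close>)
      then have "continuous_on {0..1} (D y)" by (simp only: prod.case)
      then have "D y integrable_on {0..1}" by (rule integrable_continuous_real)
      then have "integral {0..1} ((\<lambda>F. blinfun_apply F v) \<circ> D y) = blinfun_apply (integral {0..1} (D y)) v"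
        by (rule integral_linear) (rule blinfun.bounded_linear_left)
      then show ?thesis
        using Henstock_Kurzweil_Integration.integral_cong[of "{0..1}" "\<lambda>t. blinfun_apply (D y t) v"
            "\<lambda>t. t ^ Suc j * frechet_derivative k (at (?p y t)) v"] appD[OF y]
        by (simp add: o_def)
    qed
    show ?thesis
      by (rule has_derivative_eq_rhs[OF L[unfolded at_within_open[OF y open_ball] box_real]])
        (rule ext, rule I[unfolded box_real])
  qed
  show ?thesis using assms
  proof (induction m arbitrary: k j)
    case 0
    show ?case
      using der[OF 0] has_derivative_continuous continuous_at_imp_continuous_on by (simp, blast)
  next
    case (Suc m)
    show ?case
      by (rule Ck_on_SucI[OF open_ball der[OF Suc.prems]])
        (assumption, rule Suc.IH[OF C_infinity_on_frechet[OF Suc.prems]])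
  qed
qed

lemma hadamard_quotients:
  fixes f :: "'a::euclidean_space \<Rightarrow> real"
  assumes f: "C_infinity_on (ball c r) f" and r: "r > 0"
  obtains g where "\<And>b. b \<in> Basis \<Longrightarrow> C_infinity_on (ball c r) (g b)"
    "\<And>b. g b c = frechet_derivative f (at c) b"
    "\<And>y. y \<in> ball c r \<Longrightarrow> f y = f c + (\<Sum>b\<in>Basis. ((y - c) \<bullet> b) * g b y)"
proof
  let ?p = "\<lambda>y t. c + t *\<^sub>R (y - c)"
  let ?g = "\<lambda>b y. integral {0..1} (\<lambda>t. frechet_derivative f (at (?p y t)) b)"
  show "C_infinity_on (ball c r) (?g b)" if "b \<in> Basis" for b
    unfolding C_infinity_on_def
    using Ck_on_ray_integral[OF C_infinity_on_frechet[OF f, of b], of _ 0] by simp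
  show "?g b c = frechet_derivative f (at c) b" for b by simp
  fix y assume y: "y \<in> ball c r"
  have inB: "?p y t \<in> ball c r" if "t \<in> {0..1}" for t
  proof -
    have "norm (t *\<^sub>R (y - c)) \<le> 1 * norm (y - c)"
      using that by (simp only: norm_scaleR) (intro mult_right_mono, auto)
    then show ?thesis using y by (auto simp: dist_norm norm_minus_commute)
  qed
  have "((\<lambda>t. f (?p y t)) has_vector_derivative frechet_derivative f (at (?p y t)) (y - c)) (at t within {0..1})"
    if t: "t \<in> {0..1}" for t
  proof -
    have "((\<lambda>t. ?p y t) has_derivative (\<lambda>s. s *\<^sub>R (y - c))) (at t)"
      by (auto intro!: derivative_eq_intros)
    from diff_chain_at[OF this C_infinity_on_has_derivative[OF f inB[OF t]]]
    have "((\<lambda>t. f (?p y t)) has_vector_derivative frechet_derivative f (at (?p y t)) (y - c)) (at t)"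
      using linear_cmul[OF has_derivative_linear[OF C_infinity_on_has_derivative[OF f inB[OF t]]]]
      by (simp add: has_vector_derivative_def o_def)
    then show ?thesis by (rule has_vector_derivative_at_within)
  qed
  then have "((\<lambda>t. frechet_derivative f (at (?p y t)) (y - c)) has_integral (f (?p y 1) - f (?p y 0))) {0..1}"
    by (intro fundamental_theorem_of_calculus) auto
  then have "f y - f c = integral {0..1} (\<lambda>t. frechet_derivative f (at (?p y t)) (y - c))"
    by (simp add: integral_unique)
  also have "\<dots> = integral {0..1} (\<lambda>t. \<Sum>b\<in>Basis. ((y - c) \<bullet> b) *\<^sub>R frechet_derivative f (at (?p y t)) b)"
    by (rule Henstock_Kurzweil_Integration.integral_cong,
        rule linear_euclidean_sum[OF has_derivative_linear[OF C_infinity_on_has_derivative[OF f inB]]])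
  also have "\<dots> = (\<Sum>b\<in>Basis. integral {0..1} (\<lambda>t. ((y - c) \<bullet> b) *\<^sub>R frechet_derivative f (at (?p y t)) b))"
  proof (rule integral_sum)
    fix b :: 'a assume "b \<in> Basis"
    have "continuous_on {0..1} (\<lambda>t. frechet_derivative f (at (?p y t)) b)"
      by (rule continuous_on_compose2[OF C_infinity_on_imp_continuous_on[OF C_infinity_on_frechet[OF f, of b]]])
        (use inB in \<open>auto intro!: continuous_intros\<close>)
    then show "(\<lambda>t. ((y - c) \<bullet> b) *\<^sub>R frechet_derivative f (at (?p y t)) b) integrable_on {0..1}"
      by (intro integrable_continuous_real continuous_intros)
  qed simp
  finally show "f y = f c + (\<Sum>b\<in>Basis. ((y - c) \<bullet> b) * ?g b y)" by simp
qed

section \<open>Ordinary differential equations\<close>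

text \<open>Gronwall: \<open>exp (- 2 K t)\<close> times the squared distance is nonincreasing and
  starts at zero.\<close>

lemma lipschitz_ode_unique_forward:
  fixes c1 c2 :: "real \<Rightarrow> 'a::real_inner"
  assumes d: "\<And>t. 0 \<le> t \<Longrightarrow> t < e \<Longrightarrow> (c1 has_vector_derivative x1 t) (at t)"
      "\<And>t. 0 \<le> t \<Longrightarrow> t < e \<Longrightarrow> (c2 has_vector_derivative x2 t) (at t)"
    and K: "\<And>t. 0 \<le> t \<Longrightarrow> t < e \<Longrightarrow> norm (x1 t - x2 t) \<le> K * norm (c1 t - c2 t)"
    and 0: "c1 0 = c2 0" and T: "0 \<le> T" "T < e"
  shows "c1 T = c2 T"
proof (cases "T = 0")
  case False
  define u where "u = (\<lambda>t. exp (- 2 * K * t) * ((c1 t - c2 t) \<bullet> (c1 t - c2 t)))"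
  have "u T \<le> u 0"
  proof (rule DERIV_nonpos_imp_nonincreasing[OF T(1)])
    fix t assume t: "0 \<le> t" "t \<le> T"
    have cd: "((\<lambda>t. c1 t - c2 t) has_vector_derivative (x1 t - x2 t)) (at t)"
      using d[of t] t T by (intro has_vector_derivative_diff) auto
    then have "((\<lambda>t. c1 t - c2 t) has_derivative (\<lambda>h. h *\<^sub>R (x1 t - x2 t))) (at t)"
      by (simp add: has_vector_derivative_def)
    from has_derivative_inner[OF this this]
    have "((\<lambda>t. (c1 t - c2 t) \<bullet> (c1 t - c2 t)) has_real_derivative 2 * ((c1 t - c2 t) \<bullet> (x1 t - x2 t))) (at t)"
      unfolding has_field_derivative_def
      by (rule has_derivative_eq_rhs) (auto simp: inner_commute algebra_simps fun_eq_iff)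
    then have "(u has_real_derivative exp (- 2 * K * t) * (2 * ((c1 t - c2 t) \<bullet> (x1 t - x2 t)))
        + exp (- 2 * K * t) * (- 2 * K) * ((c1 t - c2 t) \<bullet> (c1 t - c2 t))) (at t)"
      unfolding u_def by (auto intro!: derivative_eq_intros)
    moreover have AB: "(c1 t - c2 t) \<bullet> (x1 t - x2 t) \<le> K * ((c1 t - c2 t) \<bullet> (c1 t - c2 t))"
    proof -
      have "(c1 t - c2 t) \<bullet> (x1 t - x2 t) \<le> norm (c1 t - c2 t) * norm (x1 t - x2 t)" by (rule norm_cauchy_schwarz)
      also have "\<dots> \<le> norm (c1 t - c2 t) * (K * norm (c1 t - c2 t))"
        using K[of t] t T by (intro mult_left_mono) auto
      finally show ?thesis by (simp add: dot_square_norm power2_eq_square algebra_simps)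
    qed
    have "exp (- 2 * K * t) * (2 * A) + exp (- 2 * K * t) * (- 2 * K) * B \<le> 0" if "A \<le> K * B" for A B :: real
    proof -
      have "exp (- 2 * K * t) * (2 * A) + exp (- 2 * K * t) * (- 2 * K) * B = exp (- 2 * K * t) * (2 * (A - K * B))"
        by (simp add: algebra_simps)
      also have "\<dots> \<le> 0" using that by (intro mult_nonneg_nonpos) auto
      finally show ?thesis .
    qed
    from this[OF AB] have "exp (- 2 * K * t) * (2 * ((c1 t - c2 t) \<bullet> (x1 t - x2 t)))
        + exp (- 2 * K * t) * (- 2 * K) * ((c1 t - c2 t) \<bullet> (c1 t - c2 t)) \<le> 0" .
    ultimately show "\<exists>y. (u has_real_derivative y) (at t) \<and> y \<le> 0" by blast
  qed
  then have "exp (- 2 * K * T) * ((c1 T - c2 T) \<bullet> (c1 T - c2 T)) \<le> exp (- 2 * K * T) * 0"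
    using 0 by (simp add: u_def)
  then have "(c1 T - c2 T) \<bullet> (c1 T - c2 T) \<le> 0"
    by (simp only: mult_le_cancel_left_pos[OF exp_gt_zero])
  then show ?thesis by (metis inner_eq_zero_iff inner_ge_zero order_antisym right_minus_eq)
qed (use 0 in simp)

lemma lipschitz_ode_unique:
  fixes c1 c2 :: "real \<Rightarrow> 'a::real_inner"
  assumes d: "\<And>t. \<bar>t\<bar> < e \<Longrightarrow> (c1 has_vector_derivative \<xi> (c1 t)) (at t)"
      "\<And>t. \<bar>t\<bar> < e \<Longrightarrow> (c2 has_vector_derivative \<xi> (c2 t)) (at t)"
    and B: "\<And>t. \<bar>t\<bar> < e \<Longrightarrow> c1 t \<in> B \<and> c2 t \<in> B"
    and K: "\<And>x y. x \<in> B \<Longrightarrow> y \<in> B \<Longrightarrow> norm (\<xi> x - \<xi> y) \<le> K * norm (x - y)"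
    and 0: "c1 0 = c2 0" and T: "\<bar>T\<bar> < e"
  shows "c1 T = c2 T"
proof (cases "T \<ge> 0")
  case True
  then show ?thesis
    using lipschitz_ode_unique_forward[of e c1 "\<lambda>t. \<xi> (c1 t)" c2 "\<lambda>t. \<xi> (c2 t)" K T] assms by auto
next
  case False
  have rev: "((\<lambda>t. c (- t)) has_vector_derivative (- \<xi> (c (- t)))) (at t)"
    if "(c has_vector_derivative \<xi> (c (- t))) (at (- t))" for c :: "real \<Rightarrow> 'a" and t
  proof -
    have "((\<lambda>t::real. - t) has_vector_derivative -1) (at t)" by (auto intro!: derivative_eq_intros)
    from vector_diff_chain_at[OF this that] show ?thesis by (simp add: o_def)
  qed
  have "(\<lambda>t. c1 (- t)) (- T) = (\<lambda>t. c2 (- t)) (- T)"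
  proof (rule lipschitz_ode_unique_forward[where ?x1.0 = "\<lambda>t. - \<xi> (c1 (- t))" and ?x2.0 = "\<lambda>t. - \<xi> (c2 (- t))"
        and ?c1.0 = "\<lambda>t. c1 (- t)" and ?c2.0 = "\<lambda>t. c2 (- t)" and T = "- T" and e = e and K = K])
    show "((\<lambda>t. c1 (- t)) has_vector_derivative (- \<xi> (c1 (- t)))) (at t)" if "0 \<le> t" "t < e" for t
      using d(1)[of "- t"] that by (intro rev) auto
    show "((\<lambda>t. c2 (- t)) has_vector_derivative (- \<xi> (c2 (- t)))) (at t)" if "0 \<le> t" "t < e" for t
      using d(2)[of "- t"] that by (intro rev) auto
    show "norm (- \<xi> (c1 (- t)) - - \<xi> (c2 (- t))) \<le> K * norm (c1 (- t) - c2 (- t))" if "0 \<le> t" "t < e" for t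
      using K B[of "- t"] that by (simp add: norm_minus_commute)
  qed (use False T 0 in auto)
  then show ?thesis by simp
qed

lemma C_infinity_on_lipschitz_ball:
  fixes \<xi> :: "'a::euclidean_space \<Rightarrow> 'b::euclidean_space"
  assumes "open U" "C_infinity_on U \<xi>" "cball x0 r \<subseteq> U"
  obtains K where "K > 0" "\<And>x y. x \<in> cball x0 r \<Longrightarrow> y \<in> cball x0 r \<Longrightarrow> norm (\<xi> x - \<xi> y)
      \<le> K * norm (x - y)"
proof -
  have der: "(\<xi> has_derivative frechet_derivative \<xi> (at x)) (at x)" if "x \<in> cball x0 r" for x
    using C_infinity_on_has_derivative[OF assms(2)] that assms(3) by blast
  have "\<exists>C. \<forall>x\<in>cball x0 r. norm (frechet_derivative \<xi> (at x) b) \<le> C" for b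
  proof -
    have "compact ((\<lambda>x. frechet_derivative \<xi> (at x) b) ` cball x0 r)"
      using continuous_on_subset[OF C_infinity_on_imp_continuous_on[OF C_infinity_on_frechet[OF assms(2)]] assms(3)]
      by (intro compact_continuous_image compact_cball)
    then have "bounded ((\<lambda>x. frechet_derivative \<xi> (at x) b) ` cball x0 r)" by (rule compact_imp_bounded)
    then show ?thesis unfolding bounded_iff by blast
  qed
  then obtain C where C: "\<And>b x. x \<in> cball x0 r \<Longrightarrow> norm (frechet_derivative \<xi> (at x) b) \<le> C b" by metis
  define K where "K = (\<Sum>b\<in>Basis. \<bar>C b\<bar>) + 1"
  have K: "K > 0" unfolding K_def by (simp add: sum_nonneg add_nonneg_pos)
  have on: "onorm (frechet_derivative \<xi> (at x)) \<le> K" if x: "x \<in> cball x0 r" for x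
  proof (rule onorm_bound)
    fix v :: 'a
    have "norm (frechet_derivative \<xi> (at x) v) = norm (\<Sum>b\<in>Basis. (v \<bullet> b) *\<^sub>R frechet_derivative \<xi> (at x) b)"
      by (rule arg_cong[OF linear_euclidean_sum[OF has_derivative_linear[OF der[OF x]]]])
    also have "\<dots> \<le> (\<Sum>b\<in>Basis. \<bar>C b\<bar> * norm v)"
    proof (rule sum_norm_le)
      fix b :: 'a assume b: "b \<in> Basis"
      have "\<bar>v \<bullet> b\<bar> * norm (frechet_derivative \<xi> (at x) b) \<le> norm v * \<bar>C b\<bar>"
        using Basis_le_norm[OF b] C[OF x, of b] by (intro mult_mono) auto
      then show "norm ((v \<bullet> b) *\<^sub>R frechet_derivative \<xi> (at x) b) \<le> \<bar>C b\<bar> * norm v" by (simp add: mult.commute)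
    qed
    also have "\<dots> \<le> K * norm v" by (simp add: K_def sum_distrib_right[symmetric] mult_right_mono)
    finally show "norm (frechet_derivative \<xi> (at x) v) \<le> K * norm v" .
  qed (use K in simp)
  have "norm (\<xi> x - \<xi> y) \<le> K * norm (x - y)" if "x \<in> cball x0 r" "y \<in> cball x0 r" for x y
    by (rule differentiable_bound[OF convex_cball has_derivative_at_withinI[OF der] on that])
  then show ?thesis using that K by blast
qed

lemma lipschitz_ode_exists:
  fixes \<xi> :: "'a::euclidean_space \<Rightarrow> 'a"
  assumes K: "K > 0" "\<And>x y. norm (\<xi> x - \<xi> y) \<le> K * norm (x - y)"
  obtains c e where "e > 0" "c 0 = x0" "\<And>t. \<bar>t\<bar> < e \<Longrightarrow> (c has_vector_derivative \<xi> (c t)) (at t)"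
proof -
  \<comment> \<open>Each of the two integrals in \<open>Q\<close> varies by at most
    \<open>2 e K = 1/4\<close> of the distance, which gives the contraction factor 1/2.\<close>
  define e where "e = 1 / (8 * K)"
  have e: "e > 0" using K by (simp add: e_def)
  \<comment> \<open>Times are clamped to \<open>[-e, e]\<close>, so that Picard iterates are bounded
    continuous functions on the line and form a complete space. The difference of two integrals from
    \<open>- e\<close> in \<open>Q\<close> stands for the integral from 0 to \<open>t\<close> for
    either sign of \<open>t\<close>.\<close>
  define cl where "cl = (\<lambda>t. max (- e) (min e t))"
  have cl: "cl t \<in> {-e..e}" for t using e by (auto simp: cl_def)
  define Q where "Q = (\<lambda>(x :: real \<Rightarrow>\<^sub>C 'a) t. x0 + integral {-e..t} (\<lambda>s. \<xi> (x s)) - integral {-e..0}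
      (\<lambda>s. \<xi> (x s)))"
  have cont\<xi>: "continuous_on UNIV \<xi>"
  proof (rule continuous_onI)
    fix x and \<epsilon> :: real assume "\<epsilon> > 0"
    then show "\<exists>d>0. \<forall>x'\<in>UNIV. dist x' x < d \<longrightarrow> dist (\<xi> x') (\<xi> x) \<le> \<epsilon>"
      using K by (intro exI[of _ "\<epsilon> / K"]) (auto simp: dist_norm field_simps intro: order_trans[OF K(2)])
  qed
  have cont: "continuous_on S (\<lambda>s. \<xi> (apply_bcontfun x s))" for x :: "real \<Rightarrow>\<^sub>C 'a" and S
    by (rule continuous_on_compose2[OF cont\<xi>]) auto
  have intg: "(\<lambda>s. \<xi> (apply_bcontfun x s)) integrable_on {a..b}" for x :: "real \<Rightarrow>\<^sub>C 'a" and a b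
    by (rule integrable_continuous_real[OF cont])
  have derQ: "(Q x has_vector_derivative \<xi> (x t)) (at t within {-e..e})" if "t \<in> {-e..e}" for x t
  proof -
    have "((\<lambda>u. integral {-e..u} (\<lambda>s. \<xi> (x s))) has_vector_derivative \<xi> (x t)) (at t within {-e..e})"
      by (rule integral_has_vector_derivative[OF cont that])
    then show ?thesis unfolding Q_def by (auto intro!: derivative_eq_intros)
  qed
  have contQ: "continuous_on {-e..e} (Q x)" for x
    using derQ has_vector_derivative_continuous continuous_on_eq_continuous_within by blast
  have Qb: "(\<lambda>t. Q x (cl t)) \<in> bcontfun" for x
  proof -
    have "continuous_on UNIV (\<lambda>t. Q x (cl t))"
      by (rule continuous_on_compose2[OF contQ]) (use cl in \<open>auto simp: cl_def intro!: continuous_intros\<close>)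
    moreover have "bounded (Q x ` {-e..e})"
      by (intro compact_imp_bounded compact_continuous_image contQ compact_Icc)
    then have "bounded (range (\<lambda>t. Q x (cl t)))"
      by (rule bounded_subset) (use cl in auto)
    ultimately show ?thesis by (simp add: bcontfun_def)
  qed
  define P where "P = (\<lambda>x. Bcontfun (\<lambda>t. Q x (cl t)))"
  have P: "apply_bcontfun (P x) t = Q x (cl t)" for x t
    unfolding P_def using Bcontfun_inverse[OF Qb] by simp
  have "dist (P x) (P y) \<le> 1 / 2 * dist x y" for x y
  proof (rule dist_bound)
    fix t
    have b: "norm (integral {-e..u} (\<lambda>s. \<xi> (x s)) - integral {-e..u} (\<lambda>s. \<xi> (y s))) \<le> 1/4 * dist x y"
      if u: "u \<in> {-e..e}" for u
    proof -
      have "norm (integral {-e..u} (\<lambda>s. \<xi> (x s)) - integral {-e..u} (\<lambda>s. \<xi> (y s)))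
          = norm (integral {-e..u} (\<lambda>s. \<xi> (x s) - \<xi> (y s)))"
        by (simp add: Henstock_Kurzweil_Integration.integral_diff[OF intg intg])
      also have "\<dots> \<le> K * dist x y * (u - - e)"
      proof (rule integral_bound)
        fix s
        have "norm (\<xi> (x s) - \<xi> (y s)) \<le> K * dist (x s) (y s)" using K(2) by (simp add: dist_norm)
        also have "\<dots> \<le> K * dist x y" using K by (intro mult_left_mono dist_bounded) auto
        finally show "norm (\<xi> (x s) - \<xi> (y s)) \<le> K * dist x y" .
      qed (use u in \<open>auto intro!: continuous_intros cont\<close>)
      also have "\<dots> \<le> K * dist x y * (2 * e)" using u K by (intro mult_left_mono) auto
      finally show ?thesis using K by (simp add: e_def)
    qed
    have eq: "P x t - P y t = (integral {-e..cl t} (\<lambda>s. \<xi> (x s)) - integral {-e..cl t} (\<lambda>s. \<xi> (y s)))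
        - (integral {-e..0} (\<lambda>s. \<xi> (x s)) - integral {-e..0} (\<lambda>s. \<xi> (y s)))"
      by (simp add: P Q_def)
    have "norm (P x t - P y t) \<le> 1/4 * dist x y + 1/4 * dist x y"
      unfolding eq by (rule order_trans[OF norm_triangle_ineq4 add_mono[OF b[OF cl] b]]) (use e in simp)
    then show "dist (P x t) (P y t) \<le> 1 / 2 * dist x y" by (simp add: dist_norm)
  qed
  then obtain x where x: "P x = x"
    using banach_fix_type[of "1/2" P] by auto
  show thesis
  proof (rule that[OF e])
    show "apply_bcontfun x 0 = x0"
      using P[of x 0] e by (simp add: x cl_def Q_def)
    fix t assume t: "\<bar>t\<bar> < e"
    then have "(Q x has_vector_derivative \<xi> (x t)) (at t)"
    proof -
      have "t \<in> {-e..e}" "t \<in> interior {-e..e}" using t by auto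
      then show ?thesis using derQ[of t x] at_within_interior[of t "{-e..e}"] by metis
    qed
    then show "(apply_bcontfun x has_vector_derivative \<xi> (x t)) (at t)"
    proof (rule has_vector_derivative_transform_within_open[of _ _ _ "{-e<..<e}"])
      show "Q x s = apply_bcontfun x s" if "s \<in> {-e<..<e}" for s
        using P[of x s] that by (simp add: x cl_def)
    qed (use t in auto)
  qed
qed

lemma smooth_ode_exists:
  fixes \<xi> :: "'a::euclidean_space \<Rightarrow> 'a"
  assumes U: "open U" "C_infinity_on U \<xi>" "x0 \<in> U"
  obtains c e where "e > 0" "c 0 = x0" "\<And>t. \<bar>t\<bar> < e \<Longrightarrow> c t \<in> U"
    "\<And>t. \<bar>t\<bar> < e \<Longrightarrow> (c has_vector_derivative \<xi> (c t)) (at t)" "C_infinity_on {-e<..<e} c"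
proof -
  obtain r where r: "r > 0" "cball x0 r \<subseteq> U" using U(1,3) open_contains_cball by blast
  obtain K where K: "K > 0" "\<And>x y. x \<in> cball x0 r \<Longrightarrow> y \<in> cball x0 r \<Longrightarrow> norm (\<xi> x - \<xi> y)
      \<le> K * norm (x - y)"
    using C_infinity_on_lipschitz_ball[OF U(1,2) r(2)] by blast
  \<comment> \<open>The nearest-point retraction onto the ball makes the field globally Lipschitz.
    For short times the solution stays in the ball, where the retraction is the identity.\<close>
  let ?p = "closest_point (cball x0 r)"
  have p: "?p x \<in> cball x0 r" for x using r(1) by (intro closest_point_in_set) auto
  have "norm (\<xi> (?p x) - \<xi> (?p y)) \<le> K * norm (x - y)" for x y
  proof -
    have "dist (?p x) (?p y) \<le> dist x y" by (rule closest_point_lipschitz) (use r(1) in auto)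
    then have "norm (?p x - ?p y) \<le> norm (x - y)" by (simp add: dist_norm)
    then show ?thesis using K(2)[OF p p, of x y] K(1) mult_left_mono[of "norm (?p x - ?p y)" "norm (x - y)" K] by linarith
  qed
  then obtain c e where c: "e > 0" "c 0 = x0" "\<And>t. \<bar>t\<bar> < e \<Longrightarrow> (c has_vector_derivative \<xi> (?p (c t))) (at t)"
    using lipschitz_ode_exists[OF K(1), of "\<lambda>x. \<xi> (?p x)" x0] by blast
  have "(c has_vector_derivative \<xi> (?p (c 0))) (at 0)" using c(1) c(3)[of 0] by simp
  then have "isCont c 0" by (rule has_vector_derivative_continuous)
  then obtain d where d: "d > 0" "\<And>t. \<bar>t\<bar> < d \<Longrightarrow> dist (c t) x0 < r"
    using r(1) c(2) unfolding continuous_at_eps_delta dist_real_def by fastforce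
  define e' where "e' = min d e"
  have e': "e' > 0" using d c by (simp add: e'_def)
  have inB: "c t \<in> cball x0 r" if "\<bar>t\<bar> < e'" for t
    using d(2)[of t] that by (auto simp: e'_def dist_commute less_imp_le)
  have der: "(c has_vector_derivative \<xi> (c t)) (at t)" if "\<bar>t\<bar> < e'" for t
    using c(3)[of t] closest_point_self[OF inB[OF that]] that by (simp add: e'_def)
  \<comment> \<open>Bootstrapping: the equation expresses the derivative of \<open>c\<close> by
    \<open>c\<close> itself.\<close>
  have "Ck_on k {-e'<..<e'} c" for k
  proof (induction k)
    case 0
    have "isCont c t" if "\<bar>t\<bar> < e'" for t using der[OF that] has_vector_derivative_continuous by blast
    then show ?case by (auto intro!: continuous_at_imp_continuous_on)
  next
    case (Suc k)
    show ?case
    proof (rule Ck_on_SucI[of _ _ "\<lambda>t h. h *\<^sub>R \<xi> (c t)"])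
      show "(c has_derivative (\<lambda>h. h *\<^sub>R \<xi> (c t))) (at t)" if "t \<in> {-e'<..<e'}" for t
        using der[of t] that by (auto simp: has_vector_derivative_def abs_less_iff)
      have "Ck_on k {-e'<..<e'} (\<lambda>t. \<xi> (c t))"
      proof (rule Ck_on_compose[OF _ U(1) _ Suc])
        show "c ` {-e'<..<e'} \<subseteq> U" using inB r(2) by (fastforce simp: abs_less_iff)
        show "Ck_on k U \<xi>" using U(2) unfolding C_infinity_on_def by blast
      qed simp
      then show "Ck_on k {-e'<..<e'} (\<lambda>t. v *\<^sub>R \<xi> (c t))" for v
        by (intro Ck_on_bilinear[OF bounded_bilinear_scaleR] Ck_on_const) auto
    qed simp
  qed
  then have "C_infinity_on {-e'<..<e'} c" unfolding C_infinity_on_def by blast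
  then show ?thesis using that[of e' c] e' c(2) inB r(2) der by blast
qed

lemma atlas_cover:
  assumes "smooth_manifold M" "p \<in> topspace (mtop M)"
  obtains U \<phi> where "(U, \<phi>) \<in> atlas M" "p \<in> U"
  using assms unfolding smooth_manifold_def by blast

section \<open>Charts and smooth functions on manifolds\<close>

lemma chart_openin: "smooth_manifold M \<Longrightarrow> (U, \<phi>) \<in> atlas M \<Longrightarrow> openin (mtop M) U"
  unfolding smooth_manifold_def by blast

lemma chart_open_image: "smooth_manifold M \<Longrightarrow> (U, \<phi>) \<in> atlas M \<Longrightarrow> open (\<phi> ` U)"
  unfolding smooth_manifold_def by blast

lemma chart_homeomorphic:
  "smooth_manifold M \<Longrightarrow> (U, \<phi>) \<in> atlas M \<Longrightarrow> homeomorphic_map (subtopology (mtop M) U) (top_of_set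
      (\<phi> ` U)) \<phi>"
  unfolding smooth_manifold_def by blast

lemma chart_transition:
  "smooth_manifold M \<Longrightarrow> (U, \<phi>) \<in> atlas M \<Longrightarrow> (V, \<psi>) \<in> atlas M \<Longrightarrow>
    C_infinity_on (\<phi> ` (U \<inter> V)) (\<lambda>y. \<psi> (inv_into U \<phi> y))"
  unfolding smooth_manifold_def o_def by blast

lemma chart_subset: "smooth_manifold M \<Longrightarrow> (U, \<phi>) \<in> atlas M \<Longrightarrow> U \<subseteq> topspace (mtop M)"
  using chart_openin openin_subset by blast

lemma chart_topspace_subtopology:
  "smooth_manifold M \<Longrightarrow> (U, \<phi>) \<in> atlas M \<Longrightarrow> topspace (subtopology (mtop M) U) = U"
  using chart_subset by (metis inf.absorb_iff2 topspace_subtopology)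

lemma chart_inj_on: 
  assumes "smooth_manifold M" "(U, \<phi>) \<in> atlas M" shows "inj_on \<phi> U"
  using homeomorphic_imp_injective_map[OF chart_homeomorphic[OF assms]] chart_topspace_subtopology[OF assms] by simp

lemma chart_inv_in: "y \<in> \<phi> ` U \<Longrightarrow> inv_into U \<phi> y \<in> U"
  by (rule inv_into_into)

lemma chart_inv_right: "y \<in> \<phi> ` U \<Longrightarrow> \<phi> (inv_into U \<phi> y) = y"
  by (rule f_inv_into_f)

lemma chart_inv_left:
  "smooth_manifold M \<Longrightarrow> (U, \<phi>) \<in> atlas M \<Longrightarrow> x \<in> U \<Longrightarrow> inv_into U \<phi> (\<phi> x) = x"
  using chart_inj_on inv_into_f_f by metis

lemma chart_continuous:
  assumes "smooth_manifold M" "(U, \<phi>) \<in> atlas M"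
  shows "continuous_map (subtopology (mtop M) U) (top_of_set (\<phi> ` U)) \<phi>"
  using homeomorphic_imp_continuous_map[OF chart_homeomorphic[OF assms]] .

lemma chart_inv_continuous:
  assumes "smooth_manifold M" "(U, \<phi>) \<in> atlas M"
  shows "continuous_map (top_of_set (\<phi> ` U)) (mtop M) (inv_into U \<phi>)"
proof -
  obtain g where g: "homeomorphic_maps (subtopology (mtop M) U) (top_of_set (\<phi> ` U)) \<phi> g"
    using chart_homeomorphic[OF assms] homeomorphic_map_maps by blast
  have "g y = inv_into U \<phi> y" if "y \<in> \<phi> ` U" for y
    using g that chart_topspace_subtopology[OF assms] chart_inv_left[OF assms]
    unfolding homeomorphic_maps_def by auto
  moreover have "continuous_map (top_of_set (\<phi> ` U)) (mtop M) g"
    using g unfolding homeomorphic_maps_def continuous_map_in_subtopology by blast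
  ultimately show ?thesis using continuous_map_eq by (metis topspace_euclidean_subtopology)
qed

lemma chart_open_preimage:
  assumes "smooth_manifold M" "(U, \<phi>) \<in> atlas M" "open Q"
  shows "openin (mtop M) {x \<in> U. \<phi> x \<in> Q}"
proof -
  have "continuous_map (subtopology (mtop M) U) euclidean \<phi>"
    using chart_continuous[OF assms(1,2)] continuous_map_in_subtopology by blast
  then have "openin (subtopology (mtop M) U) {x \<in> topspace (subtopology (mtop M) U). \<phi> x \<in> Q}"
    by (rule openin_continuous_map_preimage) (use assms(3) in simp)
  then show ?thesis
    unfolding chart_topspace_subtopology[OF assms(1,2)]
    using openin_open_subtopology[OF chart_openin[OF assms(1,2)]] by blast
qed

lemma chart_open_image_subset:
  assumes "smooth_manifold M" "(U, \<phi>) \<in> atlas M" "openin (mtop M) W"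
  shows "open (\<phi> ` (U \<inter> W))"
proof -
  have "openin (top_of_set (\<phi> ` U)) {y \<in> topspace (top_of_set (\<phi> ` U)). inv_into U \<phi> y \<in> W}"
    by (rule openin_continuous_map_preimage[OF chart_inv_continuous[OF assms(1,2)] assms(3)])
  moreover have "{y \<in> topspace (top_of_set (\<phi> ` U)). inv_into U \<phi> y \<in> W} = \<phi> ` (U \<inter> W)"
    using chart_inv_left[OF assms(1,2)] by auto
  ultimately show ?thesis
    using openin_open_eq[OF chart_open_image[OF assms(1,2)]] by auto
qed

lemma smooth_functionsD:
  assumes "f \<in> smooth_functions M" "(U, \<phi>) \<in> atlas M"
  shows "C_infinity_on (\<phi> ` U) (\<lambda>y. f (inv_into U \<phi> y))"
  using assms unfolding smooth_functions_def smooth_map_def euclidean_manifold_def by (auto simp: o_def)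

lemma smooth_functions_zero: "f \<in> smooth_functions M \<Longrightarrow> x \<notin> topspace (mtop M) \<Longrightarrow> f x = 0"
  unfolding smooth_functions_def by blast

lemma continuous_map_chart_locally:
  assumes M: "smooth_manifold M"
    and loc: "\<And>p. p \<in> topspace (mtop M) \<Longrightarrow> \<exists>U \<phi> W. (U, \<phi>) \<in> atlas M \<and> openin (mtop M) W
        \<and> p \<in> W \<and> W \<subseteq> U \<and>
      continuous_on (\<phi> ` W) (\<lambda>y. f (inv_into U \<phi> y))"
  shows "continuous_map (mtop M) (euclidean :: 'b::topological_space topology) f"
  unfolding continuous_map_eq_topcontinuous_at
proof
  fix p assume p: "p \<in> topspace (mtop M)"
  then obtain U \<phi> W where c: "(U, \<phi>) \<in> atlas M" and W: "openin (mtop M) W" "p \<in> W" "W \<subseteq> U"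
    and f: "continuous_on (\<phi> ` W) (\<lambda>y. f (inv_into U \<phi> y))" using loc by blast
  show "topcontinuous_at (mtop M) euclidean f p"
    unfolding topcontinuous_at_def
  proof (intro conjI allI impI)
    fix V assume V: "openin euclidean V \<and> f p \<in> V"
    have "open (\<phi> ` (U \<inter> W))" by (rule chart_open_image_subset[OF M c W(1)])
    then have "open (\<phi> ` W)" using W(3) by (simp add: inf.absorb2)
    then have "open ((\<lambda>y. f (inv_into U \<phi> y)) -` V \<inter> \<phi> ` W)"
      using f V continuous_on_open_vimage by (metis open_openin)
    then have "openin (mtop M) {x \<in> U. \<phi> x \<in> (\<lambda>y. f (inv_into U \<phi> y)) -` V \<inter> \<phi> ` W}"
      by (rule chart_open_preimage[OF M c])
    moreover have "{x \<in> U. \<phi> x \<in> (\<lambda>y. f (inv_into U \<phi> y)) -` V \<inter> \<phi> ` W} = {x \<in> W. f x \<in> V}"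
      (is "?A = ?B")
    proof (rule Set.set_eqI, rule iffI)
      fix x assume x: "x \<in> ?A"
      then have "x \<in> W" using W(3) inj_on_image_mem_iff[OF chart_inj_on[OF M c], of x W] by auto
      then show "x \<in> ?B" using x chart_inv_left[OF M c, of x] by auto
    next
      fix x assume "x \<in> ?B"
      then show "x \<in> ?A" using W(3) chart_inv_left[OF M c, of x] by auto
    qed
    ultimately show "\<exists>Ua. openin (mtop M) Ua \<and> p \<in> Ua \<and> (\<forall>y\<in>Ua. f y \<in> V)" using W V by auto
  qed (use p in auto)
qed

text \<open>One chart near each point is enough, since transition maps carry the test to every other
  chart.\<close>

lemma smooth_functionsI:
  assumes M: "smooth_manifold M" and z: "\<And>x. x \<notin> topspace (mtop M) \<Longrightarrow> f x = (0::real)"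
    and loc: "\<And>p. p \<in> topspace (mtop M) \<Longrightarrow> \<exists>U \<phi> W. (U, \<phi>) \<in> atlas M \<and> openin (mtop M) W
        \<and> p \<in> W \<and> W \<subseteq> U \<and>
      C_infinity_on (\<phi> ` W) (\<lambda>y. f (inv_into U \<phi> y))"
  shows "f \<in> smooth_functions M"
proof -
  have "continuous_map (mtop M) euclideanreal f"
  proof (rule continuous_map_chart_locally[OF M])
    fix p assume "p \<in> topspace (mtop M)"
    from loc[OF this] show "\<exists>U \<phi> W. (U, \<phi>) \<in> atlas M \<and> openin (mtop M) W \<and> p \<in> W \<and> W \<subseteq> U \<and>
        continuous_on (\<phi> ` W) (\<lambda>y. f (inv_into U \<phi> y))"
      using C_infinity_on_imp_continuous_on by blast
  qed
  moreover have "C_infinity_on (\<phi> ` U) (\<lambda>y. f (inv_into U \<phi> y))" if c: "(U, \<phi>) \<in> atlas M" for U \<phi>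
  proof (rule C_infinity_on_locally[OF chart_open_image[OF M c]])
    fix y assume y: "y \<in> \<phi> ` U"
    define p where "p = inv_into U \<phi> y"
    have p: "p \<in> U" "\<phi> p = y" using chart_inv_in[OF y] chart_inv_right[OF y] by (auto simp: p_def)
    then have "p \<in> topspace (mtop M)" using chart_subset[OF M c] by blast
    then obtain V \<psi> W where d: "(V, \<psi>) \<in> atlas M" and W: "openin (mtop M) W" "p \<in> W" "W \<subseteq> V"
      and f: "C_infinity_on (\<psi> ` W) (\<lambda>y. f (inv_into V \<psi> y))" using loc by blast
    let ?O = "\<phi> ` (U \<inter> W)"
    have O: "open ?O" by (rule chart_open_image_subset[OF M c W(1)])
    have "open (\<psi> ` (V \<inter> W))" by (rule chart_open_image_subset[OF M d W(1)])
    then have O': "open (\<psi> ` W)" using W(3) by (simp add: inf.absorb2)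
    have "C_infinity_on ?O (\<lambda>y. f (inv_into V \<psi> (\<psi> (inv_into U \<phi> y))))"
    proof (rule C_infinity_on_compose[OF O O' _ _ f])
      show "(\<lambda>y. \<psi> (inv_into U \<phi> y)) ` ?O \<subseteq> \<psi> ` W" using chart_inv_left[OF M c] by auto
      show "C_infinity_on ?O (\<lambda>y. \<psi> (inv_into U \<phi> y))"
        by (rule C_infinity_on_subset[OF chart_transition[OF M c d]]) (use W in auto)
    qed
    moreover have eq: "f (inv_into V \<psi> (\<psi> (inv_into U \<phi> y))) = f (inv_into U \<phi> y)" if "y \<in> ?O" for y
      using that chart_inv_left[OF M d] chart_inv_left[OF M c] W(3) by auto
    ultimately have "C_infinity_on ?O (\<lambda>y. f (inv_into U \<phi> y))" by (simp only: C_infinity_on_cong[OF O eq])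
    then show "\<exists>V. open V \<and> y \<in> V \<and> C_infinity_on V (\<lambda>y. f (inv_into U \<phi> y))"
      using O p W(2) by blast
  qed
  ultimately show ?thesis
    unfolding smooth_functions_def smooth_map_def euclidean_manifold_def using z by (auto simp: o_def)
qed

lemma smooth_functions_chartI:
  assumes M: "smooth_manifold M" and z: "\<And>x. x \<notin> topspace (mtop M) \<Longrightarrow> f x = (0::real)"
    and C: "\<And>U \<phi>. (U, \<phi>) \<in> atlas M \<Longrightarrow> C_infinity_on (\<phi> ` U) (\<lambda>y. f (inv_into U \<phi> y))"
  shows "f \<in> smooth_functions M"
proof (rule smooth_functionsI[OF M z])
  fix p assume "p \<in> topspace (mtop M)"
  then obtain U \<phi> where c: "(U, \<phi>) \<in> atlas M" "p \<in> U" using atlas_cover[OF M] by blast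
  then show "\<exists>U \<phi> W. (U, \<phi>) \<in> atlas M \<and> openin (mtop M) W \<and> p \<in> W \<and> W \<subseteq> U \<and>
      C_infinity_on (\<phi> ` W) (\<lambda>y. f (inv_into U \<phi> y))"
    using chart_openin[OF M c(1)] C[OF c(1)] by blast
qed

lemma smooth_functions_add:
  assumes M: "smooth_manifold M" and f: "f \<in> smooth_functions M" "g \<in> smooth_functions M"
  shows "f + g \<in> smooth_functions M"
  by (rule smooth_functions_chartI[OF M])
    (auto simp: smooth_functions_zero[OF f(1)] smooth_functions_zero[OF f(2)]
      intro!: C_infinity_on_add smooth_functionsD[OF f(1)] smooth_functionsD[OF f(2)] chart_open_image[OF M])

lemma smooth_functions_times:
  assumes M: "smooth_manifold M" and f: "f \<in> smooth_functions M" "g \<in> smooth_functions M"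
  shows "f * g \<in> smooth_functions M"
  by (rule smooth_functions_chartI[OF M])
    (auto simp: smooth_functions_zero[OF f(1)] smooth_functions_zero[OF f(2)]
      intro!: C_infinity_on_mult smooth_functionsD[OF f(1)] smooth_functionsD[OF f(2)] chart_open_image[OF M])

lemma smooth_functions_scaleR:
  assumes M: "smooth_manifold M" and f: "f \<in> smooth_functions M"
  shows "c *\<^sub>R f \<in> smooth_functions M"
  by (rule smooth_functions_chartI[OF M])
    (auto simp: smooth_functions_zero[OF f(1)] scaleR_fun_def
      intro!: C_infinity_on_mult C_infinity_on_const smooth_functionsD[OF f(1)] chart_open_image[OF M])

lemma smooth_functions_const:
  assumes M: "smooth_manifold M"
  shows "(\<lambda>x. if x \<in> topspace (mtop M) then c else 0) \<in> smooth_functions M"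
proof (rule smooth_functions_chartI[OF M])
  fix U \<phi> assume c: "(U, \<phi>) \<in> atlas M"
  have "C_infinity_on (\<phi> ` U) (\<lambda>y. if inv_into U \<phi> y \<in> topspace (mtop M) then c else 0)
      = C_infinity_on (\<phi> ` U) (\<lambda>y. c)"
    by (rule C_infinity_on_cong[OF chart_open_image[OF M c]])
      (use chart_subset[OF M c] chart_inv_in in \<open>metis subsetD\<close>)
  then show "C_infinity_on (\<phi> ` U) (\<lambda>y. if inv_into U \<phi> y \<in> topspace (mtop M) then c else 0)" by simp
qed auto

text \<open>The function is cut off by a bump supported in a closed ball of the chart. The image of
  that ball is compact, hence closed because \<open>M\<close> is Hausdorff, so the continuation by
  zero is smooth; the price is agreement on the smaller set \<open>Q'\<close> only.\<close>

lemma smooth_local_extension: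
  fixes M :: "('a, 'e::euclidean_space) manifold" and h :: "'e \<Rightarrow> real"
  assumes M: "smooth_manifold M" and c: "(U, \<phi>) \<in> atlas M" and Q: "open Q" "Q \<subseteq> \<phi> ` U" "y0 \<in> Q"
    and h: "C_infinity_on Q h"
  obtains f Q' where "f \<in> smooth_functions M" "open Q'" "y0 \<in> Q'" "Q' \<subseteq> Q"
    "\<And>y. y \<in> Q' \<Longrightarrow> f (inv_into U \<phi> y) = h y" "\<And>x. f x \<noteq> 0 \<Longrightarrow> x \<in> U \<and>
        \<phi> x \<in> Q"
proof -
  obtain s where s: "s > 0" "cball y0 s \<subseteq> Q" using Q(1,3) open_contains_cball by blast
  define r where "r = s / 2"
  have r: "r > 0" "cball y0 (2 * r) \<subseteq> Q" using s by (auto simp: r_def)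
  obtain bmp :: "'e \<Rightarrow> real" where bmp: "C_infinity_on UNIV bmp" "\<And>y. y \<in> ball y0 r \<Longrightarrow> bmp y = 1"
    "\<And>y. y \<notin> ball y0 (2 * r) \<Longrightarrow> bmp y = 0"
    using euclidean_bump_exists[OF r(1)] by blast
  define f where "f = (\<lambda>x. if x \<in> U \<and> \<phi> x \<in> Q then bmp (\<phi> x) * h (\<phi> x) else 0)"
  define C where "C = inv_into U \<phi> ` cball y0 (2 * r)"
  have "compactin (mtop M) C"
    unfolding C_def
  proof (rule image_compactin)
    show "compactin (top_of_set (\<phi> ` U)) (cball y0 (2 * r))"
      using r(2) Q(2) by (auto simp: compactin_subtopology)
    show "continuous_map (top_of_set (\<phi> ` U)) (mtop M) (inv_into U \<phi>)" by (rule chart_inv_continuous[OF M c])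
  qed
  then have "closedin (mtop M) C"
    using M by (intro compactin_imp_closedin) (auto simp: smooth_manifold_def)
  have fC: "f x = 0" if "x \<notin> C" for x
  proof (cases "x \<in> U \<and> \<phi> x \<in> Q")
    case True
    then have "\<phi> x \<notin> cball y0 (2 * r)" using that chart_inv_left[OF M c, of x] by (force simp: C_def)
    then show ?thesis using bmp(3)[of "\<phi> x"] by (auto simp: f_def)
  qed (auto simp: f_def)
  have "f \<in> smooth_functions M"
  proof (rule smooth_functionsI[OF M])
    show "f x = 0" if "x \<notin> topspace (mtop M)" for x
      using that chart_subset[OF M c] by (auto simp: f_def)
    fix p assume p: "p \<in> topspace (mtop M)"
    show "\<exists>U \<phi> W. (U, \<phi>) \<in> atlas M \<and> openin (mtop M) W \<and> p \<in> W \<and> W \<subseteq> U \<and>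
        C_infinity_on (\<phi> ` W) (\<lambda>y. f (inv_into U \<phi> y))"
    proof (cases "p \<in> U \<and> \<phi> p \<in> Q")
      case True
      let ?W = "{x \<in> U. \<phi> x \<in> Q}"
      have W: "\<phi> ` ?W = Q" using Q(2) by auto
      have "C_infinity_on Q (\<lambda>y. bmp y * h y)"
        by (intro C_infinity_on_mult Q h C_infinity_on_subset[OF bmp(1)]) auto
      moreover have eq: "bmp y * h y = f (inv_into U \<phi> y)" if "y \<in> Q" for y
        using that Q(2) chart_inv_in[of y \<phi> U] chart_inv_right[of y \<phi> U] by (auto simp: f_def)
      ultimately have "C_infinity_on (\<phi> ` ?W) (\<lambda>y. f (inv_into U \<phi> y))"
        unfolding W by (simp only: C_infinity_on_cong[OF Q(1) eq])
      moreover have "openin (mtop M) ?W" by (rule chart_open_preimage[OF M c Q(1)])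
      ultimately show ?thesis using c True by blast
    next
      case False
      then have "p \<notin> C" using r(2) Q(2) chart_inv_in[of _ \<phi> U] chart_inv_right[of _ \<phi> U] by (force simp: C_def)
      obtain V \<psi> where d: "(V, \<psi>) \<in> atlas M" "p \<in> V" using atlas_cover[OF M p] by blast
      let ?W = "V \<inter> (topspace (mtop M) - C)"
      have W: "openin (mtop M) ?W" using chart_openin[OF M d(1)] \<open>closedin (mtop M) C\<close> by blast
      have "C_infinity_on (\<psi> ` (V \<inter> ?W)) (\<lambda>y. f (inv_into V \<psi> y)) = C_infinity_on (\<psi> ` (V \<inter> ?W))
          (\<lambda>y. 0 :: real)"
        by (rule C_infinity_on_cong[OF chart_open_image_subset[OF M d(1) W]])
          (use chart_inv_left[OF M d(1)] fC in auto)
      then have "C_infinity_on (\<psi> ` ?W) (\<lambda>y. f (inv_into V \<psi> y))" by (simp add: Int_assoc[symmetric])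
      then show ?thesis using d W p \<open>p \<notin> C\<close> by (intro exI[of _ V] exI[of _ \<psi>] exI[of _ ?W]) auto
    qed
  qed
  moreover have "f (inv_into U \<phi> y) = h y" if "y \<in> ball y0 r" for y
  proof -
    have y: "y \<in> Q" using that r by (auto simp: subset_iff)
    then show ?thesis
      using bmp(2)[OF that] Q(2) chart_inv_in[of y \<phi> U] chart_inv_right[of y \<phi> U] by (auto simp: f_def)
  qed
  moreover have "ball y0 r \<subseteq> Q" using r by (auto simp: subset_iff)
  moreover have "x \<in> U \<and> \<phi> x \<in> Q" if "f x \<noteq> 0" for x
    using that unfolding f_def by meson
  moreover have "y0 \<in> ball y0 r" using r(1) by simp
  ultimately show ?thesis by (rule_tac that[of f "ball y0 r"]) (assumption | rule open_ball)+
qed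

lemma smooth_bump:
  assumes M: "smooth_manifold M" and W: "openin (mtop M) W" "p \<in> W"
  obtains f W' where "f \<in> smooth_functions M" "openin (mtop M) W'" "p \<in> W'" "W' \<subseteq> W"
    "\<And>x. x \<in> W' \<Longrightarrow> f x = 1" "\<And>x. x \<notin> W \<Longrightarrow> f x = 0"
proof -
  have "p \<in> topspace (mtop M)" using W openin_subset by blast
  then obtain U \<phi> where c: "(U, \<phi>) \<in> atlas M" "p \<in> U" using atlas_cover[OF M] by blast
  have Q: "open (\<phi> ` (U \<inter> W))" "\<phi> ` (U \<inter> W) \<subseteq> \<phi> ` U" "\<phi> p \<in> \<phi> ` (U \<inter> W)"
    using chart_open_image_subset[OF M c(1) W(1)] c W(2) by auto
  obtain f Q' where f: "f \<in> smooth_functions M" "open Q'" "\<phi> p \<in> Q'" "Q' \<subseteq> \<phi> ` (U \<inter> W)"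
    "\<And>y. y \<in> Q' \<Longrightarrow> f (inv_into U \<phi> y) = 1" "\<And>x. f x \<noteq> 0 \<Longrightarrow> x \<in> U \<and> \<phi>
        x \<in> \<phi> ` (U \<inter> W)"
    by (rule smooth_local_extension[OF M c(1) Q, of "\<lambda>_. 1"]) auto
  have W: "x \<in> W" if "x \<in> U" "\<phi> x \<in> \<phi> ` (U \<inter> W)" for x
    using that chart_inj_on[OF M c(1)] by (auto simp: inj_on_def)
  show ?thesis
  proof (rule that[of f "{x \<in> U. \<phi> x \<in> Q'}"])
    show "openin (mtop M) {x \<in> U. \<phi> x \<in> Q'}" by (rule chart_open_preimage[OF M c(1) f(2)])
    show "f x = 0" if "x \<notin> W" for x using f(6)[of x] W[of x] that by blast
    show "f x = 1" if "x \<in> {x \<in> U. \<phi> x \<in> Q'}" for x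
      using f(5)[of "\<phi> x"] that chart_inv_left[OF M c(1)] by auto
  qed (use f c W in auto)
qed

text \<open>Testing smoothness against \<open>smooth_functions M\<close> avoids any choice of charts of \<open>M\<close>.\<close>

definition smooth_param ::
  "('a, 'e::euclidean_space) manifold \<Rightarrow> 'z::euclidean_space set \<Rightarrow> ('z \<Rightarrow> 'a) \<Rightarrow> bool" where
  "smooth_param M Q \<Phi> \<longleftrightarrow>
     open Q \<and> \<Phi> ` Q \<subseteq> topspace (mtop M) \<and> (\<forall>f\<in>smooth_functions M. C_infinity_on Q (\<lambda>z. f (\<Phi> z)))"

lemma smooth_param_open: "smooth_param M Q \<Phi> \<Longrightarrow> open Q"
  and smooth_param_in: "smooth_param M Q \<Phi> \<Longrightarrow> z \<in> Q \<Longrightarrow> \<Phi> z \<in> topspace (mtop M)"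
  and smooth_param_function:
    "smooth_param M Q \<Phi> \<Longrightarrow> f \<in> smooth_functions M \<Longrightarrow> C_infinity_on Q (\<lambda>z. f (\<Phi> z))"
  unfolding smooth_param_def by auto

text \<open>Continuity of \<open>\<Phi>\<close> is not built into \<open>smooth_param\<close>; it is
  recovered because bump functions detect open sets.\<close>

lemma smooth_param_preimage_open:
  assumes M: "smooth_manifold M" and \<Phi>: "smooth_param M Q \<Phi>" and W: "openin (mtop M) W"
  shows "open {z \<in> Q. \<Phi> z \<in> W}"
proof (subst open_subopen, intro ballI)
  fix z0 assume z0: "z0 \<in> {z \<in> Q. \<Phi> z \<in> W}"
  obtain f W' where f: "f \<in> smooth_functions M" "\<Phi> z0 \<in> W'" "\<And>x. x \<in> W' \<Longrightarrow> f x = 1" "\<And>x. x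
      \<notin> W \<Longrightarrow> f x = 0"
    by (rule smooth_bump[OF M W, of "\<Phi> z0"]) (use z0 in auto)
  have "open ((\<lambda>z. f (\<Phi> z)) -` (- {0}) \<inter> Q)"
    using C_infinity_on_imp_continuous_on[OF smooth_param_function[OF \<Phi> f(1)]]
    by (subst (asm) continuous_on_open_vimage[OF smooth_param_open[OF \<Phi>]]) auto
  moreover have "z0 \<in> (\<lambda>z. f (\<Phi> z)) -` (- {0}) \<inter> Q" using z0 f(2,3) by auto
  moreover have "(\<lambda>z. f (\<Phi> z)) -` (- {0}) \<inter> Q \<subseteq> {z \<in> Q. \<Phi> z \<in> W}" using f(4) by auto
  ultimately show "\<exists>T. open T \<and> z0 \<in> T \<and> T \<subseteq> {z \<in> Q. \<Phi> z \<in> W}" by blast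
qed

text \<open>Coordinates live on \<open>U\<close> alone; near each point they agree with globally
  smooth functions, against which \<open>\<Phi>\<close> can be tested.\<close>

lemma smooth_param_coord:
  fixes M :: "('a, 'e::euclidean_space) manifold"
  assumes M: "smooth_manifold M" and \<Phi>: "smooth_param M Q \<Phi>" and c: "(U, \<phi>) \<in> atlas M"
  shows "C_infinity_on {z \<in> Q. \<Phi> z \<in> U} (\<lambda>z. \<phi> (\<Phi> z))"
proof (rule C_infinity_on_componentwise)
  show op: "open {z \<in> Q. \<Phi> z \<in> U}" by (rule smooth_param_preimage_open[OF M \<Phi> chart_openin[OF M c]])
  fix b :: 'e assume "b \<in> Basis"
  show "C_infinity_on {z \<in> Q. \<Phi> z \<in> U} (\<lambda>z. \<phi> (\<Phi> z) \<bullet> b)"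
  proof (rule C_infinity_on_locally[OF op])
    fix z0 assume z0: "z0 \<in> {z \<in> Q. \<Phi> z \<in> U}"
    have lin: "C_infinity_on (\<phi> ` U) (\<lambda>y. y \<bullet> b)"
      by (intro C_infinity_on_bounded_linear bounded_linear_inner_left chart_open_image[OF M c])
    obtain f Q' where f: "f \<in> smooth_functions M" "open Q'" "\<phi> (\<Phi> z0) \<in> Q'" "Q' \<subseteq> \<phi> ` U"
      "\<And>y. y \<in> Q' \<Longrightarrow> f (inv_into U \<phi> y) = y \<bullet> b"
      by (rule smooth_local_extension[OF M c chart_open_image[OF M c] subset_refl _ lin, of "\<phi> (\<Phi> z0)"])
        (use z0 in blast)+
    let ?P = "{z \<in> Q. \<Phi> z \<in> {x \<in> U. \<phi> x \<in> Q'}}"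
    have P: "open ?P" by (rule smooth_param_preimage_open[OF M \<Phi> chart_open_preimage[OF M c f(2)]])
    have "f (\<Phi> z) = \<phi> (\<Phi> z) \<bullet> b" if "z \<in> ?P" for z
      using f(5)[of "\<phi> (\<Phi> z)"] that chart_inv_left[OF M c, of "\<Phi> z"] by auto
    from C_infinity_on_cong[OF P this]
    have "C_infinity_on ?P (\<lambda>z. \<phi> (\<Phi> z) \<bullet> b)"
      using C_infinity_on_subset[OF smooth_param_function[OF \<Phi> f(1)], of ?P] by auto
    then show "\<exists>V. open V \<and> z0 \<in> V \<and> C_infinity_on V (\<lambda>z. \<phi> (\<Phi> z) \<bullet> b)"
      using P z0 f(3) by blast
  qed
qed

lemma smooth_param_chart:
  assumes "smooth_manifold M" "(U, \<phi>) \<in> atlas M"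
  shows "smooth_param M (\<phi> ` U) (inv_into U \<phi>)"
  unfolding smooth_param_def
proof (intro conjI ballI)
  show "inv_into U \<phi> ` \<phi> ` U \<subseteq> topspace (mtop M)"
    using chart_subset[OF assms] chart_inv_left[OF assms] by auto
qed (auto intro: chart_open_image[OF assms] smooth_functionsD[OF _ assms(2)])

lemma smooth_param_compose:
  assumes "smooth_param M Q \<Phi>" "open P" "C_infinity_on P h" "h ` P \<subseteq> Q"
  shows "smooth_param M P (\<lambda>z. \<Phi> (h z))"
  unfolding smooth_param_def
proof (intro conjI ballI)
  show "(\<lambda>z. \<Phi> (h z)) ` P \<subseteq> topspace (mtop M)" using smooth_param_in[OF assms(1)] assms(4) by blast
  fix f assume "f \<in> smooth_functions M"
  from smooth_param_function[OF assms(1) this]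
  show "C_infinity_on P (\<lambda>z. f (\<Phi> (h z)))"
    by (rule C_infinity_on_compose[OF assms(2) smooth_param_open[OF assms(1)] assms(4,3)])
qed (rule assms(2))

lemma smooth_param_subset: "smooth_param M Q \<Phi> \<Longrightarrow> open P \<Longrightarrow> P \<subseteq> Q \<Longrightarrow>
    smooth_param M P \<Phi>"
  unfolding smooth_param_def by (meson C_infinity_on_subset image_mono order_trans)

lemma smooth_param_const: "open Q \<Longrightarrow> a \<in> topspace (mtop M) \<Longrightarrow> smooth_param M Q (\<lambda>z. a)"
  unfolding smooth_param_def by auto

lemma smooth_param_locally:
  assumes "open Q" "\<And>z. z \<in> Q \<Longrightarrow> \<exists>P. z \<in> P \<and> smooth_param M P \<Phi>"
  shows "smooth_param M Q \<Phi>"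
  unfolding smooth_param_def
proof (intro conjI ballI)
  show "\<Phi> ` Q \<subseteq> topspace (mtop M)" using assms(2) smooth_param_in by blast
  fix f assume f: "f \<in> smooth_functions M"
  show "C_infinity_on Q (\<lambda>z. f (\<Phi> z))"
  proof (rule C_infinity_on_locally[OF assms(1)])
    fix z assume "z \<in> Q"
    then obtain P where "z \<in> P" "smooth_param M P \<Phi>" using assms(2) by blast
    then show "\<exists>V. open V \<and> z \<in> V \<and> C_infinity_on V (\<lambda>z. f (\<Phi> z))"
      by (intro exI[of _ P] conjI smooth_param_function[OF _ f] smooth_param_open[of M P \<Phi>])
  qed
qed (rule assms(1))

lemma smooth_param_cong:
  assumes "smooth_param M Q \<Phi>" "\<And>z. z \<in> Q \<Longrightarrow> \<Phi> z = \<Psi> z" shows "smooth_param M Q \<Psi>"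
  unfolding smooth_param_def
proof (intro conjI ballI)
  show "open Q" by (rule smooth_param_open[OF assms(1)])
  show "\<Psi> ` Q \<subseteq> topspace (mtop M)" using smooth_param_in[OF assms(1)] assms(2) by fastforce
  fix f assume f: "f \<in> smooth_functions M"
  have "f (\<Phi> z) = f (\<Psi> z)" if "z \<in> Q" for z using assms(2)[OF that] by simp
  from C_infinity_on_cong[OF smooth_param_open[OF assms(1)] this] smooth_param_function[OF assms(1) f]
  show "C_infinity_on Q (\<lambda>z. f (\<Psi> z))" by simp
qed

lemma smooth_param_imp_smooth_map:
  assumes M: "smooth_manifold M" and \<Phi>: "smooth_param M UNIV \<Phi>"
  shows "smooth_map euclidean_manifold M \<Phi>"
proof -
  have "continuous_map euclidean (mtop M) \<Phi>"
    unfolding continuous_map_def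
  proof (intro conjI allI impI)
    show "\<Phi> \<in> topspace euclidean \<rightarrow> topspace (mtop M)" using smooth_param_in[OF \<Phi>] by auto
    fix W assume "openin (mtop M) W"
    from smooth_param_preimage_open[OF M \<Phi> this]
    show "openin euclidean {x \<in> topspace euclidean. \<Phi> x \<in> W}" by simp
  qed
  moreover have "C_infinity_on (\<Phi> -` V) (\<lambda>z. \<psi> (\<Phi> z))" if "(V, \<psi>) \<in> atlas M" for V \<psi>
    using smooth_param_coord[OF M \<Phi> that] by (simp add: vimage_def)
  ultimately show ?thesis
    unfolding smooth_map_def euclidean_manifold_def by (auto simp: o_def inv_into_f_f)
qed

lemma pullback_in_smooth_functions:
  assumes M: "smooth_manifold M"
      and F: "\<And>U \<phi>. (U, \<phi>) \<in> atlas M \<Longrightarrow> smooth_param N (\<phi> ` U) (\<lambda>y. F (inv_into U \<phi> y))"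
    and f: "f \<in> smooth_functions N"
  shows "pullback M F f \<in> smooth_functions M"
proof (rule smooth_functions_chartI[OF M])
  fix U \<phi> assume c: "(U, \<phi>) \<in> atlas M"
  have "f (F (inv_into U \<phi> y)) = pullback M F f (inv_into U \<phi> y)" if "y \<in> \<phi> ` U" for y
    using chart_inv_in[OF that] chart_subset[OF M c] by (auto simp: pullback_def)
  from C_infinity_on_cong[OF chart_open_image[OF M c] this] smooth_param_function[OF F[OF c] f]
  show "C_infinity_on (\<phi> ` U) (\<lambda>y. pullback M F f (inv_into U \<phi> y))" by simp
qed (simp add: pullback_def)

lemma smooth_map_chart_param:
  assumes M: "smooth_manifold M" and N: "smooth_manifold N" and F: "smooth_map M N F" and c: "(U, \<phi>) \<in> atlas M"
  shows "smooth_param N (\<phi> ` U) (\<lambda>y. F (inv_into U \<phi> y))"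
proof (rule smooth_param_locally[OF chart_open_image[OF M c]])
  fix y assume y: "y \<in> \<phi> ` U"
  have Fc: "continuous_map (mtop M) (mtop N) F" using F unfolding smooth_map_def by blast
  have in1: "inv_into U \<phi> y \<in> topspace (mtop M)" if "y \<in> \<phi> ` U" for y
    using chart_inv_in[OF that] chart_subset[OF M c] by blast
  then have "F (inv_into U \<phi> y) \<in> topspace (mtop N)" using Fc y unfolding continuous_map_def by blast
  then obtain V \<psi> where d: "(V, \<psi>) \<in> atlas N" "F (inv_into U \<phi> y) \<in> V" using atlas_cover[OF N] by blast
  let ?W = "{x \<in> topspace (mtop M). F x \<in> V}"
  let ?P = "\<phi> ` (U \<inter> ?W)"
  have "openin (mtop M) ?W" by (rule openin_continuous_map_preimage[OF Fc chart_openin[OF N d(1)]])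
  then have P: "open ?P" by (rule chart_open_image_subset[OF M c])
  have "C_infinity_on (\<phi> ` (U \<inter> F -` V)) (\<lambda>y. \<psi> (F (inv_into U \<phi> y)))"
    using F c d(1) unfolding smooth_map_def o_def by blast
  then have C: "C_infinity_on ?P (\<lambda>y. \<psi> (F (inv_into U \<phi> y)))" by (rule C_infinity_on_subset) auto
  have "smooth_param N ?P (\<lambda>y. inv_into V \<psi> (\<psi> (F (inv_into U \<phi> y))))"
    by (rule smooth_param_compose[OF smooth_param_chart[OF N d(1)] P C]) (use chart_inv_left[OF M c] in auto)
  then have "smooth_param N ?P (\<lambda>y. F (inv_into U \<phi> y))"
    by (rule smooth_param_cong) (use chart_inv_left[OF M c] chart_inv_left[OF N d(1)] in auto)
  moreover have "y \<in> ?P"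
    using y d(2) chart_inv_in[OF y] in1[OF y] chart_inv_right[OF y] by (intro image_eqI[of _ _ "inv_into U \<phi> y"]) auto
  ultimately show "\<exists>P. y \<in> P \<and> smooth_param N P (\<lambda>y. F (inv_into U \<phi> y))"
    by (intro exI[of _ ?P] conjI)
qed

lemma smooth_map_pullback:
  assumes "smooth_manifold M" "smooth_manifold N" "smooth_map M N F" "f \<in> smooth_functions N"
  shows "pullback M F f \<in> smooth_functions M"
  using pullback_in_smooth_functions[OF assms(1) smooth_map_chart_param[OF assms(1-3)] assms(4)] .

text \<open>Smoothness of multiplication, given in product charts, is translated once and for all
  into products of parametrisations; translations, conjugations and one-parameter curves are then
  composed freely.\<close>

lemma smooth_param_mult:
  assumes G: "lie_group G M" and \<Phi>: "smooth_param M Q \<Phi>" and \<Psi>: "smooth_param M Q \<Psi>"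
  shows "smooth_param M Q (\<lambda>z. \<Phi> z \<otimes>\<^bsub>G\<^esub> \<Psi> z)"
proof (rule smooth_param_locally[OF smooth_param_open[OF \<Phi>]])
  have M: "smooth_manifold M" and T: "topspace (mtop M) = carrier G" and gr: "group G"
    and mu: "smooth_map (product_manifold M M) M (\<lambda>(x, y). x \<otimes>\<^bsub>G\<^esub> y)"
    using G unfolding lie_group_def by auto
  fix z0 assume z0: "z0 \<in> Q"
  let ?a = "\<Phi> z0" and ?b = "\<Psi> z0"
  have ab: "?a \<in> topspace (mtop M)" "?b \<in> topspace (mtop M)"
    using smooth_param_in[OF \<Phi> z0] smooth_param_in[OF \<Psi> z0] by auto
  then have "?a \<otimes>\<^bsub>G\<^esub> ?b \<in> topspace (mtop M)" using T gr by (simp add: group.is_monoid monoid.m_closed)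
  then obtain V \<psi> where d: "(V, \<psi>) \<in> atlas M" "?a \<otimes>\<^bsub>G\<^esub> ?b \<in> V" using atlas_cover[OF M] by blast
  obtain U1 \<phi>1 where c1: "(U1, \<phi>1) \<in> atlas M" "?a \<in> U1" using atlas_cover[OF M ab(1)] by blast
  obtain U2 \<phi>2 where c2: "(U2, \<phi>2) \<in> atlas M" "?b \<in> U2" using atlas_cover[OF M ab(2)] by blast
  have "continuous_map (prod_topology (mtop M) (mtop M)) (mtop M) (\<lambda>(x, y). x \<otimes>\<^bsub>G\<^esub> y)"
    using mu unfolding smooth_map_def product_manifold_def by simp
  then have op: "openin (prod_topology (mtop M) (mtop M))
      {p \<in> topspace (prod_topology (mtop M) (mtop M)). (\<lambda>(x, y). x \<otimes>\<^bsub>G\<^esub> y) p \<in> V}"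
    by (rule openin_continuous_map_preimage) (rule chart_openin[OF M d(1)])
  have inn: "(?a, ?b) \<in> {p \<in> topspace (prod_topology (mtop M) (mtop M)). (\<lambda>(x, y). x \<otimes>\<^bsub>G\<^esub> y) p \<in> V}"
    using ab d(2) by simp
  obtain W1 W2 where W: "openin (mtop M) W1" "openin (mtop M) W2" "?a \<in> W1" "?b \<in> W2"
      "W1 \<times> W2 \<subseteq> {p \<in> topspace (prod_topology (mtop M) (mtop M)). (\<lambda>(x, y). x \<otimes>\<^bsub>G\<^esub> y) p \<in> V}"
    using iffD1[OF openin_prod_topology_alt op, rule_format, OF inn] by auto
  have WV: "x \<otimes>\<^bsub>G\<^esub> y \<in> V" if "x \<in> W1" "y \<in> W2" for x y using W(5) that by auto
  let ?A = "\<phi>1 ` (U1 \<inter> W1) \<times> \<phi>2 ` (U2 \<inter> W2)"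
  have A: "open ?A"
    by (intro open_Times chart_open_image_subset[OF M c1(1) W(1)] chart_open_image_subset[OF M c2(1) W(2)])
  let ?m = "\<lambda>y. \<psi> (inv_into U1 \<phi>1 (fst y) \<otimes>\<^bsub>G\<^esub> inv_into U2 \<phi>2 (snd y))"
  have inv: "inv_into (U1 \<times> U2) (map_prod \<phi>1 \<phi>2) (\<phi>1 x, \<phi>2 y) = (x, y)" if "x \<in> U1" "y \<in> U2" for x y
    using inv_into_f_f[of "map_prod \<phi>1 \<phi>2" "U1 \<times> U2" "(x, y)"] that chart_inj_on[OF M c1(1)] chart_inj_on[OF M c2(1)]
    by (auto simp: map_prod_inj_on)
  have "(U1 \<times> U2, map_prod \<phi>1 \<phi>2) \<in> atlas (product_manifold M M)"
    using c1 c2 unfolding product_manifold_def by auto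
  then have "C_infinity_on (map_prod \<phi>1 \<phi>2 ` ((U1 \<times> U2) \<inter> (\<lambda>(x, y). x \<otimes>\<^bsub>G\<^esub> y) -` V))
      (\<psi> \<circ> (\<lambda>(x, y). x \<otimes>\<^bsub>G\<^esub> y) \<circ> inv_into (U1 \<times> U2) (map_prod \<phi>1 \<phi>2))"
    using mu d(1) unfolding smooth_map_def by blast
  then have "C_infinity_on ?A (\<psi> \<circ> (\<lambda>(x, y). x \<otimes>\<^bsub>G\<^esub> y) \<circ> inv_into (U1 \<times> U2) (map_prod
      \<phi>1 \<phi>2))"
  proof (rule C_infinity_on_subset)
    show "?A \<subseteq> map_prod \<phi>1 \<phi>2 ` ((U1 \<times> U2) \<inter> (\<lambda>(x, y). x \<otimes>\<^bsub>G\<^esub> y) -` V)"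
    proof
      fix y assume "y \<in> ?A"
      then obtain x1 x2 where "y = map_prod \<phi>1 \<phi>2 (x1, x2)" "x1 \<in> U1" "x1 \<in> W1" "x2 \<in> U2" "x2 \<in> W2" by auto
      then show "y \<in> map_prod \<phi>1 \<phi>2 ` ((U1 \<times> U2) \<inter> (\<lambda>(x, y). x \<otimes>\<^bsub>G\<^esub> y) -` V)"
        using WV by (intro image_eqI) auto
    qed
  qed
  moreover have mm: "(\<psi> \<circ> (\<lambda>(x, y). x \<otimes>\<^bsub>G\<^esub> y) \<circ> inv_into (U1 \<times> U2) (map_prod \<phi>1
      \<phi>2)) y = ?m y" if "y \<in> ?A" for y
    using that inv chart_inv_left[OF M c1(1)] chart_inv_left[OF M c2(1)] by auto
  ultimately have C: "C_infinity_on ?A ?m" by (simp only: C_infinity_on_cong[OF A mm])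
  let ?P = "{z \<in> Q. \<Phi> z \<in> U1 \<inter> W1} \<inter> {z \<in> Q. \<Psi> z \<in> U2 \<inter> W2}"
  have P: "open ?P"
    by (intro open_Int smooth_param_preimage_open[OF M \<Phi>] smooth_param_preimage_open[OF M \<Psi>] openin_Int W
        chart_openin[OF M c1(1)] chart_openin[OF M c2(1)])
  have "C_infinity_on ?P (\<lambda>z. \<phi>1 (\<Phi> z))"
    by (rule C_infinity_on_subset[OF smooth_param_coord[OF M \<Phi> c1(1)]]) auto
  moreover have "C_infinity_on ?P (\<lambda>z. \<phi>2 (\<Psi> z))"
    by (rule C_infinity_on_subset[OF smooth_param_coord[OF M \<Psi> c2(1)]]) auto
  ultimately have pr: "C_infinity_on ?P (\<lambda>z. (\<phi>1 (\<Phi> z), \<phi>2 (\<Psi> z)))" by (rule C_infinity_on_Pair[OF P])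
  have cm: "C_infinity_on ?P (\<lambda>z. ?m (\<phi>1 (\<Phi> z), \<phi>2 (\<Psi> z)))"
    by (rule C_infinity_on_compose[OF P A _ pr C]) auto
  have mz: "?m (\<phi>1 (\<Phi> z), \<phi>2 (\<Psi> z)) = \<psi> (\<Phi> z \<otimes>\<^bsub>G\<^esub> \<Psi> z)" if "z \<in> ?P" for z
    using that chart_inv_left[OF M c1(1)] chart_inv_left[OF M c2(1)] by auto
  have "smooth_param M ?P (\<lambda>z. inv_into V \<psi> (?m (\<phi>1 (\<Phi> z), \<phi>2 (\<Psi> z))))"
    by (rule smooth_param_compose[OF smooth_param_chart[OF M d(1)] P cm]) (use mz WV in auto)
  then have "smooth_param M ?P (\<lambda>z. \<Phi> z \<otimes>\<^bsub>G\<^esub> \<Psi> z)"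
  proof (rule smooth_param_cong)
    fix z assume z: "z \<in> ?P"
    show "inv_into V \<psi> (?m (\<phi>1 (\<Phi> z), \<phi>2 (\<Psi> z))) = \<Phi> z \<otimes>\<^bsub>G\<^esub> \<Psi> z"
      unfolding mz[OF z] by (rule chart_inv_left[OF M d(1)]) (use z WV in auto)
  qed
  moreover have "z0 \<in> ?P" using z0 c1 c2 W by auto
  ultimately show "\<exists>P. z0 \<in> P \<and> smooth_param M P (\<lambda>z. \<Phi> z \<otimes>\<^bsub>G\<^esub> \<Psi> z)"
    by (intro exI[of _ ?P] conjI)
qed

section \<open>Tangent vectors as point derivations, and submersions\<close>

lemma smooth_functions_zero_fun: "smooth_manifold M \<Longrightarrow> 0 \<in> smooth_functions M"
  using smooth_functions_const[of M 0] by (simp add: zero_fun_def)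

lemma smooth_functions_sum:
  assumes "smooth_manifold M" "\<And>i. i \<in> I \<Longrightarrow> f i \<in> smooth_functions M"
  shows "sum f I \<in> smooth_functions M"
  using assms(2)
  by (induction I rule: infinite_finite_induct)
    (simp_all add: smooth_functions_zero_fun[OF assms(1)] smooth_functions_add[OF assms(1)])

lemma sum_fun_apply: "sum f I x = (\<Sum>i\<in>I. f i x)" for f :: "'i \<Rightarrow> 'a \<Rightarrow> 'b::comm_monoid_add"
  by (induction I rule: infinite_finite_induct) auto

lemma tangent_space_add:
  "v \<in> tangent_space M p \<Longrightarrow> f \<in> smooth_functions M \<Longrightarrow> g \<in> smooth_functions M \<Longrightarrow> v
      (f + g) = v f + v g"
  and tangent_space_scaleR: "v \<in> tangent_space M p \<Longrightarrow> f \<in> smooth_functions M \<Longrightarrow> v (c *\<^sub>R f) = c * v f"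
  and tangent_space_times:
  "v \<in> tangent_space M p \<Longrightarrow> f \<in> smooth_functions M \<Longrightarrow> g \<in> smooth_functions M
    \<Longrightarrow> v (f * g) = f p * v g + g p * v f"
  and tangent_space_outside: "v \<in> tangent_space M p \<Longrightarrow> f \<notin> smooth_functions M \<Longrightarrow> v f = 0"
  unfolding tangent_space_def linear_map_on_def by auto

lemma tangent_space_zero: "smooth_manifold M \<Longrightarrow> v \<in> tangent_space M p \<Longrightarrow> v 0 = 0"
  using tangent_space_scaleR[of v M p 0 0] smooth_functions_zero_fun[of M] by simp

lemma tangent_space_sum:
  assumes "smooth_manifold M" "v \<in> tangent_space M p" "\<And>i. i \<in> I \<Longrightarrow> f i \<in> smooth_functions M"
  shows "v (sum f I) = (\<Sum>i\<in>I. v (f i))"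
  using assms(3)
proof (induction I rule: infinite_finite_induct)
  case (insert i I)
  have "v (f i + sum f I) = v (f i) + v (sum f I)"
    using insert.prems by (intro tangent_space_add[OF assms(2)] smooth_functions_sum[OF assms(1)]) auto
  moreover have "v (sum f I) = (\<Sum>i\<in>I. v (f i))" by (rule insert.IH) (simp add: insert.prems)
  ultimately show ?case by (simp only: sum.insert[OF insert.hyps])
qed (simp_all add: tangent_space_zero[OF assms(1,2)])

text \<open>A bump \<open>g\<close> supported in \<open>W\<close> has \<open>f * g = 0\<close> and
  \<open>g = 1\<close> near \<open>p\<close>; the Leibniz rule then leaves only
  \<open>v f\<close>.\<close>

lemma tangent_space_local:
  assumes M: "smooth_manifold M" and v: "v \<in> tangent_space M p" and f: "f \<in> smooth_functions M"
    and W: "openin (mtop M) W" "p \<in> W" "\<And>x. x \<in> W \<Longrightarrow> f x = 0"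
  shows "v f = 0"
proof -
  obtain g W' where g: "g \<in> smooth_functions M" "p \<in> W'" "\<And>x. x \<in> W' \<Longrightarrow> g x = 1" "\<And>x. x \<notin> W
      \<Longrightarrow> g x = 0"
    by (rule smooth_bump[OF M W(1,2)]) auto
  have "f x * g x = 0" for x using W(3)[of x] g(4)[of x] by (cases "x \<in> W") auto
  then have "f * g = 0" by (simp add: fun_eq_iff)
  then have "f p * v g + g p * v f = 0"
    using tangent_space_times[OF v f g(1)] tangent_space_zero[OF M v] by simp
  then show ?thesis using W(2,3) g(2,3) by simp
qed

lemma tangent_space_constant:
  assumes M: "smooth_manifold M" and v: "v \<in> tangent_space M p" and p: "p \<in> topspace (mtop M)"
  shows "v (\<lambda>x. if x \<in> topspace (mtop M) then 1 else 0) = 0"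
proof -
  let ?one = "\<lambda>x. if x \<in> topspace (mtop M) then 1 else (0::real)"
  have "?one * ?one = ?one" by (simp add: fun_eq_iff)
  then show ?thesis
    using tangent_space_times[OF v smooth_functions_const[OF M] smooth_functions_const[OF M], of 1 1] p by simp
qed

definition chart_vector ::
  "('a, 'e::euclidean_space) manifold \<Rightarrow> 'a set \<Rightarrow> ('a \<Rightarrow> 'e) \<Rightarrow> 'a \<Rightarrow> 'e
      \<Rightarrow> ('a \<Rightarrow> real) \<Rightarrow> real" where
  "chart_vector M U \<phi> p e =
    (\<lambda>f. if f \<in> smooth_functions M then frechet_derivative (\<lambda>y. f (inv_into U \<phi> y)) (at (\<phi> p)) e else 0)"

lemma smooth_function_chart_derivative:
  assumes "f \<in> smooth_functions M" "(U, \<phi>) \<in> atlas M" "p \<in> U"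
  shows "((\<lambda>y. f (inv_into U \<phi> y)) has_derivative frechet_derivative (\<lambda>y. f (inv_into U \<phi> y)) (at (\<phi> p)))
      (at (\<phi> p))"
  by (rule C_infinity_on_has_derivative[OF smooth_functionsD[OF assms(1,2)]]) (use assms(3) in simp)

lemma chart_vector_tangent:
  assumes M: "smooth_manifold M" and c: "(U, \<phi>) \<in> atlas M" "p \<in> U"
  shows "chart_vector M U \<phi> p e \<in> tangent_space M p"
proof -
  let ?D = "\<lambda>f. frechet_derivative (\<lambda>y. f (inv_into U \<phi> y)) (at (\<phi> p))"
  note D = smooth_function_chart_derivative[OF _ c]
  have 1: "?D (f + g) e = ?D f e + ?D g e" if "f \<in> smooth_functions M" "g \<in> smooth_functions M" for f g
    using frechet_derivative_at[OF has_derivative_add[OF D[OF that(1)] D[OF that(2)]]] by (simp add: fun_eq_iff)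
  have 2: "?D (a *\<^sub>R f) e = a * ?D f e" if "f \<in> smooth_functions M" for a f
    using frechet_derivative_at[OF has_derivative_scaleR_right[OF D[OF that], of a]]
    by (simp add: fun_eq_iff scaleR_fun_def)
  have 3: "?D (f * g) e = f p * ?D g e + g p * ?D f e" if "f \<in> smooth_functions M" "g \<in> smooth_functions M" for f g
    using frechet_derivative_at[OF has_derivative_mult[OF D[OF that(1)] D[OF that(2)]]] chart_inv_left[OF M c]
    by (simp add: fun_eq_iff mult.commute)
  show ?thesis
    unfolding tangent_space_def linear_map_on_def chart_vector_def
    using 1 2 3 smooth_functions_add[OF M] smooth_functions_scaleR[OF M] smooth_functions_times[OF M] by auto
qed

lemma chart_vector_coordinate:
  assumes M: "smooth_manifold M" and c: "(U, \<phi>) \<in> atlas M" "p \<in> U"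
  obtains X where "X \<in> smooth_functions M" "\<And>e. chart_vector M U \<phi> p e X = e \<bullet> b"
proof -
  have lin: "C_infinity_on (\<phi> ` U) (\<lambda>y. y \<bullet> b)"
    by (intro C_infinity_on_bounded_linear bounded_linear_inner_left chart_open_image[OF M c(1)])
  obtain f Q' where f: "f \<in> smooth_functions M" "open Q'" "\<phi> p \<in> Q'"
    "\<And>y. y \<in> Q' \<Longrightarrow> f (inv_into U \<phi> y) = y \<bullet> b"
    by (rule smooth_local_extension[OF M c(1) chart_open_image[OF M c(1)] subset_refl _ lin, of "\<phi> p"])
      (use c(2) in blast)+
  have "((\<lambda>y. y \<bullet> b) has_derivative (\<lambda>y. y \<bullet> b)) (at (\<phi> p))"
    by (rule bounded_linear_imp_has_derivative[OF bounded_linear_inner_left])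
  then have "((\<lambda>y. f (inv_into U \<phi> y)) has_derivative (\<lambda>y. y \<bullet> b)) (at (\<phi> p))"
    by (rule has_derivative_transform_within_open[OF _ f(2,3)]) (simp add: f(4))
  from frechet_derivative_at[OF this] have "chart_vector M U \<phi> p e f = e \<bullet> b" for e
    using f(1) by (simp add: chart_vector_def fun_eq_iff)
  then show ?thesis by (rule that[OF f(1)])
qed

lemma chart_vector_inj:
  assumes M: "smooth_manifold M" and c: "(U, \<phi>) \<in> atlas M" "p \<in> U"
    and eq: "chart_vector M U \<phi> p e = chart_vector M U \<phi> p e'"
  shows "e = e'"
proof (rule euclidean_eqI)
  fix b :: 'b assume "b \<in> Basis"
  obtain X where "\<And>e. chart_vector M U \<phi> p e X = e \<bullet> b"
    using chart_vector_coordinate[OF M c] by metis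
  then show "e \<bullet> b = e' \<bullet> b" using eq by metis
qed

text \<open>By Hadamard's lemma, near \<open>p\<close> a function is its value at \<open>p\<close>
  plus a sum of products \<open>X b * G b\<close> with \<open>X b p = 0\<close> and
  \<open>G b p\<close> a partial derivative. The Leibniz rule makes \<open>v f\<close> the
  derivative of \<open>f\<close> along \<open>e\<close>, whose coordinates are
  \<open>v (X b)\<close>. The local factors are first extended to global smooth functions, since
  \<open>v\<close> acts on those.\<close>

lemma tangent_representation:
  fixes M :: "('a, 'e::euclidean_space) manifold"
  assumes M: "smooth_manifold M" and c: "(U, \<phi>) \<in> atlas M" "p \<in> U" and v: "v \<in> tangent_space M p"
  shows "\<exists>e. v = chart_vector M U \<phi> p e"
proof -
  have pt: "p \<in> topspace (mtop M)" using chart_subset[OF M c(1)] c(2) by blast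
  obtain r where r: "r > 0" "ball (\<phi> p) r \<subseteq> \<phi> ` U"
    using chart_open_image[OF M c(1)] c(2) openE[of "\<phi> ` U" "\<phi> p"] by blast
  have ext: "\<exists>f Q'. f \<in> smooth_functions M \<and> open Q' \<and> \<phi> p \<in> Q' \<and> (\<forall>y\<in>Q'. f (inv_into U
      \<phi> y) = h y)"
    if C: "C_infinity_on (ball (\<phi> p) r) h" for h
  proof -
    obtain f Q' where "f \<in> smooth_functions M" "open Q'" "\<phi> p \<in> Q'"
        "\<And>y. y \<in> Q' \<Longrightarrow> f (inv_into U \<phi> y) = h y"
      by (rule smooth_local_extension[OF M c(1) open_ball r(2) _ C]) (use r(1) in auto)
    then show ?thesis by (intro exI[of _ f] exI[of _ Q']) auto
  qed
  have "\<forall>b::'e. \<exists>f Q'. f \<in> smooth_functions M \<and> open Q' \<and> \<phi> p \<in> Q' \<and>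
      (\<forall>y\<in>Q'. f (inv_into U \<phi> y) = (y + - \<phi> p) \<bullet> b)"
  proof
    fix b :: 'e
    show "\<exists>f Q'. f \<in> smooth_functions M \<and> open Q' \<and> \<phi> p \<in> Q' \<and> (\<forall>y\<in>Q'. f (inv_into U \<phi>
        y) = (y + - \<phi> p) \<bullet> b)"
      by (rule ext) (intro C_infinity_on_inner C_infinity_on_add C_infinity_on_id C_infinity_on_const open_ball)
  qed
  then obtain X QX where X: "\<And>b. X b \<in> smooth_functions M" "\<And>b. open (QX b)" "\<And>b. \<phi> p \<in> QX b"
      "\<And>b y. y \<in> QX b \<Longrightarrow> X b (inv_into U \<phi> y) = (y + - \<phi> p) \<bullet> b"
    by metis
  have Xp: "X b p = 0" for b using X(4)[OF X(3), of b] chart_inv_left[OF M c] by simp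
  define e where "e = (\<Sum>b\<in>Basis. v (X b) *\<^sub>R b)"
  have "v f = frechet_derivative (\<lambda>y. f (inv_into U \<phi> y)) (at (\<phi> p)) e" if f: "f \<in> smooth_functions M" for f
  proof -
    let ?k = "\<lambda>y. f (inv_into U \<phi> y)"
    have k: "C_infinity_on (ball (\<phi> p) r) ?k" by (rule C_infinity_on_subset[OF smooth_functionsD[OF f c(1)] r(2)])
    obtain g where g: "\<And>b. b \<in> Basis \<Longrightarrow> C_infinity_on (ball (\<phi> p) r) (g b)"
      "\<And>b. g b (\<phi> p) = frechet_derivative ?k (at (\<phi> p)) b"
      "\<And>y. y \<in> ball (\<phi> p) r \<Longrightarrow> ?k y = ?k (\<phi> p) + (\<Sum>b\<in>Basis. ((y - \<phi> p) \<bullet> b) * g b y)"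
      by (rule hadamard_quotients[OF k r(1)]) blast
    have "\<forall>b\<in>Basis. \<exists>f Q'. f \<in> smooth_functions M \<and> open Q' \<and> \<phi> p \<in> Q' \<and>
        (\<forall>y\<in>Q'. f (inv_into U \<phi> y) = g b y)"
      by (intro ballI ext g(1))
    then obtain G QG where G: "\<And>b. b \<in> Basis \<Longrightarrow> G b \<in> smooth_functions M" "\<And>b. b \<in> Basis
        \<Longrightarrow> open (QG b)"
        "\<And>b. b \<in> Basis \<Longrightarrow> \<phi> p \<in> QG b"
        "\<And>b y. b \<in> Basis \<Longrightarrow> y \<in> QG b \<Longrightarrow> G b (inv_into U \<phi> y) = g b y"
      by metis
    let ?one = "\<lambda>x. if x \<in> topspace (mtop M) then 1 else (0::real)"
    define h where "h = f p *\<^sub>R ?one + (\<Sum>b\<in>Basis. X b * G b)"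
    have XG: "(\<Sum>b\<in>Basis. X b * G b) \<in> smooth_functions M"
      by (intro smooth_functions_sum[OF M] smooth_functions_times[OF M] X(1) G(1))
    have one: "f p *\<^sub>R ?one \<in> smooth_functions M" by (intro smooth_functions_scaleR[OF M] smooth_functions_const[OF M])
    have h: "h \<in> smooth_functions M" unfolding h_def by (intro smooth_functions_add[OF M] one XG)
    define Q where "Q = ball (\<phi> p) r \<inter> (\<Inter>b\<in>Basis. QX b \<inter> QG b)"
    have "open Q" unfolding Q_def by (intro open_Int open_ball open_INT ballI X(2) G(2) finite_Basis)
    moreover have "\<phi> p \<in> Q" using X(3) G(3) r(1) by (auto simp: Q_def)
    ultimately have Q: "open Q" "\<phi> p \<in> Q" by auto
    have "v (f + (-1) *\<^sub>R h) = 0"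
    proof (rule tangent_space_local[OF M v _ chart_open_preimage[OF M c(1) Q(1)]])
      show "f + (-1) *\<^sub>R h \<in> smooth_functions M" by (intro smooth_functions_add[OF M] smooth_functions_scaleR[OF M] f h)
      show "p \<in> {x \<in> U. \<phi> x \<in> Q}" using c(2) Q(2) by simp
      fix x assume x: "x \<in> {x \<in> U. \<phi> x \<in> Q}"
      then have xt: "x \<in> topspace (mtop M)" using chart_subset[OF M c(1)] by blast
      have xx: "inv_into U \<phi> (\<phi> x) = x" using x chart_inv_left[OF M c(1)] by simp
      have "h x = f p + (\<Sum>b\<in>Basis. X b x * G b x)" using xt by (simp add: h_def sum_fun_apply scaleR_fun_def)
      also have "(\<Sum>b\<in>Basis. X b x * G b x) = (\<Sum>b\<in>Basis. ((\<phi> x - \<phi> p) \<bullet> b) * g b (\<phi> x))"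
      proof (rule sum.cong)
        fix b :: 'e assume b: "b \<in> Basis"
        have "\<phi> x \<in> QX b" "\<phi> x \<in> QG b" using x b by (auto simp: Q_def)
        then show "X b x * G b x = ((\<phi> x - \<phi> p) \<bullet> b) * g b (\<phi> x)"
          using X(4)[of "\<phi> x" b] G(4)[OF b, of "\<phi> x"] unfolding xx by simp
      qed simp
      also have "f p + \<dots> = f x"
        using g(3)[of "\<phi> x"] x chart_inv_left[OF M c] unfolding xx by (simp add: Q_def)
      finally show "(f + (-1) *\<^sub>R h) x = 0" by (simp add: scaleR_fun_def)
    qed
    then have "v f = v h"
      using tangent_space_add[OF v f smooth_functions_scaleR[OF M h, of "-1"]] tangent_space_scaleR[OF v h, of "-1"] by simp
    also have "\<dots> = (\<Sum>b\<in>Basis. v (X b * G b))"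
      unfolding h_def using tangent_space_add[OF v one XG] tangent_space_scaleR[OF v smooth_functions_const[OF M], of "f p" 1]
        tangent_space_constant[OF M v pt] tangent_space_sum[OF M v, of Basis "\<lambda>b. X b * G b"]
        smooth_functions_times[OF M X(1) G(1)] by simp
    also have "\<dots> = (\<Sum>b\<in>Basis. frechet_derivative ?k (at (\<phi> p)) b * v (X b))"
    proof (rule sum.cong)
      fix b :: 'e assume b: "b \<in> Basis"
      have "G b p = frechet_derivative ?k (at (\<phi> p)) b"
        using G(4)[OF b G(3)[OF b]] g(2)[of b] chart_inv_left[OF M c] by simp
      then show "v (X b * G b) = frechet_derivative ?k (at (\<phi> p)) b * v (X b)"
        using tangent_space_times[OF v X(1)[of b] G(1)[OF b]] Xp by simp
    qed simp
    also have "\<dots> = frechet_derivative ?k (at (\<phi> p)) e"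
      using has_derivative_linear[OF smooth_function_chart_derivative[OF f c]]
      by (simp add: e_def linear_sum linear_cmul mult.commute)
    finally show ?thesis .
  qed
  then have "v = chart_vector M U \<phi> p e"
    using tangent_space_outside[OF v] by (auto simp: chart_vector_def fun_eq_iff)
  then show ?thesis by blast
qed

lemma differential_chart_vector:
  assumes M: "smooth_manifold M" and N: "smooth_manifold N" and F: "smooth_map M N F"
    and c: "(U, \<phi>) \<in> atlas M" "p \<in> U" and d: "(V, \<psi>) \<in> atlas N" "F p \<in> V"
  shows "differential M N F (chart_vector M U \<phi> p e) =
    chart_vector N V \<psi> (F p) (frechet_derivative (\<lambda>y. \<psi> (F (inv_into U \<phi> y))) (at (\<phi> p)) e)"
proof
  fix f :: "'c \<Rightarrow> real"
  let ?k = "\<lambda>y. \<psi> (F (inv_into U \<phi> y))"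
  let ?f = "\<lambda>z. f (inv_into V \<psi> z)"
  show "differential M N F (chart_vector M U \<phi> p e) f =
    chart_vector N V \<psi> (F p) (frechet_derivative ?k (at (\<phi> p)) e) f"
  proof (cases "f \<in> smooth_functions N")
    case f: True
    note sp = smooth_map_chart_param[OF M N F c(1)]
    let ?P = "{y \<in> \<phi> ` U. F (inv_into U \<phi> y) \<in> V}"
    have P: "open ?P" by (rule smooth_param_preimage_open[OF N sp chart_openin[OF N d(1)]])
    have pp: "inv_into U \<phi> (\<phi> p) = p" by (rule chart_inv_left[OF M c])
    have cP: "\<phi> p \<in> ?P" using c d pp by auto
    have 1: "(?k has_derivative frechet_derivative ?k (at (\<phi> p))) (at (\<phi> p))"
      by (rule C_infinity_on_has_derivative[OF smooth_param_coord[OF N sp d(1)] cP])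
    have 2: "(?f has_derivative frechet_derivative ?f (at (\<psi> (F p)))) (at (?k (\<phi> p)))"
      unfolding pp by (rule smooth_function_chart_derivative[OF f d])
    have "((\<lambda>y. pullback M F f (inv_into U \<phi> y)) has_derivative
       (\<lambda>v. frechet_derivative ?f (at (\<psi> (F p))) (frechet_derivative ?k (at (\<phi> p)) v))) (at (\<phi> p))"
    proof (rule has_derivative_transform_within_open[OF _ P cP])
      show "((\<lambda>y. ?f (?k y)) has_derivative
        (\<lambda>v. frechet_derivative ?f (at (\<psi> (F p))) (frechet_derivative ?k (at (\<phi> p)) v))) (at (\<phi> p))"
        using diff_chain_at[OF 1 2] by (simp add: o_def)
      fix y assume y: "y \<in> ?P"
      have "inv_into U \<phi> y \<in> topspace (mtop M)" using y chart_inv_in[of y \<phi> U] chart_subset[OF M c(1)] by blast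
      then show "?f (?k y) = pullback M F f (inv_into U \<phi> y)"
        using y chart_inv_left[OF N d(1)] by (simp add: pullback_def)
    qed
    from frechet_derivative_at[OF this]
    show ?thesis
      using f smooth_map_pullback[OF M N F f] by (simp add: differential_def chart_vector_def fun_eq_iff)
  qed (simp add: differential_def chart_vector_def)
qed

text \<open>A submersion has smooth local sections: along the affine slice \<open>j\<close> through
  \<open>\<phi> p\<close>, directed by a right inverse of the differential, the map in charts has
  invertible derivative and so a smooth local inverse \<open>h\<close>. Along this section
  \<open>g\<close> is a composite of its pullback with smooth maps.\<close>

lemma smooth_function_from_pullback:
  fixes M :: "('a, 'e::euclidean_space) manifold" and N :: "('b, 'f::euclidean_space) manifold"
  assumes M: "smooth_manifold M" and N: "smooth_manifold N" and F: "smooth_submersion M N F"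
    and surj: "F ` topspace (mtop M) = topspace (mtop N)"
    and z: "\<And>x. x \<notin> topspace (mtop N) \<Longrightarrow> g x = 0" and g: "pullback M F g \<in> smooth_functions M"
  shows "g \<in> smooth_functions N"
proof (rule smooth_functionsI[OF N z])
  have Fs: "smooth_map M N F" and Fd: "\<And>p. p \<in> topspace (mtop M) \<Longrightarrow>
      differential M N F ` tangent_space M p = tangent_space N (F p)"
    using F unfolding smooth_submersion_def by auto
  fix q0 assume "q0 \<in> topspace (mtop N)"
  then have "q0 \<in> F ` topspace (mtop M)" using surj by simp
  then obtain p where p: "p \<in> topspace (mtop M)" "F p = q0" by auto
  obtain U \<phi> where c: "(U, \<phi>) \<in> atlas M" "p \<in> U" using atlas_cover[OF M p(1)] by blast
  obtain V \<psi> where d: "(V, \<psi>) \<in> atlas N" "q0 \<in> V" using atlas_cover[OF N \<open>q0 \<in> topspace (mtop N)\<close>] by blast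
  have d': "F p \<in> V" using d p by simp
  let ?k = "\<lambda>y. \<psi> (F (inv_into U \<phi> y))"
  note sp = smooth_map_chart_param[OF M N Fs c(1)]
  let ?P = "{y \<in> \<phi> ` U. F (inv_into U \<phi> y) \<in> V}"
  have P: "open ?P" by (rule smooth_param_preimage_open[OF N sp chart_openin[OF N d(1)]])
  have pp: "inv_into U \<phi> (\<phi> p) = p" by (rule chart_inv_left[OF M c])
  have cP: "\<phi> p \<in> ?P" using c d' pp by auto
  have kC: "C_infinity_on ?P ?k" by (rule smooth_param_coord[OF N sp d(1)])
  let ?A = "frechet_derivative ?k (at (\<phi> p))"
  have kd: "(?k has_derivative ?A) (at (\<phi> p))" by (rule C_infinity_on_has_derivative[OF kC cP])
  have "surj ?A"
    unfolding surj_def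
  proof
    fix e' :: 'f
    have "chart_vector N V \<psi> (F p) e' \<in> differential M N F ` tangent_space M p"
      using Fd[OF p(1)] chart_vector_tangent[OF N d(1) d'] by blast
    then obtain v where v: "v \<in> tangent_space M p" "chart_vector N V \<psi> (F p) e' = differential M N F v" by blast
    obtain e where "v = chart_vector M U \<phi> p e" using tangent_representation[OF M c v(1)] by blast
    then have "chart_vector N V \<psi> (F p) e' = chart_vector N V \<psi> (F p) (?A e)"
      using v(2) differential_chart_vector[OF M N Fs c d(1) d'] by simp
    then have "e' = ?A e" by (rule chart_vector_inj[OF N d(1) d'])
    then show "\<exists>e. e' = ?A e" by (rule exI)
  qed
  then obtain R where R: "linear R" "?A \<circ> R = id"
    using linear_surjective_right_inverse[OF has_derivative_linear[OF kd]] by blast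
  have bR: "bounded_linear R" using R(1) linear_conv_bounded_linear by blast
  define z0 where "z0 = \<psi> q0"
  define j where "j = (\<lambda>z. \<phi> p + R (z + - z0))"
  have jC: "C_infinity_on UNIV j"
    unfolding j_def
    by (intro C_infinity_on_add C_infinity_on_const open_UNIV C_infinity_on_linear_compose[OF bR] C_infinity_on_id)
  have j0: "j z0 = \<phi> p" using linear_0[OF R(1)] by (simp add: j_def)
  have jd: "(j has_derivative R) (at z0)"
    unfolding j_def
    by (rule has_derivative_eq_rhs[OF has_derivative_add[OF has_derivative_const
            bounded_linear.has_derivative[OF bR has_derivative_add[OF has_derivative_ident has_derivative_const]]]]) simp
  define Q where "Q = j -` ?P"
  have Q: "open Q" unfolding Q_def
    by (rule open_vimage[OF P C_infinity_on_imp_continuous_on[OF jC]])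
  have z0Q: "z0 \<in> Q" unfolding Q_def vimage_eq j0 by (rule cP)
  have jQ: "C_infinity_on Q j" by (rule C_infinity_on_subset[OF jC]) simp
  define k where "k = (\<lambda>z. ?k (j z))"
  have kQ: "C_infinity_on Q k"
    unfolding k_def by (rule C_infinity_on_compose[OF Q P _ jQ kC]) (auto simp: Q_def)
  have "(k has_derivative (\<lambda>v. ?A (R v))) (at z0)"
    unfolding k_def using diff_chain_at[OF jd, of ?k ?A] kd j0 by (simp add: o_def)
  then have "frechet_derivative k (at z0) = (\<lambda>v. v)"
    using frechet_derivative_at R(2) by (metis (no_types, lifting) comp_apply eq_id_iff ext)
  then have inj: "\<And>v. frechet_derivative k (at z0) v = 0 \<Longrightarrow> v = 0" by simp
  have k0: "k z0 = z0" unfolding k_def j0 pp using p by (simp add: z0_def)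
  obtain U' V' h where h: "open U'" "U' \<subseteq> Q" "z0 \<in> U'" "open V'" "k z0 \<in> V'" "homeomorphism U' V' k h"
    "C_infinity_on V' h"
    by (rule smooth_inverse_function[OF Q kQ z0Q inj]) blast
  let ?W = "{x \<in> V. \<psi> x \<in> V'}"
  have W: "openin (mtop N) ?W" by (rule chart_open_preimage[OF N d(1) h(4)])
  have "q0 \<in> ?W" using d(2) h(5) k0 by (simp add: z0_def)
  have hU: "h y \<in> U'" "k (h y) = y" if "y \<in> V'" for y
    using h(6) that unfolding homeomorphism_def by auto
  have W': "open (\<psi> ` ?W)"
    using chart_open_image_subset[OF N d(1) W] by (simp add: Int_def conj_ac cong: conj_cong)
  have "C_infinity_on (\<psi> ` ?W) (\<lambda>y. g (inv_into V \<psi> y))"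
  proof -
    let ?g = "\<lambda>y. pullback M F g (inv_into U \<phi> (j (h y)))"
    have hW: "C_infinity_on (\<psi> ` ?W) h" by (rule C_infinity_on_subset[OF h(7)]) auto
    have jh: "C_infinity_on (\<psi> ` ?W) (\<lambda>y. j (h y))"
      by (rule C_infinity_on_compose[OF W' open_UNIV _ hW jC]) auto
    have "C_infinity_on (\<psi> ` ?W) ?g"
    proof (rule C_infinity_on_compose[OF W' chart_open_image[OF M c(1)] _ jh smooth_functionsD[OF g c(1)]])
      show "(\<lambda>y. j (h y)) ` \<psi> ` ?W \<subseteq> \<phi> ` U"
      proof
        fix x assume "x \<in> (\<lambda>y. j (h y)) ` \<psi> ` ?W"
        then obtain y where y: "x = j (h y)" "y \<in> V'" by blast
        then have "h y \<in> Q" using hU(1) h(2) by blast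
        then show "x \<in> \<phi> ` U" using y(1) by (simp add: Q_def)
      qed
    qed
    moreover have eq: "?g y = g (inv_into V \<psi> y)" if y: "y \<in> \<psi> ` ?W" for y
    proof -
      have yV: "y \<in> V'" "y \<in> \<psi> ` V" using y by auto
      have hQ: "j (h y) \<in> ?P" using hU(1)[OF yV(1)] h(2) by (auto simp: Q_def)
      then have "inv_into U \<phi> (j (h y)) \<in> topspace (mtop M)"
        using chart_inv_in[of "j (h y)" \<phi> U] chart_subset[OF M c(1)] by blast
      then have "?g y = g (F (inv_into U \<phi> (j (h y))))" by (simp add: pullback_def)
      also have "F (inv_into U \<phi> (j (h y))) = inv_into V \<psi> (k (h y))"
        unfolding k_def using hQ chart_inv_left[OF N d(1)] by simp
      finally show ?thesis using hU(2)[OF yV(1)] by simp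
    qed
    ultimately show ?thesis by (simp only: C_infinity_on_cong[OF W' eq])
  qed
  then show "\<exists>U \<phi> W. (U, \<phi>) \<in> atlas N \<and> openin (mtop N) W \<and> q0 \<in> W \<and> W \<subseteq> U \<and>
      C_infinity_on (\<phi> ` W) (\<lambda>y. g (inv_into U \<phi> y))"
    using d W \<open>q0 \<in> ?W\<close> by (intro exI[of _ V] exI[of _ \<psi>] exI[of _ ?W] conjI) auto
qed

lemma frechet_derivative_partial_snd:
  assumes "C_infinity_on Q g" "(x, y) \<in> Q"
  shows "((\<lambda>y. g (x, y)) has_derivative (\<lambda>e. frechet_derivative g (at (x, y)) (0, e))) (at y)"
proof -
  have "((\<lambda>y. (x, y)) has_derivative (\<lambda>e. (0, e))) (at y)"
    by (auto intro!: derivative_eq_intros)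
  from diff_chain_at[OF this C_infinity_on_has_derivative[OF assms]] show ?thesis by (simp add: o_def)
qed

lemma frechet_derivative_partial_fst:
  assumes "C_infinity_on Q g" "(x, y) \<in> Q"
  shows "((\<lambda>x. g (x, y)) has_derivative (\<lambda>e. frechet_derivative g (at (x, y)) (e, 0))) (at x)"
proof -
  have "((\<lambda>x. (x, y)) has_derivative (\<lambda>e. (e, 0))) (at x)"
    by (auto intro!: derivative_eq_intros)
  from diff_chain_at[OF this C_infinity_on_has_derivative[OF assms]] show ?thesis by (simp add: o_def)
qed

lemma scaleR_fun_apply: "(c *\<^sub>R f) x = c *\<^sub>R f x"
  by (simp add: scaleR_fun_def)

lemma vector_field_tangent:
  assumes "X \<in> vector_fields M" "p \<in> topspace (mtop M)"
  shows "(\<lambda>f. X f p) \<in> tangent_space M p"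
  using assms unfolding vector_fields_def tangent_space_def linear_map_on_def
  by (auto simp: scaleR_fun_def)

lemma vector_field_in: "X \<in> vector_fields M \<Longrightarrow> f \<in> smooth_functions M \<Longrightarrow> X f \<in> smooth_functions M"
  unfolding vector_fields_def linear_map_on_def by auto

lemma vector_field_outside: "X \<in> vector_fields M \<Longrightarrow> f \<notin> smooth_functions M \<Longrightarrow> X f = 0"
  unfolding vector_fields_def by auto

section \<open>Left-invariant fields and the adjoint representation\<close>

locale smooth_lie_group = group G for G :: "'g monoid" (structure) +
  fixes M :: "('g, 'e::euclidean_space) manifold"
  assumes lie: "lie_group G M"
begin

lemma mfd: "smooth_manifold M" and top_carrier: "topspace (mtop M) = carrier G"
  using lie unfolding lie_group_def by auto

lemma smooth_param_times:
  "smooth_param M Q \<Phi> \<Longrightarrow> smooth_param M Q \<Psi> \<Longrightarrow> smooth_param M Q (\<lambda>z. \<Phi> z \<otimes> \<Psi> z)"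
  by (rule smooth_param_mult[OF lie])

lemma smooth_param_const': "open Q \<Longrightarrow> a \<in> carrier G \<Longrightarrow> smooth_param M Q (\<lambda>z. a)"
  by (rule smooth_param_const) (simp_all add: top_carrier)

lemma pullback_left_right:
  assumes "a \<in> carrier G" "b \<in> carrier G" "f \<in> smooth_functions M"
  shows "pullback M (\<lambda>x. a \<otimes> x \<otimes> b) f \<in> smooth_functions M"
  by (rule pullback_in_smooth_functions[OF mfd _ assms(3)])
    (intro smooth_param_times smooth_param_const' smooth_param_chart[OF mfd] chart_open_image[OF mfd] assms(1,2), assumption+)

lemma pullback_left:
  assumes "a \<in> carrier G" "f \<in> smooth_functions M"
  shows "pullback M (\<lambda>x. a \<otimes> x) f \<in> smooth_functions M"
  by (rule pullback_in_smooth_functions[OF mfd _ assms(2)])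
    (intro smooth_param_times smooth_param_const' smooth_param_chart[OF mfd] chart_open_image[OF mfd] assms(1), assumption+)

lemma lie_algebra_vector_field: "X \<in> lie_algebra G M \<Longrightarrow> X \<in> vector_fields M"
  unfolding lie_algebra_def by simp

lemma lie_algebra_left_invariant:
  "X \<in> lie_algebra G M \<Longrightarrow> a \<in> carrier G \<Longrightarrow> f \<in> smooth_functions M \<Longrightarrow>
    X (pullback M (\<lambda>x. a \<otimes> x) f) = pullback M (\<lambda>x. a \<otimes> x) (X f)"
  unfolding lie_algebra_def by simp

lemma lie_algebra_at:
  assumes "X \<in> lie_algebra G M" "a \<in> carrier G" "x \<in> carrier G" "f \<in> smooth_functions M"
  shows "X (pullback M (\<lambda>x. a \<otimes> x) f) x = X f (a \<otimes> x)"
  using lie_algebra_left_invariant[OF assms(1,2,4)] assms(3) by (simp add: pullback_def top_carrier)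

definition U0 :: "'g set" where "U0 = (SOME U. \<exists>\<phi>. (U, \<phi>) \<in> atlas M \<and> \<one> \<in> U)"
definition \<phi>0 :: "'g \<Rightarrow> 'e" where "\<phi>0 = (SOME \<phi>. (U0, \<phi>) \<in> atlas M)"
definition \<kappa>0 :: "'e \<Rightarrow> 'g" where "\<kappa>0 = inv_into U0 \<phi>0"
definition y0 :: 'e where "y0 = \<phi>0 \<one>"

lemma chart0: "(U0, \<phi>0) \<in> atlas M" and one_U0: "\<one> \<in> U0"
proof -
  obtain U \<phi> where "(U, \<phi>) \<in> atlas M" "\<one> \<in> U" using atlas_cover[OF mfd, of \<one>] top_carrier by auto
  then have "\<exists>U. \<exists>\<phi>. (U, \<phi>) \<in> atlas M \<and> \<one> \<in> U" by (intro exI conjI)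
  then have *: "\<exists>\<phi>. (U0, \<phi>) \<in> atlas M \<and> \<one> \<in> U0" unfolding U0_def by (rule someI_ex)
  then show "\<one> \<in> U0" by (elim exE conjE)
  from * have "\<exists>\<phi>. (U0, \<phi>) \<in> atlas M" by (elim exE conjE) (rule exI)
  then show "(U0, \<phi>0) \<in> atlas M" unfolding \<phi>0_def by (rule someI_ex)
qed

lemma open_chart0: "open (\<phi>0 ` U0)" by (rule chart_open_image[OF mfd chart0])

lemma \<kappa>0_in: "y \<in> \<phi>0 ` U0 \<Longrightarrow> \<kappa>0 y \<in> U0" unfolding \<kappa>0_def by (rule chart_inv_in)

lemma U0_carrier: "x \<in> U0 \<Longrightarrow> x \<in> carrier G" using chart_subset[OF mfd chart0] top_carrier by blast

lemma \<phi>0_\<kappa>0: "y \<in> \<phi>0 ` U0 \<Longrightarrow> \<phi>0 (\<kappa>0 y) = y" unfolding \<kappa>0_def by (rule chart_inv_right)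

lemma \<kappa>0_\<phi>0: "x \<in> U0 \<Longrightarrow> \<kappa>0 (\<phi>0 x) = x" unfolding \<kappa>0_def by (rule chart_inv_left[OF mfd chart0])

lemma y0_in: "y0 \<in> \<phi>0 ` U0" unfolding y0_def using one_U0 by simp

lemma \<kappa>0_y0: "\<kappa>0 y0 = \<one>" unfolding y0_def by (rule \<kappa>0_\<phi>0[OF one_U0])

lemma smooth_param_\<kappa>0: "smooth_param M (\<phi>0 ` U0) \<kappa>0"
  unfolding \<kappa>0_def by (rule smooth_param_chart[OF mfd chart0])

abbreviation vec0 :: "'e \<Rightarrow> ('g \<Rightarrow> real) \<Rightarrow> real" where "vec0 \<equiv> chart_vector M U0 \<phi>0 \<one>"

lemma vec0_eq: "f \<in> smooth_functions M \<Longrightarrow> vec0 e f = frechet_derivative (\<lambda>y. f (\<kappa>0 y)) (at y0) e"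
  by (simp add: chart_vector_def \<kappa>0_def y0_def)

text \<open>The coordinates of a left-invariant field at the identity. They identify the Lie algebra
  with \<open>'e\<close>, which supplies a norm and derivatives; \<open>left_field\<close> is the
  inverse.\<close>

definition cvec :: "(('g \<Rightarrow> real) \<Rightarrow> ('g \<Rightarrow> real)) \<Rightarrow> 'e" where
  "cvec X = (SOME e. (\<lambda>f. X f \<one>) = vec0 e)"

lemma cvec:
  assumes "X \<in> lie_algebra G M" shows "X f \<one> = vec0 (cvec X) f"
proof -
  have "\<exists>e. (\<lambda>f. X f \<one>) = vec0 e"
    by (rule tangent_representation[OF mfd chart0 one_U0 vector_field_tangent[OF lie_algebra_vector_field[OF assms]]])
      (simp add: top_carrier)
  then have "(\<lambda>f. X f \<one>) = vec0 (cvec X)" unfolding cvec_def by (rule someI_ex)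
  then show ?thesis by (rule fun_cong)
qed

lemma vec0_inj: "vec0 e = vec0 e' \<Longrightarrow> e = e'"
  by (rule chart_vector_inj[OF mfd chart0 one_U0])

lemma lie_algebra_eval:
  assumes "X \<in> lie_algebra G M" "a \<in> carrier G" "f \<in> smooth_functions M"
  shows "X f a = vec0 (cvec X) (pullback M (\<lambda>x. a \<otimes> x) f)"
  using lie_algebra_at[OF assms(1,2) one_closed assms(3)] cvec[OF assms(1)] assms(2) by simp

lemma lie_algebra_zero_outside:
  assumes "X \<in> lie_algebra G M" shows "f \<notin> smooth_functions M \<Longrightarrow> X f = 0"
    and "x \<notin> carrier G \<Longrightarrow> X f x = 0"
proof -
  have X: "X \<in> vector_fields M" by (rule lie_algebra_vector_field[OF assms])
  show 1: "f \<notin> smooth_functions M \<Longrightarrow> X f = 0" by (rule vector_field_outside[OF X])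
  show "x \<notin> carrier G \<Longrightarrow> X f x = 0"
  proof (cases "f \<in> smooth_functions M")
    case True
    then show "x \<notin> carrier G \<Longrightarrow> X f x = 0"
      using smooth_functions_zero[OF vector_field_in[OF X True]] top_carrier by simp
  qed (simp add: 1)
qed

lemma cvec_inj:
  assumes "X \<in> lie_algebra G M" "Y \<in> lie_algebra G M" "cvec X = cvec Y" shows "X = Y"
proof (rule ext, rule ext)
  fix f x
  show "X f x = Y f x"
  proof (cases "f \<in> smooth_functions M \<and> x \<in> carrier G")
    case True
    then show ?thesis using lie_algebra_eval[OF assms(1)] lie_algebra_eval[OF assms(2)] assms(3) by simp
  next
    case False
    then show ?thesis using lie_algebra_zero_outside[OF assms(1)] lie_algebra_zero_outside[OF assms(2)] by auto
  qed
qed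

definition left_field :: "'e \<Rightarrow> ('g \<Rightarrow> real) \<Rightarrow> ('g \<Rightarrow> real)" where
  "left_field e f = (if f \<in> smooth_functions M then
     (\<lambda>a. if a \<in> carrier G then vec0 e (pullback M (\<lambda>x. a \<otimes> x) f) else 0) else 0)"

text \<open>The value at \<open>x\<close> is the derivative of \<open>f (x y)\<close> in
  \<open>y\<close> at the identity, a partial derivative of a function that is jointly smooth in
  charts.\<close>

lemma smooth_left_field:
  assumes f: "f \<in> smooth_functions M" shows "left_field e f \<in> smooth_functions M"
proof (rule smooth_functions_chartI[OF mfd])
  show "left_field e f x = 0" if "x \<notin> topspace (mtop M)" for x
    using that f top_carrier by (simp add: left_field_def)
  fix U \<phi> assume c: "(U, \<phi>) \<in> atlas M"
  let ?Q = "\<phi> ` U \<times> \<phi>0 ` U0"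
  define g where "g = (\<lambda>z. f (inv_into U \<phi> (fst z) \<otimes> \<kappa>0 (snd z)))"
  have Q: "open ?Q" by (intro open_Times open_chart0 chart_open_image[OF mfd c])
  have "smooth_param M ?Q (\<lambda>z. inv_into U \<phi> (fst z) \<otimes> \<kappa>0 (snd z))"
  proof (intro smooth_param_times)
    show "smooth_param M ?Q (\<lambda>z. inv_into U \<phi> (fst z))"
      by (rule smooth_param_compose[OF smooth_param_chart[OF mfd c] Q C_infinity_on_bounded_linear[OF bounded_linear_fst Q]]) auto
    show "smooth_param M ?Q (\<lambda>z. \<kappa>0 (snd z))"
      by (rule smooth_param_compose[OF smooth_param_\<kappa>0 Q C_infinity_on_bounded_linear[OF bounded_linear_snd Q]]) auto
  qed
  from smooth_param_function[OF this f] have g: "C_infinity_on ?Q g" unfolding g_def .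
  have "C_infinity_on (\<phi> ` U) (\<lambda>y. frechet_derivative g (at (y, y0)) (0, e))"
    by (rule C_infinity_on_compose[OF chart_open_image[OF mfd c] Q _ _ C_infinity_on_frechet[OF g]])
      (use y0_in in \<open>auto intro!: C_infinity_on_Pair chart_open_image[OF mfd c] C_infinity_on_id\<close>)
  moreover have eq: "frechet_derivative g (at (y, y0)) (0, e) = left_field e f (inv_into U \<phi> y)" if y: "y \<in> \<phi> ` U" for y
  proof -
    have a: "inv_into U \<phi> y \<in> carrier G"
      using chart_inv_in[OF y] chart_subset[OF mfd c] top_carrier by blast
    have "((\<lambda>y'. g (y, y')) has_derivative (\<lambda>e. frechet_derivative g (at (y, y0)) (0, e))) (at y0)"
      by (rule frechet_derivative_partial_snd[OF g]) (use y y0_in in auto)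
    then have "((\<lambda>y'. pullback M (\<lambda>x. inv_into U \<phi> y \<otimes> x) f (\<kappa>0 y')) has_derivative
        (\<lambda>e. frechet_derivative g (at (y, y0)) (0, e))) (at y0)"
      by (rule has_derivative_transform_within_open[OF _ open_chart0 y0_in])
        (simp add: g_def pullback_def top_carrier U0_carrier[OF \<kappa>0_in])
    from frechet_derivative_at[OF this] show ?thesis
      using f a vec0_eq[OF pullback_left[OF a f]] by (simp add: left_field_def fun_eq_iff)
  qed
  ultimately show "C_infinity_on (\<phi> ` U) (\<lambda>y. left_field e f (inv_into U \<phi> y))"
    by (simp only: C_infinity_on_cong[OF chart_open_image[OF mfd c] eq])
qed

lemma pullback_add: "pullback M F (f + g) = pullback M F f + pullback M F g"
  and pullback_times: "pullback M F (f * g) = pullback M F f * pullback M F g"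
  and pullback_scaleR: "pullback M F (c *\<^sub>R f) = c *\<^sub>R pullback M F f"
  by (auto simp: pullback_def fun_eq_iff scaleR_fun_def)

lemma left_field_lie_algebra: "left_field e \<in> lie_algebra G M"
proof -
  have v: "vec0 e \<in> tangent_space M \<one>" by (rule chart_vector_tangent[OF mfd chart0 one_U0])
  have *: "pullback M (\<lambda>x. a \<otimes> x) f a' = f (a \<otimes> a')" if "a' \<in> carrier G" for a a' f
    using that by (simp add: pullback_def top_carrier)
  have "left_field e \<in> vector_fields M"
    unfolding vector_fields_def linear_map_on_def mem_Collect_eq
  proof (intro conjI ballI allI impI)
    show "left_field e \<in> smooth_functions M \<rightarrow> smooth_functions M" using smooth_left_field by auto
    fix f g assume f: "f \<in> smooth_functions M" and g: "g \<in> smooth_functions M"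
    show "left_field e (f + g) = left_field e f + left_field e g"
      using f g smooth_functions_add[OF mfd f g] tangent_space_add[OF v] pullback_left
      by (auto simp: left_field_def fun_eq_iff pullback_add)
    show "left_field e (f * g) = f * left_field e g + g * left_field e f"
      using f g smooth_functions_times[OF mfd f g] tangent_space_times[OF v] pullback_left *
      by (auto simp: left_field_def fun_eq_iff pullback_times)
  next
    fix c f assume f: "f \<in> smooth_functions M"
    show "left_field e (c *\<^sub>R f) = c *\<^sub>R left_field e f"
      using f smooth_functions_scaleR[OF mfd f] tangent_space_scaleR[OF v] pullback_left
      by (auto simp: left_field_def fun_eq_iff pullback_scaleR scaleR_fun_apply)
  qed (simp add: left_field_def)
  moreover have "left_field e (pullback M (\<lambda>x. a \<otimes> x) f) = pullback M (\<lambda>x. a \<otimes> x) (left_field e f)"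
    if a: "a \<in> carrier G" and f: "f \<in> smooth_functions M" for a f
  proof
    fix b
    show "left_field e (pullback M (\<lambda>x. a \<otimes> x) f) b = pullback M (\<lambda>x. a \<otimes> x) (left_field e f) b"
    proof (cases "b \<in> carrier G")
      case b: True
      have "pullback M (\<lambda>x. b \<otimes> x) (pullback M (\<lambda>x. a \<otimes> x) f) = pullback M (\<lambda>x. a \<otimes> b \<otimes> x) f"
        using a b by (auto simp: pullback_def fun_eq_iff top_carrier m_assoc)
      then have "left_field e (pullback M (\<lambda>x. a \<otimes> x) f) b = left_field e f (a \<otimes> b)"
        using a b f pullback_left[OF a f] by (simp add: left_field_def)
      then show ?thesis using *[OF b] by simp
    next
      case False
      then have "pullback M (\<lambda>x. a \<otimes> x) (left_field e f) b = 0" by (simp add: pullback_def top_carrier)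
      then show ?thesis using False by (simp add: left_field_def)
    qed
  qed
  ultimately show ?thesis unfolding lie_algebra_def by simp
qed

lemma left_field_one: "f \<in> smooth_functions M \<Longrightarrow> left_field e f \<one> = vec0 e f"
proof -
  assume f: "f \<in> smooth_functions M"
  have "pullback M (\<lambda>x. \<one> \<otimes> x) f = f"
    using smooth_functions_zero[OF f] by (auto simp: pullback_def fun_eq_iff top_carrier)
  then show ?thesis using f by (simp add: left_field_def)
qed

lemma cvec_left_field: "cvec (left_field e) = e"
proof (rule vec0_inj, rule ext)
  fix f
  show "vec0 (cvec (left_field e)) f = vec0 e f"
  proof (cases "f \<in> smooth_functions M")
    case True
    then show ?thesis using cvec[OF left_field_lie_algebra, of e f] left_field_one by simp
  next
    case False
    then show ?thesis by (simp add: chart_vector_def)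
  qed
qed

lemma left_field_cvec: "X \<in> lie_algebra G M \<Longrightarrow> left_field (cvec X) = X"
  by (rule cvec_inj[OF left_field_lie_algebra _ cvec_left_field])

lemma vec0_linear:
  assumes "f \<in> smooth_functions M"
  shows "linear (\<lambda>e. vec0 e f)"
  using has_derivative_linear[OF smooth_function_chart_derivative[OF assms chart0 one_U0]] assms
  by (simp add: chart_vector_def)

lemma left_field_add: "left_field (e + e') = left_field e + left_field e'"
  by (auto simp: left_field_def fun_eq_iff linear_add[OF vec0_linear[OF pullback_left]])

lemma left_field_scaleR: "left_field (c *\<^sub>R e) = c *\<^sub>R left_field e"
  by (auto simp: left_field_def fun_eq_iff scaleR_fun_def linear_cmul[OF vec0_linear[OF pullback_left]])

lemma lie_algebra_add: "X \<in> lie_algebra G M \<Longrightarrow> Y \<in> lie_algebra G M \<Longrightarrow> X + Y \<in> lie_algebra G M"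
  and cvec_add: "X \<in> lie_algebra G M \<Longrightarrow> Y \<in> lie_algebra G M \<Longrightarrow> cvec (X + Y) = cvec X + cvec Y"
proof -
  assume "X \<in> lie_algebra G M" "Y \<in> lie_algebra G M"
  then have "X + Y = left_field (cvec X + cvec Y)" by (simp add: left_field_add left_field_cvec)
  then show "X + Y \<in> lie_algebra G M" "cvec (X + Y) = cvec X + cvec Y"
    by (simp_all add: left_field_lie_algebra cvec_left_field)
qed

lemma lie_algebra_scaleR: "X \<in> lie_algebra G M \<Longrightarrow> c *\<^sub>R X \<in> lie_algebra G M"
  and cvec_scaleR: "X \<in> lie_algebra G M \<Longrightarrow> cvec (c *\<^sub>R X) = c *\<^sub>R cvec X"
proof -
  assume "X \<in> lie_algebra G M"
  then have "c *\<^sub>R X = left_field (c *\<^sub>R cvec X)" by (simp add: left_field_scaleR left_field_cvec)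
  then show "c *\<^sub>R X \<in> lie_algebra G M" "cvec (c *\<^sub>R X) = c *\<^sub>R cvec X"
    by (simp_all add: left_field_lie_algebra cvec_left_field)
qed

lemma cvec_coordinate:
  obtains X where "\<And>b. X b \<in> smooth_functions M" "\<And>Y b. Y \<in> lie_algebra G M \<Longrightarrow> Y (X b) \<one> = cvec Y \<bullet> b"
proof -
  have "\<forall>b. \<exists>X. X \<in> smooth_functions M \<and> (\<forall>e. vec0 e X = e \<bullet> b)"
  proof
    fix b :: 'e
    obtain X where "X \<in> smooth_functions M" "\<And>e. vec0 e X = e \<bullet> b"
      by (rule chart_vector_coordinate[OF mfd chart0 one_U0]) (rule that)
    then show "\<exists>X. X \<in> smooth_functions M \<and> (\<forall>e. vec0 e X = e \<bullet> b)" by (intro exI[of _ X] conjI allI)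
  qed
  then obtain X where X: "\<And>b. X b \<in> smooth_functions M" "\<And>b e. vec0 e (X b) = e \<bullet> b" by metis
  show ?thesis by (rule that[of X]) (simp_all add: X cvec)
qed

end

section \<open>One-parameter subgroups\<close>

context smooth_lie_group begin

text \<open>The components of the field are locally its values on extended coordinate functions,
  hence smooth.\<close>

lemma chart_field:
  assumes X: "X \<in> vector_fields M"
  obtains \<xi> where "C_infinity_on (\<phi>0 ` U0) \<xi>"
    "\<And>y f. y \<in> \<phi>0 ` U0 \<Longrightarrow> f \<in> smooth_functions M \<Longrightarrow> X f (\<kappa>0 y) = frechet_derivative
        (\<lambda>y. f (\<kappa>0 y)) (at y) (\<xi> y)"
proof -
  have "\<forall>y\<in>\<phi>0 ` U0. \<exists>e. (\<lambda>f. X f (\<kappa>0 y)) = chart_vector M U0 \<phi>0 (\<kappa>0 y) e"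
  proof
    fix y assume y: "y \<in> \<phi>0 ` U0"
    have "\<kappa>0 y \<in> topspace (mtop M)" using U0_carrier[OF \<kappa>0_in[OF y]] top_carrier by simp
    from tangent_representation[OF mfd chart0 \<kappa>0_in[OF y] vector_field_tangent[OF X this]]
    show "\<exists>e. (\<lambda>f. X f (\<kappa>0 y)) = chart_vector M U0 \<phi>0 (\<kappa>0 y) e" .
  qed
  then obtain \<xi> where \<xi>: "\<forall>y\<in>\<phi>0 ` U0. (\<lambda>f. X f (\<kappa>0 y)) = chart_vector M U0 \<phi>0 (\<kappa>0 y) (\<xi> y)"
    by (rule bchoice[THEN exE])
  have eval: "X f (\<kappa>0 y) = frechet_derivative (\<lambda>y. f (\<kappa>0 y)) (at y) (\<xi> y)"
    if "y \<in> \<phi>0 ` U0" "f \<in> smooth_functions M" for y f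
    using fun_cong[OF bspec[OF \<xi> that(1)], of f] that(2) \<phi>0_\<kappa>0[OF that(1)]
    by (simp add: chart_vector_def \<kappa>0_def)
  have "C_infinity_on (\<phi>0 ` U0) \<xi>"
  proof (rule C_infinity_on_componentwise[OF open_chart0])
    fix b :: 'e assume "b \<in> Basis"
    show "C_infinity_on (\<phi>0 ` U0) (\<lambda>y. \<xi> y \<bullet> b)"
    proof (rule C_infinity_on_locally[OF open_chart0])
      fix y1 assume y1: "y1 \<in> \<phi>0 ` U0"
      have lin: "C_infinity_on (\<phi>0 ` U0) (\<lambda>y. y \<bullet> b)"
        by (intro C_infinity_on_bounded_linear bounded_linear_inner_left open_chart0)
      obtain f Q' where f: "f \<in> smooth_functions M" "open Q'" "y1 \<in> Q'" "Q' \<subseteq> \<phi>0 ` U0"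
        "\<And>y. y \<in> Q' \<Longrightarrow> f (\<kappa>0 y) = y \<bullet> b"
        unfolding \<kappa>0_def
        by (rule smooth_local_extension[OF mfd chart0 open_chart0 subset_refl y1 lin]) blast
      have eq: "X f (\<kappa>0 y) = \<xi> y \<bullet> b" if y: "y \<in> Q'" for y
      proof -
        have "((\<lambda>y. y \<bullet> b) has_derivative (\<lambda>y. y \<bullet> b)) (at y)"
          by (rule bounded_linear_imp_has_derivative[OF bounded_linear_inner_left])
        then have "((\<lambda>y. f (\<kappa>0 y)) has_derivative (\<lambda>y. y \<bullet> b)) (at y)"
          by (rule has_derivative_transform_within_open[OF _ f(2) y]) (simp add: f(5))
        from frechet_derivative_at[OF this] show ?thesis
          using eval[of y f] y f(1,4) by (auto simp: fun_eq_iff)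
      qed
      have "C_infinity_on Q' (\<lambda>y. X f (\<kappa>0 y))"
        by (rule C_infinity_on_subset[OF smooth_param_function[OF smooth_param_\<kappa>0 vector_field_in[OF X f(1)]] f(4)])
      then have "C_infinity_on Q' (\<lambda>y. \<xi> y \<bullet> b)" by (simp only: C_infinity_on_cong[OF f(2) eq])
      then show "\<exists>V. open V \<and> y1 \<in> V \<and> C_infinity_on V (\<lambda>y. \<xi> y \<bullet> b)" using f(2,3)
          by (intro exI[of _ Q'] conjI)
    qed
  qed
  then show ?thesis using eval by (rule that)
qed

text \<open>An integral curve is first known only through test functions; extended coordinates turn
  this into a differential equation in the chart.\<close>

lemma integral_curve_chart:
  fixes \<eta> :: "real \<Rightarrow> 'g"
  assumes \<xi>: "\<And>y f. y \<in> \<phi>0 ` U0 \<Longrightarrow> f \<in> smooth_functions M \<Longrightarrow> X f (\<kappa>0 y) =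
      frechet_derivative (\<lambda>y. f (\<kappa>0 y)) (at y) (\<xi> y)"
    and \<eta>: "smooth_param M J \<eta>" "t \<in> J" "\<eta> t \<in> U0"
    and d: "\<And>f. f \<in> smooth_functions M \<Longrightarrow> ((\<lambda>t. f (\<eta> t)) has_real_derivative X f (\<eta> t)) (at t)"
  shows "((\<lambda>t. \<phi>0 (\<eta> t)) has_vector_derivative \<xi> (\<phi>0 (\<eta> t))) (at t)"
  unfolding has_vector_derivative_def
proof (subst has_derivative_componentwise_within, intro ballI)
  fix b :: 'e assume "b \<in> Basis"
  let ?y = "\<phi>0 (\<eta> t)"
  have y: "?y \<in> \<phi>0 ` U0" using \<eta>(3) by simp
  have lin: "C_infinity_on (\<phi>0 ` U0) (\<lambda>y. y \<bullet> b)"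
    by (intro C_infinity_on_bounded_linear bounded_linear_inner_left open_chart0)
  obtain f Q' where f: "f \<in> smooth_functions M" "open Q'" "?y \<in> Q'" "Q' \<subseteq> \<phi>0 ` U0"
    "\<And>y. y \<in> Q' \<Longrightarrow> f (\<kappa>0 y) = y \<bullet> b"
    unfolding \<kappa>0_def
    by (rule smooth_local_extension[OF mfd chart0 open_chart0 subset_refl y lin]) blast
  let ?P = "{s \<in> J. \<eta> s \<in> {x \<in> U0. \<phi>0 x \<in> Q'}}"
  have P: "open ?P" by (rule smooth_param_preimage_open[OF mfd \<eta>(1) chart_open_preimage[OF mfd chart0 f(2)]])
  have tP: "t \<in> ?P" using \<eta> f(3) by simp
  have "((\<lambda>y. y \<bullet> b) has_derivative (\<lambda>y. y \<bullet> b)) (at ?y)"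
    by (rule bounded_linear_imp_has_derivative[OF bounded_linear_inner_left])
  then have "((\<lambda>y. f (\<kappa>0 y)) has_derivative (\<lambda>y. y \<bullet> b)) (at ?y)"
    by (rule has_derivative_transform_within_open[OF _ f(2,3)]) (simp add: f(5))
  from frechet_derivative_at[OF this] have Xf: "X f (\<eta> t) = \<xi> ?y \<bullet> b"
    using \<xi>[OF y f(1)] \<kappa>0_\<phi>0[OF \<eta>(3)] by (simp add: fun_eq_iff)
  have "((\<lambda>s. f (\<eta> s)) has_derivative (\<lambda>h. h *\<^sub>R \<xi> ?y \<bullet> b)) (at t)"
    by (rule has_derivative_eq_rhs[OF d[OF f(1), unfolded has_field_derivative_def]]) (simp add: fun_eq_iff Xf)
  then show "((\<lambda>s. \<phi>0 (\<eta> s) \<bullet> b) has_derivative (\<lambda>h. h *\<^sub>R \<xi> ?y \<bullet> b)) (at t)"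
  proof (rule has_derivative_transform_within_open[OF _ P tP])
    fix s assume "s \<in> ?P"
    then show "f (\<eta> s) = \<phi>0 (\<eta> s) \<bullet> b" using f(5)[of "\<phi>0 (\<eta> s)"] \<kappa>0_\<phi>0[of "\<eta> s"] by simp
  qed
qed

text \<open>By left invariance, \<open>t \<mapsto> \<gamma> s \<otimes> \<gamma> t\<close> is an
  integral curve of \<open>X\<close> just like \<open>t \<mapsto> \<gamma> (s + t)\<close>, with the
  same value at 0. Uniqueness is applied in the chart at the identity, and \<open>d\<close> is
  chosen to keep both curves in a ball where the field is Lipschitz.\<close>

lemma local_one_parameter:
  assumes X: "X \<in> lie_algebra G M"
  obtains \<gamma> and d :: real where "d > 0" "\<gamma> 0 = \<one>" "smooth_param M {-d<..<d} \<gamma>"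
    "\<And>t f. \<bar>t\<bar> < d \<Longrightarrow> f \<in> smooth_functions M \<Longrightarrow> ((\<lambda>t. f (\<gamma> t))
        has_real_derivative X f (\<gamma> t)) (at t)"
    "\<And>s t. \<bar>s\<bar> < d \<Longrightarrow> \<bar>t\<bar> < d \<Longrightarrow> \<bar>s + t\<bar> < d \<Longrightarrow> \<gamma> (s
        + t) = \<gamma> s \<otimes> \<gamma> t"
proof -
  obtain \<xi> where \<xi>: "C_infinity_on (\<phi>0 ` U0) \<xi>"
    "\<And>y f. y \<in> \<phi>0 ` U0 \<Longrightarrow> f \<in> smooth_functions M \<Longrightarrow> X f (\<kappa>0 y) = frechet_derivative
        (\<lambda>y. f (\<kappa>0 y)) (at y) (\<xi> y)"
    by (rule chart_field[OF lie_algebra_vector_field[OF X]]) blast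
  obtain c e where c: "e > 0" "c 0 = y0" "\<And>t. \<bar>t\<bar> < e \<Longrightarrow> c t \<in> \<phi>0 ` U0"
    "\<And>t. \<bar>t\<bar> < e \<Longrightarrow> (c has_vector_derivative \<xi> (c t)) (at t)" "C_infinity_on {-e<..<e} c"
    by (rule smooth_ode_exists[OF open_chart0 \<xi>(1) y0_in]) blast
  define \<gamma> where "\<gamma> = (\<lambda>t. \<kappa>0 (c t))"
  have \<gamma>0: "\<gamma> 0 = \<one>" by (simp add: \<gamma>_def c(2) \<kappa>0_y0)
  have sp: "smooth_param M {-e<..<e} \<gamma>"
    unfolding \<gamma>_def
    by (rule smooth_param_compose[OF smooth_param_\<kappa>0 _ c(5)]) (use c(3) in \<open>auto simp: abs_less_iff\<close>)
  have \<gamma>G: "\<gamma> t \<in> carrier G" if "\<bar>t\<bar> < e" for t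
    using smooth_param_in[OF sp, of t] that top_carrier by (auto simp: abs_less_iff)
  have der: "((\<lambda>t. f (\<gamma> t)) has_real_derivative X f (\<gamma> t)) (at t)"
    if t: "\<bar>t\<bar> < e" and f: "f \<in> smooth_functions M" for t f
  proof -
    have 1: "(c has_derivative (\<lambda>h. h *\<^sub>R \<xi> (c t))) (at t)" using c(4)[OF t] by (simp add: has_vector_derivative_def)
    have 2: "((\<lambda>y. f (\<kappa>0 y)) has_derivative frechet_derivative (\<lambda>y. f (\<kappa>0 y)) (at (c t))) (at (c t))"
      by (rule C_infinity_on_has_derivative[OF smooth_param_function[OF smooth_param_\<kappa>0 f] c(3)[OF t]])
    have "((\<lambda>t. f (\<gamma> t)) has_derivative (\<lambda>h. frechet_derivative (\<lambda>y. f (\<kappa>0 y)) (at (c t)) (h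
        *\<^sub>R \<xi> (c t)))) (at t)"
      using diff_chain_at[OF 1 2] by (simp add: \<gamma>_def o_def)
    then show ?thesis
      unfolding has_field_derivative_def \<gamma>_def \<xi>(2)[OF c(3)[OF t] f]
      by (rule has_derivative_eq_rhs) (simp add: fun_eq_iff linear_cmul[OF has_derivative_linear[OF 2]])
  qed
  obtain r where r: "r > 0" "cball y0 r \<subseteq> \<phi>0 ` U0" using open_chart0 y0_in open_contains_cball by blast
  obtain K where "K > 0"
      and K: "\<And>x y. x \<in> cball y0 r \<Longrightarrow> y \<in> cball y0 r \<Longrightarrow> norm (\<xi> x - \<xi> y) \<le> K * norm (x - y)"
    by (rule C_infinity_on_lipschitz_ball[OF open_chart0 \<xi>(1) r(2)]) blast
  define W where "W = {x \<in> U0. \<phi>0 x \<in> ball y0 r}"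
  have W: "openin (mtop M) W" unfolding W_def by (rule chart_open_preimage[OF mfd chart0 open_ball])
  let ?Q = "{-e<..<e} \<times> {-e<..<e}"
  have Q: "open ?Q" by (intro open_Times open_greaterThanLessThan)
  have sp1: "smooth_param M ?Q (\<lambda>z. \<gamma> (fst z))"
    by (rule smooth_param_compose[OF sp Q C_infinity_on_bounded_linear[OF bounded_linear_fst Q]]) auto
  have sp2: "smooth_param M ?Q (\<lambda>z. \<gamma> (snd z))"
    by (rule smooth_param_compose[OF sp Q C_infinity_on_bounded_linear[OF bounded_linear_snd Q]]) auto
  have "open {z \<in> ?Q. \<gamma> (fst z) \<otimes> \<gamma> (snd z) \<in> W}"
    by (rule smooth_param_preimage_open[OF mfd smooth_param_times[OF sp1 sp2] W])
  moreover have "(0, 0) \<in> {z \<in> ?Q. \<gamma> (fst z) \<otimes> \<gamma> (snd z) \<in> W}"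
    using c(1) \<gamma>0 one_U0 r(1) by (simp add: W_def y0_def)
  ultimately obtain d1 where d1: "d1 > 0" "ball (0, 0) d1 \<subseteq> {z \<in> ?Q. \<gamma> (fst z) \<otimes> \<gamma> (snd z) \<in> W}"
    using openE by blast
  have "open ({-e<..<e} \<inter> c -` ball y0 r)"
    using continuous_on_open_vimage[of "{-e<..<e}" c] C_infinity_on_imp_continuous_on[OF c(5)] by (auto simp: Int_commute)
  moreover have "0 \<in> {-e<..<e} \<inter> c -` ball y0 r" using c r by simp
  ultimately obtain d2 where d2: "d2 > 0" "ball 0 d2 \<subseteq> {-e<..<e} \<inter> c -` ball y0 r"
    using openE by blast
  \<comment> \<open>Halved because the bounds on \<open>|s| + |t|\<close> and on
    \<open>s + t\<close> are \<open>2 * d\<close>.\<close>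
  define d where "d = min (d1 / 2) (d2 / 2)"
  have d: "d > 0" using d1 d2 by (simp add: d_def)
  have inW: "\<bar>s\<bar> < e \<and> \<bar>t\<bar> < e \<and> \<gamma> s \<otimes> \<gamma> t \<in> W"
      if "\<bar>s\<bar> < d" "\<bar>t\<bar> < d" for s t
  proof -
    have "norm (s, t) \<le> \<bar>s\<bar> + \<bar>t\<bar>" using norm_Pair_le[of s t] by simp
    then have "dist (s, t) (0, 0) < d1" using that by (simp add: d_def dist_norm)
    then have "(s, t) \<in> ball (0, 0) d1" by (simp only: mem_ball dist_commute)
    from subsetD[OF d1(2) this] show ?thesis by (auto simp: abs_less_iff)
  qed
  have inc: "\<bar>u\<bar> < e \<and> c u \<in> cball y0 r" if "\<bar>u\<bar> < 2 * d" for u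
  proof -
    have "u \<in> ball 0 d2" using that by (simp add: d_def)
    from subsetD[OF d2(2) this] show ?thesis by (auto simp: abs_less_iff)
  qed
  have hom: "\<gamma> (s + t) = \<gamma> s \<otimes> \<gamma> t" if s: "\<bar>s\<bar> < d" and t: "\<bar>t\<bar> < d" for s t
  proof -
    have se: "\<bar>s\<bar> < e" using inW[OF s s] by simp
    have "(\<lambda>t. c (s + t)) t = (\<lambda>t. \<phi>0 (\<gamma> s \<otimes> \<gamma> t)) t"
    proof (rule lipschitz_ode_unique[where e = d and B = "cball y0 r" and K = K and \<xi> = \<xi>])
      fix t :: real assume t: "\<bar>t\<bar> < d"
      have st: "\<bar>s + t\<bar> < 2 * d" using s t by linarith
      have "((\<lambda>t. s + t) has_vector_derivative 1) (at t)" by (auto intro!: derivative_eq_intros)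
      from vector_diff_chain_at[OF this, of c "\<xi> (c (s + t))"]
      show "((\<lambda>t. c (s + t)) has_vector_derivative \<xi> (c (s + t))) (at t)"
        using c(4)[of "s + t"] inc[OF st] by (simp add: o_def)
      show "((\<lambda>t. \<phi>0 (\<gamma> s \<otimes> \<gamma> t)) has_vector_derivative \<xi> (\<phi>0 (\<gamma> s \<otimes> \<gamma> t))) (at t)"
      proof (rule integral_curve_chart[where X = X and J = "{-e<..<e}" and \<xi> = \<xi>])
        show "smooth_param M {-e<..<e} (\<lambda>t. \<gamma> s \<otimes> \<gamma> t)"
          by (intro smooth_param_times smooth_param_const' sp \<gamma>G[OF se] open_greaterThanLessThan)
        show "t \<in> {-e<..<e}" using inW[OF s t] by (auto simp: abs_less_iff)
        show "\<gamma> s \<otimes> \<gamma> t \<in> U0" using inW[OF s t] by (simp add: W_def)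
        fix f assume f: "f \<in> smooth_functions M"
        have te: "\<bar>t\<bar> < e" using inW[OF s t] by simp
        have "((\<lambda>t. pullback M (\<lambda>x. \<gamma> s \<otimes> x) f (\<gamma> t)) has_real_derivative X (pullback M (\<lambda>x.
            \<gamma> s \<otimes> x) f) (\<gamma> t)) (at t)"
          by (rule der[OF te pullback_left[OF \<gamma>G[OF se] f]])
        then have "((\<lambda>t. pullback M (\<lambda>x. \<gamma> s \<otimes> x) f (\<gamma> t)) has_real_derivative X f (\<gamma> s
            \<otimes> \<gamma> t)) (at t)"
          by (simp add: lie_algebra_at[OF X \<gamma>G[OF se] \<gamma>G[OF te] f])
        then show "((\<lambda>t. f (\<gamma> s \<otimes> \<gamma> t)) has_real_derivative X f (\<gamma> s \<otimes> \<gamma> t)) (at t)"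
        proof (rule has_field_derivative_transform_within_open[of _ _ _ "{-e<..<e}"])
          fix u assume "u \<in> {-e<..<e}"
          then show "pullback M (\<lambda>x. \<gamma> s \<otimes> x) f (\<gamma> u) = f (\<gamma> s \<otimes> \<gamma> u)"
            using \<gamma>G[of u] by (auto simp: pullback_def top_carrier abs_less_iff)
        qed (use te in \<open>auto simp: abs_less_iff\<close>)
      qed (rule \<xi>(2))
      show "c (s + t) \<in> cball y0 r \<and> \<phi>0 (\<gamma> s \<otimes> \<gamma> t) \<in> cball y0 r"
        using inc[OF st] inW[OF s t] by (auto simp: W_def)
    next
      have "\<gamma> s \<in> U0" using inW[OF s, of 0] d \<gamma>0 \<gamma>G[OF se] by (simp add: W_def)
      then show "c (s + 0) = \<phi>0 (\<gamma> s \<otimes> \<gamma> 0)"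
        using \<gamma>0 \<gamma>G[OF se] c(3)[OF se] by (simp add: \<gamma>_def \<phi>0_\<kappa>0)
    qed (use t K in auto)
    then have "\<gamma> (s + t) = \<kappa>0 (\<phi>0 (\<gamma> s \<otimes> \<gamma> t))" by (simp add: \<gamma>_def)
    then show ?thesis using inW[OF s t] by (simp add: W_def \<kappa>0_\<phi>0)
  qed
  have de: "d \<le> e"
  proof (rule ccontr)
    assume "\<not> d \<le> e"
    then have "\<bar>e\<bar> < 2 * d" using c(1) d by simp
    from inc[OF this] show False using c(1) by simp
  qed
  show ?thesis
  proof (rule that[of d \<gamma>])
    show "smooth_param M {-d<..<d} \<gamma>" by (rule smooth_param_subset[OF sp]) (use de in auto)
    show "((\<lambda>t. f (\<gamma> t)) has_real_derivative X f (\<gamma> t)) (at t)"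
      if "\<bar>t\<bar> < d" "f \<in> smooth_functions M" for t f
      by (rule der) (use that de in auto)
  qed (use d \<gamma>0 hom in auto)
qed

lemma local_power:
  assumes \<gamma>: "\<gamma> 0 = \<one>" "\<And>t. \<bar>t\<bar> < d \<Longrightarrow> \<gamma> t \<in> carrier G"
    "\<And>s t. \<bar>s\<bar> < d \<Longrightarrow> \<bar>t\<bar> < d \<Longrightarrow> \<bar>s + t\<bar> < d \<Longrightarrow> \<gamma> (s
        + t) = \<gamma> s \<otimes> \<gamma> t"
    and m: "\<bar>real m * u\<bar> < d"
  shows "\<gamma> u [^] m = \<gamma> (real m * u)"
  using m
proof (induction m)
  case (Suc m)
  have "\<bar>real m * u\<bar> \<le> \<bar>real (Suc m) * u\<bar>" "\<bar>u\<bar> \<le> \<bar>real (Suc m) * u\<bar>"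
    by (simp_all add: abs_mult mult_right_mono) (simp add: distrib_right)
  then have b: "\<bar>real m * u\<bar> < d" "\<bar>u\<bar> < d" using Suc.prems by linarith+
  have "\<gamma> u [^] Suc m = \<gamma> (real m * u) \<otimes> \<gamma> u" using Suc.IH[OF b(1)] by simp
  also have "\<dots> = \<gamma> (real m * u + u)"
    using \<gamma>(3)[OF b] Suc.prems by (simp add: algebra_simps)
  finally show ?case by (simp add: algebra_simps)
qed (simp add: \<gamma>(1))

lemma one_parameter_exists:
  assumes X: "X \<in> lie_algebra G M"
  obtains \<gamma> where "one_parameter_subgroup G M X \<gamma>" "smooth_param M UNIV \<gamma>"
proof -
  obtain \<gamma> d where d: "d > 0" and \<gamma>0: "\<gamma> 0 = \<one>" and sp: "smooth_param M {-d<..<d} \<gamma>"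
    and der: "\<And>t f. \<bar>t\<bar> < d \<Longrightarrow> f \<in> smooth_functions M \<Longrightarrow> ((\<lambda>t. f (\<gamma> t))
        has_real_derivative X f (\<gamma> t)) (at t)"
    and hom: "\<And>s t. \<bar>s\<bar> < d \<Longrightarrow> \<bar>t\<bar> < d \<Longrightarrow> \<bar>s + t\<bar> < d \<Longrightarrow>
        \<gamma> (s + t) = \<gamma> s \<otimes> \<gamma> t"
    by (rule local_one_parameter[OF X]) blast
  have \<gamma>G: "\<gamma> t \<in> carrier G" if "\<bar>t\<bar> < d" for t
    using smooth_param_in[OF sp, of t] that top_carrier by (auto simp: abs_less_iff)
  note pow = local_power[of \<gamma> d, OF \<gamma>0 \<gamma>G hom]
  \<comment> \<open>The value is \<open>\<gamma> (t / n) ^ n\<close> for any \<open>n\<close> with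
    \<open>|t| / n < d\<close>; the \<open>+ 1\<close> makes the inequality strict. Independence of
    \<open>n\<close> follows by comparing two choices through their product, and a common
    \<open>n\<close> for \<open>s\<close>, \<open>t\<close> and \<open>s + t\<close> gives the
    homomorphism law.\<close>
  define \<Gamma> where "\<Gamma> = (\<lambda>t. let n = nat \<lceil>\<bar>t\<bar> / d\<rceil> + 1 in \<gamma> (t / real n) [^] n)"
  have \<Gamma>: "\<Gamma> t = \<gamma> (t / real n) [^] n" if n: "n > 0" "\<bar>t\<bar> / real n < d" for t n
  proof -
    define m where "m = nat \<lceil>\<bar>t\<bar> / d\<rceil> + 1"
    have m: "m > 0" by (simp add: m_def)
    have "\<bar>t\<bar> / d < real m" unfolding m_def by linarith
    then have mt: "\<bar>t\<bar> / real m < d" using d m by (simp add: field_simps)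
    let ?u = "t / (real n * real m)"
    have un: "\<bar>?u\<bar> < d"
    proof -
      have "\<bar>?u\<bar> \<le> \<bar>t\<bar> / real n" using n m by (simp add: abs_mult field_simps) (simp add: mult_le_cancel_left1)
      then show ?thesis using n by linarith
    qed
    have 1: "\<gamma> ?u [^] m = \<gamma> (t / real n)" using pow[of m ?u] n m by simp
    have 2: "\<gamma> ?u [^] n = \<gamma> (t / real m)" using pow[of n ?u] n m mt by simp
    have "\<gamma> (t / real n) [^] n = \<gamma> (t / real m) [^] m"
      unfolding 1[symmetric] 2[symmetric] using \<gamma>G[OF un] by (simp add: nat_pow_pow mult.commute)
    then show ?thesis by (simp add: \<Gamma>_def m_def Let_def)
  qed
  have \<Gamma>\<gamma>: "\<Gamma> t = \<gamma> t" if "\<bar>t\<bar> < d" for t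
    using \<Gamma>[of 1 t] that \<gamma>G[OF that] by simp
  have \<Gamma>hom: "\<Gamma> (s + t) = \<Gamma> s \<otimes> \<Gamma> t" for s t
  proof -
    define n where "n = nat \<lceil>(\<bar>s\<bar> + \<bar>t\<bar>) / d\<rceil> + 1"
    have n: "n > 0" by (simp add: n_def)
    have "(\<bar>s\<bar> + \<bar>t\<bar>) / d < real n" unfolding n_def by linarith
    then have b: "(\<bar>s\<bar> + \<bar>t\<bar>) / real n < d" using d n by (simp add: field_simps)
    have bs: "\<bar>s\<bar> / real n < d" "\<bar>t\<bar> / real n < d" "\<bar>s + t\<bar> / real n < d"
      using n by (auto intro!: le_less_trans[OF _ b] divide_right_mono)
    then have bs': "\<bar>s / real n\<bar> < d" "\<bar>t / real n\<bar> < d" "\<bar>s / real n + t / real n\<bar> < d" "\<bar>t / real n +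
        s / real n\<bar> < d"
      by (simp_all add: add_divide_distrib[symmetric] add.commute)
    have "\<gamma> (s / real n) \<otimes> \<gamma> (t / real n) = \<gamma> (t / real n) \<otimes> \<gamma> (s / real n)"
      using hom[OF bs'(1-3)] hom[OF bs'(2,1,4)] by (simp add: add.commute)
    then have "(\<gamma> (s / real n) \<otimes> \<gamma> (t / real n)) [^] n = \<gamma> (s / real n) [^] n \<otimes> \<gamma> (t / real n) [^] n"
      by (rule pow_mult_distrib) (intro \<gamma>G bs')+
    then show ?thesis
      using \<Gamma>[OF n bs(1)] \<Gamma>[OF n bs(2)] \<Gamma>[OF n bs(3)] hom[OF bs'(1-3)] by (simp add: add_divide_distrib)
  qed
  have \<Gamma>G: "\<Gamma> t \<in> carrier G" for t
  proof -
    define n where "n = nat \<lceil>\<bar>t\<bar> / d\<rceil> + 1"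
    have n: "n > 0" by (simp add: n_def)
    have "\<bar>t\<bar> / d < real n" unfolding n_def by linarith
    then have "\<bar>t\<bar> / real n < d" using d n by (simp add: field_simps)
    then show ?thesis using \<Gamma>[OF n] \<gamma>G[of "t / real n"] n by simp
  qed
  have spG: "smooth_param M UNIV \<Gamma>"
  proof (rule smooth_param_locally[OF open_UNIV])
    fix t0 :: real
    let ?P = "(\<lambda>t. t + - t0) -` {-d<..<d}"
    have jC: "C_infinity_on UNIV (\<lambda>t. t + - t0)"
      by (intro C_infinity_on_add C_infinity_on_id C_infinity_on_const open_UNIV)
    have P: "open ?P" by (rule open_vimage[OF open_greaterThanLessThan C_infinity_on_imp_continuous_on[OF jC]])
    have "smooth_param M ?P (\<lambda>t. \<gamma> (t + - t0))"
      by (rule smooth_param_compose[OF sp P C_infinity_on_subset[OF jC]]) auto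
    then have "smooth_param M ?P (\<lambda>t. \<Gamma> t0 \<otimes> \<gamma> (t + - t0))"
      by (intro smooth_param_times smooth_param_const' P \<Gamma>G)
    then have "smooth_param M ?P \<Gamma>"
    proof (rule smooth_param_cong)
      fix t assume "t \<in> ?P"
      then have "\<Gamma> (t + - t0) = \<gamma> (t + - t0)" by (intro \<Gamma>\<gamma>) (auto simp: abs_less_iff)
      then show "\<Gamma> t0 \<otimes> \<gamma> (t + - t0) = \<Gamma> t" using \<Gamma>hom[of t0 "t + - t0"] by simp
    qed
    then show "\<exists>P. t0 \<in> P \<and> smooth_param M P \<Gamma>" using d by (intro exI[of _ ?P]) auto
  qed
  have "one_parameter_subgroup G M X \<Gamma>"
    unfolding one_parameter_subgroup_def
  proof (intro conjI allI ballI)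
    show "smooth_map euclidean_manifold M \<Gamma>" by (rule smooth_param_imp_smooth_map[OF mfd spG])
    show "\<Gamma> (s + t) = \<Gamma> s \<otimes> \<Gamma> t" for s t by (rule \<Gamma>hom)
    fix f x assume f: "f \<in> smooth_functions M" and x: "x \<in> carrier G"
    have "((\<lambda>t. pullback M (\<lambda>y. x \<otimes> y) f (\<gamma> t)) has_real_derivative X (pullback M (\<lambda>y. x \<otimes>
        y) f) (\<gamma> 0)) (at 0)"
      by (rule der[OF _ pullback_left[OF x f]]) (use d in simp)
    then have "((\<lambda>t. pullback M (\<lambda>y. x \<otimes> y) f (\<gamma> t)) has_real_derivative X f x) (at 0)"
      using lie_algebra_at[OF X x one_closed f] x by (simp add: \<gamma>0)
    then show "((\<lambda>t. f (x \<otimes> \<Gamma> t)) has_real_derivative X f x) (at 0)"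
    proof (rule has_field_derivative_transform_within_open[of _ _ _ "{-d<..<d}"])
      fix u assume "u \<in> {-d<..<d}"
      then have "\<bar>u\<bar> < d" by (auto simp: abs_less_iff)
      then show "pullback M (\<lambda>y. x \<otimes> y) f (\<gamma> u) = f (x \<otimes> \<Gamma> u)"
        using \<gamma>G[of u] \<Gamma>\<gamma>[of u] by (simp add: pullback_def top_carrier)
    qed (use d in auto)
  qed
  then show ?thesis using spG by (rule that)
qed

end

section \<open>The adjoint representation and its derivative\<close>

context smooth_lie_group begin

lemma lie_algebra_in: "X \<in> lie_algebra G M \<Longrightarrow> f \<in> smooth_functions M \<Longrightarrow> X f \<in> smooth_functions M"
  by (rule vector_field_in[OF lie_algebra_vector_field])

lemma lie_algebra_fun_add:
  "X \<in> lie_algebra G M \<Longrightarrow> f \<in> smooth_functions M \<Longrightarrow> g \<in> smooth_functions M \<Longrightarrow> X (f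
      + g) = X f + X g"
  and lie_algebra_fun_scaleR:
  "X \<in> lie_algebra G M \<Longrightarrow> f \<in> smooth_functions M \<Longrightarrow> X (c *\<^sub>R f) = c *\<^sub>R X f"
  and lie_algebra_fun_times:
  "X \<in> lie_algebra G M \<Longrightarrow> f \<in> smooth_functions M \<Longrightarrow> g \<in> smooth_functions M \<Longrightarrow> X (f
      * g) = f * X g + g * X f"
  unfolding lie_algebra_def vector_fields_def linear_map_on_def by auto

lemma lie_algebra_fun_zero: "X \<in> lie_algebra G M \<Longrightarrow> X 0 = 0"
  using lie_algebra_fun_scaleR[of X 0 0] smooth_functions_zero_fun[OF mfd] by simp

lemma smooth_functions_diff:
  "f \<in> smooth_functions M \<Longrightarrow> g \<in> smooth_functions M \<Longrightarrow> f - g \<in> smooth_functions M"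
  using smooth_functions_add[OF mfd, of f "(-1) *\<^sub>R g"] smooth_functions_scaleR[OF mfd, of g "-1"] by simp

lemma pullback_apply: "x \<in> carrier G \<Longrightarrow> pullback M F f x = f (F x)"
  and pullback_outside: "x \<notin> carrier G \<Longrightarrow> pullback M F f x = 0"
  by (simp_all add: pullback_def top_carrier)

lemma pullback_diff: "pullback M F (f - g) = pullback M F f - pullback M F g"
  by (auto simp: pullback_def fun_eq_iff)

lemma lie_algebraI:
  assumes "\<And>f. f \<notin> smooth_functions M \<Longrightarrow> X f = 0"
    and "\<And>f. f \<in> smooth_functions M \<Longrightarrow> X f \<in> smooth_functions M"
    and "\<And>f g. f \<in> smooth_functions M \<Longrightarrow> g \<in> smooth_functions M \<Longrightarrow> X (f + g) = X f + X g"
    and "\<And>c f. f \<in> smooth_functions M \<Longrightarrow> X (c *\<^sub>R f) = c *\<^sub>R X f"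
    and "\<And>f g. f \<in> smooth_functions M \<Longrightarrow> g \<in> smooth_functions M \<Longrightarrow> X (f * g) = f * X g + g * X f"
    and "\<And>a f. a \<in> carrier G \<Longrightarrow> f \<in> smooth_functions M \<Longrightarrow>
      X (pullback M (\<lambda>x. a \<otimes> x) f) = pullback M (\<lambda>x. a \<otimes> x) (X f)"
  shows "X \<in> lie_algebra G M"
  unfolding lie_algebra_def vector_fields_def linear_map_on_def using assms by auto

lemma lie_bracket_lie_algebra:
  assumes X: "X \<in> lie_algebra G M" and Y: "Y \<in> lie_algebra G M"
  shows "lie_bracket X Y \<in> lie_algebra G M"
proof (rule lie_algebraI)
  note XY = lie_algebra_in[OF X] lie_algebra_in[OF Y]
  fix f assume f: "f \<in> smooth_functions M"
  show "lie_bracket X Y f \<in> smooth_functions M"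
    using f XY smooth_functions_diff by (simp add: lie_bracket_def)
  show "lie_bracket X Y (c *\<^sub>R f) = c *\<^sub>R lie_bracket X Y f" for c
    using f XY by (simp add: lie_bracket_def lie_algebra_fun_scaleR X Y scaleR_right_diff_distrib)
  show "lie_bracket X Y (pullback M (\<lambda>x. a \<otimes> x) f) = pullback M (\<lambda>x. a \<otimes> x) (lie_bracket X Y f)"
    if "a \<in> carrier G" for a
    using f XY that by (simp add: lie_bracket_def lie_algebra_left_invariant X Y pullback_diff)
  fix g assume g: "g \<in> smooth_functions M"
  have add: "A (B (f + g)) = A (B f) + A (B g)"
    if "A \<in> lie_algebra G M" "B \<in> lie_algebra G M" for A B
    using lie_algebra_fun_add[OF that(2) f g]
      lie_algebra_fun_add[OF that(1) lie_algebra_in[OF that(2) f] lie_algebra_in[OF that(2) g]] by (simp only:)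
  show "lie_bracket X Y (f + g) = lie_bracket X Y f + lie_bracket X Y g"
    unfolding lie_bracket_def add[OF X Y] add[OF Y X] by (simp add: fun_eq_iff)
  have times: "A (B (f * g)) = (f * A (B g) + B g * A f) + (g * A (B f) + B f * A g)"
    if A: "A \<in> lie_algebra G M" and B: "B \<in> lie_algebra G M" for A B
    using lie_algebra_fun_times[OF B f g]
      lie_algebra_fun_add[OF A smooth_functions_times[OF mfd f lie_algebra_in[OF B g]]
        smooth_functions_times[OF mfd g lie_algebra_in[OF B f]]]
      lie_algebra_fun_times[OF A f lie_algebra_in[OF B g]] lie_algebra_fun_times[OF A g lie_algebra_in[OF B f]]
    by (simp only:)
  show "lie_bracket X Y (f * g) = f * lie_bracket X Y g + g * lie_bracket X Y f"
    unfolding lie_bracket_def times[OF X Y] times[OF Y X] by (simp add: fun_eq_iff algebra_simps)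
next
  fix f assume "f \<notin> smooth_functions M"
  then show "lie_bracket X Y f = 0"
    using lie_algebra_zero_outside(1)[OF X] lie_algebra_zero_outside(1)[OF Y]
    by (simp add: lie_bracket_def lie_algebra_fun_zero X Y)
qed

definition cj :: "'g \<Rightarrow> ('g \<Rightarrow> real) \<Rightarrow> 'g \<Rightarrow> real" where
  "cj a = pullback M (\<lambda>x. a \<otimes> x \<otimes> inv a)"

lemma cj_in: "a \<in> carrier G \<Longrightarrow> f \<in> smooth_functions M \<Longrightarrow> cj a f \<in> smooth_functions M"
  unfolding cj_def by (rule pullback_left_right) auto

lemma cj_add: "cj a (f + g) = cj a f + cj a g"
  and cj_diff: "cj a (f - g) = cj a f - cj a g"
  and cj_times: "cj a (f * g) = cj a f * cj a g"
  and cj_scaleR: "cj a (c *\<^sub>R f) = c *\<^sub>R cj a f"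
  unfolding cj_def by (rule pullback_add pullback_diff pullback_times pullback_scaleR)+

lemma Ad_eq:
  assumes "X \<in> lie_algebra G M" "f \<in> smooth_functions M" "a \<in> carrier G"
  shows "Ad G M a X f = cj (inv a) (X (cj a f))"
  using assms by (simp add: Ad_def cj_def)

lemma Ad_outside: "f \<notin> smooth_functions M \<Longrightarrow> Ad G M a X f = 0"
  by (simp add: Ad_def)

lemma cj_cj: "a \<in> carrier G \<Longrightarrow> b \<in> carrier G \<Longrightarrow> cj b (cj a f) = cj (a \<otimes> b) f"
  by (auto simp: cj_def pullback_def fun_eq_iff top_carrier m_assoc inv_mult_group)

lemma cj_one: "f \<in> smooth_functions M \<Longrightarrow> cj \<one> f = f"
  using smooth_functions_zero[of f M] by (auto simp: cj_def pullback_def fun_eq_iff top_carrier)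

lemma Ad_lie_algebra:
  assumes X: "X \<in> lie_algebra G M" and a: "a \<in> carrier G"
  shows "Ad G M a X \<in> lie_algebra G M"
proof (rule lie_algebraI)
  note in1 = cj_in[OF a] and in2 = cj_in[OF inv_closed[OF a]] and Xin = lie_algebra_in[OF X]
  fix f assume f: "f \<in> smooth_functions M"
  show "Ad G M a X f \<in> smooth_functions M" unfolding Ad_eq[OF X f a] by (intro in2 Xin in1 f)
  show "Ad G M a X (c *\<^sub>R f) = c *\<^sub>R Ad G M a X f" for c
    using f by (simp add: Ad_eq[OF X _ a] smooth_functions_scaleR[OF mfd] cj_scaleR lie_algebra_fun_scaleR[OF X] in1)
  show "Ad G M a X (pullback M (\<lambda>x. b \<otimes> x) f) = pullback M (\<lambda>x. b \<otimes> x) (Ad G M a X f)"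
    if b: "b \<in> carrier G" for b
  proof -
    have "cj a (pullback M (\<lambda>x. b \<otimes> x) f) = pullback M (\<lambda>x. (inv a \<otimes> b \<otimes> a) \<otimes> x) (cj a f)"
      using a b by (auto simp: cj_def pullback_def fun_eq_iff top_carrier m_assoc[symmetric])
    then have "X (cj a (pullback M (\<lambda>x. b \<otimes> x) f)) = pullback M (\<lambda>x. (inv a \<otimes> b \<otimes> a) \<otimes> x)
        (X (cj a f))"
      using lie_algebra_left_invariant[OF X _ in1[OF f]] a b by simp
    moreover have "cj (inv a) (pullback M (\<lambda>x. (inv a \<otimes> b \<otimes> a) \<otimes> x) h) = pullback M (\<lambda>x. b
        \<otimes> x) (cj (inv a) h)" for h
      using a b by (auto simp: cj_def pullback_def fun_eq_iff top_carrier m_assoc)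
        (simp add: m_assoc[symmetric])
    ultimately show ?thesis by (simp add: Ad_eq[OF X _ a] f pullback_left[OF b f])
  qed
  fix g assume g: "g \<in> smooth_functions M"
  show "Ad G M a X (f + g) = Ad G M a X f + Ad G M a X g"
    using f g by (simp add: Ad_eq[OF X _ a] smooth_functions_add[OF mfd] cj_add lie_algebra_fun_add[OF X] in1)
  have cc: "cj (inv a) (cj a h) = h" if "h \<in> smooth_functions M" for h
    using cj_cj[OF a inv_closed[OF a]] cj_one[OF that] a by simp
  show "Ad G M a X (f * g) = f * Ad G M a X g + g * Ad G M a X f"
    using f g by (simp add: Ad_eq[OF X _ a] smooth_functions_times[OF mfd] cj_times cj_add
        lie_algebra_fun_times[OF X] in1 cc)
qed (rule Ad_outside)

lemma Ad_add:
  assumes "X \<in> lie_algebra G M" "Y \<in> lie_algebra G M" "a \<in> carrier G"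
  shows "Ad G M a (X + Y) = Ad G M a X + Ad G M a Y"
proof
  fix f show "Ad G M a (X + Y) f = (Ad G M a X + Ad G M a Y) f"
    using assms by (cases "f \<in> smooth_functions M") (simp_all add: Ad_eq Ad_outside lie_algebra_add cj_add)
qed

lemma Ad_scaleR:
  assumes "X \<in> lie_algebra G M" "a \<in> carrier G"
  shows "Ad G M a (c *\<^sub>R X) = c *\<^sub>R Ad G M a X"
proof
  fix f show "Ad G M a (c *\<^sub>R X) f = (c *\<^sub>R Ad G M a X) f"
    using assms by (cases "f \<in> smooth_functions M")
      (simp_all add: Ad_eq Ad_outside lie_algebra_scaleR cj_scaleR scaleR_fun_apply)
qed

lemma Ad_mult:
  assumes X: "X \<in> lie_algebra G M" and a: "a \<in> carrier G" and b: "b \<in> carrier G"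
  shows "Ad G M a (Ad G M b X) = Ad G M (a \<otimes> b) X"
proof
  fix f show "Ad G M a (Ad G M b X) f = Ad G M (a \<otimes> b) X f"
  proof (cases "f \<in> smooth_functions M")
    case f: True
    have "Ad G M a (Ad G M b X) f = cj (inv a) (cj (inv b) (X (cj b (cj a f))))"
      by (simp add: Ad_eq[OF Ad_lie_algebra[OF X b] f a] Ad_eq[OF X cj_in[OF a f] b])
    also have "\<dots> = Ad G M (a \<otimes> b) X f"
      using a b by (simp add: cj_cj Ad_eq[OF X f] inv_mult_group)
    finally show ?thesis .
  qed (simp add: Ad_outside)
qed

lemma Ad_one:
  assumes X: "X \<in> lie_algebra G M" shows "Ad G M \<one> X = X"
proof
  fix f show "Ad G M \<one> X f = X f"
  proof (cases "f \<in> smooth_functions M")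
    case f: True
    then show ?thesis by (simp add: Ad_eq[OF X f] cj_one lie_algebra_in[OF X])
  qed (simp add: Ad_outside lie_algebra_zero_outside(1)[OF X])
qed

lemma Ad_bracket:
  assumes X: "X \<in> lie_algebra G M" and Y: "Y \<in> lie_algebra G M" and a: "a \<in> carrier G"
  shows "Ad G M a (lie_bracket X Y) = lie_bracket (Ad G M a X) (Ad G M a Y)"
proof
  fix f show "Ad G M a (lie_bracket X Y) f = lie_bracket (Ad G M a X) (Ad G M a Y) f"
  proof (cases "f \<in> smooth_functions M")
    case f: True
    have cc: "cj a (cj (inv a) h) = h" if "h \<in> smooth_functions M" for h
      using cj_cj[OF inv_closed[OF a] a] cj_one[OF that] a by simp
    have "Ad G M a X (Ad G M a Y f) = cj (inv a) (X (Y (cj a f)))"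
      using f by (simp add: Ad_eq[OF X _ a] Ad_eq[OF Y _ a] cc cj_in a lie_algebra_in[OF Y])
    moreover have "Ad G M a Y (Ad G M a X f) = cj (inv a) (Y (X (cj a f)))"
      using f by (simp add: Ad_eq[OF X _ a] Ad_eq[OF Y _ a] cc cj_in a lie_algebra_in[OF X])
    ultimately show ?thesis
      unfolding Ad_eq[OF lie_bracket_lie_algebra[OF X Y] f a] unfolding lie_bracket_def cj_diff by simp
  next
    case False
    then show ?thesis
      by (simp add: Ad_outside lie_bracket_def lie_algebra_fun_zero[OF Ad_lie_algebra[OF X a]]
          lie_algebra_fun_zero[OF Ad_lie_algebra[OF Y a]])
  qed
qed

lemma one_parameter_in: "one_parameter_subgroup G M X \<gamma> \<Longrightarrow> \<gamma> t \<in> carrier G"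
  unfolding one_parameter_subgroup_def smooth_map_def continuous_map_def euclidean_manifold_def
  by (auto simp: top_carrier)

lemma one_parameter_hom: "one_parameter_subgroup G M X \<gamma> \<Longrightarrow> \<gamma> (s + t) = \<gamma> s \<otimes> \<gamma> t"
  unfolding one_parameter_subgroup_def by simp

lemma one_parameter_zero:
  assumes "one_parameter_subgroup G M X \<gamma>" shows "\<gamma> 0 = \<one>"
  using one_parameter_hom[OF assms, of 0 0] one_parameter_in[OF assms, of 0] by simp

lemma one_parameter_minus:
  assumes "one_parameter_subgroup G M X \<gamma>" shows "\<gamma> (- t) = inv (\<gamma> t)"
  using one_parameter_hom[OF assms, of "-t" t] one_parameter_zero[OF assms]
    one_parameter_in[OF assms] by (simp add: inv_equality)

lemma one_parameter_derivative:
  "one_parameter_subgroup G M X \<gamma> \<Longrightarrow> f \<in> smooth_functions M \<Longrightarrow> x \<in> carrier G \<Longrightarrow>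
    ((\<lambda>t. f (x \<otimes> \<gamma> t)) has_real_derivative X f x) (at 0)"
  unfolding one_parameter_subgroup_def by simp

lemma frechet_real_slice:
  fixes k :: "real \<Rightarrow> real"
  assumes "(k has_derivative D) (at 0)" "(k has_real_derivative d) (at 0)"
  shows "D 1 = d"
  using has_derivative_unique[OF assms(1) assms(2)[unfolded has_field_derivative_def]] by simp

text \<open>\<open>K (t, s)\<close> applies \<open>A\<close> at the identity to
  \<open>x \<mapsto> f (\<gamma> t \<otimes> x \<otimes> \<gamma> s)\<close>, and \<open>Ad\<close>
  is its restriction to \<open>s = - t\<close>. The first partial derivative is
  \<open>X (A f)\<close> by left invariance; the second is \<open>A (X f)\<close> after
  interchanging two mixed derivatives.\<close>

lemma Ad_derivative:
  assumes X: "X \<in> lie_algebra G M" and A: "A \<in> lie_algebra G M" and f: "f \<in> smooth_functions M"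
    and \<gamma>: "one_parameter_subgroup G M X \<gamma>" "smooth_param M UNIV \<gamma>"
  shows "((\<lambda>t. Ad G M (\<gamma> t) A f \<one>) has_real_derivative lie_bracket X A f \<one>) (at 0)"
proof -
  note \<gamma>G = one_parameter_in[OF \<gamma>(1)]
  define a where "a = cvec A"
  let ?Q = "(UNIV :: (real \<times> real) set) \<times> \<phi>0 ` U0"
  have Q: "open ?Q" by (intro open_Times open_UNIV open_chart0)
  define \<Theta> where "\<Theta> = (\<lambda>z. f (\<gamma> (fst (fst z)) \<otimes> \<kappa>0 (snd z) \<otimes> \<gamma> (snd (fst z))))"
  have "smooth_param M ?Q (\<lambda>z. \<gamma> (fst (fst z)) \<otimes> \<kappa>0 (snd z) \<otimes> \<gamma> (snd (fst z)))"
  proof (intro smooth_param_times)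
    show "smooth_param M ?Q (\<lambda>z. \<gamma> (fst (fst z)))"
      by (rule smooth_param_compose[OF \<gamma>(2) Q C_infinity_on_fst[OF Q C_infinity_on_bounded_linear[OF bounded_linear_fst Q]]]) auto
    show "smooth_param M ?Q (\<lambda>z. \<gamma> (snd (fst z)))"
      by (rule smooth_param_compose[OF \<gamma>(2) Q C_infinity_on_snd[OF Q C_infinity_on_bounded_linear[OF bounded_linear_fst Q]]]) auto
    show "smooth_param M ?Q (\<lambda>z. \<kappa>0 (snd z))"
      by (rule smooth_param_compose[OF smooth_param_\<kappa>0 Q C_infinity_on_bounded_linear[OF bounded_linear_snd Q]]) auto
  qed
  from smooth_param_function[OF this f] have \<Theta>: "C_infinity_on ?Q \<Theta>" unfolding \<Theta>_def .
  define K where "K = (\<lambda>p. frechet_derivative \<Theta> (at (p, y0)) (0, a))"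
  have K: "C_infinity_on UNIV K"
    unfolding K_def
    by (rule C_infinity_on_compose[OF open_UNIV Q _ _ C_infinity_on_frechet[OF \<Theta>]])
      (use y0_in in \<open>auto intro!: C_infinity_on_Pair C_infinity_on_id\<close>)
  have evalA: "A (pullback M F f) \<one> = K (t, s)"
    if F: "\<And>x. x \<in> carrier G \<Longrightarrow> F x = \<gamma> t \<otimes> x \<otimes> \<gamma> s" for t s F
  proof -
    have eq: "pullback M F f = pullback M (\<lambda>x. \<gamma> t \<otimes> x \<otimes> \<gamma> s) f"
      using F by (auto simp: pullback_def fun_eq_iff top_carrier)
    have "((\<lambda>y. \<Theta> ((t, s), y)) has_derivative (\<lambda>e. frechet_derivative \<Theta> (at ((t, s), y0)) (0, e))) (at y0)"
      by (rule frechet_derivative_partial_snd[OF \<Theta>]) (use y0_in in auto)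
    then have "((\<lambda>y. pullback M F f (\<kappa>0 y)) has_derivative (\<lambda>e. frechet_derivative \<Theta> (at ((t, s), y0)) (0, e))) (at y0)"
      by (rule has_derivative_transform_within_open[OF _ open_chart0 y0_in])
        (simp add: \<Theta>_def pullback_apply U0_carrier[OF \<kappa>0_in] F)
    from frechet_derivative_at[OF this]
    show ?thesis
      using cvec[OF A, of "pullback M F f"] vec0_eq[of "pullback M F f"] pullback_left_right[OF \<gamma>G \<gamma>G f]
      by (simp add: eq K_def a_def fun_eq_iff)
  qed
  let ?D = "frechet_derivative K (at (0, 0))"
  have KD: "(K has_derivative ?D) (at (0, 0))" by (rule C_infinity_on_has_derivative[OF K]) simp
  have lin: "linear ?D" using has_derivative_linear[OF KD] .
  have Ad: "Ad G M (\<gamma> t) A f \<one> = K (t, - t)" for t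
  proof -
    have "Ad G M (\<gamma> t) A f \<one> = A (cj (\<gamma> t) f) \<one>"
      using \<gamma>G[of t] by (simp add: Ad_eq[OF A f] cj_def pullback_apply)
    also have "\<dots> = K (t, - t)" unfolding cj_def by (rule evalA) (simp add: one_parameter_minus[OF \<gamma>(1)])
    finally show ?thesis .
  qed
  have "((\<lambda>t::real. (t, - t)) has_derivative (\<lambda>h. (h, - h))) (at 0)" by (auto intro!: derivative_eq_intros)
  from diff_chain_at[OF this, of K ?D]
  have d: "((\<lambda>t. Ad G M (\<gamma> t) A f \<one>) has_derivative (\<lambda>h. ?D (h, - h))) (at 0)"
    using KD by (simp add: o_def Ad)
  have "?D (1, 0) = X (A f) \<one>"
  proof (rule frechet_real_slice[where D = "\<lambda>h. ?D (h, 0)" and k = "\<lambda>t. K (t, 0)"])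
    show "((\<lambda>t. K (t, 0)) has_derivative (\<lambda>h. ?D (h, 0))) (at 0)"
      by (rule frechet_derivative_partial_fst[OF K]) simp
    have "K (t, 0) = A f (\<one> \<otimes> \<gamma> t)" for t
    proof -
      have "K (t, 0) = A (pullback M (\<lambda>x. \<gamma> t \<otimes> x) f) \<one>"
        by (rule evalA[symmetric]) (simp add: one_parameter_zero[OF \<gamma>(1)] \<gamma>G)
      then show ?thesis using lie_algebra_at[OF A \<gamma>G[of t] one_closed f] \<gamma>G[of t] by simp
    qed
    then show "((\<lambda>t. K (t, 0)) has_real_derivative X (A f) \<one>) (at 0)"
      using one_parameter_derivative[OF \<gamma>(1) lie_algebra_in[OF A f] one_closed] by simp
  qed
  moreover have "?D (0, 1) = A (X f) \<one>"
  proof -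
    let ?z = "((0, 0), y0) :: (real \<times> real) \<times> 'e"
    have z: "?z \<in> ?Q" using y0_in by simp
    have "(K has_derivative (\<lambda>p. frechet_derivative (\<lambda>z. frechet_derivative \<Theta> (at z) (0, a)) (at ?z) (p, 0))) (at (0, 0))"
      unfolding K_def by (rule frechet_derivative_partial_fst[OF C_infinity_on_frechet[OF \<Theta>] z])
    from frechet_derivative_at[OF this]
    have "?D (0, 1) = frechet_derivative (\<lambda>z. frechet_derivative \<Theta> (at z) (0, a)) (at ?z) ((0, 1), 0)"
      by (simp add: fun_eq_iff)
    also have "\<dots> = frechet_derivative (\<lambda>z. frechet_derivative \<Theta> (at z) ((0, 1), 0)) (at ?z) (0, a)"
      by (rule frechet_derivative_symmetric[OF Q \<Theta> z])
    also have "\<dots> = A (X f) \<one>"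
    proof -
      have "((\<lambda>y. frechet_derivative \<Theta> (at ((0, 0), y)) ((0, 1), 0)) has_derivative
          (\<lambda>e. frechet_derivative (\<lambda>z. frechet_derivative \<Theta> (at z) ((0, 1), 0)) (at ?z) (0, e))) (at y0)"
        by (rule frechet_derivative_partial_snd[OF C_infinity_on_frechet[OF \<Theta>] z])
      moreover have eq: "frechet_derivative \<Theta> (at ((0, 0), y)) ((0, 1), 0) = X f (\<kappa>0 y)" if y: "y \<in> \<phi>0 ` U0" for y
      proof (rule frechet_real_slice[where D = "\<lambda>h. frechet_derivative \<Theta> (at ((0, 0), y)) ((0, h), 0)"
            and k = "\<lambda>s. \<Theta> ((0, s), y)"])
        have "((\<lambda>s::real. ((0::real, s), y)) has_derivative (\<lambda>h. ((0, h), 0))) (at 0)" by (auto intro!: derivative_eq_intros)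
        from diff_chain_at[OF this, of \<Theta>] C_infinity_on_has_derivative[OF \<Theta>, of "((0, 0), y)"] y
        show "((\<lambda>s. \<Theta> ((0, s), y)) has_derivative (\<lambda>h. frechet_derivative \<Theta> (at ((0, 0), y)) ((0, h), 0))) (at 0)"
          by (simp add: o_def)
        show "((\<lambda>s. \<Theta> ((0, s), y)) has_real_derivative X f (\<kappa>0 y)) (at 0)"
          using one_parameter_derivative[OF \<gamma>(1) f U0_carrier[OF \<kappa>0_in[OF y]]] U0_carrier[OF \<kappa>0_in[OF y]]
          by (simp add: \<Theta>_def one_parameter_zero[OF \<gamma>(1)])
      qed
      ultimately have "((\<lambda>y. X f (\<kappa>0 y)) has_derivative
          (\<lambda>e. frechet_derivative (\<lambda>z. frechet_derivative \<Theta> (at z) ((0, 1), 0)) (at ?z) (0, e))) (at y0)"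
        using has_derivative_transform_within_open[OF _ open_chart0 y0_in eq] by simp
      from frechet_derivative_at[OF this] show ?thesis
        using cvec[OF A, of "X f"] vec0_eq[OF lie_algebra_in[OF X f]] by (simp add: a_def fun_eq_iff)
    qed
    finally show ?thesis .
  qed
  moreover have "?D (h, - h) = h * (?D (1, 0) - ?D (0, 1))" for h
  proof -
    have "(h, - h) = h *\<^sub>R (1, 0) + (- h) *\<^sub>R (0, 1 :: real)" by simp
    then have "?D (h, - h) = h *\<^sub>R ?D (1, 0) + (- h) *\<^sub>R ?D (0, 1)"
      by (simp only: linear_add[OF lin] linear_cmul[OF lin])
    then show ?thesis by (simp add: algebra_simps)
  qed
  ultimately have "(\<lambda>h. ?D (h, - h)) = (*) (lie_bracket X A f \<one>)"
    by (simp add: lie_bracket_def fun_eq_iff mult.commute)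
  then show ?thesis using d by (simp only: has_field_derivative_def)
qed

end

section \<open>Homogeneous spaces\<close>

locale smooth_homogeneous_space = smooth_lie_group G M
  for G :: "'g monoid" (structure) and M :: "('g, 'e::euclidean_space) manifold" +
  fixes H :: "'g set" and N :: "('g set, 'f::euclidean_space) manifold"
  assumes subgroup: "subgroup H G" and coset: "coset_manifold G M H N"
begin

abbreviation proj :: "'g \<Rightarrow> 'g set" where "proj \<equiv> \<lambda>a. a <# H"

lemma mfdN: "smooth_manifold N" and topN: "topspace (mtop N) = lcosets H"
  and submersion: "smooth_submersion M N proj"
  using coset unfolding coset_manifold_def by auto

lemma smooth_proj: "smooth_map M N proj"
  using submersion unfolding smooth_submersion_def by simp

lemma H_carrier: "H \<subseteq> carrier G" by (rule subgroup.subset[OF subgroup])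

lemma proj_in: "a \<in> carrier G \<Longrightarrow> proj a \<in> topspace (mtop N)"
  unfolding topN LCOSETS_def by blast

lemma proj_mult: "a \<in> carrier G \<Longrightarrow> b \<in> carrier G \<Longrightarrow> a <# proj b = proj (a \<otimes> b)"
  by (rule lcos_m_assoc[OF H_carrier])

lemma proj_one: "proj \<one> = H" by (rule lcos_mult_one[OF H_carrier])

lemma proj_eq_H_iff:
  assumes "a \<in> carrier G" shows "proj a = H \<longleftrightarrow> a \<in> H"
proof
  assume "proj a = H"
  then show "a \<in> H" using lcos_self[OF assms subgroup] by simp
next
  assume a: "a \<in> H"
  show "proj a = H"
  proof (rule equalityI; rule subsetI)
    fix x assume "x \<in> proj a"
    then show "x \<in> H" using subgroup.m_closed[OF subgroup a] by (auto simp: l_coset_def)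
  next
    fix x assume x: "x \<in> H"
    have xc: "x \<in> carrier G" using x H_carrier by blast
    have "inv a \<otimes> x \<in> H" by (intro subgroup.m_closed[OF subgroup] subgroup.m_inv_closed[OF subgroup] a x)
    moreover have "x = a \<otimes> (inv a \<otimes> x)" using xc assms by (simp add: m_assoc[symmetric])
    ultimately show "x \<in> proj a" unfolding l_coset_def by blast
  qed
qed

lemma pullback_proj: "f \<in> smooth_functions N \<Longrightarrow> pullback M proj f \<in> smooth_functions M"
  by (rule smooth_map_pullback[OF mfd mfdN smooth_proj])

lemma pullback_translate_proj:
  "a \<in> carrier G \<Longrightarrow> pullback M proj (pullback N (\<lambda>p. a <# p) f) = pullback M (\<lambda>x. a \<otimes> x)
      (pullback M proj f)"
  using proj_in by (auto simp: pullback_def fun_eq_iff top_carrier proj_mult)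

text \<open>On \<open>G\<close> the composite is a left translate of a smooth function, and
  smoothness descends along the submersion.\<close>

lemma pullback_translate:
  assumes a: "a \<in> carrier G" and f: "f \<in> smooth_functions N"
  shows "pullback N (\<lambda>p. a <# p) f \<in> smooth_functions N"
proof (rule smooth_function_from_pullback[OF mfd mfdN submersion])
  show "proj ` topspace (mtop M) = topspace (mtop N)" unfolding topN top_carrier LCOSETS_def by blast
  show "pullback N (\<lambda>p. a <# p) f x = 0" if "x \<notin> topspace (mtop N)" for x using that by (simp add: pullback_def)
  show "pullback M proj (pullback N (\<lambda>p. a <# p) f) \<in> smooth_functions M"
    unfolding pullback_translate_proj[OF a] by (rule pullback_left[OF a pullback_proj[OF f]])
qed

definition dproj :: "(('g \<Rightarrow> real) \<Rightarrow> ('g \<Rightarrow> real)) \<Rightarrow> ('g set \<Rightarrow> real)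
    \<Rightarrow> real" where
  "dproj X = differential M N proj (\<lambda>f. X f \<one>)"

lemma dproj_eq: "f \<in> smooth_functions N \<Longrightarrow> dproj X f = X (pullback M proj f) \<one>"
  and dproj_outside: "f \<notin> smooth_functions N \<Longrightarrow> dproj X f = 0"
  by (simp_all add: dproj_def differential_def)

lemma image_tangent_one: "differential M N proj ` tangent_space M \<one> = tangent_space N H"
proof -
  have "\<forall>p\<in>topspace (mtop M). differential M N proj ` tangent_space M p = tangent_space N (proj p)"
    using submersion unfolding smooth_submersion_def by simp
  from bspec[OF this, of \<one>] show ?thesis by (simp add: top_carrier proj_one)
qed

lemma dproj_tangent: "X \<in> lie_algebra G M \<Longrightarrow> dproj X \<in> tangent_space N H"
  unfolding image_tangent_one[symmetric] dproj_def
  by (intro imageI vector_field_tangent lie_algebra_vector_field) (simp_all add: top_carrier)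

lemma dproj_surj:
  assumes "v \<in> tangent_space N H"
  obtains X where "X \<in> lie_algebra G M" "dproj X = v"
proof -
  obtain w where w: "w \<in> tangent_space M \<one>" "v = differential M N proj w"
    using assms unfolding image_tangent_one[symmetric] by blast
  obtain e where e: "w = vec0 e" using tangent_representation[OF mfd chart0 one_U0 w(1)] by (elim exE)
  have "dproj (left_field e) f = v f" for f
    using left_field_one[OF pullback_proj, of f e] by (simp add: dproj_def w(2) differential_def e)
  then show ?thesis by (intro that[OF left_field_lie_algebra]) (rule ext)
qed

lemma dproj_add: "dproj (X + Y) = dproj X + dproj Y"
  and dproj_scaleR: "dproj (c *\<^sub>R X) = c *\<^sub>R dproj X"
  by (auto simp: dproj_def differential_def fun_eq_iff scaleR_fun_apply)

text \<open>Left invariance moves the value at \<open>a\<close> to the identity, where the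
  translated function is again pulled back from \<open>G/H\<close>.\<close>

lemma isotropy_invariant:
  assumes X: "X \<in> lie_algebra G M" "dproj X = 0" and f: "f \<in> smooth_functions N"
  shows "X (pullback M proj f) = 0"
proof
  fix a
  show "X (pullback M proj f) a = 0 a"
  proof (cases "a \<in> carrier G")
    case a: True
    have "X (pullback M proj f) a = X (pullback M (\<lambda>x. a \<otimes> x) (pullback M proj f)) \<one>"
      using lie_algebra_at[OF X(1) a one_closed pullback_proj[OF f]] a by simp
    also have "\<dots> = dproj X (pullback N (\<lambda>p. a <# p) f)"
      unfolding pullback_translate_proj[OF a, symmetric] by (rule dproj_eq[symmetric, OF pullback_translate[OF a f]])
    finally show ?thesis by (simp add: X(2))
  qed (simp add: lie_algebra_zero_outside(2)[OF X(1)])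
qed

lemma isotropy_one_parameter:
  assumes X: "X \<in> lie_algebra G M" "dproj X = 0" and \<gamma>: "one_parameter_subgroup G M X \<gamma>"
  shows "\<gamma> t \<in> H"
proof (rule ccontr)
  assume nH: "\<gamma> t \<notin> H"
  note \<gamma>G = one_parameter_in[OF \<gamma>]
  have const: "f (proj (\<gamma> t)) = f H" if f: "f \<in> smooth_functions N" for f
  proof -
    have "((\<lambda>t. f (proj (\<gamma> t))) has_real_derivative 0) (at s)" for s
    proof -
      have "((\<lambda>h. pullback M proj f (\<gamma> s \<otimes> \<gamma> h)) has_real_derivative X (pullback M proj f) (\<gamma> s)) (at 0)"
        by (rule one_parameter_derivative[OF \<gamma> pullback_proj[OF f] \<gamma>G])
      then have "((\<lambda>h. f (proj (\<gamma> (s + h)))) has_real_derivative 0) (at 0)"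
        by (simp add: pullback_apply \<gamma>G one_parameter_hom[OF \<gamma>] isotropy_invariant[OF X f])
      then have "((\<lambda>h. f (proj (\<gamma> (h + s)))) has_real_derivative 0) (at 0)" by (simp add: add.commute)
      then show ?thesis using DERIV_shift[of "\<lambda>t. f (proj (\<gamma> t))" 0 0 s] by simp
    qed
    then have "\<forall>s. ((\<lambda>t. f (proj (\<gamma> t))) has_real_derivative 0) (at s)" by (intro allI)
    from DERIV_isconst_all[OF this, of t 0] have "f (proj (\<gamma> t)) = f (proj (\<gamma> 0))" .
    then show ?thesis by (simp add: one_parameter_zero[OF \<gamma>] proj_one)
  qed
  have ne: "proj (\<gamma> t) \<noteq> H" using proj_eq_H_iff[OF \<gamma>G] nH by simp
  have Hin: "H \<in> topspace (mtop N)" using proj_in[OF one_closed] proj_one by simp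
  have "Hausdorff_space (mtop N)" using mfdN unfolding smooth_manifold_def by (elim conjE)
  then obtain W W' where W: "openin (mtop N) W" "proj (\<gamma> t) \<in> W" "H \<in> W'" "disjnt W W'"
    unfolding Hausdorff_space_def using proj_in[OF \<gamma>G] Hin ne by meson
  obtain f W'' where f: "f \<in> smooth_functions N" "proj (\<gamma> t) \<in> W''" "\<And>x. x \<in> W'' \<Longrightarrow> f x = 1"
      "\<And>x. x \<notin> W \<Longrightarrow> f x = 0"
    by (rule smooth_bump[OF mfdN W(1,2)]) blast
  have "H \<notin> W" using W(3,4) unfolding disjnt_def by blast
  then show False using const[OF f(1)] f(3)[OF f(2)] f(4)[of H] by simp
qed

lemma subgroup_lie_algebra_eq: "subgroup_lie_algebra G M H = {X \<in> lie_algebra G M. dproj X = 0}"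
proof (intro equalityI subsetI)
  fix X assume "X \<in> subgroup_lie_algebra G M H"
  then obtain \<gamma> where X: "X \<in> lie_algebra G M" and \<gamma>: "one_parameter_subgroup G M X \<gamma>" "range \<gamma> \<subseteq> H"
    unfolding subgroup_lie_algebra_def by blast
  have "dproj X = 0"
  proof
    fix f show "dproj X f = 0 f"
    proof (cases "f \<in> smooth_functions N")
      case f: True
      have "((\<lambda>t. pullback M proj f (\<one> \<otimes> \<gamma> t)) has_real_derivative X (pullback M proj f) \<one>) (at 0)"
        by (rule one_parameter_derivative[OF \<gamma>(1) pullback_proj[OF f] one_closed])
      moreover have "pullback M proj f (\<one> \<otimes> \<gamma> t) = f H" for t
      proof -
        have "proj (\<gamma> t) = H" using proj_eq_H_iff[OF one_parameter_in[OF \<gamma>(1)]] \<gamma>(2) by blast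
        then show ?thesis using one_parameter_in[OF \<gamma>(1), of t] by (simp add: pullback_apply)
      qed
      ultimately have "((\<lambda>t::real. f H) has_real_derivative X (pullback M proj f) \<one>) (at 0)" by simp
      from DERIV_unique[OF this DERIV_const] show ?thesis by (simp add: dproj_eq[OF f])
    qed (simp add: dproj_outside)
  qed
  then show "X \<in> {X \<in> lie_algebra G M. dproj X = 0}" using X by simp
next
  fix X assume "X \<in> {X \<in> lie_algebra G M. dproj X = 0}"
  then have X: "X \<in> lie_algebra G M" "dproj X = 0" by auto
  obtain \<gamma> where \<gamma>: "one_parameter_subgroup G M X \<gamma>" by (rule one_parameter_exists[OF X(1)])
  have "range \<gamma> \<subseteq> H" using isotropy_one_parameter[OF X \<gamma>] by blast
  then show "X \<in> subgroup_lie_algebra G M H" unfolding subgroup_lie_algebra_def using X(1) \<gamma> by blast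
qed

lemma dproj_Ad:
  assumes X: "X \<in> lie_algebra G M" and a: "a \<in> H"
  shows "dproj (Ad G M a X) = differential N N (\<lambda>p. a <# p) (dproj X)"
proof
  fix f
  have aG: "a \<in> carrier G" using a H_carrier by blast
  show "dproj (Ad G M a X) f = differential N N (\<lambda>p. a <# p) (dproj X) f"
  proof (cases "f \<in> smooth_functions N")
    case f: True
    have ia: "proj (inv a) = H" using proj_eq_H_iff[of "inv a"] subgroup.m_inv_closed[OF subgroup a] aG by simp
    \<comment> \<open>Here \<open>a \<in> H\<close> is used: right multiplication by
      \<open>inv a\<close> is invisible in \<open>G/H\<close>, so conjugation descends to left
      translation.\<close>
    have "proj (a \<otimes> x \<otimes> inv a) = a <# proj x" if x: "x \<in> carrier G" for x
    proof -
      have "proj (a \<otimes> x \<otimes> inv a) = (a \<otimes> x) <# proj (inv a)" by (rule proj_mult[symmetric]) (use aG x in auto)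
      then show ?thesis unfolding ia using proj_mult[OF aG x] by simp
    qed
    then have eq: "cj a (pullback M proj f) = pullback M proj (pullback N (\<lambda>p. a <# p) f)"
      using proj_in aG by (auto simp: cj_def pullback_def fun_eq_iff top_carrier)
    have "dproj (Ad G M a X) f = cj (inv a) (X (cj a (pullback M proj f))) \<one>"
      by (simp add: dproj_eq[OF f] Ad_eq[OF X pullback_proj[OF f] aG])
    also have "\<dots> = X (pullback M proj (pullback N (\<lambda>p. a <# p) f)) \<one>"
      unfolding eq using aG by (simp add: cj_def pullback_apply)
    also have "\<dots> = dproj X (pullback N (\<lambda>p. a <# p) f)" by (rule dproj_eq[symmetric, OF pullback_translate[OF aG f]])
    finally show ?thesis using f by (simp add: differential_def)
  qed (simp add: dproj_outside differential_def)
qed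

lemma invariant_form_Ad:
  assumes q: "left_translation_invariant G N q" and X: "X \<in> lie_algebra G M" and a: "a \<in> H"
  shows "q H (dproj (Ad G M a X)) = q H (dproj X)"
proof -
  have aG: "a \<in> carrier G" using a H_carrier by blast
  have Hin: "H \<in> topspace (mtop N)" using proj_in[OF one_closed] proj_one by simp
  have "q (a <# H) (differential N N (\<lambda>x. a <# x) (dproj X)) = q H (dproj X)"
    using q aG Hin dproj_tangent[OF X] unfolding left_translation_invariant_def by simp
  moreover have "a <# H = H" using proj_eq_H_iff[OF aG] a by simp
  ultimately show ?thesis by (simp add: dproj_Ad[OF X a])
qed

end

section \<open>From the Minkowski form on the tangent space to a form on \<open>so\<close>\<close>

text \<open>\<open>B\<close> is the standard Lorentz form in the coordinates \<open>x v i\<close> of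
  a Minkowski basis.\<close>

lemma minkowski_bilinear:
  assumes "minkowski_form V q"
  obtains B where "\<forall>v\<in>V. q v = B v v" "\<forall>v w. B v w = B w v"
    "\<forall>u\<in>V. \<forall>v\<in>V. \<forall>w. B w (u + v) = (B w u + B w v :: real)"
    "\<forall>u\<in>V. \<forall>c w. B w (c *\<^sub>R u) = c * B w u"
    "\<forall>v\<in>V. (\<forall>w\<in>V. B v w = 0) \<longrightarrow> v = 0"
    "\<forall>v\<in>V. \<forall>w\<in>V. B v v = 0 \<longrightarrow> B v w = 0 \<longrightarrow> B w w = 0 \<longrightarrow>
      (\<exists>s t. (s \<noteq> 0 \<or> t \<noteq> 0) \<and> s *\<^sub>R v + t *\<^sub>R w = 0)"
    "V \<noteq> {0}" "subspace V"
proof -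
  obtain m b where mb: "m \<ge> 1" "inj_on b {..m}" "independent (b ` {..m})" "span (b ` {..m}) = V"
    "\<And>c :: nat \<Rightarrow> real. q (\<Sum>i\<le>m. c i *\<^sub>R b i) = - (c 0)\<^sup>2 + (\<Sum>i=1..m. (c i)\<^sup>2)"
    using assms unfolding minkowski_form_def by blast
  define x where "x v i = representation (b ` {..m}) v (b i)" for v i
  have xadd: "x (u + v) i = x u i + x v i" if "u \<in> V" "v \<in> V" for u v i
    unfolding x_def using that representation_add[OF mb(3)] by (simp add: mb(4))
  have xscale: "x (c *\<^sub>R u) i = c * x u i" if "u \<in> V" for u c i
    unfolding x_def using that representation_scale[OF mb(3)] by (simp add: mb(4))
  have expand: "v = (\<Sum>i\<le>m. x v i *\<^sub>R b i)" if "v \<in> V" for v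
  proof -
    have "(\<Sum>w\<in>b ` {..m}. representation (b ` {..m}) v w *\<^sub>R w) = v"
      by (rule sum_representation_eq[OF mb(3)]) (use that mb(4) in auto)
    then show ?thesis by (simp add: sum.reindex[OF mb(2)] x_def)
  qed
  have xb: "x (b j) i = (if i = j then 1 else 0)" if "i \<le> m" "j \<le> m" for i j
    unfolding x_def using representation_basis[OF mb(3), of "b j"] that inj_on_eq_iff[OF mb(2), of i j] by simp
  have bV: "b j \<in> V" if "j \<le> m" for j using span_base[of "b j" "b ` {..m}"] that mb(4) by auto
  have zero: "v = 0" if "v \<in> V" "\<And>i. i \<le> m \<Longrightarrow> x v i = 0" for v using expand[OF that(1)] that(2) by simp
  define B where "B v w = - (x v 0 * x w 0) + (\<Sum>i=1..m. x v i * x w i)" for v w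
  have B1: "q v = B v v" if "v \<in> V" for v
    using mb(5)[of "x v"] expand[OF that, symmetric] by (simp add: B_def power2_eq_square)
  have B2: "B v w = B w v" for v w by (simp add: B_def mult.commute)
  have B3: "B w (u + v) = B w u + B w v" if "u \<in> V" "v \<in> V" for u v w
    by (simp add: B_def xadd[OF that] sum.distrib algebra_simps)
  have B4: "B w (c *\<^sub>R u) = c * B w u" if "u \<in> V" for c u w
    by (simp add: B_def xscale[OF that] sum_distrib_left algebra_simps)
  have Bb: "B v (b j) = (if j = 0 then - x v 0 else x v j)" if "j \<le> m" for v j
  proof -
    have "(\<Sum>i=1..m. x v i * x (b j) i) = (\<Sum>i=1..m. if i = j then x v i else 0)"
      using that by (intro sum.cong) (auto simp: xb)
    then show ?thesis using that by (simp add: B_def xb)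
  qed
  have B5: "v = 0" if "v \<in> V" "\<And>w. w \<in> V \<Longrightarrow> B v w = 0" for v
  proof (rule zero[OF that(1)])
    fix i assume i: "i \<le> m"
    then show "x v i = 0" using that(2)[OF bV[OF i]] Bb[OF i, of v] by (simp split: if_splits)
  qed
  have sub: "subspace V" unfolding mb(4)[symmetric] by (rule subspace_span)
  have pos: "v = 0" if v: "v \<in> V" "x v 0 = 0" "B v v = 0" for v
  proof (rule zero[OF v(1)])
    fix i assume i: "i \<le> m"
    have "(\<Sum>i=1..m. x v i * x v i) = 0" using v by (simp add: B_def)
    then have "\<forall>i\<in>{1..m}. x v i * x v i = 0" by (subst (asm) sum_nonneg_eq_0_iff) auto
    then show "x v i = 0" using v(2) i by (cases i) auto
  qed
  have B6: "\<exists>s t. (s \<noteq> 0 \<or> t \<noteq> 0) \<and> s *\<^sub>R v + t *\<^sub>R w = 0"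
    if v: "v \<in> V" "w \<in> V" "B v v = 0" "B v w = 0" "B w w = 0" for v w
  proof (cases "x v 0 = 0")
    case True
    then show ?thesis using pos[OF v(1) True v(3)] by (intro exI[of _ 1] exI[of _ 0]) simp
  next
    case False
    \<comment> \<open>The combination with vanishing time coordinate: it is null and lies where the
      form is positive definite, so it is zero.\<close>
    let ?u = "x w 0 *\<^sub>R v + (- x v 0) *\<^sub>R w"
    have u: "?u \<in> V" by (intro subspace_add[OF sub] subspace_mul[OF sub] v)
    note m1 = subspace_mul[OF sub v(1), of "x w 0"] and m2 = subspace_mul[OF sub v(2), of "- x v 0"]
    have Bu: "B z ?u = x w 0 * B z v + (- x v 0) * B z w" for z unfolding B3[OF m1 m2] B4[OF v(1)] B4[OF v(2)] ..
    have "B ?u v = 0" "B ?u w = 0" using Bu[of v] Bu[of w] v B2 by simp_all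
    then have "B ?u ?u = 0" using Bu[of ?u] by simp
    moreover have "x ?u 0 = 0" unfolding xadd[OF m1 m2] xscale[OF v(1)] xscale[OF v(2)] by simp
    ultimately have "?u = 0" using pos[OF u] by blast
    then show ?thesis using False by (intro exI[of _ "x w 0"] exI[of _ "- x v 0"]) simp
  qed
  have "b 0 \<noteq> 0" using dependent_zero[of "b ` {..m}"] mb(3) by (metis imageI atMost_iff le0)
  then have "V \<noteq> {0}" using bV[of 0] by auto
  show ?thesis
  proof (rule that[of B])
    show "\<forall>v\<in>V. q v = B v v" by (intro ballI B1)
    show "\<forall>v w. B v w = B w v" by (intro allI B2)
    show "\<forall>u\<in>V. \<forall>v\<in>V. \<forall>w. B w (u + v) = B w u + B w v" by (intro ballI allI B3)
    show "\<forall>u\<in>V. \<forall>c w. B w (c *\<^sub>R u) = c * B w u" by (intro ballI allI B4)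
    show "\<forall>v\<in>V. (\<forall>w\<in>V. B v w = 0) \<longrightarrow> v = 0" using B5 by simp
    show "\<forall>v\<in>V. \<forall>w\<in>V. B v v = 0 \<longrightarrow> B v w = 0 \<longrightarrow> B w w = 0 \<longrightarrow>
      (\<exists>s t. (s \<noteq> 0 \<or> t \<noteq> 0) \<and> s *\<^sub>R v + t *\<^sub>R w = 0)" by (intro ballI impI B6)
  qed (use \<open>V \<noteq> {0}\<close> sub in auto)
qed

text \<open>\<open>D\<close> presents \<open>V\<close> as the quotient of \<open>so\<close> by its
  kernel. Skewness is supplied on the diagonal, as differentiating a quadratic form gives it, and is
  polarised here.\<close>

lemma so_isotropy_of_form:
  fixes D :: "real ^ (2 + 'n::finite) ^ (2 + 'n) \<Rightarrow> 'v::real_vector" and B :: "'v \<Rightarrow> 'v \<Rightarrow> real"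
  assumes n3: "CARD('n) \<ge> 3"
    and Dadd: "\<And>X Y. D (X + Y) = D X + D Y" and Dscale: "\<And>c X. D (c *\<^sub>R X) = c *\<^sub>R D X"
    and DV: "\<And>X. D X \<in> V" and surj: "\<And>v. v \<in> V \<Longrightarrow> \<exists>X\<in>so. D X = v"
    and Bsym: "\<And>v w. B v w = B w v"
    and Badd: "\<And>u v w. u \<in> V \<Longrightarrow> v \<in> V \<Longrightarrow> B w (u + v) = B w u + B w v"
    and Bscale: "\<And>c u w. u \<in> V \<Longrightarrow> B w (c *\<^sub>R u) = c * B w u"
    and nondeg: "\<And>v. v \<in> V \<Longrightarrow> (\<And>w. w \<in> V \<Longrightarrow> B v w = 0) \<Longrightarrow> v = 0"
    and null: "\<And>v w. v \<in> V \<Longrightarrow> w \<in> V \<Longrightarrow> B v v = 0 \<Longrightarrow> B v w = 0 \<Longrightarrow> B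
        w w = 0 \<Longrightarrow>
      \<exists>s t. (s \<noteq> 0 \<or> t \<noteq> 0) \<and> s *\<^sub>R v + t *\<^sub>R w = 0"
    and V: "V \<noteq> {0}" "0 \<in> V"
    and skew: "\<And>X Y. X \<in> so \<Longrightarrow> D X = 0 \<Longrightarrow> Y \<in> so \<Longrightarrow> B (D (br X Y)) (D Y) = 0"
  shows "so_isotropy {X \<in> so. D X = 0} (\<lambda>X Y. B (D X) (D Y))"
proof (rule so_isotropy.intro)
  have right: "B (D Z) (D (X + Y)) = B (D Z) (D X) + B (D Z) (D Y)" for X Y Z
    unfolding Dadd by (rule Badd[OF DV DV])
  have left: "B (D (X + Y)) (D Z) = B (D X) (D Z) + B (D Y) (D Z)" for X Y Z
    using right[of Z X Y] Bsym by simp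
  have zero: "B (D X) 0 = 0" for X using Bscale[OF V(2), of "D X" 0] by simp
  show "linear (\<lambda>Y. B (D X) (D Y))" for X
    by (rule linearI) (simp_all only: right Dscale Bscale[OF DV] real_scaleR_def)
  show "X \<in> {X \<in> so. D X = 0} \<longleftrightarrow> (\<forall>Y\<in>so. B (D X) (D Y) = 0)" if X: "X \<in> so" for X
  proof
    assume "X \<in> {X \<in> so. D X = 0}"
    then show "\<forall>Y\<in>so. B (D X) (D Y) = 0" using zero Bsym by simp
  next
    assume *: "\<forall>Y\<in>so. B (D X) (D Y) = 0"
    have "D X = 0"
    proof (rule nondeg[OF DV])
      fix w assume "w \<in> V"
      then obtain Y where "Y \<in> so" "D Y = w" using surj by blast
      then show "B (D X) w = 0" using * by blast
    qed
    then show "X \<in> {X \<in> so. D X = 0}" using X by simp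
  qed
  show "B (D (br X Y)) (D Z) = - B (D Y) (D (br X Z))" if "X \<in> {X \<in> so. D X = 0}" "Y \<in> so" "Z \<in> so" for X Y Z
  proof -
    have X: "X \<in> so" "D X = 0" using that(1) by simp_all
    have "B (D (br X (Y + Z))) (D (Y + Z)) = 0" by (rule skew[OF X subspace_add[OF subspace_so that(2,3)]])
    then have "B (D (br X Y)) (D Z) + B (D (br X Z)) (D Y) = 0"
      unfolding br_add_right left right using skew[OF X that(2)] skew[OF X that(3)] by simp
    then show ?thesis using Bsym[of "D Y" "D (br X Z)"] by simp
  qed
  show "\<exists>s t. (s \<noteq> 0 \<or> t \<noteq> 0) \<and> s *\<^sub>R X + t *\<^sub>R Y \<in> {X \<in> so. D X = 0}"
    if "X \<in> so" "Y \<in> so" "B (D X) (D X) = 0" "B (D X) (D Y) = 0" "B (D Y) (D Y) = 0" for X Y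
  proof -
    from null[OF DV DV that(3-5)]
    obtain s t where st: "s \<noteq> 0 \<or> t \<noteq> 0" "s *\<^sub>R D X + t *\<^sub>R D Y = 0" by blast
    have "s *\<^sub>R X + t *\<^sub>R Y \<in> {X \<in> so. D X = 0}"
      using st(2) subspace_add[OF subspace_so subspace_mul[OF subspace_so that(1)] subspace_mul[OF subspace_so that(2)]]
      by (simp add: Dadd Dscale)
    then show ?thesis using st(1) by blast
  qed
  show "{X \<in> so. D X = 0} \<noteq> so"
  proof
    assume "{X \<in> so. D X = 0} = so"
    then have "v = 0" if "v \<in> V" for v using surj[OF that] by blast
    then show False using V by blast
  qed
qed (use n3 Bsym in auto)

section \<open>The topology of \<open>GL L\<close>: bounded isotropy has compact closure\<close>

context smooth_lie_group
begin

abbreviation L where "L \<equiv> lie_algebra G M"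

lemma linear_cvec_Ad:
  assumes a: "a \<in> carrier G" shows "linear (\<lambda>e. cvec (Ad G M a (left_field e)))"
  by (rule linearI)
    (simp_all add: left_field_add left_field_scaleR Ad_add Ad_scaleR a left_field_lie_algebra Ad_lie_algebra cvec_add cvec_scaleR)

lemma cvec_left_field_derivative:
  assumes X: "X \<in> L" and A: "A \<in> L" and \<gamma>: "one_parameter_subgroup G M X \<gamma>" "smooth_param M UNIV \<gamma>"
  shows "((\<lambda>t. cvec (Ad G M (\<gamma> t) A)) has_vector_derivative cvec (lie_bracket X A)) (at 0)"
proof -
  obtain x where x: "\<And>b. x b \<in> smooth_functions M" "\<And>Y b. Y \<in> L \<Longrightarrow> Y (x b) \<one> = cvec Y \<bullet> b"
    by (rule cvec_coordinate) (rule that)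
  have "((\<lambda>t. cvec (Ad G M (\<gamma> t) A) \<bullet> b) has_real_derivative cvec (lie_bracket X A) \<bullet> b) (at 0)" for b
    using Ad_derivative[OF X A x(1)[of b] \<gamma>]
    by (simp add: x(2) Ad_lie_algebra[OF A one_parameter_in[OF \<gamma>(1)]] lie_bracket_lie_algebra[OF X A])
  then show ?thesis
    unfolding has_vector_derivative_def has_real_derivative_iff_has_vector_derivative
    by (subst has_derivative_componentwise_within) simp
qed

lemma subspace_L: "subspace L"
  using lie_algebra_add lie_algebra_scaleR left_field_lie_algebra[of 0] left_field_scaleR[of 0 0]
  unfolding subspace_def by auto

definition GLB where "GLB = (SOME B. independent B \<and> span B = L)"

lemma GLB: "independent GLB" "span GLB = L"
proof -
  have "\<exists>B. independent B \<and> span B = L"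
    using basis_exists[of L] span_minimal[OF _ subspace_L] by (metis subset_antisym)
  then have "independent GLB \<and> span GLB = L" unfolding GLB_def by (rule someI_ex)
  then show "independent GLB" "span GLB = L" by blast+
qed

definition entries where
  "entries T = (\<lambda>(b, c). if b \<in> GLB \<and> c \<in> GLB then representation GLB (T b) c else (0::real))"

lemma GL_topology_eq: "GL_topology L = pullback_topology (GL L) entries euclidean"
  unfolding GL_topology_def Let_def GLB_def[symmetric] entries_def[abs_def] ..

text \<open>For the Hausdorff property, which makes compact sets of the pullback topology
  closed.\<close>

lemma entries_inj: "inj_on entries (GL L)"
proof (rule inj_onI)
  fix S T assume S: "S \<in> GL L" and T: "T \<in> GL L" and eq: "entries S = entries T"
  have lin: "linear_map_on L L S" "linear_map_on L L T" and out: "\<And>v. v \<notin> L \<Longrightarrow> S v = T v"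
    using S T unfolding GL_def by simp_all
  have b: "S b = T b" if "b \<in> GLB" for b
  proof -
    have "b \<in> L" using that GLB(2) span_base by blast
    then have SL: "S b \<in> span GLB" "T b \<in> span GLB" using lin GLB(2) unfolding linear_map_on_def by auto
    have "representation GLB (S b) c = representation GLB (T b) c" for c
    proof (cases "c \<in> GLB")
      case True
      then show ?thesis using fun_cong[OF eq, of "(b, c)"] that by (simp add: entries_def)
    next
      case False
      then show ?thesis using representation_ne_zero by metis
    qed
    then have r: "representation GLB (S b) = representation GLB (T b)" by (rule ext)
    show ?thesis
      by (rule trans[OF sum_nonzero_representation_eq[OF GLB(1) SL(1), unfolded r, symmetric] sum_nonzero_representation_eq[OF GLB(1) SL(2)]])
  qed
  have on: "v \<in> L \<and> S v = T v" if "v \<in> span GLB" for v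
    using that
  proof (induction rule: span_induct_alt)
    case base
    have "S 0 = 0" "T 0 = 0" using lin subspace_0[OF subspace_L] unfolding linear_map_on_def by (metis scaleR_zero_left)+
    then show ?case using subspace_0[OF subspace_L] by (simp only: simp_thms)
  next
    case (step c x y)
    have x: "x \<in> L" using span_base[OF step.hyps(1)] unfolding GLB(2) .
    have y: "y \<in> L" using step.IH by (rule conjunct1)
    have li: "F (c *\<^sub>R x + y) = c *\<^sub>R F x + F y" if "linear_map_on L L F" for F
    proof -
      have ad: "\<forall>x\<in>L. \<forall>y\<in>L. F (x + y) = F x + F y" using that unfolding linear_map_on_def by (elim conjE)
      have sc: "\<forall>c. \<forall>x\<in>L. F (c *\<^sub>R x) = c *\<^sub>R F x" using that unfolding linear_map_on_def by (elim conjE)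
      have "F (c *\<^sub>R x + y) = F (c *\<^sub>R x) + F y" by (rule ad[rule_format, OF subspace_mul[OF subspace_L x] y])
      also have "F (c *\<^sub>R x) = c *\<^sub>R F x" by (rule sc[rule_format, OF x])
      finally show ?thesis .
    qed
    show ?case using li[OF lin(1)] li[OF lin(2)] subspace_add[OF subspace_L subspace_mul[OF subspace_L x] y] conjunct2[OF step.IH] b[OF step.hyps(1)]
      by (simp only: simp_thms)
  qed
  show "S = T"
  proof
    fix v show "S v = T v"
    proof (cases "v \<in> L")
      case True
      then show ?thesis by (rule conjunct2[OF on[unfolded GLB(2)]])
    qed (rule out)
  qed
qed

lemma topspace_GL: "topspace (GL_topology L) = GL L"
  unfolding GL_topology_eq by (simp add: topspace_pullback_topology)

lemma Hausdorff_GL: "Hausdorff_space (GL_topology L)"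
proof (rule Hausdorff_space_injective_preimage[of euclidean _ entries])
  show "continuous_map (GL_topology L) euclidean entries"
    unfolding GL_topology_eq using continuous_map_pullback[of euclidean euclidean id] by (simp add: o_def)
  show "inj_on entries (topspace (GL_topology L))" unfolding topspace_GL by (rule entries_inj)
  show "Hausdorff_space (euclidean :: (((('g \<Rightarrow> real) \<Rightarrow> 'g \<Rightarrow> real) \<times> (('g \<Rightarrow> real)
      \<Rightarrow> 'g \<Rightarrow> real)) \<Rightarrow> real) topology)"
    unfolding euclidean_product_topology[symmetric] by (simp add: Hausdorff_space_product_topology)
qed

text \<open>Operators on the coordinate space \<open>'e\<close> carried over to the Lie algebra;
  compactness of bounded sets of operators is transported along it.\<close>

definition field_map :: "('e \<Rightarrow>\<^sub>L 'e) \<Rightarrow> (('g \<Rightarrow> real) \<Rightarrow> ('g \<Rightarrow> real))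
    \<Rightarrow> (('g \<Rightarrow> real) \<Rightarrow> ('g \<Rightarrow> real))" where
  "field_map S X = (if X \<in> L then left_field (blinfun_apply S (cvec X)) else 0)"

lemma linear_field_map: "linear_map_on L L (field_map S)"
  unfolding linear_map_on_def field_map_def
  by (auto simp: lie_algebra_add lie_algebra_scaleR cvec_add cvec_scaleR left_field_lie_algebra
      left_field_add left_field_scaleR blinfun.add_right blinfun.scaleR_right)

lemma field_map_GL:
  assumes "S o\<^sub>L R = id_blinfun" "R o\<^sub>L S = id_blinfun" shows "field_map S \<in> GL L"
proof -
  have 1: "blinfun_apply S (blinfun_apply R e) = e" "blinfun_apply R (blinfun_apply S e) = e" for e
    using arg_cong[OF assms(1), of "\<lambda>F. blinfun_apply F e"] arg_cong[OF assms(2), of "\<lambda>F. blinfun_apply F e"] by simp_all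
  have "bij_betw (field_map S) L L"
    by (rule bij_betw_byWitness[of _ "field_map R"])
      (auto simp: field_map_def left_field_lie_algebra cvec_left_field left_field_cvec 1)
  then show ?thesis using linear_field_map unfolding GL_def by (simp add: field_map_def)
qed

text \<open>\<open>H\<close> is closed under inverses, so the bound holds for each operator and its
  inverse. Pairs of mutually inverse operators of norm at most \<open>C\<close> form a compact set;
  recording the inverse keeps the limits invertible. Its image in \<open>GL L\<close> is compact,
  hence closed, and contains \<open>Ad H\<close>.\<close>

lemma compact_closure_Ad:
  assumes C0: "0 \<le> C" and H: "H \<subseteq> carrier G" "\<And>a. a \<in> H \<Longrightarrow> inv a \<in> H"
    and C: "\<And>a e. a \<in> H \<Longrightarrow> norm (cvec (Ad G M a (left_field e))) \<le> C * norm e"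
  shows "compactin (GL_topology L) (GL_topology L closure_of (Ad G M ` H))"
proof -
  define P where "P = {(S :: 'e \<Rightarrow>\<^sub>L 'e, R :: 'e \<Rightarrow>\<^sub>L 'e). S o\<^sub>L R = id_blinfun \<and> R o\<^sub>L
      S = id_blinfun} \<inter> (cball 0 C \<times> cball 0 C)"
  have "closed {(S :: 'e \<Rightarrow>\<^sub>L 'e, R :: 'e \<Rightarrow>\<^sub>L 'e). S o\<^sub>L R = id_blinfun \<and> R o\<^sub>L S = id_blinfun}"
    unfolding case_prod_beta
    by (intro closed_Collect_conj closed_Collect_eq bounded_bilinear.continuous_on[OF bounded_bilinear_blinfun_compose]
        continuous_intros)
  moreover have "compact (cball (0 :: 'e \<Rightarrow>\<^sub>L 'e) C)" by (rule compact_cball)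
  ultimately have P: "compact P" unfolding P_def by (intro closed_Int_compact compact_Times)
  define K where "K = (\<lambda>z. field_map (fst z)) ` P"
  have "continuous_map (top_of_set P) (GL_topology L) (\<lambda>z. field_map (fst z))"
    unfolding GL_topology_eq
  proof (rule continuous_map_pullback')
    show "topspace (top_of_set P) \<subseteq> (\<lambda>z. field_map (fst z)) -` GL L"
      using field_map_GL by (auto simp: P_def)
    have "continuous_on P (\<lambda>z. entries (field_map (fst z)))"
    proof (rule continuous_on_coordinatewise_then_product)
      fix bc :: "(('g \<Rightarrow> real) \<Rightarrow> 'g \<Rightarrow> real) \<times> (('g \<Rightarrow> real) \<Rightarrow> 'g \<Rightarrow> real)"
      obtain b c where bc: "bc = (b, c)" by (cases bc)
      show "continuous_on P (\<lambda>z. entries (field_map (fst z)) bc)"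
      proof (cases "b \<in> GLB \<and> c \<in> GLB")
        case True
        then have bL: "b \<in> L" using GLB(2) span_base by blast
        have "linear (\<lambda>e. representation GLB (left_field e) c)"
          by (rule linearI) (simp_all add: left_field_add left_field_scaleR representation_add[OF GLB(1)]
              representation_scale[OF GLB(1)] GLB(2) left_field_lie_algebra)
        then have "continuous_on UNIV (\<lambda>e. representation GLB (left_field e) c)"
          using linear_continuous_on linear_conv_bounded_linear by blast
        then have "continuous_on P (\<lambda>z. representation GLB (left_field (blinfun_apply (fst z) (cvec b))) c)"
          by (rule continuous_on_compose2) (auto intro!: continuous_intros)
        then show ?thesis using True bL by (simp add: bc entries_def field_map_def)
      next
        case False
        then have "entries T bc = 0" for T by (auto simp: bc entries_def)
        then show ?thesis by simp
      qed
    qed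
    then show "continuous_map (top_of_set P) euclidean (entries \<circ> (\<lambda>z. field_map (fst z)))" by (simp add: o_def)
  qed
  moreover have "compactin (top_of_set P) P" using P by (simp add: compactin_subtopology)
  ultimately have K: "compactin (GL_topology L) K" unfolding K_def by (rule image_compactin[rotated])
  have "Ad G M ` H \<subseteq> K"
  proof (rule image_subsetI)
    fix a assume a: "a \<in> H"
    have ac: "a \<in> carrier G" "inv a \<in> carrier G" using a H by auto
    let ?S = "\<lambda>a. Blinfun (\<lambda>e. cvec (Ad G M a (left_field e)))"
    have bl: "bounded_linear (\<lambda>e. cvec (Ad G M a (left_field e)))" if "a \<in> carrier G" for a
      using linear_cvec_Ad[OF that] linear_conv_bounded_linear by blast
    note app = bounded_linear_Blinfun_apply[OF bl]
    have n: "norm (?S a) \<le> C" if "a \<in> H" for a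
      by (rule norm_blinfun_bound[OF C0]) (use C[OF that] H that in \<open>simp add: app subsetD[OF H(1)]\<close>)
    have comp: "?S a o\<^sub>L ?S b = id_blinfun" if "a \<in> carrier G" "b \<in> carrier G" "a \<otimes> b = \<one>" for a b
      using that by (intro blinfun_eqI)
        (simp add: app left_field_cvec Ad_lie_algebra left_field_lie_algebra Ad_mult Ad_one cvec_left_field)
    have "(?S a, ?S (inv a)) \<in> P" unfolding P_def using ac a H(2)[OF a] by (auto simp: comp n)
    moreover have "Ad G M a = field_map (fst (?S a, ?S (inv a)))"
    proof
      fix X show "Ad G M a X = field_map (fst (?S a, ?S (inv a))) X"
        using ac by (cases "X \<in> L") (simp_all add: field_map_def app left_field_cvec Ad_lie_algebra, simp add: Ad_def)
    qed
    ultimately show "Ad G M a \<in> K" unfolding K_def by (metis image_eqI)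
  qed
  then have "GL_topology L closure_of (Ad G M ` H) \<subseteq> K"
    by (rule closure_of_minimal[OF _ compactin_imp_closedin[OF Hausdorff_GL K]])
  then show ?thesis by (rule closed_compactin[OF K _ closedin_closure_of])
qed

end

section \<open>The isotropy algebra in matrix form\<close>

context smooth_homogeneous_space
begin

text \<open>The value of \<open>q H\<close> on \<open>dproj (Ad (\<gamma> t) Y)\<close> is constant
  since \<open>\<gamma> t \<in> H\<close>; its derivative at 0 is twice the left-hand side.\<close>

lemma isotropy_skew:
  assumes B: "\<And>v. v \<in> tangent_space N H \<Longrightarrow> q H v = B v v" "\<And>v w. B v w = (B w v :: real)"
      "\<And>u v w. u \<in> tangent_space N H \<Longrightarrow> v \<in> tangent_space N H \<Longrightarrow> B w (u + v) = B w u + B w v"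
      "\<And>c u w. u \<in> tangent_space N H \<Longrightarrow> B w (c *\<^sub>R u) = c * B w u"
    and q: "left_translation_invariant G N q"
    and X: "X \<in> L" "dproj X = 0" and Y: "Y \<in> L"
  shows "B (dproj (lie_bracket X Y)) (dproj Y) = 0"
proof -
  obtain \<gamma> where \<gamma>: "one_parameter_subgroup G M X \<gamma>" "smooth_param M UNIV \<gamma>" by (rule one_parameter_exists[OF X(1)])
  note \<gamma>H = isotropy_one_parameter[OF X \<gamma>(1)]
  define \<Phi> where "\<Phi> d e = B (dproj (left_field d)) (dproj (left_field e))" for d e
  have lin: "linear (\<Phi> d)" for d
    by (rule linearI)
      (simp_all add: \<Phi>_def left_field_add left_field_scaleR dproj_add dproj_scaleR B dproj_tangent left_field_lie_algebra)
  have sym: "\<Phi> d e = \<Phi> e d" for d e unfolding \<Phi>_def by (rule B(2))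
  have "bounded_bilinear \<Phi>"
    unfolding bilinear_conv_bounded_bilinear[symmetric] bilinear_def
  proof (intro conjI allI)
    show "linear (\<Phi> d)" for d by (rule lin)
    then show "linear (\<lambda>d. \<Phi> d e)" for e by (subst sym)
  qed
  note bb = this
  let ?c = "\<lambda>t. cvec (Ad G M (\<gamma> t) Y)" and ?c' = "cvec (lie_bracket X Y)"
  note der = cvec_left_field_derivative[OF X(1) Y \<gamma>]
  note AdL = Ad_lie_algebra[OF Y one_parameter_in[OF \<gamma>(1)]]
  have "\<Phi> (?c t) (?c t) = q H (dproj Y)" for t
    using invariant_form_Ad[OF q Y \<gamma>H, of t] by (simp add: \<Phi>_def left_field_cvec AdL B(1) dproj_tangent)
  then have "((\<lambda>t. \<Phi> (?c t) (?c t)) has_vector_derivative 0) (at 0)" by simp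
  from vector_derivative_unique_at[OF bounded_bilinear.has_vector_derivative[OF bb der der] this]
  have "\<Phi> (?c 0) ?c' + \<Phi> ?c' (?c 0) = 0" .
  then have "\<Phi> ?c' (?c 0) = 0" using sym[of "?c 0" ?c'] by simp
  then show ?thesis
    by (simp add: \<Phi>_def one_parameter_zero[OF \<gamma>(1)] Ad_one[OF Y] left_field_cvec Y lie_bracket_lie_algebra X)
qed

theorem isotropy_algebra_conjugate:
  fixes \<sigma> :: "(('g \<Rightarrow> real) \<Rightarrow> ('g \<Rightarrow> real)) \<Rightarrow> real ^ (2 + 'n::finite) ^ (2 + 'n)"
  assumes n3: "CARD('n) \<ge> 3"
    and noncompact: "\<not> compactin (GL_topology L) (GL_topology L closure_of (Ad G M ` H))"
    and lorentz: "lorentz_metric N q" and q: "left_translation_invariant G N q"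
    and iso: "lie_algebra_iso_so L \<sigma>"
  shows "\<exists>(i::2). \<exists>g\<in>SO. \<sigma> ` subgroup_lie_algebra G M H = (\<lambda>A. g ** A ** matrix_inv g) ` standard_so1n i"
proof -
  have lin\<sigma>: "linear_map_on L so \<sigma>" and bij: "bij_betw \<sigma> L so"
    and brL: "\<forall>X\<in>L. \<forall>Y\<in>L. \<sigma> (lie_bracket X Y) = \<sigma> X ** \<sigma> Y - \<sigma> Y ** \<sigma> X"
    using iso unfolding lie_algebra_iso_so_def by simp_all
  have \<sigma>in: "\<sigma> X \<in> so" if "X \<in> L" for X using bij_betwE[OF bij] that by simp
  have \<sigma>add: "\<sigma> (X + Y) = \<sigma> X + \<sigma> Y" if "X \<in> L" "Y \<in> L" for X Y using lin\<sigma> that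
      unfolding linear_map_on_def by simp
  have \<sigma>scale: "\<sigma> (c *\<^sub>R X) = c *\<^sub>R \<sigma> X" if "X \<in> L" for c X using lin\<sigma> that
      unfolding linear_map_on_def by simp
  have \<sigma>br: "\<sigma> (lie_bracket X Y) = br (\<sigma> X) (\<sigma> Y)" if "X \<in> L" "Y \<in> L" for X Y using brL that by (simp add: br_def)
  \<comment> \<open>The inverse of \<open>\<sigma>\<close>, composed with \<open>so_proj\<close> to
    be linear on all matrices.\<close>
  define \<tau> where "\<tau> A = inv_into L \<sigma> (so_proj A)" for A
  have im: "so_proj A \<in> \<sigma> ` L" for A using bij so_proj_in[of A] unfolding bij_betw_def by simp
  have \<tau>in: "\<tau> A \<in> L" for A unfolding \<tau>_def by (rule inv_into_into[OF im])
  have \<sigma>\<tau>': "\<sigma> (\<tau> A) = so_proj A" for A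
    unfolding \<tau>_def by (rule f_inv_into_f[OF im])
  have \<sigma>\<tau>: "\<sigma> (\<tau> A) = A" if "A \<in> so" for A using \<sigma>\<tau>' so_proj_eq[OF that] by simp
  have \<tau>\<sigma>: "\<tau> (\<sigma> X) = X" if "X \<in> L" for X
    unfolding \<tau>_def so_proj_eq[OF \<sigma>in[OF that]] using bij that by (simp add: bij_betw_def)
  have \<tau>eq: "\<tau> A = X" if "X \<in> L" "\<sigma> X = so_proj A" for A X
    unfolding \<tau>_def that(2)[symmetric] using bij that(1) by (simp add: bij_betw_def)
  have \<tau>add: "\<tau> (A + A') = \<tau> A + \<tau> A'" for A A'
    by (rule \<tau>eq) (simp_all add: lie_algebra_add \<tau>in \<sigma>add \<sigma>\<tau>' linear_add[OF linear_so_proj])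
  have \<tau>scale: "\<tau> (c *\<^sub>R A) = c *\<^sub>R \<tau> A" for c A
    by (rule \<tau>eq) (simp_all add: lie_algebra_scaleR \<tau>in \<sigma>scale \<sigma>\<tau>' linear_scale[OF linear_so_proj])
  have \<tau>br: "\<tau> (br A A') = lie_bracket (\<tau> A) (\<tau> A')" if "A \<in> so" "A' \<in> so" for A A'
    by (rule \<tau>eq) (simp_all add: lie_bracket_lie_algebra \<tau>in \<sigma>br \<sigma>\<tau> that so_proj_eq[OF so_br[OF that]])
  have \<tau>proj: "\<tau> (so_proj A) = \<tau> A" for A unfolding \<tau>_def so_proj_eq[OF so_proj_in] ..

  let ?V = "tangent_space N H"
  have "H \<in> topspace (mtop N)" using proj_in[OF one_closed] proj_one by simp
  then have "minkowski_form ?V (q H)" using lorentz unfolding lorentz_metric_def by blast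
  then obtain B where B0: "\<forall>v\<in>?V. q H v = B v v" "\<forall>v w. B v w = B w v"
    "\<forall>u\<in>?V. \<forall>v\<in>?V. \<forall>w. B w (u + v) = (B w u + B w v :: real)"
    "\<forall>u\<in>?V. \<forall>c w. B w (c *\<^sub>R u) = c * B w u"
    "\<forall>v\<in>?V. (\<forall>w\<in>?V. B v w = 0) \<longrightarrow> v = 0"
    "\<forall>v\<in>?V. \<forall>w\<in>?V. B v v = 0 \<longrightarrow> B v w = 0 \<longrightarrow> B w w = 0 \<longrightarrow>
      (\<exists>s t. (s \<noteq> 0 \<or> t \<noteq> 0) \<and> s *\<^sub>R v + t *\<^sub>R w = 0)"
    "?V \<noteq> {0}" "subspace ?V"
    by (rule minkowski_bilinear)
  have Bq: "q H v = B v v" if "v \<in> ?V" for v using B0(1) that by (rule bspec)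
  have Bsym: "B v w = B w v" for v w by (rule B0(2)[rule_format])
  note Badd = B0(3)[rule_format] and Bscale = B0(4)[rule_format]
  define D where "D A = dproj (\<tau> A)" for A
  define h where "h = {A \<in> so. D A = 0}"
  have h_eq: "\<sigma> ` subgroup_lie_algebra G M H = h"
  proof (rule subset_antisym; rule subsetI)
    fix A assume "A \<in> \<sigma> ` subgroup_lie_algebra G M H"
    then show "A \<in> h" unfolding subgroup_lie_algebra_eq h_def D_def by (auto simp: \<sigma>in \<tau>\<sigma>)
  next
    fix A assume A: "A \<in> h"
    then have "\<tau> A \<in> subgroup_lie_algebra G M H"
      unfolding subgroup_lie_algebra_eq h_def D_def by (simp add: \<tau>in)
    from imageI[OF this, of \<sigma>] show "A \<in> \<sigma> ` subgroup_lie_algebra G M H" using A \<sigma>\<tau> by (simp add: h_def)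
  qed
  interpret I: so_isotropy h "\<lambda>A A'. B (D A) (D A')"
    unfolding h_def
  proof (rule so_isotropy_of_form[of D ?V B, OF n3])
    show "D (A + A') = D A + D A'" for A A' unfolding D_def by (simp add: \<tau>add dproj_add)
    show "D (c *\<^sub>R A) = c *\<^sub>R D A" for c A unfolding D_def by (simp add: \<tau>scale dproj_scaleR)
    show "D A \<in> ?V" for A unfolding D_def by (rule dproj_tangent[OF \<tau>in])
    show "\<exists>A\<in>so. D A = v" if v: "v \<in> ?V" for v
    proof -
      obtain X where "X \<in> L" "dproj X = v" by (rule dproj_surj[OF v])
      then show ?thesis by (intro bexI[of _ "\<sigma> X"]) (simp_all add: D_def \<tau>\<sigma> \<sigma>in)
    qed
    show "0 \<in> ?V" by (rule subspace_0[OF B0(8)])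
    show "?V \<noteq> {0}" by (rule B0(7))
    show "B v w = B w v" for v w by (rule Bsym)
    show "B w (u + v) = B w u + B w v" if "u \<in> ?V" "v \<in> ?V" for u v w by (rule Badd[OF that])
    show "B w (c *\<^sub>R u) = c * B w u" if "u \<in> ?V" for c u w by (rule Bscale[OF that])
    show "v = 0" if "v \<in> ?V" "\<And>w. w \<in> ?V \<Longrightarrow> B v w = 0" for v using B0(5)[rule_format, OF that(1)] that(2) by simp
    show "\<exists>s t. (s \<noteq> 0 \<or> t \<noteq> 0) \<and> s *\<^sub>R v + t *\<^sub>R w = 0"
      if "v \<in> ?V" "w \<in> ?V" "B v v = 0" "B v w = 0" "B w w = 0" for v w by (rule B0(6)[rule_format, OF that])
    show "B (D (br A A')) (D A') = 0" if "A \<in> so" "D A = 0" "A' \<in> so" for A A'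
      unfolding D_def \<tau>br[OF that(1,3)]
      by (rule isotropy_skew[where B = B, OF Bq Bsym Badd Bscale q \<tau>in that(2)[unfolded D_def] \<tau>in])
  qed

  define T where "T a A = \<sigma> (Ad G M a (\<tau> A))" for a A
  have HG: "a \<in> carrier G" "inv a \<in> H" if "a \<in> H" for a
    using that H_carrier subgroup.m_inv_closed[OF subgroup] by auto
  have \<tau>T: "\<tau> (T a A) = Ad G M a (\<tau> A)" if "a \<in> carrier G" for a A
    unfolding T_def by (rule \<tau>\<sigma>[OF Ad_lie_algebra[OF \<tau>in that]])
  have linT: "linear (T a)" if "a \<in> carrier G" for a
    by (rule linearI)
      (simp_all add: T_def \<tau>add \<tau>scale Ad_add Ad_scaleR \<tau>in that \<sigma>add \<sigma>scale Ad_lie_algebra)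
  have inv: "T a (T b A) = A" if "a \<in> carrier G" "b \<in> carrier G" "a \<otimes> b = \<one>" "A \<in> so" for a b A
    unfolding T_def[of a] \<tau>T[OF that(2)] Ad_mult[OF \<tau>in that(1,2)] that(3) Ad_one[OF \<tau>in] by (rule \<sigma>\<tau>[OF that(4)])
  have aut: "I.autpair (T a) (T (inv a))" if a: "a \<in> H" for a
    unfolding I.autpair_def
  proof (intro conjI allI ballI)
    note aG = HG(1)[OF a]
    have iG: "inv a \<in> carrier G" using aG by simp
    show "linear (T a)" "linear (T (inv a))" by (rule linT[OF aG], rule linT[OF iG])
    show "T a (so_proj A) = T a A" "T (inv a) (so_proj A) = T (inv a) A" for A by (simp_all add: T_def \<tau>proj)
    show "T a A \<in> so" "T (inv a) A \<in> so" for A unfolding T_def by (intro \<sigma>in Ad_lie_algebra \<tau>in aG iG)+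
    show "T (inv a) (T a A) = A" "T a (T (inv a) A) = A" if "A \<in> so" for A
      by (rule inv[OF iG aG _ that], use aG in simp) (rule inv[OF aG iG _ that], use aG in simp)
    show "B (D (T a A)) (D (T a A)) = B (D A) (D A)" for A
      unfolding D_def \<tau>T[OF aG] using invariant_form_Ad[OF q \<tau>in a, of A]
      by (simp only: Bq dproj_tangent Ad_lie_algebra \<tau>in aG)
    show "T a (br A A') = br (T a A) (T a A')" if "A \<in> so" "A' \<in> so" for A A'
      unfolding T_def \<tau>br[OF that] Ad_bracket[OF \<tau>in \<tau>in aG] by (rule \<sigma>br) (intro Ad_lie_algebra \<tau>in aG)+
  qed
  \<comment> \<open>Otherwise the linear maps between \<open>so\<close> and the coordinates turn the
    bound on \<open>T\<close> into one on \<open>Ad H\<close>, and \<open>compact_closure_Ad\<close>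
    contradicts \<open>noncompact\<close>.\<close>
  have unb: "\<exists>T'\<in>T ` H. \<exists>A. C * norm A < norm (T' A)" for C
  proof (rule ccontr)
    assume "\<not> ?thesis"
    then have C: "norm (T a A) \<le> C * norm A" if "a \<in> H" for a A using that by (auto simp: not_less)
    have "linear (\<lambda>e. \<sigma> (left_field e))"
      by (rule linearI) (simp_all add: left_field_add left_field_scaleR \<sigma>add \<sigma>scale left_field_lie_algebra)
    then obtain K1 where K1: "K1 > 0" "\<And>e. norm (\<sigma> (left_field e)) \<le> norm e * K1"
      using bounded_linear.pos_bounded linear_conv_bounded_linear by blast
    have "linear (\<lambda>A. cvec (\<tau> A))" by (rule linearI) (simp_all add: \<tau>add \<tau>scale cvec_add cvec_scaleR \<tau>in)
    then obtain K2 where K2: "K2 > 0" "\<And>A. norm (cvec (\<tau> A)) \<le> norm A * K2"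
      using bounded_linear.pos_bounded linear_conv_bounded_linear by blast
    have "norm (cvec (Ad G M a (left_field e))) \<le> (\<bar>C\<bar> * K1 * K2) * norm e" if a: "a \<in> H" for a e
    proof -
      have "cvec (Ad G M a (left_field e)) = cvec (\<tau> (T a (\<sigma> (left_field e))))"
        by (simp add: \<tau>T HG(1)[OF a] \<tau>\<sigma> left_field_lie_algebra)
      then have "norm (cvec (Ad G M a (left_field e))) \<le> norm (T a (\<sigma> (left_field e))) * K2" using K2(2) by simp
      also have "\<dots> \<le> (\<bar>C\<bar> * norm (\<sigma> (left_field e))) * K2"
        by (intro mult_right_mono order_trans[OF C[OF a]]) (use K2(1) in auto)
      also have "\<dots> \<le> (\<bar>C\<bar> * (norm e * K1)) * K2"
        by (intro mult_right_mono mult_left_mono K1(2)) (use K2(1) in auto)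
      finally show ?thesis by (simp add: mult_ac)
    qed
    then have "compactin (GL_topology L) (GL_topology L closure_of (Ad G M ` H))"
      by (intro compact_closure_Ad[of "\<bar>C\<bar> * K1 * K2"] H_carrier HG) (use K1(1) K2(1) in auto)
    then show False using noncompact by simp
  qed
  have "\<exists>S. I.autpair T' S" if "T' \<in> T ` H" for T' using that aut by auto
  from I.unbounded_imp_nilpotent[OF this unb] obtain w
      where w: "w \<in> h" "w \<noteq> 0" "\<And>A. A \<in> so \<Longrightarrow> (br w ^^ 5) A = 0" by blast
  from I.nilpotent_stabilizer[OF w] obtain p0 where p0: "bf p0 p0 < 0" "h = {A \<in> so. A *v p0 = 0}" by blast
  \<comment> \<open>Negative lines form one orbit of \<open>SO\<close>, so the first coordinate
    vector serves and \<open>i = 1\<close>.\<close>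
  obtain g c where g: "g \<in> SO" "g *v axis (Inl (1 :: 2)) 1 = c *\<^sub>R p0" "c \<noteq> 0" by (rule unit_negative_transitive[OF p0(1)])
  show ?thesis
    unfolding h_eq p0(2) standard_so1n_def stabilizer_conjugate[OF g, symmetric] using g(1) by blast
qed

end

theorem theorem3p5:
  fixes G :: "'g monoid"
    and M :: "('g, 'e::euclidean_space) manifold"
    and S :: "(real ^ (2 + 'n::finite) ^ (2 + 'n), 's::euclidean_space) manifold"
    and H :: "'g set"
    and N :: "('g set, 'f::euclidean_space) manifold"
    and q :: "'g set \<Rightarrow> (('g set \<Rightarrow> real) \<Rightarrow> real) \<Rightarrow> real"
    and \<sigma> :: "(('g \<Rightarrow> real) \<Rightarrow> ('g \<Rightarrow> real)) \<Rightarrow> real ^ (2 + 'n) ^ (2 + 'n)"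
  assumes "CARD('n) \<ge> 3"
    and "lie_group G M"
    and "embedded_submanifold S SO"
    and "locally_isomorphic G M SO_group S"
    and "subgroup H G" and "closedin (mtop M) H"
    and "\<not> compactin (GL_topology (lie_algebra G M))
             (GL_topology (lie_algebra G M) closure_of (Ad G M ` H))"
    and "coset_manifold G M H N"
    and "lorentz_metric N q" and "left_translation_invariant G N q"
    and "lie_algebra_iso_so (lie_algebra G M) \<sigma>"
  shows "\<exists>(i::2). \<exists>g\<in>SO. \<sigma> ` subgroup_lie_algebra G M H =
           (\<lambda>A. g ** A ** matrix_inv g) ` standard_so1n i"
proof -
  have "group G" using assms(2) unfolding lie_group_def by simp
  then interpret smooth_homogeneous_space G M H N
    by (intro smooth_homogeneous_space.intro smooth_lie_group.intro smooth_lie_group_axioms.intro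
        smooth_homogeneous_space_axioms.intro assms)
  show ?thesis by (rule isotropy_algebra_conjugate[OF assms(1,7,9,10,11)])
qed

end
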